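(* Assume (g1), (g2), (g3) and (g5). Then: (i) for every $k\in\mathbb N$ there exists $m_k\ge0$ such that for every $m>m_k$ problem $(P_m)$ has at least $k$ distinct pairs $\pm u$ of nontrivial solutions (i.e. there are $k$ functions $u_1,\dots,u_k\in H^s_r(\mathbb R^N)\setminus\{0\}$ with $u_i\ne\pm u_j$ for $i\neq j$, each solving $(P_m)$ for some $\mu_i>0$); (ii) if in addition (g4) holds, then for every $m>0$ problem $(P_m)$ has a sequence of solutions $(\mu_n,u_n)_{n\in\mathbb N}$ with $\mathcal L(u_n)<0$ for all $n$ and $\mathcal L(u_n)\to0$ as $n\to\infty$, where $\mathcal L(u)=\frac12\int_{\mathbb R^N}|(-\Delta)^{s/2}u|^2\,dx-\int_{\mathbb R^N}G(u)\,dx$.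
   Context: Let $N\ge 2$ and $s\in(0,1)$. $H^s(\mathbb R^N)=\{u\in L^2(\mathbb R^N):\int|\xi|^{2s}|\mathcal F u(\xi)|^2\,d\xi<\infty\}$ with norm $\|u\|_{H^s}^2=\|(-\Delta)^{s/2}u\|_2^2+\|u\|_2^2$, where $\mathcal F$ is the Fourier transform and $(-\Delta)^{s/2}u=\mathcal F^{-1}(|\xi|^{s}\mathcal F u)$; $H^s_r(\mathbb R^N)$ is its closed subspace of radially symmetric functions. Let $g\in C(\mathbb R,\mathbb R)$, $G(t)=\int_0^t g(\tau)\,d\tau$, and $p=1+\frac{4s}{N}$. Hypotheses: (g1) $g$ is continuous and $\lim_{t\to0}g(t)/t=0$; (g2) $\lim_{|t|\to\infty}g(t)/|t|^{p}=0$; (g3) there is $t_0>0$ with $G(t_0)>0$; (g4) $\lim_{t\to0}\frac{g(t)}{|t|^{4s/N}t}=+\infty$; (g5) $g(-t)=-g(t)$ for all $t$. For $m>0$, a solution of problem $(P_m)$ is a pair $(\mu,u)\in\mathbb R\times H^s_r(\mathbb R^N)$ such that $\int_{\mathbb R^N}(-\Delta)^{s/2}u\,(-\Delta)^{s/2}\varphi+\mu u\varphi\,dx=\int_{\mathbb R^N}g(u)\varphi\,dx$ for all $\varphi\in H^s_r(\mathbb R^N)$ and $\int_{\mathbb R^N}u^2\,dx=m$. *)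

theory Defs
  imports "HOL-Analysis.Analysis"
begin

definition L2c :: "('a::euclidean_space \<Rightarrow> complex) \<Rightarrow> bool" where
  "L2c f \<longleftrightarrow> f \<in> borel_measurable lborel \<and> integrable lborel (\<lambda>x. (cmod (f x))\<^sup>2)"

definition fourier1 :: "('a::euclidean_space \<Rightarrow> complex) \<Rightarrow> 'a \<Rightarrow> complex" where
  "fourier1 f \<xi> = complex_of_real ((2 * pi) powr (- real DIM('a) / 2)) *
      (LINT x|lborel. f x * exp (- \<i> * complex_of_real (x \<bullet> \<xi>)))"

text \<open>The L^2 (Plancherel) Fourier transform: v is (a representative of) the Fourier
  transform of f in L^2, obtained as the L^2 limit of Fourier transforms of L^1 \<inter> L^2
  functions converging to f in L^2.\<close>
definition L2_fourier :: "('a::euclidean_space \<Rightarrow> complex) \<Rightarrow> ('a \<Rightarrow> complex) \<Rightarrow> bool" where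
  "L2_fourier f v \<longleftrightarrow> L2c f \<and> L2c v \<and>
     (\<exists>fn :: nat \<Rightarrow> 'a \<Rightarrow> complex.
        (\<forall>n. integrable lborel (fn n) \<and> L2c (fn n)) \<and>
        (\<lambda>n. LINT x|lborel. (cmod (fn n x - f x))\<^sup>2) \<longlonglongrightarrow> 0 \<and>
        (\<lambda>n. LINT \<xi>|lborel. (cmod (fourier1 (fn n) \<xi> - v \<xi>))\<^sup>2) \<longlonglongrightarrow> 0)"

definition Hs :: "real \<Rightarrow> ('a::euclidean_space \<Rightarrow> real) \<Rightarrow> bool" where
  "Hs s u \<longleftrightarrow> (\<exists>v. L2_fourier (\<lambda>x. complex_of_real (u x)) v \<and>
      integrable lborel (\<lambda>\<xi>. norm \<xi> powr (2 * s) * (cmod (v \<xi>))\<^sup>2))"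

text \<open>Radial functions of H^s (represented by pointwise radial functions).\<close>
definition Hsr :: "real \<Rightarrow> ('a::euclidean_space \<Rightarrow> real) \<Rightarrow> bool" where
  "Hsr s u \<longleftrightarrow> Hs s u \<and> (\<forall>x y. norm x = norm y \<longrightarrow> u x = u y)"

text \<open>w = (-\<Delta>)^{s/2} u, i.e. F w = |\<xi>|^s F u in L^2.\<close>
definition frac_lap :: "real \<Rightarrow> ('a::euclidean_space \<Rightarrow> real) \<Rightarrow> ('a \<Rightarrow> complex) \<Rightarrow> bool" where
  "frac_lap s u w \<longleftrightarrow> (\<exists>v. L2_fourier (\<lambda>x. complex_of_real (u x)) v \<and>
      L2_fourier w (\<lambda>\<xi>. complex_of_real (norm \<xi> powr s) * v \<xi>))"

definition solves_P :: "real \<Rightarrow> (real \<Rightarrow> real) \<Rightarrow> real \<Rightarrow> real \<Rightarrow> ('a::euclidean_space \<Rightarrow> real) \<Rightarrow> bool" where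
  "solves_P s g m \<mu> u \<longleftrightarrow> Hsr s u \<and>
     (\<forall>\<phi> wu w\<phi>. Hsr s \<phi> \<longrightarrow> frac_lap s u wu \<longrightarrow> frac_lap s \<phi> w\<phi> \<longrightarrow>
        (LINT x|lborel. wu x * w\<phi> x) + complex_of_real (\<mu> * (LINT x|lborel. u x * \<phi> x))
          = complex_of_real (LINT x|lborel. g (u x) * \<phi> x)) \<and>
     (LINT x|lborel. (u x)\<^sup>2) = m"

definition Gprim :: "(real \<Rightarrow> real) \<Rightarrow> real \<Rightarrow> real" where
  "Gprim g t = (LBINT \<tau>=0..t. g \<tau>)"

definition energy :: "real \<Rightarrow> (real \<Rightarrow> real) \<Rightarrow> ('a::euclidean_space \<Rightarrow> real) \<Rightarrow> real" where
  "energy s g u = 1/2 * (LINT x|lborel. (cmod ((SOME w. frac_lap s u w) x))\<^sup>2)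
                   - (LINT x|lborel. Gprim g (u x))"

end

theory Submission
 imports Defs "HOL-Probability.Probability" "HOL-Homology.Homology" "HOL-Library.Z2" "HOL-Complex_Analysis.Great_Picard"
begin

text \<open>Solutions of mass \<open>m\<close> are sought as critical points of
\<open>J(u) = 1/2 (m/b)\<^sup>\<alpha> a(u) - (m/b) \<psi>(u)\<close>, \<open>b = \<parallel>u\<parallel>\<^sup>2\<close>, \<open>\<alpha> = 1 - 2s/N\<close>: the energy of the dilate of
\<open>u\<close> that has mass \<open>m\<close>. Being dilation invariant, \<open>J\<close> has the Pohozaev identity built into its critical points,
whose multiplier \<open>(2s/N a - 2J)/m\<close> is positive where \<open>J < 0\<close>. As bounded radial sequences converge in measure
along subsequences, \<open>\<psi>'\<close> is compact, the gradient of \<open>J\<close> is uniformly continuous on bounded sets and Palais-Smale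
sequences at negative levels converge. An Euler step along the gradient followed by a dilation onto the sphere is thus
an odd deformation, and passing a level costs at most one pair \<open>U, -U\<close> of disjoint open sets per pair of critical
points when sublevels are covered by such pairs. Finitely many pairs cover a sublevel at negative height (otherwise it
contains an orthogonal sequence), whereas \<open>k\<close> pairs never cover an odd image of the punctured \<open>(k+1)\<close>-space. Odd
families of plateau functions have negative \<open>J\<close> if \<open>m\<close> is large, or, under (g4), after scaling the amplitude.\<close>

subsection \<open>Square integrable functions\<close>

text \<open>The obstacle is mass-critical growth together with a merely continuous \<open>g\<close>.
  Mass-preserving dilations act continuously but not differentiably on H^s, so they serve as a final
  continuous map and not inside a differential equation; and the gradient has no Lipschitz bound, so
  there is no flow to integrate. One Euler step suffices, because only uniform continuity of the
  derivative enters the mean value estimate. For small s radial functions need not decay pointwise,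
  so decay is shown for averages over balls, and nonlinear terms pass to the limit under convergence
  in measure. The exponent 2 + 4 s / N is the one for which the Gagliardo-Nirenberg inequality is
  linear in \<open>aform\<close>. Hence the energy is coercive on every mass sphere at levels <= 0,
  and a family of amplitude d balances kinetic and critical potential parts at the same order d^2,
  so that (g4) decides the sign for every mass. Functions are never identified modulo null sets:
  inner products are only semi-definite, and oddness of the deformation is read up to seminorm
  zero.\<close>

abbreviation (input) tends_to :: "(nat => 'a::topological_space) => 'a => bool" (infix "~~>" 60) where
 "X ~~> L \<equiv> X \<longlonglongrightarrow> L"

lemmas squeeze_null = real_tendsto_sandwich[OF always_eventually always_eventually tendsto_const, rotated 2]

definition L2 :: "('a::euclidean_space => 'b::{banach,second_countable_topology}) => bool" where
 "L2 f \<longleftrightarrow> f \<in> borel_measurable lborel & integrable lborel (%x. (norm (f x))^2)"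

definition nsq :: "('a::euclidean_space => 'b::{banach,second_countable_topology}) => real" where
 "nsq f = (LINT x|lborel. (norm (f x))^2)"

lemma L2_measurable [measurable_dest]: "L2 f ==> f \<in> borel_measurable lborel"
 by (simp add: L2_def)

lemma L2_measurable_borel: "L2 f ==> f \<in> borel_measurable borel"
 by (simp add: L2_def)

lemma L2_integrable: "L2 f ==> integrable lborel (%x. (norm (f x))^2)"
 by (simp add: L2_def)

lemma nsq_nonneg [simp]: "0 <= nsq f"
 by (simp add: nsq_def)

lemma L2_zero [simp]: "L2 (%_. 0)"
 by (simp add: L2_def)

lemma nsq_zero [simp]: "nsq (%_. 0) = 0"
 by (simp add: nsq_def)

lemma L2_bound:
 assumes "L2 g" "f \<in> borel_measurable lborel" "AE x in lborel. norm (f x) <= C * norm (g x)"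
 shows "L2 f" "nsq f <= C^2 * nsq g"
proof -
 have i: "integrable lborel (%x. C^2 * (norm (g x))^2)"
  using assms(1) by (simp add: L2_def)
 have b: "AE x in lborel. (norm (f x))^2 <= C^2 * (norm (g x))^2"
  using assms(3)
 proof eventually_elim
  case (elim x)
  then have "(norm (f x))^2 <= (C * norm (g x))^2" by (intro power_mono) auto
  then show ?case by (simp add: power_mult_distrib)
 qed
 have f: "integrable lborel (%x. (norm (f x))^2)"
  by (rule Bochner_Integration.integrable_bound[OF i]) (use assms(2) b in auto)
 then show "L2 f" using assms(2) by (simp add: L2_def)
 have "nsq f <= (LINT x|lborel. C^2 * (norm (g x))^2)"
  unfolding nsq_def by (rule integral_mono_AE[OF f i b])
 then show "nsq f <= C^2 * nsq g" by (simp add: nsq_def)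
qed

lemma nsq_scaleR: "nsq (%x. c *\<^sub>R f x) = c^2 * nsq f"
 by (simp add: nsq_def power_mult_distrib)

lemma nsq_mult: "nsq (%x. c * f x) = (norm c)^2 * nsq f" for f :: "'a::euclidean_space => 'b::{real_normed_field,banach,second_countable_topology}"
 by (simp add: nsq_def norm_mult power_mult_distrib)

lemma L2_scaleR: "L2 f ==> L2 (%x. c *\<^sub>R f x)"
 by (auto simp: L2_def power_mult_distrib intro!: borel_measurable_scaleR)

lemma L2_mult: "L2 f ==> L2 (%x. c * f x)" for f :: "'a::euclidean_space => 'b::{real_normed_field,banach,second_countable_topology}"
 by (auto simp: L2_def norm_mult power_mult_distrib intro!: borel_measurable_times)

lemma norm_add_sq_le: "(norm (a + b :: 'b::real_normed_vector))^2 <= 2 * (norm a)^2 + 2 * (norm b)^2"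
proof -
 have "(norm (a + b))^2 <= (norm a + norm b)^2"
  by (intro power_mono norm_triangle_ineq) auto
 also have "... <= 2 * (norm a)^2 + 2 * (norm b)^2"
  using sum_squares_bound[of "norm a" "norm b"] by (simp add: power2_sum)
 finally show ?thesis .
qed

lemma L2_add:
 assumes "L2 f" "L2 g" shows "L2 (%x. f x + g x)"
proof -
 have [measurable]: "f \<in> borel_measurable lborel" "g \<in> borel_measurable lborel"
  using assms by (auto simp: L2_def)
 have "integrable lborel (%x. 2 * (norm (f x))^2 + 2 * (norm (g x))^2)"
  using assms by (auto simp: L2_def)
 then have "integrable lborel (%x. (norm (f x + g x))^2)"
  by (rule Bochner_Integration.integrable_bound) (auto simp: norm_add_sq_le)
 then show ?thesis by (simp add: L2_def)
qed

lemma L2_minus: "L2 f ==> L2 (%x. - f x)"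
 by (simp add: L2_def)

lemma L2_diff: "L2 f ==> L2 g ==> L2 (%x. f x - g x)"
 using L2_add[OF _ L2_minus, of f g] by simp

lemma nsq_minus_commute: "nsq (%x. f x - g x) = nsq (%x. g x - f x)"
 by (simp add: nsq_def norm_minus_commute)

lemma nsq_cong_AE:
 assumes "f \<in> borel_measurable lborel" "g \<in> borel_measurable lborel" "AE x in lborel. f x = g x"
 shows "nsq f = nsq g"
 unfolding nsq_def by (rule integral_cong_AE) (use assms in auto)

lemma nsq_eq_0: "L2 f ==> nsq f = 0 \<longleftrightarrow> (AE x in lborel. f x = 0)"
 unfolding nsq_def by (subst integral_nonneg_eq_0_iff_AE) (auto simp: L2_def)

lemma L2_norm_mult_integrable:
 assumes "L2 f" "L2 g" shows "integrable lborel (%x. norm (f x) * norm (g x))"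
proof (rule Bochner_Integration.integrable_bound)
 have [measurable]: "f \<in> borel_measurable lborel" "g \<in> borel_measurable lborel"
  using assms by (auto simp: L2_def)
 show "integrable lborel (%x. (norm (f x))^2 + (norm (g x))^2)"
  using assms by (auto simp: L2_def)
 show "(%x. norm (f x) * norm (g x)) \<in> borel_measurable lborel" by measurable
 have "a * b <= a^2 + b^2" if "a >= 0" "b >= 0" for a b :: real
  using sum_squares_bound[of a b] mult_nonneg_nonneg[OF that] by linarith
 then show "AE x in lborel. norm (norm (f x) * norm (g x)) <= norm ((norm (f x))^2 + (norm (g x))^2)"
  by (auto simp: abs_mult)
qed

lemma L2_mult_integrable:
 fixes f g :: "'a::euclidean_space => 'b::{real_normed_field,banach,second_countable_topology}"
 assumes "L2 f" "L2 g" shows "integrable lborel (%x. f x * g x)"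
proof (rule Bochner_Integration.integrable_bound[OF L2_norm_mult_integrable[OF assms]])
 show "(%x. f x * g x) \<in> borel_measurable lborel"
  using assms by (auto simp: L2_def)
qed (auto simp: norm_mult)

text \<open>Serves all Cauchy-Schwarz inequalities below. The leading coefficient may vanish because
  the forms are only semi-definite; a nonnegative affine function of \<open>t\<close> then has slope
  zero.\<close>

lemma quadratic_discriminant_le:
 fixes A B C :: real
 assumes "!!t. 0 <= t^2 * A - 2 * t * B + C" "A >= 0"
 shows "B^2 <= A * C"
proof (cases "A = 0")
 case True
 have "B = 0"
 proof (rule ccontr)
  assume "B ~= 0"
  \<comment> \<open>At this \<open>t\<close> the affine expression equals -1.\<close>
  then obtain t where "2 * t * B = C + 1" by (metis mult.commute nonzero_divide_eq_eq mult_cancel_right1 mult.assoc divide_eq_eq zero_neq_numeral)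
  with assms(1)[of t] True show False by simp
 qed
 then show ?thesis using True by simp
next
 case False
 then have A: "A > 0" using assms by simp
 have "0 <= A * ((B / A)^2 * A - 2 * (B / A) * B + C)"
  by (rule mult_nonneg_nonneg[OF less_imp_le[OF A] assms(1)])
 also have "... = A * C - B^2" using A by (simp add: field_simps power2_eq_square)
 finally show ?thesis by simp
qed

lemma L2_Cauchy_Schwarz_norm:
 assumes "L2 f" "L2 g"
 shows "(LINT x|lborel. norm (f x) * norm (g x)) <= sqrt (nsq f) * sqrt (nsq g)"
proof -
 let ?B = "LINT x|lborel. norm (f x) * norm (g x)"
 have "0 <= t^2 * nsq f - 2 * t * ?B + nsq g" for t
 proof -
  have "0 <= (LINT x|lborel. (t * norm (f x) - norm (g x))^2)" by simp
  also have "(%x. (t * norm (f x) - norm (g x))^2) =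
   (%x. t^2 * (norm (f x))^2 - 2 * t * (norm (f x) * norm (g x)) + (norm (g x))^2)"
   by (auto simp: power2_diff power_mult_distrib)
  also have "(LINT x|lborel. ... x) = t^2 * nsq f - 2 * t * ?B + nsq g"
   using assms L2_norm_mult_integrable[OF assms] by (simp add: nsq_def L2_def)
  finally show ?thesis .
 qed
 then have "?B^2 <= nsq f * nsq g"
  by (rule quadratic_discriminant_le) simp
 then have "?B <= sqrt (nsq f * nsq g)" by (rule real_le_rsqrt)
 then show ?thesis by (simp add: real_sqrt_mult)
qed

lemma L2_Cauchy_Schwarz:
 fixes f g :: "'a::euclidean_space => 'b::{real_normed_field,banach,second_countable_topology}"
 assumes "L2 f" "L2 g"
 shows "norm (LINT x|lborel. f x * g x) <= sqrt (nsq f) * sqrt (nsq g)"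
proof -
 have "norm (LINT x|lborel. f x * g x) <= (LINT x|lborel. norm (f x * g x))"
  by (rule integral_norm_bound)
 then show ?thesis using L2_Cauchy_Schwarz_norm[OF assms] by (simp add: norm_mult)
qed

lemma sqrt_nsq_triangle:
 assumes "L2 f" "L2 g"
 shows "sqrt (nsq (%x. f x + g x)) <= sqrt (nsq f) + sqrt (nsq g)"
proof (rule real_le_lsqrt)
 have "nsq (%x. f x + g x) <= (LINT x|lborel. (norm (f x))^2 + 2 * (norm (f x) * norm (g x)) + (norm (g x))^2)"
  unfolding nsq_def
 proof (rule integral_mono)
  show "integrable lborel (%x. (norm (f x + g x))^2)" using L2_add[OF assms] by (simp add: L2_def)
  show "integrable lborel (%x. (norm (f x))^2 + 2 * (norm (f x) * norm (g x)) + (norm (g x))^2)"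
   using assms L2_norm_mult_integrable[OF assms] by (simp add: L2_def)
  show "(norm (f x + g x))^2 <= (norm (f x))^2 + 2 * (norm (f x) * norm (g x)) + (norm (g x))^2" for x
   using power_mono[OF norm_triangle_ineq[of "f x" "g x"], of 2] by (simp add: power2_sum)
 qed
 also have "... = nsq f + 2 * (LINT x|lborel. norm (f x) * norm (g x)) + nsq g"
  using assms L2_norm_mult_integrable[OF assms] by (simp add: nsq_def L2_def)
 also have "... <= (sqrt (nsq f) + sqrt (nsq g))^2"
  using L2_Cauchy_Schwarz_norm[OF assms] by (simp add: power2_sum)
 finally show "nsq (%x. f x + g x) <= (sqrt (nsq f) + sqrt (nsq g))^2" .
qed (auto)

lemma nsq_add_le:
 assumes "L2 f" "L2 g"
 shows "nsq (%x. f x + g x) <= 2 * nsq f + 2 * nsq g"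
proof -
 have "nsq (%x. f x + g x) <= (LINT x|lborel. 2 * (norm (f x))^2 + 2 * (norm (g x))^2)"
  unfolding nsq_def
  by (rule integral_mono) (use L2_add[OF assms] assms in "auto simp: L2_def norm_add_sq_le")
 then show ?thesis using assms by (simp add: nsq_def L2_def)
qed

lemma nsq_uminus [simp]: "nsq (%x. - f x) = nsq f"
 by (simp add: nsq_def)

lemma nsq_diff_le: "L2 f ==> L2 g ==> nsq (%x. f x - g x) <= 2 * nsq f + 2 * nsq g"
 using nsq_add_le[OF _ L2_minus, of f g] by simp

lemma nsq_tendsto:
 assumes "!!n. L2 (f n)" "L2 g" "(%n. nsq (%x. f n x - g x)) ~~> 0"
 shows "(%n. nsq (f n)) ~~> nsq g"
proof -
 let ?d = "%n. sqrt (nsq (%x. f n x - g x))"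
 have d: "?d ~~> 0" using tendsto_real_sqrt[OF assms(3)] by simp
 have "(%n. sqrt (nsq (f n))) ~~> sqrt (nsq g)"
 proof (rule LIMSEQ_I)
  fix e :: real assume "e > 0"
  with LIMSEQ_D[OF d] obtain M where M: "!!n. n >= M ==> ?d n < e" by auto
  have "\<bar>sqrt (nsq (f n)) - sqrt (nsq g)\<bar> <= ?d n" for n
   using sqrt_nsq_triangle[OF L2_diff[OF assms(1)[of n] assms(2)] assms(2)]
    sqrt_nsq_triangle[OF L2_diff[OF assms(2) assms(1)[of n]] assms(1)[of n]]
   by (simp add: nsq_minus_commute[of g])
  then show "\<exists>M. \<forall>n\<ge>M. norm (sqrt (nsq (f n)) - sqrt (nsq g)) < e"
   using M by (intro exI[of _ M]) (auto intro: le_less_trans)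
 qed
 from tendsto_power[OF this, of 2] show ?thesis by simp
qed

lemma L2_integral_mult_tendsto:
 fixes f :: "nat => 'a::euclidean_space => 'b::{real_normed_field,banach,second_countable_topology}"
 assumes "!!n. L2 (f n)" "L2 g" "(%n. nsq (%x. f n x - g x)) ~~> 0" "L2 h"
 shows "(%n. LINT x|lborel. f n x * h x) ~~> (LINT x|lborel. g x * h x)"
proof (rule LIM_zero_cancel, rule Lim_null_comparison)
 show "\<forall>\<^sub>F n in sequentially. norm ((LINT x|lborel. f n x * h x) - (LINT x|lborel. g x * h x))
   <= sqrt (nsq (%x. f n x - g x)) * sqrt (nsq h)"
 proof (rule always_eventually, rule)
  fix n
  have "(LINT x|lborel. f n x * h x) - (LINT x|lborel. g x * h x) = (LINT x|lborel. (f n x - g x) * h x)"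
   using assms by (simp add: left_diff_distrib L2_mult_integrable)
  then show "norm ((LINT x|lborel. f n x * h x) - (LINT x|lborel. g x * h x)) <= sqrt (nsq (%x. f n x - g x)) * sqrt (nsq h)"
   using L2_Cauchy_Schwarz[OF L2_diff[OF assms(1,2)] assms(4), of n] by simp
 qed
 show "(%n. sqrt (nsq (%x. f n x - g x)) * sqrt (nsq h)) ~~> 0"
  using tendsto_mult_right[OF tendsto_real_sqrt[OF assms(3)], of "sqrt (nsq h)"] by simp
qed

lemma L2_AE_subseq:
 assumes "!!n. L2 (f n)" "(%n. nsq (f n)) ~~> 0"
 shows "\<exists>r::nat=>nat. strict_mono r & (AE x in lborel. (%n. f (r n) x) ~~> 0)"
proof -
 have "(%n. LINT x|lborel. norm ((norm (f n x))^2)) ~~> 0" using assms(2) by (simp add: nsq_def)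
 from tendsto_L1_AE_subseq[OF _ this] assms(1) obtain r :: "nat => nat"
  where r: "strict_mono r" "AE x in lborel. (%n. (norm (f (r n) x))^2) ~~> 0"
  by (auto simp: L2_def)
 have "AE x in lborel. (%n. f (r n) x) ~~> 0" using r(2)
 proof eventually_elim
  case (elim x)
  from tendsto_real_sqrt[OF this] show ?case by (simp add: tendsto_norm_zero_iff)
 qed
 with r show ?thesis by blast
qed

text \<open>Fatou's lemma along the subsequence \<open>r\<close>, applied to
  \<open>f m - f (r n)\<close> with \<open>m\<close> fixed, carries the Cauchy bound over to the
  distance from the almost everywhere limit.\<close>

lemma L2_limit_AE:
 assumes L: "!!n. L2 (f n)" and [measurable]: "g \<in> borel_measurable lborel"
  and C: "!!e. e > 0 ==> \<exists>M. \<forall>m\<ge>M. \<forall>n\<ge>M. nsq (%x. f m x - f n x) <= e"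
  and r: "strict_mono r" and ae: "AE x in lborel. (%n. f (r n) x) ~~> g x"
 shows "L2 g" "(%n. nsq (%x. f n x - g x)) ~~> 0"
proof -
 have [measurable]: "f n \<in> borel_measurable lborel" for n using L by (simp add: L2_def)
 have key: "L2 (%x. f m x - g x) & nsq (%x. f m x - g x) <= e"
  if M: "!!m n. m >= M ==> n >= M ==> nsq (%x. f m x - f n x) <= e" and m: "m >= M" and e: "e > 0" for m M e
 proof -
  have "(\<integral>\<^sup>+x. ennreal ((norm (f m x - g x))^2) \<partial>lborel) =
     (\<integral>\<^sup>+x. liminf (%n. ennreal ((norm (f m x - f (r n) x))^2)) \<partial>lborel)"
  proof (rule nn_integral_cong_AE, use ae in eventually_elim)
   case (elim x)
   then have "(%n. ennreal ((norm (f m x - f (r n) x))^2)) ~~> ennreal ((norm (f m x - g x))^2)"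
    by (intro tendsto_intros tendsto_ennrealI)
   from lim_imp_Liminf[OF trivial_limit_sequentially this] show ?case by simp
  qed
  also have "... <= liminf (%n. \<integral>\<^sup>+x. ennreal ((norm (f m x - f (r n) x))^2) \<partial>lborel)"
   by (rule nn_integral_liminf) measurable
  also have "... <= ennreal e"
  proof (rule Liminf_le)
   show "\<forall>\<^sub>F n in sequentially. (\<integral>\<^sup>+x. ennreal ((norm (f m x - f (r n) x))^2) \<partial>lborel) <= ennreal e"
   proof (rule eventually_sequentiallyI[of M])
    fix n assume "M <= n"
    then have rn: "r n >= M" using strict_mono_imp_increasing[OF r, of n] by simp
    have "(\<integral>\<^sup>+x. ennreal ((norm (f m x - f (r n) x))^2) \<partial>lborel) = ennreal (nsq (%x. f m x - f (r n) x))"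
     unfolding nsq_def by (rule nn_integral_eq_integral) (use L2_integrable[OF L2_diff[OF L L]] in auto)
    then show "(\<integral>\<^sup>+x. ennreal ((norm (f m x - f (r n) x))^2) \<partial>lborel) <= ennreal e"
     using M[OF m rn] by (simp add: ennreal_leI)
   qed
  qed simp
  finally have le: "(\<integral>\<^sup>+x. ennreal ((norm (f m x - g x))^2) \<partial>lborel) <= ennreal e" .
  have i: "integrable lborel (%x. (norm (f m x - g x))^2)"
   by (rule integrableI_nonneg) (use le in "auto intro: le_less_trans")
  then have "ennreal (nsq (%x. f m x - g x)) <= ennreal e"
   using le unfolding nsq_def by (subst nn_integral_eq_integral[symmetric]) auto
  then show ?thesis using i e by (auto simp: L2_def)
 qed
 obtain M where "\<forall>m\<ge>M. \<forall>n\<ge>M. nsq (%x. f m x - f n x) <= 1" using C[of 1] by auto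
 then have "L2 (%x. f M x - g x)" using key[of M 1 M] by auto
 from L2_diff[OF L this, of M] show "L2 g" by simp
 show "(%n. nsq (%x. f n x - g x)) ~~> 0"
 proof (rule LIMSEQ_I)
  fix e :: real assume e: "e > 0"
  obtain M where M: "\<forall>m\<ge>M. \<forall>n\<ge>M. nsq (%x. f m x - f n x) <= e / 2" using C[of "e/2"] e by auto
  then have "nsq (%x. f m x - g x) <= e / 2" if "m >= M" for m
   using key[of M "e/2" m] that e by auto
  then show "\<exists>no. \<forall>n\<ge>no. norm (nsq (%x. f n x - g x) - 0) < e"
   using e by (intro exI[of _ M]) (auto, fastforce)
 qed
qed

text \<open>The limit is given as an explicit pointwise limit with default 0, not just as some
  function, because radial symmetry is a pointwise condition that has to pass to it.\<close>

theorem Riesz_Fischer: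
 fixes f :: "nat => 'a::euclidean_space => 'b::{banach,second_countable_topology}"
 assumes L: "!!n. L2 (f n)"
  and C: "!!e. e > 0 ==> \<exists>M. \<forall>m\<ge>M. \<forall>n\<ge>M. nsq (%x. f m x - f n x) <= e"
 obtains r where "strict_mono r" "AE x in lborel. convergent (%n. f (r n) x)"
  "L2 (%x. if convergent (%n. f (r n) x) then lim (%n. f (r n) x) else 0)"
  "(%n. nsq (%x. f n x - (if convergent (%n. f (r n) x) then lim (%n. f (r n) x) else 0))) ~~> 0"
proof -
 have [measurable]: "f n \<in> borel_measurable lborel" for n using L by (simp add: L2_def)
 have "\<exists>M. \<forall>k. True & (M (Suc k) > M k & (\<forall>m\<ge>M (Suc k). \<forall>n\<ge>M (Suc k). nsq (%x. f m x - f n x) <= (1/16)^Suc k))"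
 proof (intro dependent_nat_choice)
  fix x :: nat and k :: nat
  obtain M where "\<forall>m\<ge>M. \<forall>n\<ge>M. nsq (%x. f m x - f n x) <= (1/16)^Suc k" using C[of "(1/16)^Suc k"] by auto
  then show "\<exists>y. True & y > x & (\<forall>m\<ge>y. \<forall>n\<ge>y. nsq (%x. f m x - f n x) <= (1/16)^Suc k)"
   by (intro exI[of _ "max M (Suc x)"]) auto
 qed auto
 then obtain M where M: "!!k. M (Suc k) > M k" "!!k m n. m >= M (Suc k) ==> n >= M (Suc k) ==> nsq (%x. f m x - f n x) <= (1/16)^Suc k"
  by blast
 define r where "r k = M (Suc k)" for k
 have r: "strict_mono r" unfolding r_def using M(1) by (simp add: strict_mono_Suc_iff)
 \<comment> \<open>The rate 16^-k for squared distances against thresholds 2^-k gives these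
   exceptional sets measure at most 4^-k, which is summable, so Borel-Cantelli applies.\<close>
 define A where "A k = {x \<in> space lborel. (1/2)^k <= norm (f (r (Suc k)) x - f (r k) x)}" for k
 have [measurable]: "A k \<in> sets lborel" for k unfolding A_def by measurable
 have Am: "emeasure lborel (A k) <= ennreal ((1/4)^k)" for k
 proof -
  have i: "integrable lborel (%x. (norm (f (r (Suc k)) x - f (r k) x))^2)"
   using L2_diff[OF L L] by (simp add: L2_def)
  have "A k = {x \<in> space lborel. ((1/2)^k)^2 <= (norm (f (r (Suc k)) x - f (r k) x))^2}"
   unfolding A_def by (auto intro: power_mono dest: power2_le_imp_le)
  then have "emeasure lborel (A k) <= ennreal (1 / ((1/2)^k)^2 * (LINT x|lborel. (norm (f (r (Suc k)) x - f (r k) x))^2))"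
   using integral_Markov_inequality[OF i, of "((1/2)^k)^2"] by auto
  also have "... <= ennreal ((1/4)^k)"
  proof (rule ennreal_leI)
   have "nsq (%x. f (r (Suc k)) x - f (r k) x) <= (1/16)^Suc k"
    using M(2)[of k "r (Suc k)" "r k"] strict_monoD[OF r, of k "Suc k"] by (simp add: r_def)
   also have "... <= (1/16)^k" by simp
   finally have "nsq (%x. f (r (Suc k)) x - f (r k) x) <= (1/16)^k" .
   then have "1 / ((1/2)^k)^2 * nsq (%x. f (r (Suc k)) x - f (r k) x) <= 1 / ((1/2)^k)^2 * (1/16)^k"
    by (intro mult_left_mono) auto
   also have "... = (1/4)^k"
    by (simp add: power_divide power_mult[symmetric] mult.commute[of k 2] power_mult)
     (simp add: power_mult_distrib[symmetric] divide_simps)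
   finally show "1 / ((1/2)^k)^2 * (LINT x|lborel. (norm (f (r (Suc k)) x - f (r k) x))^2) <= (1/4)^k"
    by (simp add: nsq_def)
  qed
  finally show ?thesis .
 qed
 have "AE x in lborel. eventually (%k. x \<in> space lborel - A k) sequentially"
 proof (rule borel_cantelli_AE1)
  show "emeasure lborel (A k) < \<infinity>" for k using le_less_trans[OF Am] by auto
  have "summable (%k. measure lborel (A k))"
  proof (rule summable_comparison_test_ev[of _ "%k. (1/4::real)^k"])
   have "measure lborel (A k) <= (1/4)^k" for k
    using Am[of k] by (simp add: measure_def enn2real_leI)
   then show "\<forall>\<^sub>F k in sequentially. norm (measure lborel (A k)) <= (1/4)^k" by simp
  qed (rule summable_geometric, simp)
  then show "summable (%k. measure lborel (A k))" .
  show "A k \<in> sets lborel" for k by measurable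
 qed
 then have ae: "AE x in lborel. convergent (%n. f (r n) x)"
 proof eventually_elim
  case (elim x)
  then have e: "\<forall>\<^sub>F k in sequentially. norm (f (r (Suc k)) x - f (r k) x) <= (1/2)^k"
   by eventually_elim (auto simp: A_def)
  have "summable (%k. f (r (Suc k)) x - f (r k) x)"
   by (rule summable_comparison_test_ev[OF e]) (simp add: summable_geometric)
  then have "convergent (%n. \<Sum>k<n. f (r (Suc k)) x - f (r k) x)"
   by (simp add: summable_iff_convergent)
  then have "convergent (%n. f (r n) x - f (r 0) x)"
   by (simp add: sum_lessThan_telescope[where f = "%k. f (r k) x"])
  then have "convergent (%n. (f (r n) x - f (r 0) x) + f (r 0) x)"
   by (intro convergent_add convergent_const)
  then show ?case by simp
 qed
 define g where "g x = (if convergent (%n. f (r n) x) then lim (%n. f (r n) x) else 0)" for x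
 have [measurable]: "Measurable.pred lborel (%x. convergent (%n. f (r n) x))"
  unfolding Cauchy_convergent_iff[symmetric] pred_def
  using sets_Collect_Cauchy[of "%n. f (r n)" lborel] by simp
 have gm: "g \<in> borel_measurable lborel" unfolding g_def by measurable
 have ae': "AE x in lborel. (%n. f (r n) x) ~~> g x"
  using ae by eventually_elim (auto simp: g_def convergent_LIMSEQ_iff)
 from L2_limit_AE[OF L gm C r ae'] have "L2 g" "(%n. nsq (%x. f n x - g x)) ~~> 0" by auto
 with r ae that show ?thesis unfolding g_def by blast
qed

section \<open>Affine substitutions in Lebesgue integrals\<close>

lemma nn_integral_affine:
 fixes t :: "'a::euclidean_space"
 assumes "c ~= 0" and [measurable]: "h \<in> borel_measurable borel"
 shows "(\<integral>\<^sup>+x. h (t + c *\<^sub>R x) \<partial>lborel) = ennreal (1 / \<bar>c\<bar> ^ DIM('a)) * (\<integral>\<^sup>+x. h x \<partial>lborel)"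
proof -
 have p: "\<bar>c\<bar> ^ DIM('a) > 0" using assms(1) by simp
 have "(\<integral>\<^sup>+x. h x \<partial>lborel) = (\<integral>\<^sup>+x. h x \<partial>density (distr lborel borel (%x. t + c *\<^sub>R x)) (%_. \<bar>c\<bar>^DIM('a)))"
  using lborel_affine[OF assms(1), of t] by simp
 also have "... = ennreal (\<bar>c\<bar>^DIM('a)) * (\<integral>\<^sup>+x. h (t + c *\<^sub>R x) \<partial>lborel)"
  by (subst nn_integral_density) (auto simp: nn_integral_distr nn_integral_cmult)
 finally have "ennreal (1 / \<bar>c\<bar> ^ DIM('a)) * (\<integral>\<^sup>+x. h x \<partial>lborel) =
  ennreal (1 / \<bar>c\<bar> ^ DIM('a)) * (ennreal (\<bar>c\<bar>^DIM('a)) * (\<integral>\<^sup>+x. h (t + c *\<^sub>R x) \<partial>lborel))" by simp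
 also have "... = (\<integral>\<^sup>+x. h (t + c *\<^sub>R x) \<partial>lborel)"
  unfolding mult.assoc[symmetric] using p by (simp add: ennreal_mult'[symmetric] del: ennreal_power)
 finally show ?thesis by simp
qed

lemma integrable_affine:
 fixes t :: "'a::euclidean_space" and f :: "'a => 'b::{banach,second_countable_topology}"
 assumes "c ~= 0" "integrable lborel f"
 shows "integrable lborel (%x. f (t + c *\<^sub>R x))"
proof -
 have [measurable]: "f \<in> borel_measurable borel" using assms(2) by auto
 have "(\<integral>\<^sup>+x. ennreal (norm (f (t + c *\<^sub>R x))) \<partial>lborel) < \<infinity>"
  using nn_integral_affine[OF assms(1), of "%x. ennreal (norm (f x))" t] assms(2)
  by (auto simp: integrable_iff_bounded ennreal_mult_less_top)
 then show ?thesis by (intro integrableI_bounded) auto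
qed

lemma integral_affine:
 fixes t :: "'a::euclidean_space" and f :: "'a => 'b::{banach,second_countable_topology}"
 assumes "c ~= 0"
 shows "(LINT x|lborel. f (t + c *\<^sub>R x)) = (1 / \<bar>c\<bar> ^ DIM('a)) *\<^sub>R (LINT x|lborel. f x)"
proof (cases "integrable lborel f")
 case True
 then have [measurable]: "f \<in> borel_measurable borel" by auto
 have p: "\<bar>c\<bar> ^ DIM('a) > 0" using assms(1) by simp
 have "(LINT x|lborel. f x) = (LINT x|density (distr lborel borel (%x. t + c *\<^sub>R x)) (%_. \<bar>c\<bar>^DIM('a)). f x)"
  using lborel_affine[OF assms(1), of t] by simp
 also have "... = (\<bar>c\<bar>^DIM('a)) *\<^sub>R (LINT x|lborel. f (t + c *\<^sub>R x))"
  by (subst integral_density) (auto simp: integral_distr)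
 finally show ?thesis using p by (simp add: divide_simps)
next
 case False
 have "\<not> integrable lborel (%x. f (t + c *\<^sub>R x))"
 proof
  assume "integrable lborel (%x. f (t + c *\<^sub>R x))"
  from integrable_affine[OF _ this, of "1/c" "- (1/c) *\<^sub>R t"] assms
  have "integrable lborel f" by (simp add: scaleR_add_right scaleR_diff_right)
  with False show False by simp
 qed
 with False show ?thesis by (simp add: not_integrable_integral_eq)
qed

lemma L2_affine: "c ~= 0 ==> L2 f ==> L2 (%x. f (t + c *\<^sub>R x))"
 using integrable_affine[of c "%x. (norm (f x))^2" t]
 by (auto simp: L2_def intro: measurable_compose[of _ _ borel])

lemma nsq_affine:
 fixes f :: "'a::euclidean_space => 'b::{banach,second_countable_topology}"
 shows "c ~= 0 ==> nsq (%x. f (t + c *\<^sub>R x)) = nsq f / \<bar>c\<bar> ^ DIM('a)"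
 unfolding nsq_def by (subst integral_affine[of c "%x. (norm (f x))^2"]) auto

text \<open>Translations and dilations act continuously on \<open>L\<^sup>1\<close>: it suffices to see this for indicators
  of open sets \<open>U\<close>, where \<open>T\<^sub>n x \<rightarrow> x\<close> controls \<open>U - T\<^sub>n\<^sup>-\<^sup>1 U\<close> and the measure scaling controls the rest.\<close>

locale near_identity =
 fixes T :: "nat => 'a::euclidean_space => 'a" and c :: "nat => real"
 assumes T_measurable [measurable]: "!!n. T n \<in> borel_measurable borel"
  and T_tendsto: "!!x. (%n. T n x) ~~> x"
  and c_nonneg: "!!n. 0 <= c n" and c_tendsto: "c ~~> 1"
  and T_scale: "!!n h. h \<in> borel_measurable borel ==> (\<integral>\<^sup>+x. h (T n x) \<partial>lborel) = ennreal (c n) * (\<integral>\<^sup>+x. h x \<partial>lborel)"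
begin

lemma integrable_T:
 fixes f :: "'a => 'b::{banach,second_countable_topology}"
 assumes "integrable lborel f"
 shows "integrable lborel (%x. f (T n x))" "(LINT x|lborel. norm (f (T n x))) = c n * (LINT x|lborel. norm (f x))"
proof -
 have [measurable]: "f \<in> borel_measurable borel" using assms by auto
 have e: "(\<integral>\<^sup>+x. ennreal (norm (f (T n x))) \<partial>lborel) = ennreal (c n) * (\<integral>\<^sup>+x. ennreal (norm (f x)) \<partial>lborel)"
  by (rule T_scale) measurable
 then show i: "integrable lborel (%x. f (T n x))"
  using assms by (intro integrableI_bounded) (auto simp: integrable_iff_bounded ennreal_mult_less_top)
 show "(LINT x|lborel. norm (f (T n x))) = c n * (LINT x|lborel. norm (f x))"
  using e i assms by (simp add: nn_integral_eq_integral ennreal_mult'[symmetric] c_nonneg ennreal_inj)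
qed

lemma indicator_open:
 assumes "open U" "emeasure lborel U < \<infinity>"
 shows "(%n. LINT x|lborel. \<bar>indicator U (T n x) - indicator U x :: real\<bar>) ~~> 0"
proof -
 have [measurable]: "U \<in> sets borel" using assms(1) by auto
 have i: "integrable lborel (indicator U :: 'a => real)" using assms by (simp add: integrable_indicator_iff)
 note iT = integrable_T[OF i]
 let ?p = "%n x. max 0 (indicator U x - indicator U (T n x)) :: real"
 have p: "(%n. LINT x|lborel. ?p n x) ~~> (LINT x::'a|lborel. (0::real))"
 proof (rule integral_dominated_convergence[where w = "indicator U"])
  show "integrable lborel (indicator U :: 'a => real)" by (rule i)
  show "AE x in lborel. (%n. ?p n x) ~~> 0"
  proof (rule AE_I2, cases)
   fix x assume "x \<in> U"
   then have "\<forall>\<^sub>F n in sequentially. T n x \<in> U"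
    using topological_tendstoD[OF T_tendsto assms(1)] by blast
   then have "\<forall>\<^sub>F n in sequentially. ?p n x = 0"
    by eventually_elim (use \<open>x \<in> U\<close> in auto)
   then show "(%n. ?p n x) ~~> 0" by (simp add: tendsto_eventually)
  next
   fix x assume "x \<notin> U" then show "(%n. ?p n x) ~~> 0" by (auto simp: indicator_def max_def intro!: tendsto_eventually always_eventually)
  qed
 qed (auto simp: indicator_def)
 have pi: "integrable lborel (?p n)" for n
  by (rule Bochner_Integration.integrable_bound[OF i]) (auto simp: indicator_def)
 have "\<bar>indicator U (T n x) - indicator U x\<bar> = 2 * ?p n x + (indicator U (T n x) - indicator U x :: real)" for n x
  by (auto simp: indicator_def)
 then have "(LINT x|lborel. \<bar>indicator U (T n x) - indicator U x :: real\<bar>) =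
  2 * (LINT x|lborel. ?p n x) + (c n - 1) * (LINT x|lborel. indicator U x)" for n
  using i iT pi by (simp add: left_diff_distrib)
 moreover have "(%n. 2 * (LINT x|lborel. ?p n x) + (c n - 1) * (LINT x|lborel. indicator U x)) ~~> 2 * 0 + (1 - 1) * (LINT x|lborel. indicator U x)"
  using p by (intro tendsto_intros c_tendsto) simp
 ultimately show ?thesis by simp
qed

text \<open>The property is stable under L^1 limits: composition with \<open>T n\<close> multiplies
  L^1 distances by \<open>c n\<close>, which is eventually below 2.\<close>

lemma L1_approx:
 fixes f :: "'a => 'b::{banach,second_countable_topology}"
 assumes f: "integrable lborel f"
  and ap: "!!e. e > 0 ==> \<exists>s::'a => 'b. integrable lborel s & (LINT x|lborel. norm (s x - f x)) <= e &
   (%n. LINT x|lborel. norm (s (T n x) - s x)) ~~> 0"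
 shows "(%n. LINT x|lborel. norm (f (T n x) - f x)) ~~> 0"
proof (rule LIMSEQ_I)
 fix e :: real assume e: "e > 0"
 obtain s :: "'a => 'b" where s: "integrable lborel s" "(LINT x|lborel. norm (s x - f x)) <= e / 8"
  "(%n. LINT x|lborel. norm (s (T n x) - s x)) ~~> 0" using ap[of "e/8"] e by auto
 have "\<forall>\<^sub>F n in sequentially. (LINT x|lborel. norm (s (T n x) - s x)) < e / 8"
  using order_tendstoD(2)[OF s(3), of "e/8"] e by auto
 moreover have "\<forall>\<^sub>F n in sequentially. c n < 2" using order_tendstoD(2)[OF c_tendsto, of 2] by auto
 ultimately have "\<forall>\<^sub>F n in sequentially. (LINT x|lborel. norm (f (T n x) - f x)) < e"
 proof eventually_elim
  case (elim n)
  have isf: "integrable lborel (%x. s x - f x)" using s f by auto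
  note sT = integrable_T(1)[OF s(1), of n] and fT = integrable_T(1)[OF f, of n] and dT = integrable_T[OF isf, of n]
  have "(LINT x|lborel. norm (f (T n x) - f x)) <=
   (LINT x|lborel. norm (s (T n x) - f (T n x)) + norm (s (T n x) - s x) + norm (s x - f x))"
  proof (rule integral_mono)
   show "integrable lborel (%x. norm (f (T n x) - f x))" using fT f by auto
   show "integrable lborel (%x. norm (s (T n x) - f (T n x)) + norm (s (T n x) - s x) + norm (s x - f x))"
    using sT fT s f by auto
   show "norm (f (T n x) - f x) <= norm (s (T n x) - f (T n x)) + norm (s (T n x) - s x) + norm (s x - f x)" for x
   proof -
    have "f (T n x) - f x = - (s (T n x) - f (T n x)) + (s (T n x) - s x) + (s x - f x)" by simp
    then show ?thesis by (smt (verit) norm_triangle_ineq norm_minus_cancel)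
   qed
  qed
  also have "... = c n * (LINT x|lborel. norm (s x - f x)) + (LINT x|lborel. norm (s (T n x) - s x)) + (LINT x|lborel. norm (s x - f x))"
   using sT fT s f dT by simp
  also have "... <= 2 * (e/8) + e/8 + e/8"
   using elim s(2) c_nonneg[of n] by (intro add_mono mult_mono) auto
  also have "... < e" using e by simp
  finally show ?case .
 qed
 then show "\<exists>no. \<forall>n\<ge>no. norm ((LINT x|lborel. norm (f (T n x) - f x)) - 0) < e"
  by (auto simp: eventually_sequentially)
qed

theorem L1_continuous:
 fixes f :: "'a => 'b::{banach,second_countable_topology}"
 assumes "integrable lborel f"
 shows "(%n. LINT x|lborel. norm (f (T n x) - f x)) ~~> 0"
 using assms
proof (induction rule: integrable_induct)
 case (base A b)
 then have [measurable]: "A \<in> sets borel" and A: "emeasure lborel A < \<infinity>" by auto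
 have r: "(%n. LINT x|lborel. norm (indicator A (T n x) - indicator A x :: real)) ~~> 0"
 proof (rule L1_approx)
  show "integrable lborel (indicator A :: 'a => real)" using A by (simp add: integrable_indicator_iff)
  fix e :: real assume e: "e > 0"
  \<comment> \<open>Outer regularity reduces a Borel set of finite measure to an open one, to which
    \<open>indicator_open\<close> applies.\<close>
  obtain U where U: "open U" "A \<subseteq> U" "emeasure lborel (U - A) < e"
   using outer_regular_lborel[of A e] e by auto
  have [measurable]: "U \<in> sets borel" using U by auto
  have "emeasure lborel U = emeasure lborel A + emeasure lborel (U - A)"
   using U by (subst plus_emeasure) (auto intro: arg_cong[where f="emeasure lborel"])
  also have "... < \<infinity>" using A U(3) by (auto simp: less_top[symmetric])
  finally have Uf: "emeasure lborel U < \<infinity>" .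
  have "(LINT x|lborel. norm (indicator U x - indicator A x :: real)) = (LINT x|lborel. indicator (U - A) x)"
   using U(2) by (intro Bochner_Integration.integral_cong) (auto simp: indicator_def)
  also have "... = measure lborel (U - A)" by simp
  also have "... <= e" using U(3) e by (simp add: measure_def enn2real_leI less_imp_le)
  finally show "\<exists>s::'a => real. integrable lborel s & (LINT x|lborel. norm (s x - indicator A x)) <= e &
   (%n. LINT x|lborel. norm (s (T n x) - s x)) ~~> 0"
   using indicator_open[OF U(1) Uf] Uf by (intro exI[of _ "indicator U"]) (auto simp: integrable_indicator_iff)
 qed
 have "norm (indicator A (T n x) *\<^sub>R b - indicator A x *\<^sub>R b) = norm (indicator A (T n x) - indicator A x :: real) * norm b" for n x
  by (auto simp: indicator_def)
 then show ?case using tendsto_mult_left_zero[OF r, of "norm b"] by simp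
next
 case (add f g)
 show ?case
 proof (rule tendsto_sandwich[OF _ _ tendsto_const])
  show "\<forall>\<^sub>F n in sequentially. (LINT x|lborel. norm (f (T n x) + g (T n x) - (f x + g x))) <=
   (LINT x|lborel. norm (f (T n x) - f x)) + (LINT x|lborel. norm (g (T n x) - g x))"
  proof (rule always_eventually, rule)
   fix n
   note T = integrable_T(1)[OF add.hyps(1), of n] integrable_T(1)[OF add.hyps(2), of n]
   have "(LINT x|lborel. norm (f (T n x) + g (T n x) - (f x + g x))) <=
   (LINT x|lborel. norm (f (T n x) - f x) + norm (g (T n x) - g x))"
    by (rule integral_mono) (use T add.hyps in "auto simp: add_diff_add norm_triangle_ineq")
   then show "(LINT x|lborel. norm (f (T n x) + g (T n x) - (f x + g x))) <=
   (LINT x|lborel. norm (f (T n x) - f x)) + (LINT x|lborel. norm (g (T n x) - g x))"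
    using T add.hyps by simp
  qed
  show "(%n. (LINT x|lborel. norm (f (T n x) - f x)) + (LINT x|lborel. norm (g (T n x) - g x))) ~~> 0"
   using tendsto_add[OF add.IH] by simp
 qed auto
next
 case (lim f s)
 show ?case
 proof (rule L1_approx[OF lim.hyps(4)])
  fix e :: real assume e: "e > 0"
  have [measurable]: "f \<in> borel_measurable lborel" "s i \<in> borel_measurable lborel" for i using lim.hyps by auto
  have "(%i. LINT x|lborel. norm (s i x - f x)) ~~> (LINT x::'a|lborel. 0)"
  proof (rule integral_dominated_convergence[where w = "%x. 3 * norm (f x)"])
   show "AE x in lborel. (%i. norm (s i x - f x)) ~~> 0"
    using lim.hyps(2) by (auto intro!: tendsto_norm_zero LIM_zero)
   show "AE x in lborel. norm (norm (s i x - f x)) <= 3 * norm (f x)" for i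
   proof (rule AE_I2)
    fix x show "norm (norm (s i x - f x)) <= 3 * norm (f x)"
     using norm_triangle_ineq4[of "s i x" "f x"] lim.hyps(3)[of x i] by simp
   qed
  qed (use lim.hyps(4) in auto)
  then have "\<forall>\<^sub>F i in sequentially. (LINT x|lborel. norm (s i x - f x)) < e"
   using e by (auto dest: order_tendstoD)
  then obtain i where "(LINT x|lborel. norm (s i x - f x)) < e" by (auto simp: eventually_sequentially)
  then show "\<exists>s::'a => 'b. integrable lborel s & (LINT x|lborel. norm (s x - f x)) <= e &
   (%n. LINT x|lborel. norm (s (T n x) - s x)) ~~> 0"
   using lim.hyps(1) lim.IH by (intro exI[of _ "s i"]) auto
 qed
qed

text \<open>The map a -> a |a| sends L^2 to L^1, and (a - b)^2 is at most twice the distance of the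
  images, so continuity in L^2 reduces to continuity in L^1 without a second density
  argument.\<close>

lemma L2_continuous:
 fixes f :: "'a => real"
 assumes "L2 f"
 shows "(%n. nsq (%x. f (T n x) - f x)) ~~> 0"
proof -
 have [measurable]: "f \<in> borel_measurable borel" using assms by (simp add: L2_def)
 let ?F = "%x. f x * \<bar>f x\<bar>"
 have F: "integrable lborel ?F"
  by (rule Bochner_Integration.integrable_bound[OF L2_integrable[OF assms]]) (auto simp: power2_eq_square abs_mult)
 have b: "(norm (a - b))^2 <= 2 * norm (a * \<bar>a\<bar> - b * \<bar>b\<bar>)" for a b :: real
 proof -
  have 1: "(a - b)^2 <= \<bar>a^2 - b^2\<bar>" if "a >= 0" "b >= 0" for a b :: real
  proof -
   have "\<bar>a - b\<bar> * \<bar>a - b\<bar> <= \<bar>a - b\<bar> * \<bar>a + b\<bar>" using that by (intro mult_left_mono) auto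
   then show ?thesis by (simp add: power2_eq_square abs_mult[symmetric] algebra_simps)
  qed
  have 2: "(a + b)^2 <= 2 * (a^2 + b^2)" for a b :: real
   using sum_squares_bound[of a b] by (simp add: power2_sum)
  show ?thesis
   using 1[of a b] 1[of "-a" "-b"] 2[of a "-b"] 2[of "-a" b]
   by (cases "a >= 0"; cases "b >= 0")
    (auto simp: power2_eq_square[symmetric] abs_if power2_commute split: if_splits)
 qed
 show ?thesis
 proof (rule tendsto_sandwich[OF _ _ tendsto_const])
  show "(%n. 2 * (LINT x|lborel. norm (?F (T n x) - ?F x))) ~~> 0"
   using tendsto_mult_left[OF L1_continuous[OF F], of 2] by simp
  show "\<forall>\<^sub>F n in sequentially. nsq (%x. f (T n x) - f x) <= 2 * (LINT x|lborel. norm (?F (T n x) - ?F x))"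
  proof (rule always_eventually, rule)
   fix n
   have i: "integrable lborel (%x. 2 * norm (?F (T n x) - ?F x))"
    using integrable_T(1)[OF F] F by auto
   have j: "integrable lborel (%x. (norm (f (T n x) - f x))^2)"
    by (rule Bochner_Integration.integrable_bound[OF i]) (use b in auto)
   have "nsq (%x. f (T n x) - f x) <= (LINT x|lborel. 2 * norm (?F (T n x) - ?F x))"
    unfolding nsq_def using b by (intro integral_mono i j)
   then show "nsq (%x. f (T n x) - f x) <= 2 * (LINT x|lborel. norm (?F (T n x) - ?F x))" by simp
  qed
 qed auto
qed

end

lemma near_identity_translation:
 assumes "h ~~> 0" shows "near_identity (%n x. h n + x) (%_. 1)"
proof
 show "(%n. h n + x) ~~> x" for x using tendsto_add[OF assms tendsto_const[of x]] by simp
 show "(\<integral>\<^sup>+x. f (h n + x) \<partial>lborel) = ennreal 1 * (\<integral>\<^sup>+x. f x \<partial>lborel)" if "f \<in> borel_measurable borel" for n f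
  using nn_integral_affine[OF _ that, of 1 "h n"] by simp
qed auto

lemma near_identity_dilation:
 fixes k :: "nat => real"
 assumes k: "k ~~> 1" and pos: "!!n. k n > 0"
 shows "near_identity (%n (x::'a::euclidean_space). k n *\<^sub>R x) (%n. 1 / k n ^ DIM('a))"
proof
 show "(%n. k n *\<^sub>R x) ~~> x" for x :: 'a using tendsto_scaleR[OF k tendsto_const[of x]] by simp
 show "(\<integral>\<^sup>+x. f (k n *\<^sub>R x) \<partial>lborel) = ennreal (1 / k n ^ DIM('a)) * (\<integral>\<^sup>+x. f x \<partial>lborel)"
  if "f \<in> borel_measurable borel" for n and f :: "'a => ennreal"
  using nn_integral_affine[OF _ that, of "k n" 0] pos[of n] by simp
 show "(%n. 1 / k n ^ DIM('a)) ~~> 1"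
  using tendsto_divide[OF tendsto_const[of 1] tendsto_power[OF k]] by simp
qed (use pos in "auto simp: less_imp_le")

subsection \<open>The Fourier transform on integrable functions\<close>

lemma L2c_eq_L2: "L2c f = L2 f"
 by (simp add: L2c_def L2_def)

lemma borel_measurable_cnj [measurable (raw)]:
 "f \<in> borel_measurable M ==> (%x. cnj (f x)) \<in> borel_measurable M"
 by (erule measurable_compose) (rule borel_measurable_continuous_onI, rule continuous_on_cnj, rule continuous_on_id)

text \<open>The normalisation that makes the transform unitary, with the dimension supplied by a
  type argument.\<close>

definition \<kappa> :: "'a::euclidean_space itself => real" where
 "\<kappa> _ = (2 * pi) powr (- real DIM('a) / 2)"

lemma \<kappa>_pos [simp]: "\<kappa> TYPE('a::euclidean_space) > 0"
 by (simp add: \<kappa>_def)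

abbreviation efun :: "'a::euclidean_space => 'a => complex" where
 "efun x xi \<equiv> exp (- \<i> * complex_of_real (x \<bullet> xi))"

lemma norm_efun [simp]: "norm (efun x xi) = 1"
 by (simp add: norm_exp_eq_Re)

lemma fourier1_alt:
 "fourier1 (f :: 'a::euclidean_space => complex) xi = complex_of_real (\<kappa> TYPE('a)) * (LINT x|lborel. f x * efun x xi)"
 by (simp add: fourier1_def \<kappa>_def)

lemma integrable_mult_bounded:
 fixes f k :: "'a::euclidean_space => complex"
 assumes "integrable lborel f" "k \<in> borel_measurable lborel" "!!x. norm (k x) <= C"
 shows "integrable lborel (%x. f x * k x)"
proof (rule Bochner_Integration.integrable_bound)
 show "integrable lborel (%x. C * norm (f x))" using assms(1) by auto
 show "(%x. f x * k x) \<in> borel_measurable lborel" using assms by auto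
 have "C >= 0" using assms(3)[of undefined] norm_ge_zero order_trans by blast
 then show "AE x in lborel. norm (f x * k x) <= norm (C * norm (f x))"
  using mult_left_mono[OF assms(3), of "norm (f _)"] by (auto simp: norm_mult abs_mult mult.commute)
qed

lemma integrable_efun [intro]:
 fixes f :: "'a::euclidean_space => complex"
 shows "integrable lborel f ==> integrable lborel (%x. f x * efun x xi)"
 by (rule integrable_mult_bounded[where C = 1]) auto

lemma fourier1_measurable [measurable]:
 fixes f :: "'a::euclidean_space => complex"
 assumes [measurable]: "f \<in> borel_measurable borel"
 shows "fourier1 f \<in> borel_measurable borel"
proof -
 have "(%xi. LINT x|lborel. f x * efun x xi) \<in> borel_measurable lborel"
  by (rule lborel.borel_measurable_lebesgue_integral) measurable
 then show ?thesis unfolding fourier1_alt[abs_def] by auto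
qed

lemma norm_fourier1_le:
 fixes f :: "'a::euclidean_space => complex"
 shows "norm (fourier1 f xi) <= \<kappa> TYPE('a) * (LINT x|lborel. norm (f x))"
proof -
 have "norm (LINT x|lborel. f x * efun x xi) <= (LINT x|lborel. norm (f x * efun x xi))"
  by (rule integral_norm_bound)
 then have "norm (LINT x|lborel. f x * efun x xi) <= (LINT x|lborel. norm (f x))"
  unfolding norm_mult norm_efun by simp
 then show ?thesis by (simp add: fourier1_alt norm_mult less_imp_le)
qed

lemma fourier1_lincomb:
 assumes "integrable lborel f" "integrable lborel g"
 shows "fourier1 (%x. a * f x + b * g x) xi = a * fourier1 f xi + b * fourier1 g xi"
proof -
 have "(LINT x|lborel. (a * f x + b * g x) * efun x xi) =
  (LINT x|lborel. a * (f x * efun x xi) + b * (g x * efun x xi))"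
  by (simp add: algebra_simps)
 also have "... = a * (LINT x|lborel. f x * efun x xi) + b * (LINT x|lborel. g x * efun x xi)"
  using integrable_efun[OF assms(1), of xi] integrable_efun[OF assms(2), of xi] by simp
 finally show ?thesis by (simp add: fourier1_alt algebra_simps)
qed

lemma fourier1_diff:
 assumes "integrable lborel f" "integrable lborel g"
 shows "fourier1 (%x. f x - g x) = (%xi. fourier1 f xi - fourier1 g xi)"
 using fourier1_lincomb[OF assms, of 1 "-1"] by (simp add: fun_eq_iff)

lemma integrable_pair_bounded:
 fixes f g :: "'a::euclidean_space => complex" and K :: "'a => 'a => complex"
 assumes f: "integrable lborel f" and g: "integrable lborel g"
  and [measurable]: "case_prod K \<in> borel_measurable (borel \<Otimes>\<^sub>M borel)" and K: "!!x y. norm (K x y) <= C"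
 shows "integrable (lborel \<Otimes>\<^sub>M lborel) (%(x, y). f x * g y * K x y)"
proof -
 have [measurable]: "f \<in> borel_measurable borel" "g \<in> borel_measurable borel" using f g by auto
 have C: "C >= 0" using K[of undefined undefined] norm_ge_zero order_trans by blast
 have "(\<integral>\<^sup>+z. ennreal (norm (case z of (x, y) => f x * g y * K x y)) \<partial>(lborel \<Otimes>\<^sub>M lborel)) <=
  (\<integral>\<^sup>+z. ennreal C * ennreal (norm (f (fst z))) * ennreal (norm (g (snd z))) \<partial>(lborel \<Otimes>\<^sub>M lborel))"
 proof (rule nn_integral_mono)
  fix z :: "'a \<times> 'a"
  have "norm (f (fst z) * g (snd z) * K (fst z) (snd z)) <= C * norm (f (fst z)) * norm (g (snd z))"
   using mult_left_mono[OF K[of "fst z" "snd z"], of "norm (f (fst z)) * norm (g (snd z))"]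
   by (simp add: norm_mult mult_ac)
  then show "ennreal (norm (case z of (x, y) => f x * g y * K x y)) <= ennreal C * ennreal (norm (f (fst z))) * ennreal (norm (g (snd z)))"
   using C by (simp add: case_prod_beta ennreal_mult[symmetric])
 qed
 also have "... = (\<integral>\<^sup>+x. (\<integral>\<^sup>+y. ennreal C * ennreal (norm (f x)) * ennreal (norm (g y)) \<partial>lborel) \<partial>lborel)"
  by (subst lborel.nn_integral_fst[symmetric]) auto
 also have "... = ennreal C * (\<integral>\<^sup>+x. ennreal (norm (f x)) \<partial>lborel) * (\<integral>\<^sup>+y. ennreal (norm (g y)) \<partial>lborel)"
  by (simp add: nn_integral_cmult nn_integral_multc)
 also have "... < \<infinity>"
  using f g by (auto simp: integrable_iff_bounded ennreal_mult_less_top)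
 finally show ?thesis by (intro integrableI_bounded) auto
qed

text \<open>Fubini for a kernel symmetric in both variables. This formula takes the place of the
  inversion theorem: Plancherel's identity and surjectivity on L^2 both come from it.\<close>

lemma fourier1_multiplication:
 fixes f g :: "'a::euclidean_space => complex"
 assumes f: "integrable lborel f" and g: "integrable lborel g"
 shows "(LINT xi|lborel. fourier1 f xi * g xi) = (LINT x|lborel. f x * fourier1 g x)"
proof -
 let ?k = "complex_of_real (\<kappa> TYPE('a))"
 have I: "integrable (lborel \<Otimes>\<^sub>M lborel) (%(x, y). f x * g y * efun x y)"
  by (rule integrable_pair_bounded[OF f g, where C = 1]) auto
 have "(LINT xi|lborel. fourier1 f xi * g xi) = ?k * (LINT xi|lborel. (LINT x|lborel. f x * g xi * efun x xi))"
  by (simp add: fourier1_alt mult_ac flip: integral_mult_right_zero integral_mult_left_zero)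
 also have "(LINT xi|lborel. (LINT x|lborel. f x * g xi * efun x xi)) = (LINT x|lborel. (LINT xi|lborel. f x * g xi * efun x xi))"
  by (rule lborel_pair.Fubini_integral[OF I])
 also have "?k * ... = (LINT x|lborel. f x * fourier1 g x)"
  by (simp add: fourier1_alt mult_ac inner_commute flip: integral_mult_right_zero integral_mult_left_zero)
 finally show ?thesis .
qed

subsection \<open>Gaussians\<close>

lemma lborel_integral_prod:
 fixes F :: "'a::euclidean_space => real => complex"
 assumes F: "!!b. b \<in> Basis ==> integrable lborel (F b)"
 shows "(LINT x|lborel. (\<Prod>b\<in>Basis. F b (x \<bullet> b))) = (\<Prod>b\<in>Basis. (LINT t|lborel. F b t))"
  and "integrable lborel (%x. \<Prod>b\<in>Basis. F b (x \<bullet> b))"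
proof -
 interpret product_sigma_finite "%_::'a. lborel :: real measure" ..
 have [measurable]: "F b \<in> borel_measurable borel" if "b \<in> Basis" for b using F[OF that] by auto
 let ?T = "%f. \<Sum>b\<in>Basis. f b *\<^sub>R b :: 'a"
 have T: "?T \<in> measurable (\<Pi>\<^sub>M b\<in>Basis. lborel) borel" by measurable
 have [measurable]: "(%x. \<Prod>b\<in>Basis. F b (x \<bullet> b)) \<in> borel_measurable borel" by measurable
 have e: "(\<Prod>b\<in>Basis. F b (?T f \<bullet> b)) = (\<Prod>b\<in>Basis. F b (f b))" for f
  by (rule prod.cong) auto
 show "(LINT x|lborel. (\<Prod>b\<in>Basis. F b (x \<bullet> b))) = (\<Prod>b\<in>Basis. (LINT t|lborel. F b t))"
  by (subst lborel_eq, subst integral_distr[OF T]) (auto simp: e product_integral_prod F)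
 show "integrable lborel (%x. \<Prod>b\<in>Basis. F b (x \<bullet> b))"
  by (subst lborel_eq, subst integrable_distr_eq[OF T]) (auto simp: e product_integrable_prod F)
qed

text \<open>A rescaling by sqrt eps of the characteristic function of the standard normal
  distribution.\<close>

lemma gauss_1d:
 assumes "eps > 0"
 shows "(LINT x|lborel. exp (- \<i> * complex_of_real (x * h)) * exp (- eps * x^2 / 2)) =
   complex_of_real (sqrt (2 * pi / eps) * exp (- h\<^sup>2 / (2 * eps)))"
  and "integrable lborel (%x. exp (- \<i> * complex_of_real (x * h)) * exp (- eps * x^2 / 2))"
proof -
 let ?s = "sqrt eps"
 have s: "?s > 0" "?s^2 = eps" using assms by auto
 have i0: "integrable lborel (std_normal_density)" by (rule integrable_normal_density) simp
 have i1: "integrable lborel (%x::real. exp (- x\<^sup>2 / 2))"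
  using integrable_mult_right[OF i0, of "sqrt (2 * pi)"] by (simp add: normal_density_def)
 have i2: "integrable lborel (%x::real. exp (- eps * x^2 / 2))"
  using integrable_affine[OF _ i1, of ?s 0] s by (simp add: power_mult_distrib)
 show int: "integrable lborel (%x. exp (- \<i> * complex_of_real (x * h)) * exp (- eps * x^2 / 2))"
  by (rule Bochner_Integration.integrable_bound[OF i2]) (auto simp: norm_mult)
 define t where "t = - h / ?s"
 have "char std_normal_distribution t = complex_of_real (exp (- t\<^sup>2 / 2))"
  by (simp add: char_std_normal_distribution)
 then have "(LINT x|lborel. std_normal_density x *\<^sub>R exp (\<i> * complex_of_real (t * x))) = complex_of_real (exp (- t\<^sup>2 / 2))"
  by (simp add: char_def integral_density normal_density_nonneg)
 then have "complex_of_real (sqrt (2 * pi)) * (LINT x|lborel. std_normal_density x *\<^sub>R exp (\<i> * complex_of_real (t * x)))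
  = complex_of_real (sqrt (2 * pi) * exp (- t\<^sup>2 / 2))" by simp
 also have "complex_of_real (sqrt (2 * pi)) * (LINT x|lborel. std_normal_density x *\<^sub>R exp (\<i> * complex_of_real (t * x))) =
  (LINT x|lborel. exp (\<i> * complex_of_real (t * x)) * exp (- x\<^sup>2 / 2))"
  unfolding integral_mult_right_zero[symmetric]
  by (rule Bochner_Integration.integral_cong) (auto simp: normal_density_def scaleR_conv_of_real field_simps simp flip: of_real_mult exp_of_real)
 finally have e: "(LINT x|lborel. exp (\<i> * complex_of_real (t * x)) * exp (- x\<^sup>2 / 2)) = complex_of_real (sqrt (2 * pi) * exp (- t\<^sup>2 / 2))" .
 have "(LINT x|lborel. exp (- \<i> * complex_of_real (x * h)) * exp (- eps * x^2 / 2)) =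
  (LINT x|lborel. exp (\<i> * complex_of_real (t * (0 + ?s *\<^sub>R x))) * exp (- (0 + ?s *\<^sub>R x)\<^sup>2 / 2))"
  using s by (intro Bochner_Integration.integral_cong) (auto simp: t_def power_mult_distrib mult_ac)
 also have "... = (1 / \<bar>?s\<bar> ^ DIM(real)) *\<^sub>R complex_of_real (sqrt (2 * pi) * exp (- t\<^sup>2 / 2))"
  using integral_affine[of ?s "%x. exp (\<i> * complex_of_real (t * x)) * exp (- x\<^sup>2 / 2)" 0] s e by simp
 also have "... = complex_of_real (sqrt (2 * pi / eps) * exp (- h\<^sup>2 / (2 * eps)))"
  using s by (simp add: t_def scaleR_conv_of_real power_divide real_sqrt_divide mult.commute)
 finally show "(LINT x|lborel. exp (- \<i> * complex_of_real (x * h)) * exp (- eps * x^2 / 2)) =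
   complex_of_real (sqrt (2 * pi / eps) * exp (- h\<^sup>2 / (2 * eps)))" .
qed

lemma norm_sq_Basis: "(norm (x::'a::euclidean_space))^2 = (\<Sum>b\<in>Basis. (x \<bullet> b)^2)"
 by (subst euclidean_inner[of x x, unfolded dot_square_norm]) (simp add: power2_eq_square)

lemma gauss_transform:
 fixes h :: "'a::euclidean_space"
 assumes "eps > 0"
 shows "(LINT xi|lborel. exp (- eps * (norm xi)^2 / 2) * efun xi h) =
   complex_of_real (sqrt (2 * pi / eps) ^ DIM('a) * exp (- (norm h)\<^sup>2 / (2 * eps)))"
  and "integrable lborel (%xi::'a. complex_of_real (exp (- eps * (norm xi)^2 / 2)) * efun xi h)"
proof -
 define F where "F b x = exp (- \<i> * complex_of_real (x * (h \<bullet> b))) * exp (- eps * x^2 / 2)" for b :: 'a and x :: real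
 have F: "integrable lborel (F b)" for b
  unfolding F_def by (rule gauss_1d[OF assms])
 have e: "complex_of_real (exp (- eps * (norm xi)^2 / 2)) * efun xi h = (\<Prod>b\<in>Basis. F b (xi \<bullet> b))" for xi
 proof -
  have "(\<Prod>b\<in>Basis. F b (xi \<bullet> b)) = exp (\<Sum>b\<in>Basis. - \<i> * complex_of_real ((xi \<bullet> b) * (h \<bullet> b)) + complex_of_real (- eps * (xi \<bullet> b)^2 / 2))"
   unfolding F_def exp_sum[OF finite_Basis] by (rule prod.cong[OF refl]) (simp only: exp_add exp_of_real)
  also have "(\<Sum>b\<in>Basis. - \<i> * complex_of_real ((xi \<bullet> b) * (h \<bullet> b)) + complex_of_real (- eps * (xi \<bullet> b)^2 / 2)) =
   - \<i> * complex_of_real (xi \<bullet> h) + complex_of_real (- eps * (norm xi)^2 / 2)"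
  proof -
   have "(\<Sum>b\<in>Basis. - \<i> * complex_of_real ((xi \<bullet> b) * (h \<bullet> b))) = - \<i> * complex_of_real (xi \<bullet> h)"
    by (subst euclidean_inner[of xi h]) (simp only: of_real_sum sum_distrib_left)
   moreover have "(\<Sum>b\<in>Basis. complex_of_real (- eps * (xi \<bullet> b)^2 / 2)) = complex_of_real (- eps * (norm xi)^2 / 2)"
    by (simp only: norm_sq_Basis of_real_sum[symmetric] sum_distrib_left sum_divide_distrib)
   ultimately show ?thesis by (simp only: sum.distrib)
  qed
  finally show ?thesis by (simp only: exp_add exp_of_real mult.commute)
 qed
 have F2: "(LINT t|lborel. F b t) = complex_of_real (sqrt (2 * pi / eps) * exp (- (h \<bullet> b)\<^sup>2 / (2 * eps)))" for b
  unfolding F_def by (rule gauss_1d[OF assms])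
 have "(\<Prod>b\<in>Basis. (LINT t|lborel. F b t)) = complex_of_real (sqrt (2 * pi / eps) ^ DIM('a) * exp (- (norm h)\<^sup>2 / (2 * eps)))"
  unfolding F2 of_real_prod[symmetric] prod.distrib norm_sq_Basis sum_negf[symmetric] sum_divide_distrib exp_sum[OF finite_Basis]
  by simp
 then show "(LINT xi|lborel. exp (- eps * (norm xi)^2 / 2) * efun xi h) =
   complex_of_real (sqrt (2 * pi / eps) ^ DIM('a) * exp (- (norm h)\<^sup>2 / (2 * eps)))"
  unfolding e using lborel_integral_prod(1)[of F, OF F] by simp
 show "integrable lborel (%xi::'a. complex_of_real (exp (- eps * (norm xi)^2 / 2)) * efun xi h)"
  unfolding e using lborel_integral_prod(2)[of F, OF F] by simp
qed

text \<open>The exact value that makes the constant in Plancherel's identity equal to 1.\<close>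

lemma \<kappa>_sqrt: "\<kappa> TYPE('a::euclidean_space) * sqrt (2 * pi) ^ DIM('a) = 1"
proof -
 have "sqrt (2 * pi) ^ DIM('a) = (2 * pi) powr (real DIM('a) / 2)"
  by (simp add: powr_half_sqrt[symmetric] powr_realpow[symmetric] powr_powr mult.commute)
 then show ?thesis by (simp add: \<kappa>_def powr_add[symmetric])
qed

lemma gauss_integral:
 "integrable lborel (%h::'a::euclidean_space. exp (- (norm h)\<^sup>2 / 2))"
 "(LINT h|lborel. exp (- (norm (h::'a))\<^sup>2 / 2)) = sqrt (2 * pi) ^ DIM('a)"
proof -
 have i: "integrable lborel (%xi::'a. complex_of_real (exp (- (norm xi)\<^sup>2 / 2)))"
  using gauss_transform(2)[of 1 "0::'a"] by simp
 then show "integrable lborel (%h::'a::euclidean_space. exp (- (norm h)\<^sup>2 / 2))"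
  using complex_of_real_integrable_eq by blast
 have "complex_of_real (LINT h|lborel. exp (- (norm (h::'a))\<^sup>2 / 2)) = complex_of_real (sqrt (2 * pi) ^ DIM('a))"
  using gauss_transform(1)[of 1 "0::'a"] by (simp add: integral_complex_of_real)
 then show "(LINT h|lborel. exp (- (norm (h::'a))\<^sup>2 / 2)) = sqrt (2 * pi) ^ DIM('a)"
  by (simp only: of_real_eq_iff)
qed

subsection \<open>Plancherel's theorem\<close>

lemma fourier1_cnj_reflect:
 fixes f :: "'a::euclidean_space => complex"
 shows "fourier1 (%x. cnj (f (- x))) xi = cnj (fourier1 f xi)"
proof -
 have "(LINT x|lborel. cnj (f (- x)) * efun x xi) = (LINT x|lborel. cnj (f x) * efun (- x) xi)"
  using integral_affine[of "-1" "%x. cnj (f x) * efun (- x) xi" 0] by simp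
 also have "... = (LINT x|lborel. cnj (f x * efun x xi))"
  by (simp add: exp_cnj)
 finally show ?thesis by (simp add: fourier1_alt del: complex_cnj_mult)
  (simp add: fourier1_alt)
qed

text \<open>The squared modulus of the transform is not known to be integrable yet, so a Gaussian
  weight is inserted. The multiplication formula then turns the weighted integral into a Gaussian
  mean of the autocorrelations of \<open>f\<close> at the shifts
  \<open>dl *\<^sub>R h\<close>.\<close>

lemma gauss_regularised_norm:
 fixes f :: "'a::euclidean_space => complex"
 assumes f: "integrable lborel f" and M: "!!x. norm (f x) <= M" and dl: "dl > 0"
 shows "integrable lborel (%xi. (cmod (fourier1 f xi))^2 * exp (- dl\<^sup>2 * (norm xi)^2 / 2))"
  and "complex_of_real (LINT xi|lborel. (cmod (fourier1 f xi))^2 * exp (- dl\<^sup>2 * (norm xi)^2 / 2)) =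
   \<kappa> TYPE('a) * (LINT h|lborel. exp (- (norm h)\<^sup>2 / 2) * (LINT x|lborel. f x * cnj (f (x - dl *\<^sub>R h))))"
proof -
 let ?k = "complex_of_real (\<kappa> TYPE('a))" and ?N = "DIM('a)"
 let ?w = "%xi::'a. complex_of_real (exp (- dl\<^sup>2 * (norm xi)^2 / 2))"
 let ?g = "%h::'a. complex_of_real (exp (- (norm h)\<^sup>2 / 2))"
 let ?ft = "%x. cnj (f (- x))"
 have [measurable]: "f \<in> borel_measurable borel" using f by auto
 have d2: "dl^2 > 0" using dl by simp
 have ft: "integrable lborel ?ft"
  using integrable_affine[of "-1" "%x. cnj (f x)" 0] f by simp
 have w: "integrable lborel ?w" using gauss_transform(2)[OF d2, of 0] by simp
 have g: "integrable lborel ?g" using gauss_integral(1) by (intro integrable_of_real)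
 have cw: "integrable lborel (%xi. ?w xi * cnj (fourier1 f xi))"
  by (rule integrable_mult_bounded[OF w]) (auto intro: norm_fourier1_le)
 have sq: "fourier1 f xi * (?w xi * cnj (fourier1 f xi)) = complex_of_real ((cmod (fourier1 f xi))^2 * exp (- dl\<^sup>2 * (norm xi)^2 / 2))" for xi
  by (simp add: complex_norm_square mult_ac del: of_real_power of_real_exp)
 have "integrable lborel (%xi. ?w xi * cnj (fourier1 f xi) * fourier1 f xi)"
  by (rule integrable_mult_bounded[OF cw]) (auto intro: norm_fourier1_le)
 then have "integrable lborel (%xi. complex_of_real ((cmod (fourier1 f xi))^2 * exp (- dl\<^sup>2 * (norm xi)^2 / 2)))"
  unfolding sq[symmetric] by (simp add: mult_ac)
 then show "integrable lborel (%xi. (cmod (fourier1 f xi))^2 * exp (- dl\<^sup>2 * (norm xi)^2 / 2))"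
  using complex_of_real_integrable_eq by blast
 \<comment> \<open>The reflected conjugate \<open>?ft\<close> has the conjugate transform, and
   \<open>?w\<close> transforms into a Gaussian of width \<open>dl\<close>; so the transform of the
   product is a convolution, rewritten as a mean over \<open>h\<close> by the substitution y = -x +
   dl h. By \<open>\<kappa>_sqrt\<close> a single factor \<open>?k\<close> is left.\<close>
 have inner: "fourier1 (%xi. ?w xi * cnj (fourier1 f xi)) x = ?k * (LINT h|lborel. ?g h * cnj (f (x - dl *\<^sub>R h)))" for x
 proof -
  have we: "integrable lborel (%xi. ?w xi * efun xi x)" using w by (rule integrable_efun)
  have 1: "fourier1 (%xi. ?w xi * efun xi x) y = complex_of_real (\<kappa> TYPE('a) * (sqrt (2 * pi / dl^2) ^ ?N * exp (- (norm (x + y))\<^sup>2 / (2 * dl^2))))" for y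
  proof -
   have "?w xi * efun xi x * efun xi y = ?w xi * efun xi (x + y)" for xi
    by (simp add: inner_add_right exp_add[symmetric] algebra_simps)
   then show ?thesis by (simp only: fourier1_alt gauss_transform(1)[OF d2] of_real_mult)
  qed
  have "fourier1 (%xi. ?w xi * cnj (fourier1 f xi)) x = ?k * (LINT xi|lborel. fourier1 ?ft xi * (?w xi * efun xi x))"
   unfolding fourier1_alt[of "%xi. ?w xi * cnj (fourier1 f xi)"] fourier1_cnj_reflect by (simp only: mult_ac)
  also have "... = ?k * (LINT y|lborel. ?ft y * complex_of_real (\<kappa> TYPE('a) * (sqrt (2 * pi / dl^2) ^ ?N * exp (- (norm (x + y))\<^sup>2 / (2 * dl^2)))))"
   by (simp only: fourier1_multiplication[OF ft we] 1)
  also have "... = ?k * complex_of_real (\<kappa> TYPE('a) * (sqrt (2 * pi / dl^2) ^ ?N)) * (LINT y|lborel. ?ft y * exp (- (norm (x + y))\<^sup>2 / (2 * dl^2)))"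
   unfolding integral_mult_right_zero[symmetric] by (simp only: of_real_mult mult_ac)
  also have "(LINT y|lborel. ?ft y * exp (- (norm (x + y))\<^sup>2 / (2 * dl^2))) =
   complex_of_real (dl ^ ?N) * (LINT h|lborel. ?g h * cnj (f (x - dl *\<^sub>R h)))"
  proof -
   have "(LINT h|lborel. ?g h * cnj (f (x - dl *\<^sub>R h))) =
    (LINT h|lborel. ?ft (- x + dl *\<^sub>R h) * exp (- (norm (x + (- x + dl *\<^sub>R h)))\<^sup>2 / (2 * dl^2)))"
    using dl by (intro Bochner_Integration.integral_cong) (auto simp: power_mult_distrib mult.commute)
   also have "... = (1 / \<bar>dl\<bar> ^ ?N) *\<^sub>R (LINT y|lborel. ?ft y * exp (- (norm (x + y))\<^sup>2 / (2 * dl^2)))"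
    using dl by (intro integral_affine[of dl "%y. ?ft y * exp (- (norm (x + y))\<^sup>2 / (2 * dl^2))" "- x"]) simp
   finally show ?thesis using dl by (simp add: scaleR_conv_of_real)
  qed
  also have "?k * complex_of_real (\<kappa> TYPE('a) * (sqrt (2 * pi / dl^2) ^ ?N)) * (complex_of_real (dl ^ ?N) * (LINT h|lborel. ?g h * cnj (f (x - dl *\<^sub>R h)))) =
   ?k * complex_of_real (\<kappa> TYPE('a) * (sqrt (2 * pi / dl^2) ^ ?N) * dl ^ ?N) * (LINT h|lborel. ?g h * cnj (f (x - dl *\<^sub>R h)))"
   by simp
  also have "\<kappa> TYPE('a) * (sqrt (2 * pi / dl^2) ^ ?N) * dl ^ ?N = 1"
   using dl \<kappa>_sqrt[where 'a = 'a] by (simp add: real_sqrt_divide power_divide)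
  finally show ?thesis by simp
 qed
 have I: "integrable (lborel \<Otimes>\<^sub>M lborel) (%(x, h). f x * ?g h * cnj (f (x - dl *\<^sub>R h)))"
  by (rule integrable_pair_bounded[OF f g, where C = M]) (use M in auto)
 have "complex_of_real (LINT xi|lborel. (cmod (fourier1 f xi))^2 * exp (- dl\<^sup>2 * (norm xi)^2 / 2)) =
  (LINT xi|lborel. fourier1 f xi * (?w xi * cnj (fourier1 f xi)))"
  by (simp only: sq integral_complex_of_real)
 also have "... = (LINT x|lborel. f x * (?k * (LINT h|lborel. ?g h * cnj (f (x - dl *\<^sub>R h)))))"
  by (simp only: fourier1_multiplication[OF f cw] inner)
 also have "... = ?k * (LINT x|lborel. (LINT h|lborel. f x * ?g h * cnj (f (x - dl *\<^sub>R h))))"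
  unfolding integral_mult_right_zero[symmetric] by (simp only: mult_ac)
 also have "(LINT x|lborel. (LINT h|lborel. f x * ?g h * cnj (f (x - dl *\<^sub>R h)))) =
   (LINT h|lborel. (LINT x|lborel. f x * ?g h * cnj (f (x - dl *\<^sub>R h))))"
  by (rule lborel_pair.Fubini_integral[OF I, symmetric])
 also have "... = (LINT h|lborel. exp (- (norm h)\<^sup>2 / 2) * (LINT x|lborel. f x * cnj (f (x - dl *\<^sub>R h))))"
  unfolding integral_mult_right_zero[symmetric] by (simp only: mult_ac)
 finally show "complex_of_real (LINT xi|lborel. (cmod (fourier1 f xi))^2 * exp (- dl\<^sup>2 * (norm xi)^2 / 2)) =
   \<kappa> TYPE('a) * (LINT h|lborel. exp (- (norm h)\<^sup>2 / 2) * (LINT x|lborel. f x * cnj (f (x - dl *\<^sub>R h))))" .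
qed

lemma LINT_norm_bound:
 fixes f :: "'a => 'b::{banach,second_countable_topology}"
 assumes "integrable M f" "integrable M g" "!!x. norm (f x) <= g x"
 shows "norm (integral\<^sup>L M f) <= integral\<^sup>L M g"
 by (rule order_trans[OF integral_norm_bound]) (use assms in "auto intro: integral_mono")

lemma L2_bounded_integrable:
 assumes "integrable lborel f" "!!x. norm (f x) <= M" shows "L2 f"
proof -
 have "integrable lborel (%x. (norm (f x))^2)"
 proof (rule Bochner_Integration.integrable_bound)
  show "integrable lborel (%x. M * norm (f x))" using assms(1) by auto
  have "M >= 0" using order_trans[OF norm_ge_zero assms(2)] .
  then show "AE x in lborel. norm ((norm (f x))^2) <= norm (M * norm (f x))"
   by (auto simp: power2_eq_square intro!: mult_right_mono assms(2))
 qed (use assms in auto)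
 then show ?thesis using assms(1) by (auto simp: L2_def)
qed

text \<open>Boundedness of \<open>f\<close> turns the L^1 continuity of translations into continuity
  of the autocorrelation at 0, where its value is \<open>nsq f\<close>.\<close>

lemma autocorrelation_tendsto:
 fixes f :: "'a::euclidean_space => complex"
 assumes f: "integrable lborel f" and M: "!!x. norm (f x) <= M" and h: "h ~~> 0"
 shows "(%n. LINT x|lborel. f x * cnj (f (x - h n))) ~~> complex_of_real (nsq f)"
proof -
 have [measurable]: "f \<in> borel_measurable borel" using f by auto
 have tr: "integrable lborel (%x. f (k + x))" for k
  using integrable_affine[OF _ f, of 1 k] by simp
 interpret near_identity "%n x. - h n + x" "%_. 1"
  by (rule near_identity_translation) (use tendsto_minus[OF h] in simp)
 have int: "integrable lborel (%x. cnj (f (- k + x)) * f x)" for k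
  by (rule integrable_mult_bounded[where C = M]) (use tr[of "- k"] M in auto)
 have n0: "(LINT x|lborel. cnj (f x) * f x) = complex_of_real (nsq f)"
  unfolding nsq_def integral_complex_of_real[symmetric]
  by (rule Bochner_Integration.integral_cong) (simp_all only: complex_norm_square mult.commute)
 have "(%n. (LINT x|lborel. cnj (f (- h n + x)) * f x) - (LINT x|lborel. cnj (f x) * f x)) ~~> 0"
 proof (rule Lim_null_comparison)
  show "\<forall>\<^sub>F n in sequentially. norm ((LINT x|lborel. cnj (f (- h n + x)) * f x) - (LINT x|lborel. cnj (f x) * f x))
   <= M * (LINT x|lborel. norm (f (- h n + x) - f x))"
  proof (rule always_eventually, rule)
   fix n
   have "(LINT x|lborel. cnj (f (- h n + x)) * f x) - (LINT x|lborel. cnj (f x) * f x) =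
    (LINT x|lborel. cnj (f (- h n + x) - f x) * f x)"
    using int[of "h n"] int[of 0] by (simp add: left_diff_distrib)
   also have "norm ... <= (LINT x|lborel. M * norm (f (- h n + x) - f x))"
   proof (rule LINT_norm_bound)
    show "integrable lborel (%x. cnj (f (- h n + x) - f x) * f x)"
     using int[of "h n"] int[of 0] by (simp add: left_diff_distrib)
    show "integrable lborel (%x. M * norm (f (- h n + x) - f x))"
     by (intro integrable_mult_right integrable_norm Bochner_Integration.integrable_diff tr f)
    show "norm (cnj (f (- h n + x) - f x) * f x) <= M * norm (f (- h n + x) - f x)" for x
     using mult_left_mono[OF M[of x], of "norm (f (- h n + x) - f x)"]
     by (simp add: norm_mult mult.commute flip: complex_cnj_diff)
   qed
   finally show "norm ((LINT x|lborel. cnj (f (- h n + x)) * f x) - (LINT x|lborel. cnj (f x) * f x))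
   <= M * (LINT x|lborel. norm (f (- h n + x) - f x))" by simp
  qed
  show "(%n. M * (LINT x|lborel. norm (f (- h n + x) - f x))) ~~> 0"
   using tendsto_mult_left[OF L1_continuous[OF f], of M] by simp
 qed
 then have "(%n. LINT x|lborel. cnj (f (- h n + x)) * f x) ~~> (LINT x|lborel. cnj (f x) * f x)"
  by (rule LIM_zero_cancel)
 then have "(%n. LINT x|lborel. cnj (f (- h n + x)) * f x) ~~> complex_of_real (nsq f)" unfolding n0 .
 then show ?thesis by (simp add: mult.commute)
qed

text \<open>The weight in \<open>gauss_regularised_norm\<close> is let tend to 1: dominated
  convergence on the autocorrelation side gives \<open>nsq f\<close>, and monotone convergence on
  the frequency side gives square integrability and the value of the integral at once.\<close>

lemma Plancherel_bounded:
 fixes f :: "'a::euclidean_space => complex"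
 assumes f: "integrable lborel f" and M: "!!x. norm (f x) <= M"
 shows "L2 (fourier1 f)" "nsq (fourier1 f) = nsq f"
proof -
 have [measurable]: "f \<in> borel_measurable borel" using f by auto
 let ?k = "complex_of_real (\<kappa> TYPE('a))"
 define d where "d n = inverse (real (Suc n))" for n
 have d: "d n > 0" "d ~~> 0" for n
  unfolding d_def using LIMSEQ_inverse_real_of_nat by auto
 let ?B = "%k. LINT x|lborel. f x * cnj (f (x - k))"
 let ?I = "%n. LINT xi|lborel. (cmod (fourier1 f xi))^2 * exp (- (d n)\<^sup>2 * (norm xi)^2 / 2)"
 have Bm: "(%h. ?B (c *\<^sub>R h)) \<in> borel_measurable lborel" for c
  by (rule lborel.borel_measurable_lebesgue_integral) measurable
 have Bb: "norm (?B k) <= M * (LINT x|lborel. norm (f x))" for k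
 proof -
  have "norm (?B k) <= (LINT x|lborel. M * norm (f x))"
  proof (rule LINT_norm_bound)
   show "integrable lborel (%x. f x * cnj (f (x - k)))"
    by (rule integrable_mult_bounded[OF f, where C = M]) (use M in auto)
   show "norm (f x * cnj (f (x - k))) <= M * norm (f x)" for x
    using mult_left_mono[OF M[of "x - k"], of "norm (f x)"] by (simp add: norm_mult mult.commute)
  qed (use f in auto)
  then show ?thesis by simp
 qed
 have "(%n. LINT h|lborel. complex_of_real (exp (- (norm (h::'a))\<^sup>2 / 2)) * ?B (d n *\<^sub>R h)) ~~>
  (LINT h|lborel. complex_of_real (exp (- (norm (h::'a))\<^sup>2 / 2)) * complex_of_real (nsq f))"
 proof (rule integral_dominated_convergence)
  show "integrable lborel (%h::'a. exp (- (norm h)\<^sup>2 / 2) * (M * (LINT x|lborel. norm (f x))))"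
   by (rule integrable_mult_left[OF gauss_integral(1)])
  show "AE h in lborel. (%n. complex_of_real (exp (- (norm (h::'a))\<^sup>2 / 2)) * ?B (d n *\<^sub>R h)) ~~>
   complex_of_real (exp (- (norm h)\<^sup>2 / 2)) * complex_of_real (nsq f)"
  proof (rule AE_I2)
   fix h :: 'a
   have "(%n. d n *\<^sub>R h) ~~> 0" using tendsto_scaleR[OF d(2) tendsto_const[of h]] by simp
   from autocorrelation_tendsto[OF f M this]
   show "(%n. complex_of_real (exp (- (norm (h::'a))\<^sup>2 / 2)) * ?B (d n *\<^sub>R h)) ~~>
    complex_of_real (exp (- (norm h)\<^sup>2 / 2)) * complex_of_real (nsq f)"
    by (intro tendsto_intros)
  qed
  show "AE h in lborel. norm (complex_of_real (exp (- (norm (h::'a))\<^sup>2 / 2)) * ?B (d n *\<^sub>R h)) <=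
    exp (- (norm h)\<^sup>2 / 2) * (M * (LINT x|lborel. norm (f x)))" for n
   using Bb by (auto simp: norm_mult intro!: mult_left_mono)
  show "(%h. complex_of_real (exp (- (norm (h::'a))\<^sup>2 / 2)) * ?B (d n *\<^sub>R h)) \<in> borel_measurable lborel" for n
   by (rule borel_measurable_times[OF _ Bm]) measurable
 qed measurable
 then have "(%n. ?k * (LINT h|lborel. complex_of_real (exp (- (norm (h::'a))\<^sup>2 / 2)) * ?B (d n *\<^sub>R h))) ~~>
  ?k * (LINT h|lborel. complex_of_real (exp (- (norm (h::'a))\<^sup>2 / 2)) * complex_of_real (nsq f))"
  by (intro tendsto_intros)
 also have "?k * (LINT h|lborel. complex_of_real (exp (- (norm (h::'a))\<^sup>2 / 2)) * complex_of_real (nsq f)) =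
  complex_of_real (\<kappa> TYPE('a) * (sqrt (2 * pi) ^ DIM('a)) * nsq f)"
  unfolding of_real_mult[symmetric] integral_complex_of_real integral_mult_left_zero gauss_integral(2)
  by simp
 also have "... = complex_of_real (nsq f)" by (simp only: \<kappa>_sqrt mult_1)
 finally have "(%n. complex_of_real (?I n)) ~~> complex_of_real (nsq f)"
  unfolding gauss_regularised_norm(2)[OF f M d(1)] .
 then have lim: "?I ~~> nsq f" by (simp only: tendsto_of_real_iff)
 have mono: "mono (%n. (cmod (fourier1 f xi))^2 * exp (- (d n)\<^sup>2 * (norm xi)^2 / 2))" for xi
 proof (rule monoI)
  fix m n :: nat assume "m <= n"
  then have "(d n)^2 <= (d m)^2" unfolding d_def by (intro power_mono le_imp_inverse_le) auto
  then have "(d n)^2 * (norm xi)^2 <= (d m)^2 * (norm xi)^2" by (intro mult_right_mono) auto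
  then show "(cmod (fourier1 f xi))^2 * exp (- (d m)\<^sup>2 * (norm xi)^2 / 2) <= (cmod (fourier1 f xi))^2 * exp (- (d n)\<^sup>2 * (norm xi)^2 / 2)"
   by (intro mult_left_mono) auto
 qed
 have pt: "(%n. (cmod (fourier1 f xi))^2 * exp (- (d n)\<^sup>2 * (norm xi)^2 / 2)) ~~> (cmod (fourier1 f xi))^2" for xi
 proof -
  have "(%n. (cmod (fourier1 f xi))^2 * exp (- (d n)\<^sup>2 * (norm xi)^2 / 2)) ~~> (cmod (fourier1 f xi))^2 * exp (- 0\<^sup>2 * (norm xi)^2 / 2)"
   by (intro tendsto_intros d(2)) auto
  then show ?thesis by simp
 qed
 have i: "integrable lborel (%xi. (cmod (fourier1 f xi))^2)"
  by (rule integrable_monotone_convergence[OF gauss_regularised_norm(1)[OF f M d(1)] _ _ lim])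
   (use mono pt in auto)
 then show "L2 (fourier1 f)" by (simp add: L2_def)
 have "(LINT xi|lborel. (cmod (fourier1 f xi))^2) = nsq f"
  by (rule integral_monotone_convergence[OF gauss_regularised_norm(1)[OF f M d(1)] _ _ lim])
   (use mono pt in auto)
 then show "nsq (fourier1 f) = nsq f" by (simp add: nsq_def)
qed

text \<open>Truncations in height converge both in L^1 and in L^2. The first gives pointwise
  convergence of the transforms, the second their Cauchy property in L^2, so the L^2 limit is
  \<open>fourier1 f\<close> itself.\<close>

theorem Plancherel_L1_L2:
 fixes f :: "'a::euclidean_space => complex"
 assumes f: "integrable lborel f" and f2: "L2 f"
 shows "L2 (fourier1 f)" "nsq (fourier1 f) = nsq f"
proof -
 have [measurable]: "f \<in> borel_measurable borel" using f by auto
 define t where "t n x = (if norm (f x) <= real n then f x else 0)" for n :: nat and x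
 have [measurable]: "t n \<in> borel_measurable borel" for n unfolding t_def by measurable
 have tl: "(%n. t n x) ~~> f x" for x
 proof -
  have "\<forall>\<^sub>F n in sequentially. norm (f x) <= real n"
   using eventually_ge_at_top[of "nat \<lceil>norm (f x)\<rceil>"] by eventually_elim linarith
  then have "\<forall>\<^sub>F n in sequentially. t n x = f x" by eventually_elim (simp add: t_def)
  then show ?thesis by (simp add: tendsto_eventually)
 qed
 have tle: "norm (t n x) <= norm (f x)" for n x by (simp add: t_def)
 have ti: "integrable lborel (t n)" for n
  by (rule Bochner_Integration.integrable_bound[OF f]) (use tle in auto)
 have tb: "norm (t n x) <= real n" for n x by (simp add: t_def)
 have tb2: "norm (t m x - t n x) <= real m + real n" for m n x
  using norm_triangle_ineq4[of "t m x" "t n x"] tb[of m x] tb[of n x] by linarith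
 have tL: "L2 (t n)" for n using L2_bounded_integrable[OF ti tb] .
 have dist1: "(%n. LINT x|lborel. norm (t n x - f x)) ~~> (LINT x::'a|lborel. 0)"
 proof (rule integral_dominated_convergence[where w = "%x. 2 * norm (f x)"])
  show "AE x in lborel. (%n. norm (t n x - f x)) ~~> 0"
   using tl by (auto intro!: tendsto_norm_zero LIM_zero)
  show "AE x in lborel. norm (norm (t n x - f x)) <= 2 * norm (f x)" for n
   by (auto simp: t_def)
 qed (use f in auto)
 have dist2: "(%n. nsq (%x. t n x - f x)) ~~> 0"
 proof -
  have "(%n. LINT x|lborel. (norm (t n x - f x))^2) ~~> (LINT x::'a|lborel. 0)"
  proof (rule integral_dominated_convergence[where w = "%x. (norm (f x))^2"])
   show "AE x in lborel. (%n. (norm (t n x - f x))^2) ~~> 0"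
   proof (rule AE_I2)
    fix x
    have "(%n. (norm (t n x - f x))^2) ~~> (norm (f x - f x))^2" by (intro tendsto_intros tl)
    then show "(%n. (norm (t n x - f x))^2) ~~> 0" by simp
   qed
   show "AE x in lborel. norm ((norm (t n x - f x))^2) <= (norm (f x))^2" for n
    by (auto simp: t_def)
  qed (use f2 in "auto simp: L2_def")
  then show ?thesis by (simp add: nsq_def)
 qed
 have FL: "L2 (fourier1 (t n))" for n using Plancherel_bounded[OF ti tb] by simp
 have Fd: "nsq (%xi. fourier1 (t m) xi - fourier1 (t n) xi) = nsq (%x. t m x - t n x)" for m n
  using Plancherel_bounded(2)[of "%x. t m x - t n x" "real m + real n"] ti tb2
  by (simp add: fourier1_diff[OF ti ti])
 have C: "\<exists>M. \<forall>m\<ge>M. \<forall>n\<ge>M. nsq (%xi. fourier1 (t m) xi - fourier1 (t n) xi) <= e" if e: "e > 0" for e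
 proof -
  have "\<forall>\<^sub>F n in sequentially. nsq (%x. t n x - f x) < e / 4"
   using order_tendstoD(2)[OF dist2, of "e/4"] e by simp
  then obtain M where M: "!!n. n >= M ==> nsq (%x. t n x - f x) < e / 4" by (auto simp: eventually_sequentially)
  have "nsq (%x. t m x - t n x) <= e" if "m >= M" "n >= M" for m n
   using nsq_diff_le[OF L2_diff[OF tL f2] L2_diff[OF tL f2], of m n] M[OF that(1)] M[OF that(2)] by simp
  then show ?thesis unfolding Fd by blast
 qed
 have pw: "(%n. fourier1 (t n) xi) ~~> fourier1 f xi" for xi
 proof (rule LIM_zero_cancel, rule Lim_null_comparison)
  show "\<forall>\<^sub>F n in sequentially. norm (fourier1 (t n) xi - fourier1 f xi) <= \<kappa> TYPE('a) * (LINT x|lborel. norm (t n x - f x))"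
   using norm_fourier1_le[of "%x. t _ x - f x" xi] by (simp add: fourier1_diff[OF ti f])
  show "(%n. \<kappa> TYPE('a) * (LINT x|lborel. norm (t n x - f x))) ~~> 0"
   using tendsto_mult_left[OF dist1, of "\<kappa> TYPE('a)"] by simp
 qed
 have fm: "fourier1 f \<in> borel_measurable lborel" by simp
 note lim = L2_limit_AE[OF FL fm C strict_mono_id, unfolded id_def]
 then show L: "L2 (fourier1 f)" using pw by auto
 have "(%n. nsq (%xi. fourier1 (t n) xi - fourier1 f xi)) ~~> 0" using lim(2) pw by auto
 from nsq_tendsto[OF FL L this] have "(%n. nsq (t n)) ~~> nsq (fourier1 f)"
  using Plancherel_bounded(2)[OF ti tb] by simp
 moreover have "(%n. nsq (t n)) ~~> nsq f" by (rule nsq_tendsto[OF tL f2 dist2])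
 ultimately show "nsq (fourier1 f) = nsq f" by (rule LIMSEQ_unique)
qed

subsection \<open>The Fourier transform on square integrable functions\<close>

lemma L2_fourier_L2: "L2_fourier f v ==> L2 f" "L2_fourier f v ==> L2 v"
 by (auto simp: L2_fourier_def L2c_eq_L2)

lemma L2_fourier_iff:
 "L2_fourier f v \<longleftrightarrow> L2 f & L2 v & (\<exists>fn. (\<forall>n. integrable lborel (fn n) & L2 (fn n)) &
  (%n::nat. nsq (%x. fn n x - f x)) ~~> 0 & (%n. nsq (%x. fourier1 (fn n) x - v x)) ~~> 0)"
 by (simp add: L2_fourier_def L2c_eq_L2 nsq_def)

lemma L2_fourier_nsq:
 assumes "L2_fourier f v" shows "nsq v = nsq f"
proof -
 obtain fn where fn: "!!n. integrable lborel (fn n)" "!!n. L2 (fn n)" "L2 f" "L2 v"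
  "(%n::nat. nsq (%x. fn n x - f x)) ~~> 0" "(%n. nsq (%x. fourier1 (fn n) x - v x)) ~~> 0"
  using assms by (auto simp: L2_fourier_iff)
 have "(%n. nsq (fn n)) ~~> nsq f" by (rule nsq_tendsto) (use fn in auto)
 moreover have "(%n. nsq (fourier1 (fn n))) ~~> nsq v"
  by (rule nsq_tendsto) (use fn in "auto intro: Plancherel_L1_L2")
 ultimately show ?thesis
  using Plancherel_L1_L2(2)[OF fn(1,2)] by (simp add: LIMSEQ_unique)
qed

lemma nsq_lincomb_tendsto:
 fixes f g :: "nat => 'a::euclidean_space => complex"
 assumes "!!n. L2 (f n)" "!!n. L2 (g n)" "(%n. nsq (f n)) ~~> 0" "(%n. nsq (g n)) ~~> 0"
 shows "(%n. nsq (%x. a * f n x + b * g n x)) ~~> 0"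
proof (rule tendsto_sandwich[OF _ _ tendsto_const])
 show "\<forall>\<^sub>F n in sequentially. nsq (%x. a * f n x + b * g n x) <= 2 * ((norm a)^2 * nsq (f n)) + 2 * ((norm b)^2 * nsq (g n))"
  using nsq_add_le[OF L2_mult L2_mult, OF assms(1,2)] by (simp add: nsq_mult)
 show "(%n. 2 * ((norm a)^2 * nsq (f n)) + 2 * ((norm b)^2 * nsq (g n))) ~~> 0"
  using tendsto_add[OF tendsto_mult_left[OF tendsto_mult_left[OF assms(3)]] tendsto_mult_left[OF tendsto_mult_left[OF assms(4)]], of 2 "(norm a)^2" 2 "(norm b)^2"]
  by simp
qed auto

lemma L2_fourier_lincomb:
 assumes "L2_fourier f v" "L2_fourier g w"
 shows "L2_fourier (%x. a * f x + b * g x) (%x. a * v x + b * w x)"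
proof -
 obtain fn where fn: "!!n. integrable lborel (fn n)" "!!n. L2 (fn n)" "L2 f" "L2 v"
  "(%n::nat. nsq (%x. fn n x - f x)) ~~> 0" "(%n. nsq (%x. fourier1 (fn n) x - v x)) ~~> 0"
  using assms(1) by (auto simp: L2_fourier_iff)
 obtain gn where gn: "!!n. integrable lborel (gn n)" "!!n. L2 (gn n)" "L2 g" "L2 w"
  "(%n::nat. nsq (%x. gn n x - g x)) ~~> 0" "(%n. nsq (%x. fourier1 (gn n) x - w x)) ~~> 0"
  using assms(2) by (auto simp: L2_fourier_iff)
 have e: "a * p + b * q - (a * r + b * s) = a * (p - r) + b * (q - s)" for p q r s :: complex
  by (simp add: algebra_simps)
 note F = Plancherel_L1_L2(1)[OF fn(1,2)] Plancherel_L1_L2(1)[OF gn(1,2)]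
 show ?thesis unfolding L2_fourier_iff
 proof (intro conjI exI[of _ "%n x. a * fn n x + b * gn n x"] allI)
  show "(%n. nsq (%x. a * fn n x + b * gn n x - (a * f x + b * g x))) ~~> 0"
   unfolding e by (rule nsq_lincomb_tendsto) (use fn gn in "auto intro: L2_diff")
  show "(%n. nsq (%x. fourier1 (%x. a * fn n x + b * gn n x) x - (a * v x + b * w x))) ~~> 0"
   unfolding fourier1_lincomb[OF fn(1) gn(1)] e by (rule nsq_lincomb_tendsto) (use fn gn F in "auto intro: L2_diff")
 qed (use fn gn in "auto intro!: L2_add L2_mult")
qed

lemma L2_fourier_diff:
 "L2_fourier f v ==> L2_fourier g w ==> L2_fourier (%x. f x - g x) (%x. v x - w x)"
 using L2_fourier_lincomb[of f v g w 1 "-1"] by simp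

lemma L2_fourier_unique:
 assumes "L2_fourier f v" "L2_fourier f w" shows "AE x in lborel. v x = w x"
proof -
 have "nsq (%x. v x - w x) = 0"
  using L2_fourier_nsq[OF L2_fourier_diff[OF assms]] by simp
 then show ?thesis
  using nsq_eq_0[OF L2_diff[OF L2_fourier_L2(2)[OF assms(1)] L2_fourier_L2(2)[OF assms(2)]]] by simp
qed

lemma L2_cong_AE:
 assumes "L2 f" "g \<in> borel_measurable lborel" "AE x in lborel. f x = g x" shows "L2 g"
 by (rule L2_bound(1)[OF assms(1,2), of 1]) (use assms(3) in auto)

lemma L2_fourier_cong:
 assumes F: "L2_fourier f v" and m: "f' \<in> borel_measurable lborel" "v' \<in> borel_measurable lborel"
  and ae: "AE x in lborel. f x = f' x" "AE x in lborel. v x = v' x"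
 shows "L2_fourier f' v'"
proof -
 obtain fn where fn: "!!n. integrable lborel (fn n)" "!!n. L2 (fn n)" "L2 f" "L2 v"
  "(%n::nat. nsq (%x. fn n x - f x)) ~~> 0" "(%n. nsq (%x. fourier1 (fn n) x - v x)) ~~> 0"
  using F by (auto simp: L2_fourier_iff)
 have [measurable]: "fn n \<in> borel_measurable borel" for n using fn(1)[of n] by auto
 have [measurable]: "f \<in> borel_measurable borel" "v \<in> borel_measurable borel" using fn by (auto simp: L2_def)
 have [measurable]: "f' \<in> borel_measurable borel" "v' \<in> borel_measurable borel" using m by auto
 have 1: "nsq (%x. fn n x - f' x) = nsq (%x. fn n x - f x)" for n
  by (rule nsq_cong_AE) (use ae(1) in auto)
 have 2: "nsq (%x. fourier1 (fn n) x - v' x) = nsq (%x. fourier1 (fn n) x - v x)" for n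
  by (rule nsq_cong_AE) (use ae(2) in auto)
 show ?thesis unfolding L2_fourier_iff
 proof (intro conjI exI[of _ fn])
  show "L2 f'" by (rule L2_cong_AE[OF fn(3) m(1) ae(1)])
  show "L2 v'" by (rule L2_cong_AE[OF fn(4) m(2) ae(2)])
 qed (use fn 1 2 in auto)
qed

lemma L2_truncate:
 fixes f :: "'a::euclidean_space => complex"
 assumes "L2 f"
 defines "t \<equiv> %n x. if norm x <= real n then f x else 0"
 shows "!!n. integrable lborel (t n)" "!!n. L2 (t n)" "(%n. nsq (%x. t n x - f x)) ~~> 0"
proof -
 have [measurable]: "f \<in> borel_measurable borel" using assms(1) by (simp add: L2_def)
 have [measurable]: "t n \<in> borel_measurable borel" for n unfolding t_def by measurable
 have tle: "norm (t n x) <= 1 * norm (f x)" for n x by (simp add: t_def)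
 show tL: "L2 (t n)" for n by (rule L2_bound(1)[OF assms(1), of _ 1]) (use tle in auto)
 show "integrable lborel (t n)" for n
 proof (rule Bochner_Integration.integrable_bound)
  have "integrable lborel (indicator (cball (0::'a) (real n)) :: 'a => real)"
   using emeasure_bounded_finite[of "cball (0::'a) (real n)"] by (auto simp: integrable_indicator_iff)
  then show "integrable lborel (%x. indicator (cball (0::'a) (real n)) x + (norm (f x))^2)"
   using assms(1) by (auto simp: L2_def)
  have "a <= 1 + a^2" for a :: real
   using sum_squares_bound[of a 1] by (cases "a >= 0") (auto, smt (verit) zero_le_power2)
  then show "AE x in lborel. norm (t n x) <= norm (indicator (cball (0::'a) (real n)) x + (norm (f x))^2 :: real)"
   by (auto simp: t_def indicator_def)
 qed measurable
 show "(%n. nsq (%x. t n x - f x)) ~~> 0"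
 proof -
  have "(%n. LINT x|lborel. (norm (t n x - f x))^2) ~~> (LINT x::'a|lborel. 0)"
  proof (rule integral_dominated_convergence[where w = "%x. (norm (f x))^2"])
   show "AE x in lborel. (%n. (norm (t n x - f x))^2) ~~> 0"
   proof (rule AE_I2)
    fix x :: 'a
    have "\<forall>\<^sub>F n in sequentially. norm x <= real n"
     using eventually_ge_at_top[of "nat \<lceil>norm x\<rceil>"] by eventually_elim linarith
    then have "\<forall>\<^sub>F n in sequentially. (norm (t n x - f x))^2 = 0" by eventually_elim (simp add: t_def)
    then show "(%n. (norm (t n x - f x))^2) ~~> 0" by (simp add: tendsto_eventually)
   qed
   show "AE x in lborel. norm ((norm (t n x - f x))^2) <= (norm (f x))^2" for n
    by (auto simp: t_def)
  qed (use assms(1) in "auto simp: L2_def")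
  then show ?thesis by (simp add: nsq_def)
 qed
qed

lemma Cauchy_of_nsq_tendsto:
 assumes "!!n. L2 (t n)" "L2 f" "(%n. nsq (%x. t n x - f x)) ~~> 0" "e > 0"
 shows "\<exists>M. \<forall>m\<ge>M. \<forall>n\<ge>M. nsq (%x. t m x - t n x) <= e"
proof -
 have "\<forall>\<^sub>F n in sequentially. nsq (%x. t n x - f x) < e / 4"
  using order_tendstoD(2)[OF assms(3), of "e/4"] assms(4) by simp
 then obtain M where M: "!!n. n >= M ==> nsq (%x. t n x - f x) < e / 4" by (auto simp: eventually_sequentially)
 have "nsq (%x. t m x - t n x) <= e" if "m >= M" "n >= M" for m n
  using nsq_diff_le[OF L2_diff[OF assms(1,2)] L2_diff[OF assms(1,2)], of m n] M[OF that(1)] M[OF that(2)] by simp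
 then show ?thesis by blast
qed

theorem L2_fourier_exists:
 assumes "L2 (f :: 'a::euclidean_space => complex)"
 shows "\<exists>v. L2_fourier f v"
proof -
 define t where "t n x = (if norm x <= real n then f x else 0)" for n :: nat and x
 note t = L2_truncate[OF assms, folded t_def]
 have C: "\<exists>M. \<forall>m\<ge>M. \<forall>n\<ge>M. nsq (%xi. fourier1 (t m) xi - fourier1 (t n) xi) <= e" if e: "e > 0" for e
 proof -
  have "nsq (%xi. fourier1 (t m) xi - fourier1 (t n) xi) = nsq (%x. t m x - t n x)" for m n
   using Plancherel_L1_L2(2)[OF Bochner_Integration.integrable_diff[OF t(1) t(1)] L2_diff[OF t(2) t(2)], of m n]
   by (simp add: fourier1_diff[OF t(1) t(1)])
  then show ?thesis using Cauchy_of_nsq_tendsto[OF t(2) assms t(3) e] by simp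
 qed
 obtain v where "L2 v" "(%n. nsq (%x. fourier1 (t n) x - v x)) ~~> 0"
  by (rule Riesz_Fischer[OF Plancherel_L1_L2(1)[OF t(1,2)] C])
 then show ?thesis
  using t assms unfolding L2_fourier_iff by (intro exI[of _ v] conjI exI[of _ t]) auto
qed

lemma L2_fourier_multiplication:
 assumes f: "L2_fourier f v" and g: "L2_fourier g w"
 shows "(LINT x|lborel. v x * g x) = (LINT x|lborel. f x * w x)"
proof -
 obtain fn where fn: "!!n. integrable lborel (fn n)" "!!n. L2 (fn n)" "L2 f" "L2 v"
  "(%n::nat. nsq (%x. fn n x - f x)) ~~> 0" "(%n. nsq (%x. fourier1 (fn n) x - v x)) ~~> 0"
  using f by (auto simp: L2_fourier_iff)
 obtain gn where gn: "!!n. integrable lborel (gn n)" "!!n. L2 (gn n)" "L2 g" "L2 w"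
  "(%n::nat. nsq (%x. gn n x - g x)) ~~> 0" "(%n. nsq (%x. fourier1 (gn n) x - w x)) ~~> 0"
  using g by (auto simp: L2_fourier_iff)
 note F = Plancherel_L1_L2(1)[OF fn(1,2)] Plancherel_L1_L2(1)[OF gn(1,2)]
 have 1: "(LINT x|lborel. v x * gn k x) = (LINT x|lborel. f x * fourier1 (gn k) x)" for k
 proof -
  have "(%n. LINT x|lborel. fourier1 (fn n) x * gn k x) ~~> (LINT x|lborel. v x * gn k x)"
   by (rule L2_integral_mult_tendsto[OF F(1) fn(4,6) gn(2)])
  moreover have "(%n. LINT x|lborel. fn n x * fourier1 (gn k) x) ~~> (LINT x|lborel. f x * fourier1 (gn k) x)"
   by (rule L2_integral_mult_tendsto[OF fn(2,3,5) F(2)])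
  ultimately show ?thesis
   unfolding fourier1_multiplication[OF fn(1) gn(1)] by (rule LIMSEQ_unique)
 qed
 have "(%n. LINT x|lborel. gn n x * v x) ~~> (LINT x|lborel. g x * v x)"
  by (rule L2_integral_mult_tendsto[OF gn(2,3,5) fn(4)])
 moreover have "(%n. LINT x|lborel. fourier1 (gn n) x * f x) ~~> (LINT x|lborel. w x * f x)"
  by (rule L2_integral_mult_tendsto[OF F(2) gn(4,6) fn(3)])
 ultimately show ?thesis
  using 1 by (simp add: mult.commute LIMSEQ_unique)
qed

lemma L2_cnj: "L2 f ==> L2 (%x. cnj (f x))"
 by (auto simp: L2_def)

lemma nsq_cnj [simp]: "nsq (%x. cnj (f x)) = nsq f"
 by (simp add: nsq_def)

lemma integral_mult_cnj_self: "(LINT x|lborel. f x * cnj (f x)) = complex_of_real (nsq f)"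
 by (simp only: nsq_def complex_norm_square[symmetric] integral_complex_of_real)

text \<open>An isometry whose transpose is an isometry is onto.\<close>

theorem L2_fourier_surj:
 assumes h: "L2 (h :: 'a::euclidean_space => complex)"
 shows "\<exists>w. L2_fourier w h"
proof -
 obtain w0 where w0: "L2_fourier (%x. cnj (h x)) w0" using L2_fourier_exists[OF L2_cnj[OF h]] by blast
 have w: "L2 (%x. cnj (w0 x))" using L2_fourier_L2(2)[OF w0] by (rule L2_cnj)
 obtain h' where h': "L2_fourier (%x. cnj (w0 x)) h'" using L2_fourier_exists[OF w] by blast
 have L: "L2 h'" using L2_fourier_L2(2)[OF h'] .
 have n: "nsq h' = nsq h" "nsq w0 = nsq h"
  using L2_fourier_nsq[OF h'] L2_fourier_nsq[OF w0] by auto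
 \<comment> \<open>The multiplication formula makes the pairing of h' with h equal to the squared
   norm of either, the case of equality in Cauchy-Schwarz; expanding \<open>nsq\<close> of the
   difference then gives h' = h almost everywhere.\<close>
 have "(LINT x|lborel. h' x * cnj (h x)) = (LINT x|lborel. cnj (w0 x) * w0 x)"
  by (rule L2_fourier_multiplication[OF h' w0])
 then have i: "(LINT x|lborel. h' x * cnj (h x)) = complex_of_real (nsq h)"
  using integral_mult_cnj_self[of w0] n by (simp add: mult.commute)
 then have "cnj (LINT x|lborel. h' x * cnj (h x)) = complex_of_real (nsq h)" by simp
 then have i': "(LINT x|lborel. h x * cnj (h' x)) = complex_of_real (nsq h)"
  using Bochner_Integration.integral_cnj[of lborel "%x. h' x * cnj (h x)"] by (simp add: mult.commute)
 have "complex_of_real (nsq (%x. h' x - h x)) =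
  (LINT x|lborel. h' x * cnj (h' x) - h' x * cnj (h x) - (h x * cnj (h' x) - h x * cnj (h x)))"
  unfolding integral_mult_cnj_self[symmetric] by (simp add: algebra_simps)
 also have "... = 0"
  using L2_mult_integrable[OF L L2_cnj[OF L]] L2_mult_integrable[OF L L2_cnj[OF h]]
   L2_mult_integrable[OF h L2_cnj[OF L]] L2_mult_integrable[OF h L2_cnj[OF h]]
  by (simp only: Bochner_Integration.integral_diff Bochner_Integration.integrable_diff integral_mult_cnj_self i i' n) simp
 finally have "nsq (%x. h' x - h x) = 0" by simp
 then have "AE x in lborel. h' x = h x" using nsq_eq_0[OF L2_diff[OF L h]] by simp
 then have "L2_fourier (%x. cnj (w0 x)) h"
  by (intro L2_fourier_cong[OF h']) (use w h in "auto simp: L2_def")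
 then show ?thesis by blast
qed

text \<open>If \<open>A\<close> on functions and \<open>B\<close> on transforms both multiply
  squared L^2 distances by fixed constants, an identity between them on integrable functions passes
  to L^2 limits. Translation, dilation and conjugation are the three instances.\<close>

lemma L2_fourier_operator:
 assumes F: "L2_fourier f v"
  and A1: "!!f. integrable lborel f ==> integrable lborel (A f)"
  and A2: "!!f. L2 f ==> L2 (A f)" and B2: "!!f. L2 f ==> L2 (B f)"
  and A3: "!!f g. nsq (%x. A f x - A g x) = al * nsq (%x. f x - g x)"
  and B3: "!!f g. nsq (%x. B f x - B g x) = bt * nsq (%x. f x - g x)"
  and AB: "!!f. integrable lborel f ==> fourier1 (A f) = B (fourier1 f)"
 shows "L2_fourier (A f) (B v)"
proof -
 obtain fn where fn: "!!n. integrable lborel (fn n)" "!!n. L2 (fn n)" "L2 f" "L2 v"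
  "(%n::nat. nsq (%x. fn n x - f x)) ~~> 0" "(%n. nsq (%x. fourier1 (fn n) x - v x)) ~~> 0"
  using F by (auto simp: L2_fourier_iff)
 show ?thesis unfolding L2_fourier_iff
 proof (intro conjI exI[of _ "%n. A (fn n)"])
  show "(%n. nsq (%x. A (fn n) x - A f x)) ~~> 0"
   unfolding A3 using tendsto_mult_left[OF fn(5), of al] by simp
  show "(%n. nsq (%x. fourier1 (A (fn n)) x - B v x)) ~~> 0"
   unfolding AB[OF fn(1)] B3 using tendsto_mult_left[OF fn(6), of bt] by simp
 qed (use fn A1 A2 B2 in auto)
qed

section \<open>Translation, dilation and conjugation under the transform\<close>

lemma L2_mult_unit:
 fixes f k :: "'a::euclidean_space => complex"
 assumes "L2 f" "k \<in> borel_measurable borel" "!!x. norm (k x) = 1"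
 shows "L2 (%x. k x * f x)"
 using assms by (auto simp: L2_def norm_mult intro!: borel_measurable_times)

lemma L2_fourier_translate:
 fixes f :: "'a::euclidean_space => complex"
 assumes "L2_fourier f v"
 shows "L2_fourier (%x. f (h + x)) (%xi. efun (- h) xi * v xi)"
proof (rule L2_fourier_operator[OF assms, where al = 1 and bt = 1])
 show "integrable lborel (%x. f (h + x))" if "integrable lborel f" for f :: "'a => complex"
  using integrable_affine[OF _ that, of 1 h] by simp
 show "L2 (%x. f (h + x))" if "L2 f" for f :: "'a => complex"
  using L2_affine[OF _ that, of 1 h] by simp
 show "L2 (%xi. efun (- h) xi * f xi)" if "L2 f" for f
  by (rule L2_mult_unit[OF that]) auto
 show "nsq (%x. f (h + x) - g (h + x)) = 1 * nsq (%x. f x - g x)" for f g :: "'a => complex"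
  using nsq_affine[of 1 "%x. f x - g x" h] by simp
 show "nsq (%xi. efun (- h) xi * f xi - efun (- h) xi * g xi) = 1 * nsq (%x. f x - g x)" for f g
  unfolding nsq_def right_diff_distrib[symmetric] norm_mult norm_efun by simp
 show "fourier1 (%x. f (h + x)) = (%xi. efun (- h) xi * fourier1 f xi)" if "integrable lborel f" for f :: "'a => complex"
 proof
  fix xi
  have "(LINT x|lborel. f (h + x) * efun x xi) = (LINT x|lborel. f x * efun (x - h) xi)"
   using integral_affine[of 1 "%x. f x * efun (x - h) xi" h] by simp
  also have "(%x. f x * efun (x - h) xi) = (%x. efun (- h) xi * (f x * efun x xi))"
   by (simp add: inner_diff_left inner_minus_left exp_add[symmetric] algebra_simps fun_eq_iff)
  finally show "fourier1 (%x. f (h + x)) xi = efun (- h) xi * fourier1 f xi"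
   unfolding fourier1_alt by (simp only: integral_mult_right_zero) (simp only: mult_ac)
 qed
qed

lemma L2_fourier_dilate:
 fixes f :: "'a::euclidean_space => complex"
 assumes "L2_fourier f v" and k: "k > 0"
 shows "L2_fourier (%x. f (k *\<^sub>R x)) (%xi. complex_of_real (1 / k ^ DIM('a)) * v ((1 / k) *\<^sub>R xi))"
proof (rule L2_fourier_operator[OF assms(1), where al = "1 / k ^ DIM('a)" and bt = "(1 / k ^ DIM('a))^2 * k ^ DIM('a)"])
 show "integrable lborel (%x. f (k *\<^sub>R x))" if "integrable lborel f" for f :: "'a => complex"
  using integrable_affine[OF _ that, of k 0] k by simp
 show "L2 (%x. f (k *\<^sub>R x))" if "L2 f" for f :: "'a => complex"
  using L2_affine[OF _ that, of k 0] k by simp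
 show "L2 (%xi. complex_of_real (1 / k ^ DIM('a)) * f ((1 / k) *\<^sub>R xi))" if "L2 f" for f :: "'a => complex"
  using L2_mult[OF L2_affine[OF _ that, of "1/k" 0], of "complex_of_real (1 / k ^ DIM('a))"] k by simp
 show "nsq (%x. f (k *\<^sub>R x) - g (k *\<^sub>R x)) = 1 / k ^ DIM('a) * nsq (%x. f x - g x)" for f g :: "'a => complex"
  using nsq_affine[of k "%x. f x - g x" 0] k by simp
 show "nsq (%xi. complex_of_real (1 / k ^ DIM('a)) * f ((1 / k) *\<^sub>R xi) - complex_of_real (1 / k ^ DIM('a)) * g ((1 / k) *\<^sub>R xi))
   = (1 / k ^ DIM('a))^2 * k ^ DIM('a) * nsq (%x. f x - g x)" for f g :: "'a => complex"
  using nsq_affine[of "1/k" "%x. f x - g x" 0] k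
  unfolding right_diff_distrib[symmetric] nsq_mult by (simp add: norm_divide norm_power power_divide field_simps)
 show "fourier1 (%x. f (k *\<^sub>R x)) = (%xi. complex_of_real (1 / k ^ DIM('a)) * fourier1 f ((1 / k) *\<^sub>R xi))"
  if "integrable lborel f" for f :: "'a => complex"
 proof
  fix xi
  have "(LINT x|lborel. f (k *\<^sub>R x) * efun x xi) = (1 / k ^ DIM('a)) *\<^sub>R (LINT x|lborel. f x * efun x ((1 / k) *\<^sub>R xi))"
   using integral_affine[of k "%x. f x * efun x ((1 / k) *\<^sub>R xi)" 0] k by simp
  then show "fourier1 (%x. f (k *\<^sub>R x)) xi = complex_of_real (1 / k ^ DIM('a)) * fourier1 f ((1 / k) *\<^sub>R xi)"
   unfolding fourier1_alt by (simp only: scaleR_conv_of_real mult_ac)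
 qed
qed

lemma L2_fourier_cnj:
 fixes f :: "'a::euclidean_space => complex"
 assumes "L2_fourier f v"
 shows "L2_fourier (%x. cnj (f x)) (%xi. cnj (v (- xi)))"
proof (rule L2_fourier_operator[OF assms(1), where al = 1 and bt = 1])
 show "L2 (%xi. cnj (f (- xi)))" if "L2 f" for f :: "'a => complex"
  using L2_cnj[OF L2_affine[OF _ that, of "-1" 0]] by simp
 show "nsq (%x. cnj (f x) - cnj (g x)) = 1 * nsq (%x. f x - g x)" for f g :: "'a => complex"
  using nsq_cnj[of "%x. f x - g x"] by simp
 show "nsq (%xi. cnj (f (- xi)) - cnj (g (- xi))) = 1 * nsq (%x. f x - g x)" for f g :: "'a => complex"
  using nsq_cnj[of "%x. f (- x) - g (- x)"] nsq_affine[of "-1" "%x. f x - g x" 0] by simp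
 show "fourier1 (%x. cnj (f x)) = (%xi. cnj (fourier1 f (- xi)))" if "integrable lborel f" for f :: "'a => complex"
 proof
  fix xi
  have "cnj (LINT x|lborel. f x * efun x (- xi)) = (LINT x|lborel. cnj (f x) * efun x xi)"
   using Bochner_Integration.integral_cnj[of lborel "%x. f x * efun x (- xi)"] by (simp add: exp_cnj)
  then show "fourier1 (%x. cnj (f x)) xi = cnj (fourier1 f (- xi))" by (simp add: fourier1_alt)
 qed
qed (auto intro: L2_cnj)

subsection \<open>Complete semi-inner product spaces of functions\<close>

text \<open>The form may be degenerate and limits are unique only up to seminorm zero, so that
  functions can be used instead of classes modulo null sets.\<close>

locale semi_hilbert =
 fixes E :: "('x => real) set" and ip :: "('x => real) => ('x => real) => real"
 assumes zero_mem: "(%_. 0) \<in> E"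
  and lc_mem: "u \<in> E ==> v \<in> E ==> (%x. c * u x + d * v x) \<in> E"
  and ip_lc: "u \<in> E ==> v \<in> E ==> w \<in> E ==> ip (%x. c * u x + d * v x) w = c * ip u w + d * ip v w"
  and ip_commute: "u \<in> E ==> v \<in> E ==> ip u v = ip v u"
  and ip_nonneg: "u \<in> E ==> 0 <= ip u u"
  and complete: "(!!n. f n \<in> E) ==>
   (!!e. e > 0 ==> \<exists>M. \<forall>m\<ge>M. \<forall>n\<ge>M. ip (%x. f m x - f n x) (%x. f m x - f n x) <= e) ==>
   \<exists>u\<in>E. (%n::nat. ip (%x. f n x - u x) (%x. f n x - u x)) ~~> 0"
begin

lemma diff_mem: "u \<in> E ==> v \<in> E ==> (%x. u x - v x) \<in> E"
 using lc_mem[of u v 1 "-1"] by simp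

lemma scale_mem: "u \<in> E ==> (%x. c * u x) \<in> E"
 using lc_mem[of u u c 0] by simp

lemma add_mem: "u \<in> E ==> v \<in> E ==> (%x. u x + v x) \<in> E"
 using lc_mem[of u v 1 1] by simp

lemma ip_lc_right: "u \<in> E ==> v \<in> E ==> w \<in> E ==> ip w (%x. c * u x + d * v x) = c * ip w u + d * ip w v"
 using ip_lc[of u v w c d] lc_mem[of u v c d] by (simp add: ip_commute)

lemma ip_diff: "u \<in> E ==> v \<in> E ==> w \<in> E ==> ip (%x. u x - v x) w = ip u w - ip v w"
 using ip_lc[of u v w 1 "-1"] by simp

lemma ip_diff_right: "u \<in> E ==> v \<in> E ==> w \<in> E ==> ip w (%x. u x - v x) = ip w u - ip w v"
 using ip_lc_right[of u v w 1 "-1"] by simp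

lemma ip_scale: "u \<in> E ==> w \<in> E ==> ip (%x. c * u x) w = c * ip u w"
 using ip_lc[of u u w c 0] by simp

lemma ip_lc_lc:
 assumes "u \<in> E" "v \<in> E"
 shows "ip (%x. c * u x + d * v x) (%x. c * u x + d * v x) = c^2 * ip u u + 2 * c * d * ip u v + d^2 * ip v v"
 using assms by (simp add: ip_lc ip_lc_right lc_mem ip_commute[of v u] power2_eq_square algebra_simps)

lemma ip_diff_diff:
 assumes "u \<in> E" "v \<in> E"
 shows "ip (%x. u x - v x) (%x. u x - v x) = ip u u - 2 * ip u v + ip v v"
 using ip_lc_lc[OF assms, of 1 "-1"] by simp

lemma ip_Cauchy_Schwarz:
 assumes "u \<in> E" "v \<in> E"
 shows "(ip u v)^2 <= ip u u * ip v v" "\<bar>ip u v\<bar> <= sqrt (ip u u) * sqrt (ip v v)"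
proof -
 have "0 <= t^2 * ip u u - 2 * t * ip u v + ip v v" for t
  using ip_nonneg[OF lc_mem[OF assms, of t "-1"]] ip_lc_lc[OF assms, of t "-1"] by simp
 then show le: "(ip u v)^2 <= ip u u * ip v v"
  by (rule quadratic_discriminant_le) (rule ip_nonneg[OF assms(1)])
 show "\<bar>ip u v\<bar> <= sqrt (ip u u) * sqrt (ip v v)"
  using real_sqrt_le_mono[OF le] by (simp add: real_sqrt_mult)
qed

lemma ip_tendsto:
 assumes "!!n. f n \<in> E" "u \<in> E" "(%n::nat. ip (%x. f n x - u x) (%x. f n x - u x)) ~~> 0" "v \<in> E"
 shows "(%n. ip (f n) v) ~~> ip u v"
proof (rule LIM_zero_cancel, rule Lim_null_comparison)
 show "\<forall>\<^sub>F n in sequentially. norm (ip (f n) v - ip u v) <= sqrt (ip (%x. f n x - u x) (%x. f n x - u x)) * sqrt (ip v v)"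
  using ip_Cauchy_Schwarz(2)[OF diff_mem[OF assms(1,2)] assms(4)] by (simp add: ip_diff assms)
 show "(%n. sqrt (ip (%x. f n x - u x) (%x. f n x - u x)) * sqrt (ip v v)) ~~> 0"
  using tendsto_mult_right[OF tendsto_real_sqrt[OF assms(3)], of "sqrt (ip v v)"] by simp
qed

lemma ip_self_tendsto:
 assumes "!!n. f n \<in> E" "u \<in> E" "(%n::nat. ip (%x. f n x - u x) (%x. f n x - u x)) ~~> 0"
 shows "(%n. ip (f n) (f n)) ~~> ip u u"
proof -
 have "ip (f n) (f n) = ip (%x. f n x - u x) (%x. f n x - u x) + 2 * ip (f n) u - ip u u" for n
  using ip_diff_diff[OF assms(1)[of n] assms(2)] by simp
 moreover have "(%n. ip (%x. f n x - u x) (%x. f n x - u x) + 2 * ip (f n) u - ip u u) ~~> 0 + 2 * ip u u - ip u u"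
  by (intro tendsto_intros ip_tendsto assms)
 ultimately show ?thesis by simp
qed

definition closed_subspace :: "('x => real) set => bool" where
 "closed_subspace V \<longleftrightarrow> V \<subseteq> E & V ~= {} & (\<forall>u\<in>V. \<forall>v\<in>V. \<forall>c d. (%x. c * u x + d * v x) \<in> V) &
  (\<forall>f u. (\<forall>n. f n \<in> V) --> u \<in> E --> (%n::nat. ip (%x. f n x - u x) (%x. f n x - u x)) ~~> 0 --> u \<in> V)"

definition bounded_lin_on :: "('x => real) set => (('x => real) => real) => bool" where
 "bounded_lin_on V \<l> \<longleftrightarrow> (\<forall>u\<in>V. \<forall>v\<in>V. \<forall>c d. \<l> (%x. c * u x + d * v x) = c * \<l> u + d * \<l> v) &
  (\<exists>C. \<forall>u\<in>V. \<bar>\<l> u\<bar> <= C * sqrt (ip u u))"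

text \<open>The functional ip v v - 2 l v is minimised over \<open>V\<close>. The parallelogram
  identity makes a minimising sequence Cauchy, and minimality of \<open>w\<close> along every line
  gives the representation.\<close>

lemma Riesz:
 assumes V: "closed_subspace V" and l: "bounded_lin_on V \<l>"
 shows "\<exists>w\<in>V. \<forall>v\<in>V. ip w v = \<l> v"
proof -
 have VE: "v \<in> E" if "v \<in> V" for v using V that by (auto simp: closed_subspace_def)
 have Vlc: "(%x. c * u x + d * v x) \<in> V" if "u \<in> V" "v \<in> V" for u v c d
  using V that by (auto simp: closed_subspace_def)
 have llc: "\<l> (%x. c * u x + d * v x) = c * \<l> u + d * \<l> v" if "u \<in> V" "v \<in> V" for u v c d
  using l that by (auto simp: bounded_lin_on_def)
 obtain C where C: "!!u. u \<in> V ==> \<bar>\<l> u\<bar> <= C * sqrt (ip u u)" using l unfolding bounded_lin_on_def by blast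
 define F where "F v = ip v v - 2 * \<l> v" for v
 have Flow: "F v >= - C\<^sup>2" if "v \<in> V" for v
 proof -
  have "0 <= (sqrt (ip v v) - C)^2" by simp
  also have "... = ip v v - 2 * (C * sqrt (ip v v)) + C^2"
   using ip_nonneg[OF VE[OF that]] by (simp add: power2_diff)
  finally show ?thesis using C[OF that] by (simp add: F_def)
 qed
 have bdd: "bdd_below (F ` V)" using Flow by (auto simp: bdd_below_def)
 define I where "I = Inf (F ` V)"
 have ne: "F ` V ~= {}" using V by (auto simp: closed_subspace_def)
 have IF: "I <= F v" if "v \<in> V" for v unfolding I_def using bdd that by (auto intro: cInf_lower)
 have "\<exists>v\<in>V. F v < I + 1 / Suc n" for n
  using cInf_lessD[OF ne, of "I + 1 / Suc n"] by (auto simp: I_def)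
 then obtain f where f: "!!n. f n \<in> V" "!!n. F (f n) < I + 1 / Suc n" by metis
 have fE: "f n \<in> E" for n using f VE by auto
 have par: "ip (%x. u x - v x) (%x. u x - v x) <= 2 * (F u - I) + 2 * (F v - I)" if "u \<in> V" "v \<in> V" for u v
 proof -
  have "I <= F (%x. 1/2 * u x + 1/2 * v x)" by (intro IF Vlc that)
  also have "... = 1/4 * ip u u + 1/2 * ip u v + 1/4 * ip v v - (\<l> u + \<l> v)"
   unfolding F_def llc[OF that] ip_lc_lc[OF VE[OF that(1)] VE[OF that(2)]] by (simp add: power2_eq_square algebra_simps)
  finally show ?thesis
   unfolding ip_diff_diff[OF VE[OF that(1)] VE[OF that(2)]] F_def by simp
 qed
 have "\<exists>M. \<forall>m\<ge>M. \<forall>n\<ge>M. ip (%x. f m x - f n x) (%x. f m x - f n x) <= e" if e: "e > 0" for e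
 proof -
  obtain M :: nat where "1 / Suc M < e / 4" using nat_approx_posE[of "e/4"] e by auto
  then have M: "1 / Suc n < e / 4" if "n >= M" for n
   using that by (smt (verit) frac_le of_nat_0_less_iff of_nat_le_iff zero_less_Suc Suc_le_mono)
  have "ip (%x. f m x - f n x) (%x. f m x - f n x) <= e" if "m >= M" "n >= M" for m n
  proof (rule order_trans[OF par[OF f(1) f(1)]])
   have "F (f m) < I + e / 4" "F (f n) < I + e / 4"
    using less_trans[OF f(2) add_strict_left_mono[OF M]] that by blast+
   then show "2 * (F (f m) - I) + 2 * (F (f n) - I) <= e" by (simp add: field_simps)
  qed
  then show ?thesis by blast
 qed
 from complete[OF fE this] obtain w where w: "w \<in> E" "(%n. ip (%x. f n x - w x) (%x. f n x - w x)) ~~> 0" by blast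
 have wV: "w \<in> V" using V f(1) w unfolding closed_subspace_def by blast
 have "(%n. \<l> (f n)) ~~> \<l> w"
 proof (rule LIM_zero_cancel, rule Lim_null_comparison)
  have "\<l> (f n) - \<l> w = \<l> (%x. f n x - w x)" for n
   using llc[OF f(1) wV, of 1 n "-1"] by simp
  moreover have "(%x. f n x - w x) \<in> V" for n using Vlc[OF f(1) wV, of 1 n "-1"] by simp
  ultimately show "\<forall>\<^sub>F n in sequentially. norm (\<l> (f n) - \<l> w) <= C * sqrt (ip (%x. f n x - w x) (%x. f n x - w x))"
   using C by simp
  show "(%n. C * sqrt (ip (%x. f n x - w x) (%x. f n x - w x))) ~~> 0"
   using tendsto_mult_left[OF tendsto_real_sqrt[OF w(2)], of C] by simp
 qed
 then have "(%n. F (f n)) ~~> F w"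
  unfolding F_def by (intro tendsto_intros ip_self_tendsto[OF fE w])
 moreover have "(%n. I + 1 / Suc n) ~~> I + 0"
  by (intro tendsto_intros LIMSEQ_Suc[OF lim_inverse_n'])
 ultimately have Fw: "F w <= I"
  using f(2) by (intro LIMSEQ_le[of "%n. F (f n)" _ "%n. I + 1 / Suc n"]) (auto intro: less_imp_le)
 have "ip w v = \<l> v" if v: "v \<in> V" for v
 proof -
  have "0 <= t^2 * ip v v - 2 * t * (\<l> v - ip w v) + 0" for t
  proof -
   have "F w <= F (%x. 1 * w x + t * v x)" using Fw IF[OF Vlc[OF wV v, of 1 t]] by simp
   then show ?thesis
    unfolding F_def llc[OF wV v] ip_lc_lc[OF w(1) VE[OF v]] by (simp add: algebra_simps)
  qed
  then have "(\<l> v - ip w v)^2 <= ip v v * 0"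
   by (rule quadratic_discriminant_le) (rule ip_nonneg[OF VE[OF v]])
  then show ?thesis by simp
 qed
 with wV show ?thesis by blast
qed

text \<open>A diagonal subsequence makes all products with members of the sequence converge. The
  vectors \<open>v\<close> for which \<open>ip (g n) v\<close> converges form a closed subspace
  \<open>V\<close> containing the sequence; the limit functional is represented by some
  \<open>u\<close> in \<open>V\<close>, and an arbitrary bounded functional acts on \<open>V\<close>
  as the product with a vector of \<open>V\<close>. Working inside \<open>V\<close> replaces
  separability of the whole space.\<close>

theorem weak_compactness:
 assumes f: "!!n. f n \<in> E" and R: "!!n. ip (f n) (f n) <= R"
 obtains r u where "strict_mono (r :: nat => nat)" "u \<in> E"
  "!!\<l>. bounded_lin_on E \<l> ==> (%n. \<l> (f (r n))) ~~> \<l> u"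
proof -
 have R0: "0 <= R" using order_trans[OF ip_nonneg[OF f[of 0]] R[of 0]] .
 have bd: "norm (ip (f n) (f k)) <= R" for n k
 proof -
  have "norm (ip (f n) (f k)) <= sqrt (ip (f n) (f n)) * sqrt (ip (f k) (f k))"
   using ip_Cauchy_Schwarz(2)[OF f f] by simp
  also have "... <= sqrt R * sqrt R" using R0 R[of n] R[of k] ip_nonneg[OF f] by (intro mult_mono) auto
  also have "... = R" using R0 by simp
  finally show ?thesis .
 qed
 obtain r :: "nat => nat" where r: "strict_mono r" "!!k. \<exists>l. (%n. ip (f (r n)) (f k)) ~~> l"
  by (rule function_convergent_subsequence[of UNIV "%n k. ip (f n) (f k)" R]) (use bd in auto)
 define g where "g n = f (r n)" for n
 have gE: "g n \<in> E" for n by (simp add: g_def f)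
 have gR: "ip (g n) (g n) <= R" for n by (simp add: g_def R)
 define V where "V = {v \<in> E. convergent (%n. ip (g n) v)}"
 have gV: "g n \<in> V" for n using r(2) gE by (auto simp: V_def g_def convergent_def)
 have V: "closed_subspace V"
  unfolding closed_subspace_def
 proof (intro conjI ballI allI impI)
  show "V \<subseteq> E" by (auto simp: V_def)
  show "V ~= {}" using gV by auto
  show "(%x. c * u x + d * v x) \<in> V" if "u \<in> V" "v \<in> V" for u v c d
   using that by (auto simp: V_def lc_mem ip_lc_right gE intro!: convergent_add convergent_mult convergent_const)
  fix h u assume h: "\<forall>n. h n \<in> V" and u: "u \<in> E" and lim: "(%n::nat. ip (%x. h n x - u x) (%x. h n x - u x)) ~~> 0"
  have hE: "h n \<in> E" for n using h by (auto simp: V_def)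
  have lim': "(%n. sqrt R * sqrt (ip (%x. h n x - u x) (%x. h n x - u x))) ~~> 0"
   using tendsto_mult_left[OF tendsto_real_sqrt[OF lim], of "sqrt R"] by simp
  \<comment> \<open>Replacing \<open>u\<close> by \<open>h k\<close> costs an amount independent of
    \<open>n\<close>, so the Cauchy property passes from \<open>h k\<close> to
    \<open>u\<close>.\<close>
  have d: "\<bar>ip (g n) u - ip (g n) (h k)\<bar> <= sqrt R * sqrt (ip (%x. h k x - u x) (%x. h k x - u x))" for n k
  proof -
   have "\<bar>ip (g n) (%x. h k x - u x)\<bar> <= sqrt (ip (g n) (g n)) * sqrt (ip (%x. h k x - u x) (%x. h k x - u x))"
    by (rule ip_Cauchy_Schwarz(2)[OF gE diff_mem[OF hE u]])
   also have "... <= sqrt R * sqrt (ip (%x. h k x - u x) (%x. h k x - u x))"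
    using gR by (intro mult_right_mono) (auto intro!: ip_nonneg diff_mem hE u)
   finally show ?thesis by (simp add: ip_diff_right gE hE u abs_minus_commute)
  qed
  have "Cauchy (%n. ip (g n) u)"
  proof (rule metric_CauchyI)
   fix e :: real assume e: "e > 0"
   obtain k where k: "sqrt R * sqrt (ip (%x. h k x - u x) (%x. h k x - u x)) < e / 3"
    using order_tendstoD(2)[OF lim', of "e/3"] e by (auto simp: eventually_sequentially)
   have "Cauchy (%n. ip (g n) (h k))" using h by (auto simp: V_def Cauchy_convergent_iff)
   then obtain M where M: "!!m n. m >= M ==> n >= M ==> dist (ip (g m) (h k)) (ip (g n) (h k)) < e / 3"
    using e by (meson metric_CauchyD zero_less_divide_iff zero_less_numeral)
   then have "dist (ip (g m) u) (ip (g n) u) < e" if "m >= M" "n >= M" for m n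
   proof -
    have "\<bar>ip (g m) u - ip (g n) u\<bar> <= \<bar>ip (g m) u - ip (g m) (h k)\<bar> + \<bar>ip (g m) (h k) - ip (g n) (h k)\<bar> + \<bar>ip (g n) u - ip (g n) (h k)\<bar>"
     by linarith
    then show ?thesis using d[of m k] d[of n k] k M[OF that] unfolding dist_real_def by linarith
   qed
   then show "\<exists>M. \<forall>m\<ge>M. \<forall>n\<ge>M. dist (ip (g m) u) (ip (g n) u) < e" by blast
  qed
  then show "u \<in> V" using u by (simp add: V_def Cauchy_convergent_iff)
 qed
 define \<l>0 where "\<l>0 v = lim (%n. ip (g n) v)" for v
 have l0: "(%n. ip (g n) v) ~~> \<l>0 v" if "v \<in> V" for v
  using that by (auto simp: V_def \<l>0_def convergent_LIMSEQ_iff)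
 have "bounded_lin_on V \<l>0"
  unfolding bounded_lin_on_def
 proof (intro conjI ballI allI exI[of _ "sqrt R"])
  fix u v c d assume uv: "u \<in> V" "v \<in> V"
  then have E: "u \<in> E" "v \<in> E" by (auto simp: V_def)
  have "(%n. ip (g n) (%x. c * u x + d * v x)) ~~> c * \<l>0 u + d * \<l>0 v"
   unfolding ip_lc_right[OF E gE] by (intro tendsto_intros l0 uv)
  then show "\<l>0 (%x. c * u x + d * v x) = c * \<l>0 u + d * \<l>0 v"
   unfolding \<l>0_def[of "%x. c * u x + d * v x"] by (rule limI)
 next
  fix u assume u: "u \<in> V" then have uE: "u \<in> E" by (simp add: V_def)
  have "\<bar>ip (g n) u\<bar> <= sqrt R * sqrt (ip u u)" for n
   by (rule order_trans[OF ip_Cauchy_Schwarz(2)[OF gE uE]]) (use gR ip_nonneg[OF uE] in "auto intro: mult_right_mono")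
  then show "\<bar>\<l>0 u\<bar> <= sqrt R * sqrt (ip u u)"
   by (intro LIMSEQ_le_const2[OF tendsto_rabs[OF l0[OF u]]]) auto
 qed
 from Riesz[OF V this] obtain u where u: "u \<in> V" "!!v. v \<in> V ==> ip u v = \<l>0 v" by blast
 have uE: "u \<in> E" using u by (simp add: V_def)
 have "(%n. \<l> (f (r n))) ~~> \<l> u" if l: "bounded_lin_on E \<l>" for \<l>
 proof -
  have VE: "V \<subseteq> E" by (auto simp: V_def)
  have "bounded_lin_on V \<l>" using l VE unfolding bounded_lin_on_def by blast
  from Riesz[OF V this] obtain w where w: "w \<in> V" "!!v. v \<in> V ==> ip w v = \<l> v" by blast
  have wE: "w \<in> E" using w VE by auto
  have "(%n. ip (g n) w) ~~> ip u w" using l0[OF w(1)] u(2)[OF w(1)] by simp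
  then show ?thesis
   using w(2)[OF gV] w(2)[OF u(1)] by (simp add: ip_commute[OF gE wE] ip_commute[OF uE wE] g_def[symmetric])
 qed
 with r(1) uE that show ?thesis by blast
qed

end

subsection \<open>The fractional Sobolev space\<close>

text \<open>A representative of the L^2 transform picked by choice; identities for it hold almost
  everywhere only.\<close>

definition FT :: "('a::euclidean_space => real) => 'a => complex" where
 "FT u = (SOME v. L2_fourier (%x. complex_of_real (u x)) v)"

text \<open>The frequency side of the operator (-\<Delta>)^(s/2).\<close>

definition WT :: "real => ('a::euclidean_space => real) => 'a => complex" where
 "WT s u xi = complex_of_real (norm xi powr s) * FT u xi"

text \<open>The inner product of complex values as plane vectors is the real part of the Hermitian
  product. By Plancherel's theorem the integral equals the pairing of the fractional
  derivatives.\<close>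

definition aform :: "real => ('a::euclidean_space => real) => ('a => real) => real" where
 "aform s u v = (LINT xi|lborel. WT s u xi \<bullet> WT s v xi)"

definition bform :: "('a::euclidean_space => real) => ('a => real) => real" where
 "bform u v = (LINT x|lborel. u x * v x)"

definition eform :: "real => ('a::euclidean_space => real) => ('a => real) => real" where
 "eform s u v = aform s u v + bform u v"

definition radial :: "('a::euclidean_space => 'b) => bool" where
 "radial u \<longleftrightarrow> (\<forall>x y. norm x = norm y --> u x = u y)"

lemma L2_of_real_iff: "L2 (%x. complex_of_real (u x)) \<longleftrightarrow> L2 u"
proof
 assume L: "L2 (%x. complex_of_real (u x))"
 have m0: "(%x. complex_of_real (u x)) \<in> borel_measurable lborel" using L by (simp only: L2_def)
 have "(%x. Re (complex_of_real (u x))) \<in> borel_measurable lborel"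
  by (rule measurable_compose[OF m0 borel_measurable_Re])
 then have m: "u \<in> borel_measurable lborel" by (simp only: Re_complex_of_real)
 show "L2 u"
  by (rule L2_bound(1)[OF L m, of 1]) (rule AE_I2, simp only: norm_of_real mult_1 real_norm_def order_refl)
next
 assume L: "L2 u"
 have m0: "u \<in> borel_measurable lborel" using L by (simp only: L2_def)
 have m: "(%x. complex_of_real (u x)) \<in> borel_measurable lborel"
  by (rule measurable_compose[OF m0]) measurable
 show "L2 (%x. complex_of_real (u x))"
  by (rule L2_bound(1)[OF L m, of 1]) (rule AE_I2, simp only: norm_of_real mult_1 real_norm_def order_refl)
qed

lemma nsq_of_real [simp]: "nsq (%x. complex_of_real (u x)) = nsq u"
 by (simp add: nsq_def)

lemma bform_self: "bform u u = nsq u"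
 by (simp add: bform_def nsq_def power2_eq_square)

lemma FT:
 assumes "L2 u" shows "L2_fourier (%x. complex_of_real (u x)) (FT u)"
proof -
 have "L2 (%x. complex_of_real (u x))" by (simp only: L2_of_real_iff assms)
 then have "\<exists>v. L2_fourier (%x. complex_of_real (u x)) v" by (rule L2_fourier_exists)
 then show ?thesis unfolding FT_def by (rule someI_ex)
qed

lemma L2_FT: "L2 u ==> L2 (FT u)"
 by (rule L2_fourier_L2(2)[OF FT])

lemma nsq_FT:
 assumes "L2 u" shows "nsq (FT u) = nsq u"
proof -
 have "nsq (FT u) = nsq (%x. complex_of_real (u x))" by (rule L2_fourier_nsq[OF FT[OF assms]])
 then show ?thesis by (simp only: nsq_of_real)
qed

lemma FT_lc:
 assumes "L2 u" "L2 v"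
 shows "AE xi in lborel. FT (%x. c * u x + d * v x) xi = complex_of_real c * FT u xi + complex_of_real d * FT v xi"
proof (rule L2_fourier_unique)
 have L: "L2 (%x. c * u x + d * v x)" by (intro L2_add L2_mult assms)
 show "L2_fourier (%x. complex_of_real (c * u x + d * v x)) (FT (%x. c * u x + d * v x))" by (rule FT[OF L])
 show "L2_fourier (%x. complex_of_real (c * u x + d * v x)) (%xi. complex_of_real c * FT u xi + complex_of_real d * FT v xi)"
  using L2_fourier_lincomb[OF FT[OF assms(1)] FT[OF assms(2)], of "complex_of_real c" "complex_of_real d"] by simp
qed

lemma WT_lc:
 assumes "L2 u" "L2 v"
 shows "AE xi in lborel. WT s (%x. c * u x + d * v x) xi = c *\<^sub>R WT s u xi + d *\<^sub>R WT s v xi"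
 using FT_lc[OF assms, of c d] by eventually_elim (simp add: WT_def scaleR_conv_of_real algebra_simps)

lemma WT_measurable [measurable]: "L2 u ==> WT s u \<in> borel_measurable borel"
 using L2_FT[of u] unfolding WT_def[abs_def] L2_def by auto

lemma powr_sq: "(a powr s)^2 = a powr (2 * s)" for a s :: real
 by (simp add: power2_eq_square powr_add[symmetric])

lemma L2_WT_iff:
 assumes "L2 u"
 shows "L2 (WT s u) \<longleftrightarrow> integrable lborel (%xi. norm xi powr (2 * s) * (cmod (FT u xi))^2)"
 using assms by (simp add: L2_def[of "WT s u"]) (simp add: WT_def norm_mult power_mult_distrib powr_sq)

lemma Hs_iff: "Hs s u \<longleftrightarrow> L2 u & L2 (WT s u)"
proof
 assume "Hs s u"
 then obtain v where v: "L2_fourier (%x. complex_of_real (u x)) v"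
  "integrable lborel (%xi. norm xi powr (2 * s) * (cmod (v xi))^2)" by (auto simp: Hs_def)
 have L: "L2 u" using L2_fourier_L2(1)[OF v(1)] by (simp add: L2_of_real_iff)
 have [measurable]: "FT u \<in> borel_measurable borel" "v \<in> borel_measurable borel"
  using L2_FT[OF L] L2_fourier_L2(2)[OF v(1)] by (auto simp: L2_def)
 have "AE xi in lborel. v xi = FT u xi" by (rule L2_fourier_unique[OF v(1) FT[OF L]])
 then have ae: "AE xi in lborel. norm xi powr (2 * s) * (cmod (v xi))^2 = norm xi powr (2 * s) * (cmod (FT u xi))^2"
  by eventually_elim simp
 have "integrable lborel (%xi. norm xi powr (2 * s) * (cmod (FT u xi))^2)"
  by (rule integrable_cong_AE_imp[OF v(2) _ ae]) measurable
 then show "L2 u & L2 (WT s u)" using L L2_WT_iff by blast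
next
 assume "L2 u & L2 (WT s u)"
 then show "Hs s u" unfolding Hs_def using FT[of u] L2_WT_iff[of u s] by blast
qed

lemma Hsr_iff: "Hsr s u \<longleftrightarrow> L2 u & L2 (WT s u) & radial u"
 by (auto simp: Hsr_def Hs_iff radial_def)

lemma HsrD: "Hsr s u ==> L2 u" "Hsr s u ==> L2 (WT s u)" "Hsr s u ==> radial u"
 by (auto simp: Hsr_iff)

lemma L2_WT_lc:
 assumes "L2 u" "L2 v" "L2 (WT s u)" "L2 (WT s v)"
 shows "L2 (WT s (%x. c * u x + d * v x))"
proof (rule L2_cong_AE)
 show "L2 (%xi. c *\<^sub>R WT s u xi + d *\<^sub>R WT s v xi)" by (intro L2_add L2_scaleR assms)
 show "AE xi in lborel. c *\<^sub>R WT s u xi + d *\<^sub>R WT s v xi = WT s (%x. c * u x + d * v x) xi"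
  using WT_lc[OF assms(1,2), of s c d] by eventually_elim simp
 show "WT s (%x. c * u x + d * v x) \<in> borel_measurable lborel"
  using L2_add[OF L2_mult[OF assms(1)] L2_mult[OF assms(2)]] by simp
qed

lemma radial_lc:
 fixes u v :: "'a::euclidean_space => real"
 assumes "radial u" "radial v" shows "radial (%x. c * u x + d * v x)"
 unfolding radial_def
proof (intro allI impI)
 fix x y :: 'a assume "norm x = norm y"
 then have "u x = u y" "v x = v y" using assms unfolding radial_def by blast+
 then show "c * u x + d * v x = c * u y + d * v y" by simp
qed

lemma Hsr_lc: "Hsr s u ==> Hsr s v ==> Hsr s (%x. c * u x + d * v x)"
 unfolding Hsr_iff by (intro conjI radial_lc L2_WT_lc L2_add L2_mult) auto

lemma L2_inner_integrable:
 fixes f g :: "'a::euclidean_space => 'b::euclidean_space"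
 assumes "L2 f" "L2 g" shows "integrable lborel (%x. f x \<bullet> g x)"
proof (rule Bochner_Integration.integrable_bound[OF L2_norm_mult_integrable[OF assms]])
 show "(%x. f x \<bullet> g x) \<in> borel_measurable lborel"
  using assms by (auto simp: L2_def)
qed (auto simp: Cauchy_Schwarz_ineq2)

lemma aform_lc:
 assumes "Hsr s u" "Hsr s v" "Hsr s w"
 shows "aform s (%x. c * u x + d * v x) w = c * aform s u w + d * aform s v w"
proof -
 note H = HsrD[OF assms(1)] HsrD[OF assms(2)] HsrD[OF assms(3)]
 have "aform s (%x. c * u x + d * v x) w = (LINT xi|lborel. c * (WT s u xi \<bullet> WT s w xi) + d * (WT s v xi \<bullet> WT s w xi))"
  unfolding aform_def
 proof (rule integral_cong_AE)
  show "AE xi in lborel. WT s (%x. c * u x + d * v x) xi \<bullet> WT s w xi = c * (WT s u xi \<bullet> WT s w xi) + d * (WT s v xi \<bullet> WT s w xi)"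
   using WT_lc[OF H(1,4), of s c d] by eventually_elim (simp add: inner_add_left)
  have [measurable]: "WT s u \<in> borel_measurable lborel" "WT s v \<in> borel_measurable lborel" "WT s w \<in> borel_measurable lborel"
   "WT s (%x. c * u x + d * v x) \<in> borel_measurable lborel"
   using H L2_add[OF L2_mult[OF H(1)] L2_mult[OF H(4)]] by simp_all
  show "(%xi. WT s (%x. c * u x + d * v x) xi \<bullet> WT s w xi) \<in> borel_measurable lborel"
   "(%xi. c * (WT s u xi \<bullet> WT s w xi) + d * (WT s v xi \<bullet> WT s w xi)) \<in> borel_measurable lborel" by measurable
 qed
 also have "... = c * aform s u w + d * aform s v w"
  using L2_inner_integrable[OF H(2,8)] L2_inner_integrable[OF H(5,8)] by (simp add: aform_def)
 finally show ?thesis .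
qed

lemma bform_lc:
 assumes "L2 u" "L2 v" "L2 w"
 shows "bform (%x. c * u x + d * v x) w = c * bform u w + d * bform v w"
proof -
 have "bform (%x. c * u x + d * v x) w = (LINT x|lborel. c * (u x * w x) + d * (v x * w x))"
  by (simp add: bform_def algebra_simps)
 then show ?thesis
  using L2_mult_integrable[OF assms(1,3)] L2_mult_integrable[OF assms(2,3)] by (simp add: bform_def)
qed

lemma aform_commute: "aform s u v = aform s v u"
 by (simp add: aform_def inner_commute)

lemma bform_commute: "bform u v = bform v u"
 by (simp add: bform_def mult.commute)

lemma aform_self: "aform s u u = nsq (WT s u)"
 by (simp add: aform_def nsq_def power2_norm_eq_inner)

lemma aform_nonneg: "0 <= aform s u u"
 by (simp add: aform_self)

lemma bform_nonneg: "0 <= bform u u"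
 by (simp add: bform_self)

lemma aform_diff_self: "Hsr s u ==> Hsr s v ==> aform s (%x. u x - v x) (%x. u x - v x) = nsq (%xi. WT s u xi - WT s v xi)"
proof -
 assume H: "Hsr s u" "Hsr s v"
 have d: "Hsr s (%x. u x - v x)" using Hsr_lc[OF H, of 1 "-1"] by simp
 show ?thesis unfolding aform_self
 proof (rule nsq_cong_AE)
  show "AE xi in lborel. WT s (%x. u x - v x) xi = WT s u xi - WT s v xi"
   using WT_lc[OF HsrD(1)[OF H(1)] HsrD(1)[OF H(2)], of s 1 "-1"] by simp
 qed (use HsrD(2)[OF d] HsrD(2)[OF H(1)] HsrD(2)[OF H(2)] in "auto simp: L2_def")
qed

text \<open>Exact radial symmetry survives because convergence and limit, default value included,
  are decided pointwise from equal sequences.\<close>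

lemma radial_limit:
 assumes "!!n. radial (f n)"
 shows "radial (%x. if convergent (%n. f n x) then lim (%n. f n x) else (0::real))"
 unfolding radial_def
proof (intro allI impI)
 fix x y :: 'a assume xy: "norm x = norm y"
 have "(%n. f n x) = (%n. f n y)" using assms xy unfolding radial_def by (intro ext) blast
 then show "(if convergent (%n. f n x) then lim (%n. f n x) else 0) = (if convergent (%n. f n y) then lim (%n. f n y) else 0)"
  by simp
qed

lemma L2_complete:
 fixes f :: "nat => 'a::euclidean_space => 'b::{banach,second_countable_topology}"
 assumes L: "!!n. L2 (f n)"
  and C: "!!e. e > 0 ==> \<exists>M. \<forall>m\<ge>M. \<forall>n\<ge>M. nsq (%x. f m x - f n x) <= e"
 shows "\<exists>r g. g = (%x. if convergent (%n. f (r n) x) then lim (%n. f (r n) x) else 0) & L2 g &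
  (%n. nsq (%x. f n x - g x)) ~~> 0"
proof (rule Riesz_Fischer[OF L C])
 fix r :: "nat => nat"
 let ?g = "%x. if convergent (%n. f (r n) x) then lim (%n. f (r n) x) else 0"
 assume "L2 ?g" "(%n. nsq (%x. f n x - ?g x)) ~~> 0"
 then show ?thesis by (intro exI[of _ r] exI[of _ ?g] conjI refl)
qed

text \<open>The functions and their weighted transforms converge separately in L^2. Along a common
  subsequence the transforms converge almost everywhere, which identifies the second limit as the
  weighted transform of the first.\<close>

lemma Hsr_complete:
 fixes f :: "nat => 'a::euclidean_space => real"
 assumes f: "!!n. Hsr s (f n)"
  and C: "!!e. e > 0 ==> \<exists>M. \<forall>m\<ge>M. \<forall>n\<ge>M. eform s (%x. f m x - f n x) (%x. f m x - f n x) <= e"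
 shows "\<exists>u. Hsr s u & (%n. eform s (%x. f n x - u x) (%x. f n x - u x)) ~~> 0"
proof -
 note fL = HsrD(1)[OF f] and fW = HsrD(2)[OF f]
 have e: "eform s (%x. f m x - f n x) (%x. f m x - f n x) = nsq (%xi. WT s (f m) xi - WT s (f n) xi) + nsq (%x. f m x - f n x)" for m n
  by (simp add: eform_def aform_diff_self[OF f f] bform_self)
 have C1: "\<exists>M. \<forall>m\<ge>M. \<forall>n\<ge>M. nsq (%x. f m x - f n x) <= eps"
  and C2: "\<exists>M. \<forall>m\<ge>M. \<forall>n\<ge>M. nsq (%x. WT s (f m) x - WT s (f n) x) <= eps" if "eps > 0" for eps
 proof -
  obtain M where M: "!!m n. m >= M ==> n >= M ==> nsq (%xi. WT s (f m) xi - WT s (f n) xi) + nsq (%x. f m x - f n x) <= eps"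
   using C[OF \<open>eps > 0\<close>] unfolding e by blast
  have "nsq (%x. f m x - f n x) <= eps" "nsq (%x. WT s (f m) x - WT s (f n) x) <= eps" if "m >= M" "n >= M" for m n
   using M[OF that] nsq_nonneg[of "%xi. WT s (f m) xi - WT s (f n) xi"] nsq_nonneg[of "%x. f m x - f n x"] by linarith+
  then show "\<exists>M. \<forall>m\<ge>M. \<forall>n\<ge>M. nsq (%x. f m x - f n x) <= eps"
   "\<exists>M. \<forall>m\<ge>M. \<forall>n\<ge>M. nsq (%x. WT s (f m) x - WT s (f n) x) <= eps" by blast+
 qed
 obtain r u where u_def: "u = (%x. if convergent (%n. f (r n) x) then lim (%n. f (r n) x) else 0)"
  and uL: "L2 u" and lim1: "(%n. nsq (%x. f n x - u x)) ~~> 0"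
  using L2_complete[OF fL C1] by blast
 have ur: "radial u" unfolding u_def by (rule radial_limit) (rule HsrD(3)[OF f])
 obtain h where h: "L2 h" "(%n. nsq (%x. WT s (f n) x - h x)) ~~> 0"
  using L2_complete[OF fW C2] by blast
 have "nsq (%xi. FT (f n) xi - FT u xi) = nsq (%x. f n x - u x)" for n
  using L2_fourier_nsq[OF L2_fourier_diff[OF FT[OF fL] FT[OF uL]], of n] by (simp flip: of_real_diff)
 then have F: "(%n. nsq (%xi. FT (f n) xi - FT u xi)) ~~> 0" using lim1 by simp
 obtain r1 where r1: "strict_mono r1" "AE x in lborel. (%n. FT (f (r1 n)) x - FT u x) ~~> 0"
  using L2_AE_subseq[OF L2_diff[OF L2_FT[OF fL] L2_FT[OF uL]] F] by blast
 have F2: "(%n. nsq (%x. WT s (f (r1 n)) x - h x)) ~~> 0"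
  using LIMSEQ_subseq_LIMSEQ[OF h(2) r1(1)] by (simp add: o_def)
 obtain r2 where r2: "strict_mono r2" "AE x in lborel. (%n. WT s (f (r1 (r2 n))) x - h x) ~~> 0"
  using L2_AE_subseq[OF L2_diff[OF fW h(1)] F2] by blast
 have hW: "AE xi in lborel. h xi = WT s u xi"
  using r1(2) r2(2)
 proof eventually_elim
  case (elim xi)
  have "(%n. FT (f (r1 (r2 n))) xi) ~~> FT u xi"
   using LIMSEQ_subseq_LIMSEQ[OF LIM_zero_cancel[OF elim(1)] r2(1)] by (simp add: o_def)
  then have "(%n. WT s (f (r1 (r2 n))) xi) ~~> WT s u xi" unfolding WT_def by (intro tendsto_intros)
  moreover have "(%n. WT s (f (r1 (r2 n))) xi) ~~> h xi" by (rule LIM_zero_cancel[OF elim(2)])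
  ultimately show ?case using LIMSEQ_unique by blast
 qed
 have Wm: "WT s u \<in> borel_measurable lborel" using uL by simp
 have WL: "L2 (WT s u)" by (rule L2_cong_AE[OF h(1) Wm hW])
 have uH: "Hsr s u" using uL WL ur by (simp add: Hsr_iff)
 have "nsq (%x. WT s (f n) x - WT s u x) = nsq (%x. WT s (f n) x - h x)" for n
  by (rule nsq_cong_AE) (use hW fW[of n] WL h(1) in "auto simp: L2_def")
 then have "(%n. nsq (%x. WT s (f n) x - WT s u x) + nsq (%x. f n x - u x)) ~~> 0 + 0"
  using h(2) lim1 by (intro tendsto_add) simp_all
 then show ?thesis
  using uH by (intro exI[of _ u]) (simp add: eform_def aform_diff_self[OF f uH] bform_self)
qed

text \<open>Not immediate, because the chosen transform of the zero function is known to vanish only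
  almost everywhere.\<close>

lemma Hsr_zero: "Hsr s (%_. 0)"
proof -
 have "nsq (FT (%_::'a. 0)) = 0" by (subst nsq_FT) auto
 then have "AE xi in lborel. FT (%_::'a. 0) xi = 0" by (subst nsq_eq_0[symmetric]) (auto intro: L2_FT)
 then have "AE xi in lborel. 0 = WT s (%_::'a. 0) xi" by eventually_elim (simp add: WT_def)
 then have "L2 (WT s (%_::'a. 0))" by (intro L2_cong_AE[OF L2_zero]) auto
 then show ?thesis by (simp add: Hsr_iff radial_def)
qed

interpretation Hsr: semi_hilbert "Collect (Hsr s) :: ('a::euclidean_space => real) set" "eform s" for s
proof
 show "\<exists>u\<in>Collect (Hsr s). (%n. eform s (%x. f n x - u x) (%x. f n x - u x)) ~~> 0"
  if "!!n. f n \<in> Collect (Hsr s)"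
  "!!e. e > 0 ==> \<exists>M. \<forall>m\<ge>M. \<forall>n\<ge>M. eform s (%x. f m x - f n x) (%x. f m x - f n x) <= e"
  for f :: "nat => 'a => real"
  using Hsr_complete[of s f] that by auto
 show "eform s u v = eform s v u" for u v :: "'a => real"
  by (simp add: eform_def aform_commute[of s u v] bform_commute[of u v])
 show "eform s (%x. c * u x + d * v x) w = c * eform s u w + d * eform s v w"
  if "u \<in> Collect (Hsr s)" "v \<in> Collect (Hsr s)" "w \<in> Collect (Hsr s)" for u v w :: "'a => real" and c d
 proof -
  have H: "Hsr s u" "Hsr s v" "Hsr s w" using that by auto
  show ?thesis
   unfolding eform_def aform_lc[OF H] bform_lc[OF HsrD(1)[OF H(1)] HsrD(1)[OF H(2)] HsrD(1)[OF H(3)]]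
   by (simp only: distrib_left add_ac)
 qed
 show "0 <= eform s u u" for u :: "'a => real"
  unfolding eform_def using aform_nonneg[of s u] bform_nonneg[of u] by linarith
 show "(%x. c * u x + d * v x) \<in> Collect (Hsr s)"
  if "u \<in> Collect (Hsr s)" "v \<in> Collect (Hsr s)" for u v :: "'a => real" and c d
  using that Hsr_lc by blast
 show "(%_. 0) \<in> (Collect (Hsr s) :: ('a => real) set)" using Hsr_zero by blast
qed

section \<open>Translation differences on the frequency side\<close>

lemma nsq_translate_diff:
 fixes u :: "'a::euclidean_space => real"
 assumes u: "L2 u"
 shows "nsq (%x. u (h + x) - u x) = (LINT xi|lborel. (cmod (efun h xi - 1))^2 * (cmod (FT u xi))^2)"
proof -
 have "L2_fourier (%x. complex_of_real (u (h + x)) - complex_of_real (u x)) (%xi. efun (- h) xi * FT u xi - FT u xi)"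
  by (rule L2_fourier_diff[OF L2_fourier_translate[OF FT[OF u]] FT[OF u]])
 from L2_fourier_nsq[OF this]
 have "nsq (%x. u (h + x) - u x) = nsq (%xi. efun (- h) xi * FT u xi - FT u xi)"
  by (simp flip: of_real_diff)
 also have "... = (LINT xi|lborel. (cmod (efun h xi - 1))^2 * (cmod (FT u xi))^2)"
  unfolding nsq_def
 proof (rule Bochner_Integration.integral_cong[OF refl])
  fix xi
  have "efun (- h) xi * FT u xi - FT u xi = (efun (- h) xi - 1) * FT u xi" by (simp add: algebra_simps)
  moreover have "efun (- h) xi - 1 = - efun (- h) xi * (efun h xi - 1)"
  proof -
   have "efun (- h) xi * efun h xi = 1" by (simp add: exp_add[symmetric])
   then show ?thesis by (simp add: algebra_simps)
  qed
  then have "cmod (efun (- h) xi - 1) = cmod (efun h xi - 1)"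
   using norm_efun[of "- h" xi] by (simp only: norm_mult norm_minus_cancel mult_1)
  ultimately show "(norm (efun (- h) xi * FT u xi - FT u xi))^2 = (cmod (efun h xi - 1))^2 * (cmod (FT u xi))^2"
   by (simp add: norm_mult power_mult_distrib)
 qed
 finally show ?thesis .
qed

lemma norm_iexp_minus_1_le: "cmod (efun h xi - 1) <= min 2 (norm h * norm xi)"
proof -
 have 1: "cmod (efun h xi - 1) <= 2"
  using norm_triangle_ineq4[of "efun h xi" 1] norm_efun[of h xi] by simp
 have "cmod (iexp (- (h \<bullet> xi)) - 1) <= \<bar>- (h \<bullet> xi)\<bar>"
  using iexp_approx1[of "- (h \<bullet> xi)" 0] by simp
 also have "... <= norm h * norm xi" using Cauchy_Schwarz_ineq2[of h xi] by simp
 finally show ?thesis using 1 by simp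
qed

subsection \<open>Averages over balls\<close>

abbreviation bvol :: "'a::euclidean_space itself => real => real" where
 "bvol _ rho \<equiv> measure lborel (ball (0::'a) rho)"

definition avg :: "real => ('a::euclidean_space => real) => 'a => real" where
 "avg rho u x = (LINT y|lborel. indicator (ball 0 rho) y * u (x + y)) / bvol TYPE('a) rho"

text \<open>A common bound for \<open>nsq\<close> of the differences under all translations of
  length at most \<open>rho\<close>: the minimum combines the two bounds 2 and |h| |xi| for the
  distance of the exponential from 1.\<close>

definition Jf :: "real => ('a::euclidean_space => real) => real" where
 "Jf rho u = (LINT xi|lborel. (min 2 (rho * norm xi))^2 * (cmod (FT u xi))^2)"

lemma bvol_pos: "rho > 0 ==> bvol TYPE('a::euclidean_space) rho > 0"
 by simp

lemma L2_indicator_ball: "L2 (indicator (ball (a::'a::euclidean_space) rho) :: 'a => real)"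
proof -
 have "(norm (indicator (ball a rho) x :: real))^2 = indicator (ball a rho) x" for x :: 'a by (auto simp: indicator_def)
 moreover have "integrable lborel (indicator (ball a rho) :: 'a => real)"
  using emeasure_bounded_finite[of "ball a rho"] by (simp add: integrable_indicator_iff)
 ultimately show ?thesis by (simp add: L2_def)
qed

lemma nsq_indicator_ball: "nsq (indicator (ball (a::'a::euclidean_space) rho) :: 'a => real) = measure lborel (ball a rho)"
proof -
 have "(norm (indicator (ball a rho) x :: real))^2 = indicator (ball a rho) x" for x :: 'a by (auto simp: indicator_def)
 then show ?thesis by (simp add: nsq_def)
qed

lemma L2_shift: "L2 u ==> L2 (%y. u (x + y))"
 using L2_affine[of 1 u x] by simp

text \<open>Joint measurability in radius and centre is what permits exchanging the integrals over
  \<open>rho\<close> and \<open>x\<close> in the Gagliardo-Nirenberg inequality.\<close>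

lemma avg_measurable [measurable]:
 fixes u :: "'a::euclidean_space => real"
 assumes [measurable]: "u \<in> borel_measurable borel"
 shows "(%p. avg (fst p) u (snd p)) \<in> borel_measurable (borel \<Otimes>\<^sub>M borel)"
proof -
 have e: "indicator (ball 0 rho) y = (if norm y < rho then 1 else 0 :: real)" for rho and y :: 'a
  by (auto simp: indicator_def)
 have e2: "bvol TYPE('a) rho = (if rho >= 0 then unit_ball_vol (real DIM('a)) * rho ^ DIM('a) else 0)" for rho
  by (auto simp: content_ball)
 have "(%p. LINT y|lborel. (if norm y < fst p then 1 else 0 :: real) * u (snd p + y)) \<in> borel_measurable (borel \<Otimes>\<^sub>M borel)"
  by (rule lborel.borel_measurable_lebesgue_integral) measurable
 then show ?thesis unfolding avg_def e e2 by measurable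
qed

lemma avg_measurable1 [measurable]:
 fixes u :: "'a::euclidean_space => real"
 assumes "u \<in> borel_measurable borel"
 shows "avg rho u \<in> borel_measurable borel"
 using measurable_compose[OF measurable_Pair1'[of rho borel borel] avg_measurable[OF assms]] by simp

lemma ball_average_sq:
 fixes w :: "'a::euclidean_space => real"
 assumes rho: "rho > 0" and i: "L2 (%y. indicator (ball 0 rho) y * w y)"
 shows "((LINT y|lborel. indicator (ball 0 rho) y * w y) / bvol TYPE('a) rho)^2
   <= (LINT y|lborel. indicator (ball 0 rho) y * (w y)^2) / bvol TYPE('a) rho"
proof -
 let ?v = "bvol TYPE('a) rho" and ?i = "%y::'a. indicator (ball 0 rho) y :: real"
 have v: "?v > 0" using rho by simp
 have e: "?i y * (?i y * w y) = ?i y * w y" "(norm (?i y * w y))^2 = ?i y * (w y)^2" for y by (auto simp: indicator_def)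
 have "\<bar>LINT y|lborel. ?i y * w y\<bar> <= sqrt ?v * sqrt (LINT y|lborel. ?i y * (w y)^2)"
  using L2_Cauchy_Schwarz[OF L2_indicator_ball[of 0 rho] i] unfolding nsq_indicator_ball unfolding nsq_def e by simp
 then have "\<bar>LINT y|lborel. ?i y * w y\<bar>\<^sup>2 <= (sqrt ?v * sqrt (LINT y|lborel. ?i y * (w y)^2))^2"
  by (intro power_mono) auto
 also have "... = ?v * (LINT y|lborel. ?i y * (w y)^2)"
  using v by (simp add: power_mult_distrib)
 finally have "(LINT y|lborel. ?i y * w y)^2 / ?v^2 <= ?v * (LINT y|lborel. ?i y * (w y)^2) / ?v^2"
  by (intro divide_right_mono) auto
 then show ?thesis using v by (simp add: power_divide power2_eq_square)
qed

lemma L2_indicator_mult: "L2 w ==> A \<in> sets borel ==> L2 (%y. indicator A y * w y :: real)"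
 by (rule L2_bound(1)[of w _ 1]) (auto simp: L2_def indicator_def)

lemma avg_sq_le:
 fixes u :: "'a::euclidean_space => real"
 assumes "rho > 0" "L2 u"
 shows "(avg rho u x)^2 <= (LINT y|lborel. indicator (ball 0 rho) y * (u (x + y))^2) / bvol TYPE('a) rho"
 unfolding avg_def by (rule ball_average_sq[OF assms(1)]) (intro L2_indicator_mult L2_shift assms, simp)

lemma integrable_sq_ball:
 fixes u :: "'a::euclidean_space => real"
 assumes "L2 u" "A \<in> sets borel"
 shows "integrable lborel (%y. indicator A y * (u (x + y))^2)"
proof -
 have "(norm (indicator A y * u (x + y)))^2 = indicator A y * (u (x + y))^2" for y by (auto simp: indicator_def)
 then show ?thesis
  using L2_integrable[OF L2_indicator_mult[OF L2_shift[OF assms(1)] assms(2)], of x] by simp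
qed

lemma avg_sq_le_nsq:
 fixes u :: "'a::euclidean_space => real"
 assumes "rho > 0" "L2 u"
 shows "(avg rho u x)^2 <= nsq u / bvol TYPE('a) rho"
proof -
 have "(LINT y|lborel. indicator (ball 0 rho) y * (u (x + y))^2) <= (LINT y|lborel. (u (x + y))^2)"
 proof (rule integral_mono)
  show "integrable lborel (%y. indicator (ball 0 rho) y * (u (x + y))^2)" by (rule integrable_sq_ball[OF assms(2)]) simp
  show "integrable lborel (%y. (u (x + y))^2)" using L2_integrable[OF L2_shift[OF assms(2)]] by simp
 qed (auto simp: indicator_def)
 also have "... = nsq u" using nsq_affine[of 1 u x] by (simp add: nsq_def)
 finally show ?thesis using avg_sq_le[OF assms, of x] by (meson divide_right_mono measure_nonneg order_trans)
qed

lemma Jf_integrable: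
 assumes "L2 u" and that: "rho >= 0"
 shows "integrable lborel (%xi::'a::euclidean_space. (min 2 (rho * norm xi))^2 * (cmod (FT u xi))^2)"
proof (rule Bochner_Integration.integrable_bound)
 have [measurable]: "FT u \<in> borel_measurable borel" using L2_FT[OF assms(1)] by (simp add: L2_def)
 show "integrable lborel (%xi. 4 * (cmod (FT u xi))^2)" using L2_integrable[OF L2_FT[OF assms(1)]] by simp
 show "(%xi::'a. (min 2 (rho * norm xi))^2 * (cmod (FT u xi))^2) \<in> borel_measurable lborel" by measurable
 have "(min 2 (rho * norm xi))^2 <= 4" for xi :: 'a
  using power_mono[of "min 2 (rho * norm xi)" 2 2] that by simp
 then show "AE xi in lborel. norm ((min 2 (rho * norm xi))^2 * (cmod (FT u xi))^2) <= norm (4 * (cmod (FT u xi))^2)"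
  by (auto simp: abs_mult intro!: mult_right_mono)
qed

lemma nsq_shift_le_Jf:
 fixes u :: "'a::euclidean_space => real"
 assumes u: "L2 u" and h: "norm h <= rho"
 shows "nsq (%x. u (h + x) - u x) <= Jf rho u"
 unfolding nsq_translate_diff[OF u] Jf_def
proof (rule integral_mono)
 have rho: "rho >= 0" using h norm_ge_zero order_trans by blast
 show "integrable lborel (%xi. (min 2 (rho * norm xi))^2 * (cmod (FT u xi))^2)" by (rule Jf_integrable[OF u rho])
 have le: "(cmod (efun h xi - 1))^2 * (cmod (FT u xi))^2 <= (min 2 (rho * norm xi))^2 * (cmod (FT u xi))^2" for xi
 proof (intro mult_right_mono power_mono)
  show "cmod (efun h xi - 1) <= min 2 (rho * norm xi)"
   using norm_iexp_minus_1_le[of h xi] mult_right_mono[OF h norm_ge_zero[of xi]] by linarith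
 qed auto
 then show "(cmod (efun h xi - 1))^2 * (cmod (FT u xi))^2 <= (min 2 (rho * norm xi))^2 * (cmod (FT u xi))^2" for xi .
 have [measurable]: "FT u \<in> borel_measurable borel" using L2_FT[OF u] by (simp add: L2_def)
 show "integrable lborel (%xi. (cmod (efun h xi - 1))^2 * (cmod (FT u xi))^2)"
  by (rule Bochner_Integration.integrable_bound[OF Jf_integrable[OF u rho]]) (use le in auto)
qed

lemma nn_integral_nsq: "L2 f ==> (\<integral>\<^sup>+x. ennreal ((norm (f x))^2) \<partial>lborel) = ennreal (nsq f)"
 unfolding nsq_def by (rule nn_integral_eq_integral) (auto simp: L2_def)

lemma measurable_pair_lborel:
 "f \<in> borel_measurable (borel \<Otimes>\<^sub>M borel) ==> f \<in> borel_measurable (lborel \<Otimes>\<^sub>M lborel)"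
 by (simp add: measurable_cong_sets[OF sets_pair_measure_cong[OF sets_lborel sets_lborel] refl])

text \<open>\<open>u x - avg rho u x\<close> is the mean over the ball of
  \<open>u x - u (x + y)\<close>. Cauchy-Schwarz on the ball and Tonelli bound its square integral
  by the mean over \<open>y\<close> of the translation differences, each at most
  \<open>Jf rho u\<close>.\<close>

lemma avg_diff_sq_le:
 fixes u :: "'a::euclidean_space => real"
 assumes rho: "rho > 0" and u: "L2 u"
 shows "(\<integral>\<^sup>+x. ennreal ((u x - avg rho u x)^2) \<partial>lborel) <= ennreal (Jf rho u)"
proof -
 let ?v = "bvol TYPE('a) rho" and ?i = "%y::'a. indicator (ball 0 rho) y :: real"
 have [measurable]: "u \<in> borel_measurable borel" using u by (simp add: L2_def)
 have v: "?v > 0" using rho by simp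
 have iL: "L2 (%y. ?i y * u (x + y))" for x by (intro L2_indicator_mult L2_shift u) simp
 have ii: "integrable lborel (%y. ?i y * u (x + y))" for x
 proof -
  have "(%y. ?i y * (?i y * u (x + y))) = (%y. ?i y * u (x + y))" by (auto simp: indicator_def)
  then show ?thesis using L2_mult_integrable[OF L2_indicator_ball[of 0 rho] iL[of x]] by (simp only:)
 qed
 have ib: "integrable lborel ?i" using emeasure_bounded_finite[of "ball (0::'a) rho"] by (simp add: integrable_indicator_iff)
 have dL: "L2 (%y. ?i y * (u x - u (x + y)))" for x
  using L2_diff[OF L2_mult[OF L2_indicator_ball[of 0 rho], of "u x"] iL[of x]] by (simp add: algebra_simps)
 have pt: "ennreal ((u x - avg rho u x)^2) <= ennreal (1 / ?v) * (\<integral>\<^sup>+y. ennreal (?i y * (u (y + x) - u x)^2) \<partial>lborel)" for x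
 proof -
  have "(LINT y|lborel. ?i y * (u x - u (x + y))) = u x * ?v - (LINT y|lborel. ?i y * u (x + y))"
   using ii[of x] ib by (simp add: right_diff_distrib mult.commute[of _ "u x"])
  then have "u x - avg rho u x = (LINT y|lborel. ?i y * (u x - u (x + y))) / ?v"
   using v by (simp add: avg_def field_simps)
  then have "(u x - avg rho u x)^2 <= (LINT y|lborel. ?i y * (u x - u (x + y))^2) / ?v"
   using ball_average_sq[OF rho dL[of x]] by simp
  also have "(LINT y|lborel. ?i y * (u x - u (x + y))^2) = (LINT y|lborel. ?i y * (u (y + x) - u x)^2)"
   by (simp add: power2_commute add.commute)
  finally have "ennreal ((u x - avg rho u x)^2) <= ennreal (1 / ?v * (LINT y|lborel. ?i y * (u (y + x) - u x)^2))"
   by (intro ennreal_leI) simp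
  also have "... = ennreal (1 / ?v) * ennreal (LINT y|lborel. ?i y * (u (y + x) - u x)^2)"
   using v by (intro ennreal_mult') simp
  also have "ennreal (LINT y|lborel. ?i y * (u (y + x) - u x)^2) = (\<integral>\<^sup>+y. ennreal (?i y * (u (y + x) - u x)^2) \<partial>lborel)"
  proof (rule nn_integral_eq_integral[symmetric])
   have "(norm (?i y * (u x - u (x + y))))^2 = ?i y * (u (y + x) - u x)^2" for y
    by (auto simp: indicator_def power2_commute add.commute)
   then show "integrable lborel (%y. ?i y * (u (y + x) - u x)^2)"
    using L2_integrable[OF dL[of x]] by simp
  qed auto
  finally show ?thesis .
 qed
 have ie: "?i y = (if norm y < rho then 1 else 0)" for y by (auto simp: indicator_def)
 have m: "(%(x, y). ennreal (?i y * (u (y + x) - u x)^2)) \<in> borel_measurable (lborel \<Otimes>\<^sub>M lborel)"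
  "(%(y, x). ennreal (?i y * (u (y + x) - u x)^2)) \<in> borel_measurable (lborel \<Otimes>\<^sub>M lborel)"
  unfolding ie by (rule measurable_pair_lborel, measurable)+
 have "(\<integral>\<^sup>+x. ennreal ((u x - avg rho u x)^2) \<partial>lborel) <= (\<integral>\<^sup>+x. ennreal (1 / ?v) * (\<integral>\<^sup>+y. ennreal (?i y * (u (y + x) - u x)^2) \<partial>lborel) \<partial>lborel)"
  by (rule nn_integral_mono) (rule pt)
 also have "... = ennreal (1 / ?v) * (\<integral>\<^sup>+x. (\<integral>\<^sup>+y. ennreal (?i y * (u (y + x) - u x)^2) \<partial>lborel) \<partial>lborel)"
  by (rule nn_integral_cmult) (rule lborel.borel_measurable_nn_integral[OF m(1)])
 also have "(\<integral>\<^sup>+x. (\<integral>\<^sup>+y. ennreal (?i y * (u (y + x) - u x)^2) \<partial>lborel) \<partial>lborel) =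
  (\<integral>\<^sup>+y. (\<integral>\<^sup>+x. ennreal (?i y * (u (y + x) - u x)^2) \<partial>lborel) \<partial>lborel)"
  by (rule lborel_pair.Fubini'[OF m(2)])
 also have "... <= (\<integral>\<^sup>+y. ennreal (Jf rho u) * indicator (ball (0::'a) rho) y \<partial>lborel)"
 proof (rule nn_integral_mono)
  fix y :: 'a
  show "(\<integral>\<^sup>+x. ennreal (?i y * (u (y + x) - u x)^2) \<partial>lborel) <= ennreal (Jf rho u) * indicator (ball (0::'a) rho) y"
  proof (cases "y \<in> ball 0 rho")
   case True
   then have "(\<integral>\<^sup>+x. ennreal (?i y * (u (y + x) - u x)^2) \<partial>lborel) = ennreal (nsq (%x. u (y + x) - u x))"
    using nn_integral_nsq[OF L2_diff[OF L2_shift[OF u] u], of y] by simp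
   also have "... <= ennreal (Jf rho u)" using True by (intro ennreal_leI nsq_shift_le_Jf[OF u]) simp
   finally show ?thesis using True by simp
  qed simp
 qed
 also have "... = ennreal (Jf rho u) * emeasure lborel (ball (0::'a) rho)"
  by (rule nn_integral_cmult_indicator) simp
 also have "emeasure lborel (ball (0::'a) rho) = ennreal ?v"
  using emeasure_bounded_finite[of "ball (0::'a) rho"] by (intro emeasure_eq_ennreal_measure) auto
 finally have "(\<integral>\<^sup>+x. ennreal ((u x - avg rho u x)^2) \<partial>lborel) <= ennreal (1 / ?v) * (ennreal (Jf rho u) * ennreal ?v)"
  by (simp add: mult_left_mono)
 also have "... = ennreal (Jf rho u)"
 proof -
  have "Jf rho u >= 0" unfolding Jf_def by (rule Bochner_Integration.integral_nonneg) auto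
  then show ?thesis using v by (simp add: ennreal_mult'[symmetric])
 qed
 finally show ?thesis .
qed

lemma min_sq_le_powr:
 fixes t s :: real
 assumes "t >= 0" "0 < s" "s < 1"
 shows "(min 2 t)^2 <= 4 * t powr (2 * s)"
proof (cases "t <= 1")
 case True
 have "(min 2 t)^2 = t powr 2" using True assms by (simp add: powr_numeral)
 also have "... <= t powr (2 * s)" using True assms by (intro powr_mono') auto
 finally show ?thesis using powr_ge_zero[of t "2 * s"] by linarith
next
 case False
 have "(min 2 t)^2 <= 2^2" using assms by (intro power_mono) auto
 moreover have "t powr (2 * s) >= 1" using False assms by (intro ge_one_powr_ge_zero) auto
 ultimately show ?thesis by simp
qed

text \<open>Gives the rate rho^(2s) at which ball averages approximate a function, uniform on
  bounded sets of H^s.\<close>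

lemma Jf_le_aform:
 fixes u :: "'a::euclidean_space => real"
 assumes rho: "rho > 0" and s: "0 < s" "s < 1" and u: "L2 u" "L2 (WT s u)"
 shows "Jf rho u <= 4 * rho powr (2 * s) * aform s u u"
proof -
 have i: "integrable lborel (%xi. norm xi powr (2 * s) * (cmod (FT u xi))^2)" using L2_WT_iff[OF u(1)] u(2) by blast
 have "Jf rho u <= (LINT xi|lborel. 4 * rho powr (2 * s) * (norm xi powr (2 * s) * (cmod (FT u xi))^2))"
  unfolding Jf_def
 proof (rule integral_mono)
  show "integrable lborel (%xi. (min 2 (rho * norm xi))^2 * (cmod (FT u xi))^2)" using rho by (intro Jf_integrable u) simp
  show "integrable lborel (%xi. 4 * rho powr (2 * s) * (norm xi powr (2 * s) * (cmod (FT u xi))^2))" using i by simp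
  fix xi :: 'a
  have "(min 2 (rho * norm xi))^2 <= 4 * (rho * norm xi) powr (2 * s)" using rho s by (intro min_sq_le_powr) auto
  then show "(min 2 (rho * norm xi))^2 * (cmod (FT u xi))^2 <= 4 * rho powr (2 * s) * (norm xi powr (2 * s) * (cmod (FT u xi))^2)"
   using rho mult_right_mono[of _ _ "(cmod (FT u xi))^2"] by (fastforce simp: powr_mult mult_ac)
 qed
 also have "... = 4 * rho powr (2 * s) * aform s u u"
  unfolding aform_self nsq_def by (simp add: WT_def norm_mult power_mult_distrib powr_sq)
 finally show ?thesis .
qed

subsection \<open>A Gagliardo-Nirenberg inequality\<close>

text \<open>Integrating (min 2 (rho |xi|))^2 against rho^(-2s-1) reproduces |xi|^(2s) up to this
  constant. Its integrand behaves like t^(1-2s) at 0 and like 4 t^(-2s-1) at infinity, hence it is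
  finite for 0 < s < 1.\<close>

definition kern :: "real => ennreal" where
 "kern s = (\<integral>\<^sup>+t. ennreal (t powr (-2 * s - 1) * (min 2 t)^2) * indicator {0<..} t \<partial>lborel)"

lemma nn_integral_powr_tail:
 fixes s a :: real
 assumes "s > 0" "a > 0"
 shows "(\<integral>\<^sup>+t. ennreal (t powr (-2 * s - 1)) * indicator {a..} t \<partial>lborel) = ennreal (a powr (-2 * s) / (2 * s))"
proof -
 have "((%t. - (t powr (-2 * s)) / (2 * s)) \<longlongrightarrow> - 0 / (2 * s)) at_top"
  using assms by (intro tendsto_intros tendsto_neg_powr filterlim_ident) auto
 then have "((%t. - (t powr (-2 * s)) / (2 * s)) \<longlongrightarrow> 0) at_top" by simp
 moreover have "DERIV (%t. - (t powr (-2 * s)) / (2 * s)) t :> t powr (-2 * s - 1)" if "a <= t" for t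
  using assms that by (auto intro!: derivative_eq_intros simp: powr_diff)
 ultimately have "(\<integral>\<^sup>+t. ennreal (t powr (-2 * s - 1)) * indicator {a..} t \<partial>lborel) = ennreal (0 - (- (a powr (-2 * s)) / (2 * s)))"
  by (intro nn_integral_FTC_atLeast) auto
 then show ?thesis by simp
qed

lemma kern_finite:
 assumes "0 < s" "s < 1" shows "kern s < \<infinity>"
proof -
 have "kern s <= (\<integral>\<^sup>+t. ennreal (t powr (1 - 2 * s)) * indicator {0..1} t + ennreal 4 * (ennreal (t powr (-2 * s - 1)) * indicator {1..} t) \<partial>lborel)"
  unfolding kern_def
 proof (rule nn_integral_mono)
  fix t :: real
  consider "t <= 0" | "0 < t" "t <= 1" | "t > 1" by linarith
  then show "ennreal (t powr (-2 * s - 1) * (min 2 t)^2) * indicator {0<..} t <=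
   ennreal (t powr (1 - 2 * s)) * indicator {0..1} t + ennreal 4 * (ennreal (t powr (-2 * s - 1)) * indicator {1..} t)"
  proof cases
   case 2
   have "t^2 = t powr 2" using 2 by (simp add: powr_numeral)
   then have "t powr (-2 * s - 1) * (min 2 t)^2 = t powr (-2 * s - 1) * t powr 2" using 2 by simp
   also have "... = t powr (1 - 2 * s)" unfolding powr_add[symmetric] by simp
   finally have "ennreal (t powr (-2 * s - 1) * (min 2 t)^2) = ennreal (t powr (1 - 2 * s))" by simp
   then show ?thesis using 2 by (simp add: add_increasing2)
  next
   case 3
   have "(min 2 t)^2 <= 2^2" using 3 by (intro power_mono) auto
   then have "t powr (-2 * s - 1) * (min 2 t)^2 <= 4 * t powr (-2 * s - 1)"
    using mult_left_mono[of "(min 2 t)^2" 4 "t powr (-2 * s - 1)"] by simp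
   then have "ennreal (t powr (-2 * s - 1) * (min 2 t)^2) <= ennreal 4 * ennreal (t powr (-2 * s - 1))"
    by (subst ennreal_mult'[symmetric]) (auto intro: ennreal_leI)
   then show ?thesis using 3 by simp
  qed simp
 qed
 also have "... = (\<integral>\<^sup>+t. ennreal (t powr (1 - 2 * s)) * indicator {0..1} t \<partial>lborel) +
   ennreal 4 * (\<integral>\<^sup>+t. ennreal (t powr (-2 * s - 1)) * indicator {1..} t \<partial>lborel)"
  by (subst nn_integral_add) (auto simp: nn_integral_cmult)
 also have "(\<integral>\<^sup>+t. ennreal (t powr (1 - 2 * s)) * indicator {0..1} t \<partial>lborel) = ennreal (1 powr (1 - 2 * s + 1) / (1 - 2 * s + 1))"
  using assms by (intro nn_integral_has_integral_lebesgue' has_integral_powr_from_0) auto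
 also have "(\<integral>\<^sup>+t. ennreal (t powr (-2 * s - 1)) * indicator {1..} t \<partial>lborel) = ennreal (1 powr (-2 * s) / (2 * s))"
  using assms by (intro nn_integral_powr_tail) auto
 finally show ?thesis by (auto simp: ennreal_mult_less_top intro: le_less_trans)
qed

lemma kern_scale:
 fixes b :: real
 assumes "b > 0"
 shows "(\<integral>\<^sup>+rho. ennreal (rho powr (-2 * s - 1) * (min 2 (rho * b))^2) * indicator {0<..} rho \<partial>lborel) = ennreal (b powr (2 * s)) * kern s"
proof -
 let ?h = "%rho. ennreal (rho powr (-2 * s - 1) * (min 2 (rho * b))^2) * indicator {0<..} rho"
 have "(\<integral>\<^sup>+rho. ?h rho \<partial>lborel) = ennreal \<bar>1 / b\<bar> * (\<integral>\<^sup>+t. ?h (0 + (1 / b) * t) \<partial>lborel)"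
  using assms by (intro nn_integral_real_affine) auto
 also have "(\<integral>\<^sup>+t. ?h (0 + (1 / b) * t) \<partial>lborel) =
  (\<integral>\<^sup>+t. ennreal (b powr (2 * s + 1)) * (ennreal (t powr (-2 * s - 1) * (min 2 t)^2) * indicator {0<..} t) \<partial>lborel)"
 proof (rule nn_integral_cong)
  fix t :: real
  show "?h (0 + (1 / b) * t) = ennreal (b powr (2 * s + 1)) * (ennreal (t powr (-2 * s - 1) * (min 2 t)^2) * indicator {0<..} t)"
  proof (cases "t > 0")
   case True
   have "(1 / b * t) powr (-2 * s - 1) = b powr (2 * s + 1) * t powr (-2 * s - 1)"
    using True assms powr_divide[of t b "-2 * s - 1"] powr_minus_divide[of b "-2 * s - 1"] by (simp add: add.commute[of 1 "2 * s"])
   then show ?thesis using True assms by (simp add: ennreal_mult'[symmetric] mult.assoc)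
  qed (use assms in "auto simp: zero_less_divide_iff")
 qed
 also have "... = ennreal (b powr (2 * s + 1)) * kern s"
  unfolding kern_def by (rule nn_integral_cmult) measurable
 also have "ennreal \<bar>1 / b\<bar> * (ennreal (b powr (2 * s + 1)) * kern s) = ennreal (\<bar>1 / b\<bar> * b powr (2 * s + 1)) * kern s"
  by (simp add: mult.assoc[symmetric] ennreal_mult'[symmetric])
 also have "\<bar>1 / b\<bar> * b powr (2 * s + 1) = b powr (2 * s)" using assms by (simp add: powr_add)
 finally show ?thesis .
qed

text \<open>Choosing the radius \<open>rho\<^sub>0\<close> for which the average is forced to be at most \<open>\<bar>u x\<bar> / 2\<close>, all larger
  radii contribute \<open>u\<^sup>2/4\<close> to the square function on the right.\<close>

lemma pointwise_power_le:
 fixes u :: "'a::euclidean_space => real"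
 assumes s: "0 < s" and u: "L2 u" and pos: "nsq u > 0"
 defines "N \<equiv> real DIM('a)" and "V \<equiv> unit_ball_vol (real DIM('a))"
 shows "ennreal (\<bar>u x\<bar> powr (2 + 4 * s / N)) <= ennreal (8 * s * (4 * nsq u / V) powr (2 * s / N)) *
  (\<integral>\<^sup>+rho. ennreal (rho powr (-2 * s - 1)) * ennreal ((u x - avg rho u x)^2) * indicator {0<..} rho \<partial>lborel)"
proof (cases "u x = 0")
 case False
 have N: "N > 0" and V: "V > 0" by (auto simp: N_def V_def)
 \<comment> \<open>The ball of radius \<open>rho0\<close> has volume 4 nsq u / (u x)^2, which turns
   \<open>avg_sq_le_nsq\<close> into |avg| <= |u x| / 2 for this radius and all larger ones.\<close>
 define rho0 where "rho0 = (4 * nsq u / (V * (u x)^2)) powr (1 / N)"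
 have base: "4 * nsq u / (V * (u x)^2) > 0" using pos V False by (intro divide_pos_pos mult_pos_pos) auto
 have rho0: "rho0 > 0" unfolding rho0_def using base by (metis powr_gt_zero less_irrefl)
 have key: "(u x)^2 / 4 <= (u x - avg rho u x)^2" if "rho >= rho0" for rho
 proof -
  have rho: "rho > 0" using that rho0 by simp
  have "rho0 ^ DIM('a) = rho0 powr N" using powr_realpow[OF rho0, of "DIM('a)"] by (simp add: N_def)
  also have "... = (4 * nsq u / (V * (u x)^2)) powr (1 / N * N)" unfolding rho0_def powr_powr ..
  also have "1 / N * N = 1" using N by simp
  also have "(4 * nsq u / (V * (u x)^2)) powr 1 = 4 * nsq u / (V * (u x)^2)" using base by (intro powr_one) simp
  finally have "rho0 ^ DIM('a) = 4 * nsq u / (V * (u x)^2)" .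
  moreover have "bvol TYPE('a) rho0 = V * rho0 ^ DIM('a)" using rho0 by (simp add: content_ball V_def)
  ultimately have "bvol TYPE('a) rho0 = 4 * nsq u / (u x)^2" using V by simp
  moreover have "bvol TYPE('a) rho0 <= bvol TYPE('a) rho"
   using that rho0 by (simp add: content_ball power_mono mult_left_mono)
  ultimately have b: "4 * nsq u / (u x)^2 <= bvol TYPE('a) rho" by simp
  have "(avg rho u x)^2 <= nsq u / bvol TYPE('a) rho" by (rule avg_sq_le_nsq[OF rho u])
  also have "... <= nsq u / (4 * nsq u / (u x)^2)"
  proof (rule divide_left_mono[OF b])
   show "0 < bvol TYPE('a) rho * (4 * nsq u / (u x)^2)"
    using rho pos False by (intro mult_pos_pos divide_pos_pos bvol_pos) auto
  qed simp
  also have "... = (\<bar>u x\<bar> / 2)^2" using pos by (simp add: power_divide)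
  finally have "\<bar>avg rho u x\<bar> <= \<bar>u x\<bar> / 2" using power2_le_imp_le[of "\<bar>avg rho u x\<bar>" "\<bar>u x\<bar> / 2"] by simp
  then have "\<bar>u x\<bar> / 2 <= \<bar>u x - avg rho u x\<bar>" by linarith
  from power_mono[OF this, of 2] show ?thesis by (simp add: power_divide)
 qed
 have "rho0 powr (-2 * s) = (4 * nsq u / (V * (u x)^2)) powr (- (2 * s / N))"
  using N by (simp add: rho0_def powr_powr)
 also have "... = ((4 * nsq u / V) powr (2 * s / N)) powr (-1) * ((u x)^2) powr (2 * s / N)"
 proof -
  have "4 * nsq u / (V * (u x)^2) = (4 * nsq u / V) / (u x)^2" by simp
  moreover have "((4 * nsq u / V) / (u x)^2) powr (- (2 * s / N)) = (4 * nsq u / V) powr (- (2 * s / N)) / ((u x)^2) powr (- (2 * s / N))"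
   by (rule powr_divide)
  moreover have "((u x)^2) powr (- (2 * s / N)) = inverse (((u x)^2) powr (2 * s / N))" by (rule powr_minus)
  moreover have "(4 * nsq u / V) powr (- (2 * s / N)) = ((4 * nsq u / V) powr (2 * s / N)) powr (-1)" unfolding powr_powr by simp
  ultimately show ?thesis by (simp only: divide_inverse inverse_inverse_eq)
 qed
 also have "((u x)^2) powr (2 * s / N) = \<bar>u x\<bar> powr (4 * s / N)"
 proof -
  have "(u x)^2 = \<bar>u x\<bar> powr 2" using False by simp
  then show ?thesis by (simp only: powr_powr) simp
 qed
 finally have r0: "rho0 powr (-2 * s) = ((4 * nsq u / V) powr (2 * s / N)) powr (-1) * \<bar>u x\<bar> powr (4 * s / N)" .
 have A: "(4 * nsq u / V) powr (2 * s / N) > 0" using pos V by simp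
 \<comment> \<open>Origin of the exponent: u^2 comes from the lower bound of the square function,
   |u|^(4s/N) from the tail integral rho0^(-2s) / (2s).\<close>
 have "\<bar>u x\<bar> powr (2 + 4 * s / N) = (u x)^2 * \<bar>u x\<bar> powr (4 * s / N)"
  using False by (simp add: powr_add powr_numeral)
 also have "... = (8 * s * (4 * nsq u / V) powr (2 * s / N)) * ((rho0 powr (-2 * s) / (2 * s)) * ((u x)^2 / 4))"
  unfolding r0 using A s by (simp add: powr_minus field_simps)
 finally have e: "\<bar>u x\<bar> powr (2 + 4 * s / N) = 8 * s * (4 * nsq u / V) powr (2 * s / N) * (rho0 powr (- 2 * s) / (2 * s) * ((u x)^2 / 4))" .
 then have "ennreal (\<bar>u x\<bar> powr (2 + 4 * s / N)) =
  ennreal (8 * s * (4 * nsq u / V) powr (2 * s / N)) * (ennreal (rho0 powr (-2 * s) / (2 * s)) * ennreal ((u x)^2 / 4))"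
  unfolding e using s by (subst ennreal_mult, simp, simp, subst ennreal_mult) simp_all
 also have "ennreal (rho0 powr (-2 * s) / (2 * s)) * ennreal ((u x)^2 / 4) =
  (\<integral>\<^sup>+rho. ennreal (rho powr (-2 * s - 1)) * indicator {rho0..} rho * ennreal ((u x)^2 / 4) \<partial>lborel)"
  by (subst nn_integral_multc) (use nn_integral_powr_tail[OF s rho0] in auto)
 also have "... <= (\<integral>\<^sup>+rho. ennreal (rho powr (-2 * s - 1)) * ennreal ((u x - avg rho u x)^2) * indicator {0<..} rho \<partial>lborel)"
 proof (rule nn_integral_mono)
  fix rho :: real
  show "ennreal (rho powr (-2 * s - 1)) * indicator {rho0..} rho * ennreal ((u x)^2 / 4)
   <= ennreal (rho powr (-2 * s - 1)) * ennreal ((u x - avg rho u x)^2) * indicator {0<..} rho"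
   using key[of rho] rho0 by (auto simp: indicator_def intro!: mult_left_mono ennreal_leI)
 qed
 finally show ?thesis by (simp add: mult_left_mono)
qed simp

text \<open>The pointwise inequality is integrated in \<open>x\<close>, and Tonelli puts the radius
  outside. For each radius \<open>avg_diff_sq_le\<close> passes to the frequency side, where
  \<open>kern_scale\<close> restores |xi|^(2s). The mass factor is the constant of the pointwise
  inequality, inherited from \<open>rho0\<close>.\<close>

theorem Gagliardo_Nirenberg:
 fixes s :: real
 assumes s: "0 < s" "s < 1"
 defines "r \<equiv> 2 + 4 * s / real DIM('a::euclidean_space)"
 shows "\<exists>C\<ge>0. \<forall>u::'a => real. L2 u --> L2 (WT s u) --> integrable lborel (%x. \<bar>u x\<bar> powr r) &
  (LINT x|lborel. \<bar>u x\<bar> powr r) <= C * aform s u u * (bform u u) powr (2 * s / real DIM('a))"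
proof -
 let ?N = "real DIM('a)" and ?V = "unit_ball_vol (real DIM('a))"
 define K where "K = enn2real (kern s)"
 have "kern s < Orderings.top" using kern_finite[OF s] by (simp only: infinity_ennreal_def)
 then have K: "kern s = ennreal K" "K >= 0" unfolding K_def by (simp_all only: ennreal_enn2real enn2real_nonneg)
 have V: "?V > 0" by simp
 define C where "C = 8 * s * (4 / ?V) powr (2 * s / ?N) * K"
 have C0: "C >= 0" using s K by (simp add: C_def)
 have main: "integrable lborel (%x. \<bar>u x\<bar> powr r) & (LINT x|lborel. \<bar>u x\<bar> powr r) <= C * aform s u u * (bform u u) powr (2 * s / ?N)"
  if u: "L2 u" "L2 (WT s u)" for u :: "'a => real"
 proof -
  have [measurable]: "u \<in> borel_measurable borel" "FT u \<in> borel_measurable borel" using u L2_FT[OF u(1)] by (auto simp: L2_def)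
  have i: "integrable lborel (%xi. norm xi powr (2 * s) * (cmod (FT u xi))^2)" using L2_WT_iff[OF u(1)] u(2) by blast
  have a: "aform s u u = (LINT xi|lborel. norm xi powr (2 * s) * (cmod (FT u xi))^2)"
   unfolding aform_self nsq_def by (simp add: WT_def norm_mult power_mult_distrib powr_sq)
  show ?thesis
  proof (cases "nsq u = 0")
   case True
   then have ae: "AE x in lborel. \<bar>u x\<bar> powr r = 0" using nsq_eq_0[OF u(1)] by auto
   have "integrable lborel (%x. \<bar>u x\<bar> powr r)"
    by (rule integrable_cong_AE_imp[of _ "%_. 0"]) (use ae in auto)
   moreover have "(LINT x|lborel. \<bar>u x\<bar> powr r) = 0" using ae by (rule integral_eq_zero_AE)
   ultimately show ?thesis using C0 aform_nonneg[of s u] by (auto intro!: mult_nonneg_nonneg)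
  next
   case False
   then have pos: "nsq u > 0" using nsq_nonneg[of u] by linarith
   let ?A = "8 * s * (4 * nsq u / ?V) powr (2 * s / ?N)"
   have A0: "?A >= 0" using s by simp
   let ?D = "%x rho. ennreal (rho powr (-2 * s - 1)) * ennreal ((u x - avg rho u x)^2) * indicator {0<..} rho"
   have [measurable]: "(%(x, rho). avg rho u x) \<in> borel_measurable (borel \<Otimes>\<^sub>M borel)"
   proof -
    have um: "u \<in> borel_measurable borel" by measurable
    have "(%z::'a \<times> real. avg (fst (snd z, fst z)) u (snd (snd z, fst z))) \<in> borel_measurable (borel \<Otimes>\<^sub>M borel)"
     by (rule measurable_compose[OF measurable_Pair[OF measurable_snd measurable_fst] avg_measurable[OF um]])
    then show ?thesis by (simp add: case_prod_beta')
   qed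
   have Dm: "case_prod ?D \<in> borel_measurable (lborel \<Otimes>\<^sub>M lborel)" by measurable
   have "(\<integral>\<^sup>+x. ennreal (\<bar>u x\<bar> powr r) \<partial>lborel) <= (\<integral>\<^sup>+x. ennreal ?A * (\<integral>\<^sup>+rho. ?D x rho \<partial>lborel) \<partial>lborel)"
    unfolding r_def by (rule nn_integral_mono) (rule pointwise_power_le[OF s(1) u(1) pos])
   also have "... = ennreal ?A * (\<integral>\<^sup>+x. (\<integral>\<^sup>+rho. ?D x rho \<partial>lborel) \<partial>lborel)"
    by (rule nn_integral_cmult) (rule lborel.borel_measurable_nn_integral, rule Dm)
   also have "(\<integral>\<^sup>+x. (\<integral>\<^sup>+rho. ?D x rho \<partial>lborel) \<partial>lborel) = (\<integral>\<^sup>+rho. (\<integral>\<^sup>+x. ?D x rho \<partial>lborel) \<partial>lborel)"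
    by (rule lborel_pair.Fubini'[symmetric]) (use measurable_compose[OF measurable_pair_swap' Dm] in "simp add: case_prod_beta'")
   also have "... <= (\<integral>\<^sup>+rho. (\<integral>\<^sup>+xi. ennreal (rho powr (-2 * s - 1) * (min 2 (rho * norm xi))^2) * indicator {0<..} rho * ennreal ((cmod (FT u xi))^2) \<partial>lborel) \<partial>lborel)"
   proof (rule nn_integral_mono)
    fix rho :: real
    show "(\<integral>\<^sup>+x. ?D x rho \<partial>lborel) <= (\<integral>\<^sup>+xi. ennreal (rho powr (-2 * s - 1) * (min 2 (rho * norm xi))^2) * indicator {0<..} rho * ennreal ((cmod (FT u xi))^2) \<partial>lborel)"
    proof (cases "rho > 0")
     case True
     have "(\<integral>\<^sup>+x. ?D x rho \<partial>lborel) = ennreal (rho powr (-2 * s - 1)) * (\<integral>\<^sup>+x. ennreal ((u x - avg rho u x)^2) \<partial>lborel)"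
      using True by (simp add: nn_integral_cmult)
     also have "... <= ennreal (rho powr (-2 * s - 1)) * ennreal (Jf rho u)"
      by (intro mult_left_mono avg_diff_sq_le True u) simp
     also have "ennreal (Jf rho u) = (\<integral>\<^sup>+xi. ennreal ((min 2 (rho * norm xi))^2 * (cmod (FT u xi))^2) \<partial>lborel)"
      unfolding Jf_def using True by (intro nn_integral_eq_integral[symmetric] Jf_integrable u) auto
     also have "ennreal (rho powr (-2 * s - 1)) * ... = (\<integral>\<^sup>+xi. ennreal (rho powr (-2 * s - 1) * (min 2 (rho * norm xi))^2) * indicator {0<..} rho * ennreal ((cmod (FT u xi))^2) \<partial>lborel)"
      using True by (subst nn_integral_cmult[symmetric]) (auto simp: ennreal_mult mult_ac)
     finally show ?thesis .
    qed simp
   qed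
   also have "... = (\<integral>\<^sup>+xi. (\<integral>\<^sup>+rho. ennreal (rho powr (-2 * s - 1) * (min 2 (rho * norm xi))^2) * indicator {0<..} rho * ennreal ((cmod (FT u xi))^2) \<partial>lborel) \<partial>lborel)"
    by (rule lborel_pair.Fubini') measurable
   also have "... = (\<integral>\<^sup>+xi. kern s * ennreal (norm xi powr (2 * s) * (cmod (FT u xi))^2) \<partial>lborel)"
   proof (rule nn_integral_cong)
    fix xi :: 'a
    show "(\<integral>\<^sup>+rho. ennreal (rho powr (-2 * s - 1) * (min 2 (rho * norm xi))^2) * indicator {0<..} rho * ennreal ((cmod (FT u xi))^2) \<partial>lborel)
     = kern s * ennreal (norm xi powr (2 * s) * (cmod (FT u xi))^2)"
    proof (cases "xi = 0")
     case False
     have "(\<integral>\<^sup>+rho. ennreal (rho powr (-2 * s - 1) * (min 2 (rho * norm xi))^2) * indicator {0<..} rho * ennreal ((cmod (FT u xi))^2) \<partial>lborel)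
      = (\<integral>\<^sup>+rho. ennreal (rho powr (-2 * s - 1) * (min 2 (rho * norm xi))^2) * indicator {0<..} rho \<partial>lborel) * ennreal ((cmod (FT u xi))^2)"
      by (rule nn_integral_multc) measurable
     also have "... = ennreal (norm xi powr (2 * s)) * kern s * ennreal ((cmod (FT u xi))^2)"
      using False by (subst kern_scale) auto
     finally show ?thesis by (simp add: ennreal_mult mult_ac)
    qed simp
   qed
   also have "... = kern s * (\<integral>\<^sup>+xi. ennreal (norm xi powr (2 * s) * (cmod (FT u xi))^2) \<partial>lborel)"
    by (rule nn_integral_cmult) measurable
   also have "(\<integral>\<^sup>+xi. ennreal (norm xi powr (2 * s) * (cmod (FT u xi))^2) \<partial>lborel) = ennreal (aform s u u)"
    unfolding a by (rule nn_integral_eq_integral[OF i]) auto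
   also have "ennreal ?A * (kern s * ennreal (aform s u u)) = ennreal (?A * (K * aform s u u))"
    unfolding K(1) using A0 K(2) aform_nonneg[of s u] by (simp add: ennreal_mult mult_nonneg_nonneg)
   also have "?A * (K * aform s u u) = C * aform s u u * (bform u u) powr (2 * s / ?N)"
    using pos V by (simp add: C_def bform_self powr_mult powr_divide)
   finally have fin: "(\<integral>\<^sup>+x. ennreal (\<bar>u x\<bar> powr r) \<partial>lborel) <= ennreal (C * aform s u u * (bform u u) powr (2 * s / ?N))"
    by (simp add: mult_left_mono)
   have I: "integrable lborel (%x. \<bar>u x\<bar> powr r)"
    by (rule integrableI_nonneg) (use fin in "auto intro: le_less_trans")
   then have "ennreal (LINT x|lborel. \<bar>u x\<bar> powr r) <= ennreal (C * aform s u u * (bform u u) powr (2 * s / ?N))"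
    using fin by (subst nn_integral_eq_integral[symmetric]) auto
   then show ?thesis using I C0 aform_nonneg[of s u] by simp
  qed
 qed
 show ?thesis using C0 main by blast
qed

subsection \<open>Radial functions\<close>

text \<open>Householder reflection. For \<open>d = 0\<close> it is the identity, which suits
  \<open>refl_swap\<close> when x = y.\<close>

definition refl :: "'a::euclidean_space => 'a => 'a" where
 "refl d x = x - (2 * (x \<bullet> d) / (d \<bullet> d)) *\<^sub>R d"

lemma refl_add: "refl d (x + y) = refl d x + refl d y"
 by (simp add: refl_def inner_add_left add_divide_distrib distrib_left scaleR_add_left)

lemma refl_refl [simp]: "refl d (refl d x) = x"
proof (cases "d = 0")
 case False
 then show ?thesis by (simp add: refl_def inner_diff_left algebra_simps)
qed (simp add: refl_def)

lemma norm_refl [simp]: "norm (refl d x) = norm x"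
proof (cases "d = 0")
 case False
 have "refl d x \<bullet> refl d x = x \<bullet> x"
 proof -
  let ?c = "2 * (x \<bullet> d) / (d \<bullet> d)"
  have "refl d x \<bullet> refl d x = x \<bullet> x - 2 * ?c * (x \<bullet> d) + ?c * (?c * (d \<bullet> d))"
   by (simp add: refl_def inner_diff_left inner_diff_right inner_commute[of d x] algebra_simps)
  also have "?c * (d \<bullet> d) = 2 * (x \<bullet> d)" using False by simp
  finally show ?thesis by (simp add: algebra_simps)
 qed
 then show ?thesis by (simp add: norm_eq_sqrt_inner)
qed (simp add: refl_def)

lemma refl_measurable [measurable]: "refl d \<in> borel_measurable borel"
 unfolding refl_def[abs_def] by measurable

lemma refl_diff: "refl d (x - y) = refl d x - refl d y"
 using refl_add[of d "x - y" y] by simp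

lemma refl_swap:
 assumes "norm x = norm y" shows "refl (x - y) x = y"
proof (cases "x = y")
 case False
 have e: "x \<bullet> x = y \<bullet> y" using assms by (simp add: norm_eq)
 have "(x - y) \<bullet> (x - y) = 2 * (x \<bullet> (x - y))"
  using e by (simp add: inner_diff_left inner_diff_right inner_commute[of y x])
 moreover have "(x - y) \<bullet> (x - y) ~= 0" using False by simp
 ultimately show ?thesis by (simp add: refl_def)
qed (simp add: refl_def)

lemma nn_integral_shift:
 fixes t :: "'a::euclidean_space"
 assumes "h \<in> borel_measurable borel"
 shows "(\<integral>\<^sup>+x. h (t + x) \<partial>lborel) = (\<integral>\<^sup>+x. h x \<partial>lborel)"
 using nn_integral_affine[OF _ assms, of 1 t] by simp

text \<open>Reflections preserve Lebesgue measure: evaluate \<open>\<integral>\<integral> 1\<^sub>A(Rx) 1\<^sub>B(Rx - y) dy dx\<close> with the unit ball \<open>B\<close>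
  in both orders, using only translation invariance and \<open>R\<^sup>-\<^sup>1 B = B\<close>.\<close>

lemma emeasure_refl:
 fixes d :: "'a::euclidean_space"
 assumes [measurable]: "A \<in> sets borel"
 shows "emeasure lborel (refl d -` A) = emeasure lborel A"
proof -
 define B where "B = ball (0::'a) 1"
 have iB: "indicator B z = (if norm z < 1 then 1 else (0::ennreal))" for z by (auto simp: B_def indicator_def)
 have Bm: "B \<in> sets borel" by (simp add: B_def)
 have b: "emeasure lborel B = ennreal (measure lborel B)" "measure lborel B > 0"
  using emeasure_bounded_finite[of "ball (0::'a) 1"] unfolding B_def by (intro emeasure_eq_ennreal_measure) auto
 have rA: "refl d -` A \<in> sets borel" using measurable_sets[OF refl_measurable assms] by simp
 have rB: "refl d -` B = B" by (auto simp: B_def)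
 have shiftB: "(\<integral>\<^sup>+y. indicator B (c - y) \<partial>lborel) = emeasure lborel B" for c :: 'a
 proof -
  have "(\<integral>\<^sup>+y. indicator B (c + (-1) *\<^sub>R y) \<partial>lborel) = (\<integral>\<^sup>+y. indicator B y \<partial>lborel)"
   by (subst nn_integral_affine) (use Bm in auto)
  then show ?thesis using Bm by simp
 qed
 have m1: "(%(x, y). indicator A (refl d x) * (indicator B (refl d x - y) :: ennreal)) \<in> borel_measurable (lborel \<Otimes>\<^sub>M lborel)"
  unfolding iB by (rule measurable_pair_lborel) measurable
 have m2: "(%(x, y). indicator A (refl d x + y) * (indicator B (refl d x) :: ennreal)) \<in> borel_measurable (lborel \<Otimes>\<^sub>M lborel)"
  unfolding iB by (rule measurable_pair_lborel) measurable
 have "(\<integral>\<^sup>+x. (\<integral>\<^sup>+y. indicator A (refl d x) * indicator B (refl d x - y) \<partial>lborel) \<partial>lborel) =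
  (\<integral>\<^sup>+x. indicator (refl d -` A) x * emeasure lborel B \<partial>lborel)"
 proof (rule nn_integral_cong)
  fix x
  have "(\<integral>\<^sup>+y. indicator A (refl d x) * indicator B (refl d x - y) \<partial>lborel) = indicator A (refl d x) * (\<integral>\<^sup>+y. indicator B (refl d x - y) \<partial>lborel)"
   by (rule nn_integral_cmult) (use Bm in measurable)
  then show "(\<integral>\<^sup>+y. indicator A (refl d x) * indicator B (refl d x - y) \<partial>lborel) = indicator (refl d -` A) x * emeasure lborel B"
   unfolding shiftB by (simp add: indicator_def)
 qed
 also have "... = emeasure lborel (refl d -` A) * emeasure lborel B"
  using rA by (simp add: nn_integral_multc)
 finally have 1: "(\<integral>\<^sup>+x. (\<integral>\<^sup>+y. indicator A (refl d x) * indicator B (refl d x - y) \<partial>lborel) \<partial>lborel) = emeasure lborel (refl d -` A) * emeasure lborel B" .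
 have "(\<integral>\<^sup>+x. (\<integral>\<^sup>+y. indicator A (refl d x) * indicator B (refl d x - y) \<partial>lborel) \<partial>lborel) =
  (\<integral>\<^sup>+y. (\<integral>\<^sup>+x. indicator A (refl d x) * indicator B (refl d x - y) \<partial>lborel) \<partial>lborel)"
  using lborel_pair.Fubini'[OF m1] by simp
 also have "... = (\<integral>\<^sup>+y. (\<integral>\<^sup>+x. indicator A (refl d x + y) * indicator B (refl d x) \<partial>lborel) \<partial>lborel)"
 proof (rule nn_integral_cong)
  fix y
  have "(\<integral>\<^sup>+x. indicator A (refl d (refl d y + x)) * indicator B (refl d (refl d y + x) - y) \<partial>lborel) =
   (\<integral>\<^sup>+x. indicator A (refl d x) * indicator B (refl d x - y) \<partial>lborel)"
   by (rule nn_integral_shift[where h = "%x. indicator A (refl d x) * indicator B (refl d x - y)"]) (use Bm in measurable)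
  then show "(\<integral>\<^sup>+x. indicator A (refl d x) * indicator B (refl d x - y) \<partial>lborel) =
   (\<integral>\<^sup>+x. indicator A (refl d x + y) * indicator B (refl d x) \<partial>lborel)"
   by (simp add: refl_add add.commute)
 qed
 also have "... = (\<integral>\<^sup>+x. (\<integral>\<^sup>+y. indicator A (refl d x + y) * indicator B (refl d x) \<partial>lborel) \<partial>lborel)"
  using lborel_pair.Fubini'[OF m2] by simp
 also have "... = (\<integral>\<^sup>+x. emeasure lborel A * indicator B x \<partial>lborel)"
 proof (rule nn_integral_cong)
  fix x
  have "(\<integral>\<^sup>+y. indicator A (refl d x + y) * indicator B (refl d x) \<partial>lborel) = (\<integral>\<^sup>+y. indicator A (refl d x + y) \<partial>lborel) * indicator B (refl d x)"
   by (rule nn_integral_multc) measurable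
  also have "(\<integral>\<^sup>+y. indicator A (refl d x + y) \<partial>lborel) = emeasure lborel A"
   by (subst nn_integral_shift) auto
  finally show "(\<integral>\<^sup>+y. indicator A (refl d x + y) * indicator B (refl d x) \<partial>lborel) = emeasure lborel A * indicator B x"
   by (simp add: iB)
 qed
 also have "... = emeasure lborel A * emeasure lborel B" using Bm by (simp add: nn_integral_cmult)
 finally have "emeasure lborel (refl d -` A) * emeasure lborel B = emeasure lborel A * emeasure lborel B" using 1 by simp
 moreover have "emeasure lborel B ~= 0" "emeasure lborel B ~= \<infinity>" using b by auto
 ultimately show ?thesis by (simp add: mult.commute[of _ "emeasure lborel B"] ennreal_mult_cancel_left)
qed

lemma distr_refl: "distr lborel borel (refl d) = (lborel :: 'a::euclidean_space measure)"
 by (rule measure_eqI) (auto simp: emeasure_distr emeasure_refl)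

lemma integral_refl:
 fixes f :: "'a::euclidean_space => real"
 assumes "f \<in> borel_measurable borel"
 shows "(LINT x|lborel. f (refl d x)) = (LINT x|lborel. f x)"
 using integral_distr[of "refl d" lborel borel f] assms by (simp add: distr_refl)

lemma ball_pred_measurable [measurable (raw)]:
 fixes f :: "'b => 'a::euclidean_space"
 assumes [measurable]: "f \<in> borel_measurable M" shows "Measurable.pred M (%x. f x \<in> ball a r)"
 unfolding mem_ball by measurable

lemma ball_integral_radial:
 fixes u :: "'a::euclidean_space => real"
 assumes r: "radial u" and [measurable]: "u \<in> borel_measurable borel" and n: "norm x = norm y"
 shows "(LINT z|lborel. indicator (ball x rho) z * (u z)^2) = (LINT z|lborel. indicator (ball y rho) z * (u z)^2)"
proof -
 let ?R = "refl (x - y)"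
 have i: "indicator (ball x rho) (?R z) = (indicator (ball y rho) z :: real)" for z
 proof -
  have "?R y = x" using refl_swap[OF n] refl_refl[of "x - y" x] by simp
  then have "x - ?R z = ?R (y - z)" by (simp only: refl_diff)
  then have "dist x (?R z) = dist y z" unfolding dist_norm by simp
  then show ?thesis by (simp add: indicator_def)
 qed
 have u: "u (?R z) = u z" for z using r unfolding radial_def by (metis norm_refl)
 have "(LINT z|lborel. indicator (ball x rho) (?R z) * (u (?R z))^2) = (LINT z|lborel. indicator (ball x rho) z * (u z)^2)"
  by (rule integral_refl) measurable
 then show ?thesis unfolding i u by simp
qed

text \<open>Points on an arc of the sphere in a coordinate plane, with first coordinates |x| i / k,
  so that any two of them differ there by at least |x| / k >= 2 rho. Dimension two or more provides
  the arc.\<close>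

lemma exists_separated_points:
 fixes x :: "'a::euclidean_space"
 assumes N: "DIM('a) >= 2" and k: "k > 0" and rho: "rho > 0" and far: "2 * rho * real k <= norm x"
 shows "\<exists>p :: nat => 'a. (\<forall>i<k. norm (p i) = norm x) & (\<forall>i<k. \<forall>j<k. i ~= j --> ball (p i) rho \<inter> ball (p j) rho = {})"
proof -
 obtain b1 b2 :: 'a where b: "b1 \<in> Basis" "b2 \<in> Basis" "b1 ~= b2"
  using N by (metis card_2_iff' card_le_Suc0_iff_eq finite_Basis not_less_eq_eq numeral_2_eq_2)
 define c where "c i = real i / real k" for i
 have c: "0 <= c i" "c i <= 1" if "i < k" for i using that by (auto simp: c_def)
 define p where "p i = (norm x * c i) *\<^sub>R b1 + (norm x * sqrt (1 - (c i)^2)) *\<^sub>R b2" for i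
 have bb: "b1 \<bullet> b1 = 1" "b2 \<bullet> b2 = 1" "b1 \<bullet> b2 = 0" "b2 \<bullet> b1 = 0" using b by (auto simp: inner_Basis)
 have np: "norm (p i) = norm x" if "i < k" for i
 proof -
  have le: "(c i)^2 <= 1" using c[OF that] by (simp add: power_le_one)
  have "p i \<bullet> p i = (norm x)^2 * ((c i)^2 + (sqrt (1 - (c i)^2))^2)"
   unfolding p_def by (simp add: inner_add_left inner_add_right bb power2_eq_square algebra_simps)
  also have "... = (norm x)^2" using le by simp
  finally show ?thesis by (metis norm_eq_sqrt_inner norm_ge_zero real_sqrt_unique)
 qed
 have sep: "ball (p i) rho \<inter> ball (p j) rho = {}" if "i < k" "j < k" "i ~= j" for i j
 proof (rule ccontr)
  assume "ball (p i) rho \<inter> ball (p j) rho ~= {}"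
  then obtain z where z: "dist (p i) z < rho" "dist (p j) z < rho" by auto
  have "\<bar>(p i - p j) \<bullet> b1\<bar> <= norm (p i - p j)" by (rule Basis_le_norm[OF b(1)])
  also have "... < 2 * rho" using z dist_triangle2[of "p i" "p j" z] by (simp add: dist_norm)
  finally have "\<bar>norm x * c i - norm x * c j\<bar> < 2 * rho"
   unfolding p_def by (simp add: inner_diff_left inner_add_left bb)
  moreover have "\<bar>norm x * c i - norm x * c j\<bar> = norm x / real k * \<bar>real i - real j\<bar>"
   by (simp add: c_def abs_mult[symmetric] abs_divide diff_divide_distrib[symmetric] right_diff_distrib[symmetric] abs_mult)
  moreover have "norm x / real k * \<bar>real i - real j\<bar> >= 2 * rho * 1"
   using far k that(3) rho by (intro mult_mono) (auto simp: field_simps)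
  ultimately show False by simp
 qed
 show ?thesis using np sep by blast
qed

lemma radial_ball_decay:
 fixes u :: "'a::euclidean_space => real"
 assumes N: "DIM('a) >= 2" and r: "radial u" and u: "L2 u" and k: "k > 0" and rho: "rho > 0" and far: "2 * rho * real k <= norm x"
 shows "(avg rho u x)^2 <= nsq u / (real k * bvol TYPE('a) rho)"
proof -
 have um: "u \<in> borel_measurable borel" using u by (simp add: L2_def)
 obtain p :: "nat => 'a" where p: "!!i. i < k ==> norm (p i) = norm x"
  "!!i j. i < k ==> j < k ==> i ~= j ==> ball (p i) rho \<inter> ball (p j) rho = {}"
  using exists_separated_points[OF N k rho far] by blast
 let ?I = "%y. LINT z|lborel. indicator (ball y rho) z * (u z)^2"
 have ii: "integrable lborel (%z. indicator (ball y rho) z * (u z)^2)" for y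
  using integrable_sq_ball[OF u, of "ball y rho" 0] by simp
 have "real k * ?I x = (\<Sum>i<k. ?I (p i))"
  using ball_integral_radial[OF r um p(1)] by simp
 also have "... = (LINT z|lborel. (\<Sum>i<k. indicator (ball (p i) rho) z * (u z)^2))"
  by (rule Bochner_Integration.integral_sum[symmetric]) (rule ii)
 also have "... <= (LINT z|lborel. (u z)^2)"
 proof (rule integral_mono)
  show "integrable lborel (%z. (u z)^2)" using L2_integrable[OF u] by simp
  show "integrable lborel (%z. \<Sum>i<k. indicator (ball (p i) rho) z * (u z)^2)"
   by (rule Bochner_Integration.integrable_sum) (rule ii)
  fix z
  have "(\<Sum>i<k. indicator (ball (p i) rho) z) = (indicator (\<Union>i<k. ball (p i) rho) z :: real)"
   by (rule indicator_UN_disjoint[symmetric]) (use p(2) in "auto simp: disjoint_family_on_def")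
  then show "(\<Sum>i<k. indicator (ball (p i) rho) z * (u z)^2) <= (u z)^2"
   unfolding sum_distrib_right[symmetric] by (simp add: indicator_def)
 qed
 finally have 1: "real k * ?I x <= nsq u" by (simp add: nsq_def)
 have "(LINT y|lborel. indicator (ball 0 rho) y * (u (x + y))^2) = ?I x"
 proof -
  have "indicator (ball 0 rho) y = (indicator (ball x rho) (x + y) :: real)" for y by (auto simp: indicator_def dist_norm)
  then show ?thesis using integral_affine[of 1 "%z. indicator (ball x rho) z * (u z)^2" x] by simp
 qed
 with avg_sq_le[OF rho u, of x] have "(avg rho u x)^2 <= ?I x / bvol TYPE('a) rho" by simp
 also have "... <= (nsq u / real k) / bvol TYPE('a) rho"
  using 1 k by (intro divide_right_mono) (auto simp: field_simps)
 finally show ?thesis by simp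
qed

subsection \<open>Weakly null radial sequences converge to zero in measure\<close>

lemma measure_superlevel_le:
 fixes f :: "'a::euclidean_space => real"
 assumes f: "f \<in> borel_measurable lborel" and le: "(\<integral>\<^sup>+x. ennreal ((f x)^2) \<partial>lborel) <= ennreal J" and J: "J >= 0" and d: "dl > 0"
 shows "emeasure lborel {x. dl <= \<bar>f x\<bar>} <= ennreal (J / dl^2)"
proof -
 have [measurable]: "f \<in> borel_measurable borel" using f by simp
 have "ennreal (dl^2) * emeasure lborel {x. dl <= \<bar>f x\<bar>} = (\<integral>\<^sup>+x. ennreal (dl^2) * indicator {x. dl <= \<bar>f x\<bar>} x \<partial>lborel)"
  by (rule nn_integral_cmult_indicator[symmetric]) measurable
 also have "... <= (\<integral>\<^sup>+x. ennreal ((f x)^2) \<partial>lborel)"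
 proof (rule nn_integral_mono)
  fix x show "ennreal (dl^2) * indicator {x. dl <= \<bar>f x\<bar>} x <= ennreal ((f x)^2)"
   using d by (auto simp: indicator_def intro!: ennreal_leI) (metis abs_le_square_iff abs_of_pos)
 qed
 finally have "ennreal (dl^2) * emeasure lborel {x. dl <= \<bar>f x\<bar>} <= ennreal J" using le by simp
 then have "ennreal (1 / dl^2) * (ennreal (dl^2) * emeasure lborel {x. dl <= \<bar>f x\<bar>}) <= ennreal (1 / dl^2) * ennreal J"
  by (intro mult_left_mono) auto
 moreover have "ennreal (1 / dl^2) * ennreal (dl^2) = 1" using d by (simp add: ennreal_mult'[symmetric])
 moreover have "ennreal (1 / dl^2) * ennreal J = ennreal (J / dl^2)" by (simp add: ennreal_mult'[symmetric])
 ultimately show ?thesis by (simp add: mult.assoc[symmetric])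
qed

text \<open>Makes the average around a fixed point converge along weakly convergent
  sequences.\<close>

lemma bounded_lin_avg:
 assumes rho: "rho > 0"
 shows "Hsr.bounded_lin_on s (Collect (Hsr s)) (%u. avg rho u (x::'a::euclidean_space))"
 unfolding Hsr.bounded_lin_on_def
proof (intro conjI ballI allI exI[of _ "1 / sqrt (bvol TYPE('a) rho)"])
 let ?i = "%y::'a. indicator (ball 0 rho) y :: real"
 fix u v :: "'a => real" and c d assume "u \<in> Collect (Hsr s)" "v \<in> Collect (Hsr s)"
 then have L: "L2 u" "L2 v" by (auto simp: HsrD)
 have i: "integrable lborel (%y. ?i y * u (x + y))" "integrable lborel (%y. ?i y * v (x + y))"
  by (rule L2_mult_integrable[OF L2_indicator_ball L2_shift], fact)+
 have "(LINT y|lborel. ?i y * (c * u (x + y) + d * v (x + y))) = (LINT y|lborel. c * (?i y * u (x + y)) + d * (?i y * v (x + y)))"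
  by (simp add: algebra_simps)
 also have "... = c * (LINT y|lborel. ?i y * u (x + y)) + d * (LINT y|lborel. ?i y * v (x + y))"
  using i by simp
 finally show "avg rho (%x. c * u x + d * v x) x = c * avg rho u x + d * avg rho v x"
  by (simp add: avg_def add_divide_distrib)
next
 fix u :: "'a => real" assume "u \<in> Collect (Hsr s)"
 then have L: "L2 u" by (auto simp: HsrD)
 have "\<bar>avg rho u x\<bar> <= sqrt (nsq u / bvol TYPE('a) rho)"
  using real_sqrt_le_mono[OF avg_sq_le_nsq[OF rho L, of x]] by simp
 also have "... <= sqrt (eform s u u / bvol TYPE('a) rho)"
  using aform_nonneg[of s u] by (intro real_sqrt_le_mono divide_right_mono) (auto simp: eform_def bform_self)
 finally show "\<bar>avg rho u x\<bar> <= 1 / sqrt (bvol TYPE('a) rho) * sqrt (eform s u u)"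
  by (simp add: real_sqrt_divide)
qed

text \<open>Where |w n| >= dl, either the average or the averaging error is at least dl / 2. The
  error set is small uniformly in \<open>n\<close> if the radius is small. The averages reach dl / 2
  only inside a fixed ball, by radial decay, and tend to 0 pointwise by weak convergence, so
  dominated convergence applies.\<close>

theorem weakly_null_in_measure:
 fixes w :: "nat => 'a::euclidean_space => real"
 assumes N: "DIM('a) >= 2" and s: "0 < s" "s < 1"
  and w: "!!n. Hsr s (w n)" and R: "!!n. eform s (w n) (w n) <= R"
  and weak: "!!\<l>. Hsr.bounded_lin_on s (Collect (Hsr s)) \<l> ==> (%n. \<l> (w n)) ~~> 0"
  and dl: "dl > 0"
 shows "(%n. measure lborel {x. dl <= \<bar>w n x\<bar>}) ~~> 0"
proof (rule LIMSEQ_I)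
 fix e :: real assume e: "e > 0"
 note wL = HsrD(1)[OF w] and wW = HsrD(2)[OF w] and wr = HsrD(3)[OF w]
 have wm[measurable]: "w n \<in> borel_measurable borel" for n using wL[of n] by (simp add: L2_def)
 have aR: "aform s (w n) (w n) <= R" "nsq (w n) <= R" for n
 proof -
  have "aform s (w n) (w n) + nsq (w n) <= R" using R[of n] by (simp only: eform_def bform_self)
  then show "aform s (w n) (w n) <= R" "nsq (w n) <= R"
   using aform_nonneg[of s "w n"] nsq_nonneg[of "w n"] by linarith+
 qed
 have R0: "R >= 0" using aR(2)[of 0] nsq_nonneg[of "w 0"] by linarith
 have "((%rho. 4 * rho powr (2 * s) * R / (dl / 2)^2) \<longlongrightarrow> 4 * 0 powr (2 * s) * R / (dl / 2)^2) (at_right 0)"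
  using s dl by (intro tendsto_intros tendsto_powr' ) (auto simp: eventually_at_right_less eventually_at_right intro!: exI[of _ 1])
 then have "\<forall>\<^sub>F rho in at_right 0. 4 * rho powr (2 * s) * R / (dl / 2)^2 < e / 2"
  using e s by (intro order_tendstoD(2)) auto
 then have "\<forall>\<^sub>F rho in at_right (0::real). rho > 0 & 4 * rho powr (2 * s) * R / (dl / 2)^2 < e / 2"
  using eventually_at_right_less[of "0::real"] by eventually_elim (intro conjI)
 \<comment> \<open>\<open>rho\<close> brings the measure of the error set below e / 2; the number
   \<open>k\<close> chosen next fixes the ball outside which averages stay under dl / 2.\<close>
 then obtain rho where rho: "rho > 0" "4 * rho powr (2 * s) * R / (dl / 2)^2 < e / 2"
  using eventually_happens'[OF trivial_limit_at_right_real] by blast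
 let ?v = "bvol TYPE('a) rho"
 have v: "?v > 0" using rho by simp
 obtain k :: nat where k: "k > 0" "R / (real k * ?v) < (dl / 2)^2"
 proof -
  obtain k :: nat where "R / ((dl / 2)^2 * ?v) < real k" using reals_Archimedean2 by blast
  moreover have "R / ((dl / 2)^2 * ?v) >= 0" using R0 v by simp
  ultimately have k: "R / ((dl / 2)^2 * ?v) < real k" "k > 0" by auto
  have "(dl / 2)^2 * ?v > 0" using v dl by (intro mult_pos_pos) auto
  then have "R < real k * ((dl / 2)^2 * ?v)" using k(1) by (simp only: pos_divide_less_eq)
  moreover have "real k * ?v > 0" using v k(2) by (intro mult_pos_pos) auto
  ultimately have "R / (real k * ?v) < (dl / 2)^2" by (simp only: pos_divide_less_eq mult_ac)
  note k(2) this
  then show thesis by (intro that)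
 qed
 define A where "A n = {x. dl / 2 <= \<bar>avg rho (w n) x\<bar>}" for n
 define r where "r = 2 * rho * real k"
 have Am[measurable]: "A n \<in> sets borel" for n unfolding A_def by measurable
 have Ab: "A n \<subseteq> ball 0 r" for n
 proof
  fix x assume x: "x \<in> A n"
  show "x \<in> ball 0 r"
  proof (rule ccontr)
   assume "x \<notin> ball 0 r"
   then have "(avg rho (w n) x)^2 <= nsq (w n) / (real k * ?v)"
    by (intro radial_ball_decay[OF N wr wL k(1) rho(1)]) (simp add: r_def)
   also have "... <= R / (real k * ?v)" using aR(2)[of n] v k by (intro divide_right_mono) auto
   also have "... < (dl / 2)^2" by (rule k)
   finally have "\<bar>avg rho (w n) x\<bar>\<^sup>2 < (dl / 2)^2" by simp
   then have "\<bar>avg rho (w n) x\<bar> < dl / 2" by (rule power2_less_imp_less) (use dl in simp)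
   with x show False by (simp add: A_def)
  qed
 qed
 have "(%n. LINT x|lborel. indicator (A n) x) ~~> (LINT x::'a|lborel. (0::real))"
 proof (rule integral_dominated_convergence[where w = "indicator (ball 0 r)"])
  show "integrable lborel (indicator (ball 0 r) :: 'a => real)"
   using emeasure_bounded_finite[of "ball (0::'a) r"] by (simp add: integrable_indicator_iff)
  show "AE x in lborel. (%n. indicator (A n) x) ~~> (0::real)"
  proof (rule AE_I2)
   fix x
   have "(%n. avg rho (w n) x) ~~> 0" by (rule weak[OF bounded_lin_avg[OF rho(1)]])
   then have "\<forall>\<^sub>F n in sequentially. \<bar>avg rho (w n) x\<bar> < dl / 2"
    using dl tendsto_rabs_zero order_tendstoD(2) half_gt_zero by blast
   then have "\<forall>\<^sub>F n in sequentially. indicator (A n) x = (0::real)"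
    by eventually_elim (simp add: A_def indicator_def)
   then show "(%n. indicator (A n) x) ~~> (0::real)" by (simp add: tendsto_eventually)
  qed
  show "AE x in lborel. norm (indicator (A n) x :: real) <= indicator (ball 0 r) x" for n
  proof (rule AE_I2)
   fix x show "norm (indicator (A n) x :: real) <= indicator (ball 0 r) x"
    using subsetD[OF Ab[of n], of x] by (cases "x \<in> A n") auto
  qed
 qed auto
 then have "(%n. measure lborel (A n)) ~~> 0" by simp
 then obtain n0 where n0: "!!n. n >= n0 ==> measure lborel (A n) < e / 2"
  using e by (fastforce dest: order_tendstoD(2)[where a = "e/2"] simp: eventually_sequentially)
 have "measure lborel {x. dl <= \<bar>w n x\<bar>} < e" if n: "n >= n0" for n
 proof -
  define B where "B = {x. dl / 2 <= \<bar>w n x - avg rho (w n) x\<bar>}"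
  have [measurable]: "B \<in> sets borel" unfolding B_def by measurable
  have "Jf rho (w n) <= 4 * rho powr (2 * s) * aform s (w n) (w n)"
   by (rule Jf_le_aform[OF rho(1) s wL wW])
  also have "... <= 4 * rho powr (2 * s) * R" using aR(1)[of n] by (intro mult_left_mono) auto
  finally have J: "Jf rho (w n) <= 4 * rho powr (2 * s) * R" .
  have "emeasure lborel B <= ennreal (4 * rho powr (2 * s) * R / (dl / 2)^2)"
   unfolding B_def
  proof (rule measure_superlevel_le)
   show "(\<integral>\<^sup>+x. ennreal ((w n x - avg rho (w n) x)^2) \<partial>lborel) <= ennreal (4 * rho powr (2 * s) * R)"
    using avg_diff_sq_le[OF rho(1) wL, of n] J by (meson ennreal_leI order_trans)
  qed (use dl R0 in auto)
  then have B: "measure lborel B <= 4 * rho powr (2 * s) * R / (dl / 2)^2" "emeasure lborel B < \<infinity>"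
   using R0 by (auto simp: measure_def intro!: enn2real_leI intro: le_less_trans)
  have fA: "emeasure lborel (A n) < \<infinity>"
   using emeasure_mono[OF Ab[of n], of lborel] emeasure_bounded_finite[of "ball (0::'a) r"] by (auto intro: le_less_trans)
  have "{x. dl <= \<bar>w n x\<bar>} \<subseteq> A n \<union> B"
  proof
   fix x assume "x \<in> {x. dl <= \<bar>w n x\<bar>}"
   then have "dl <= \<bar>w n x\<bar>" by simp
   moreover have "\<bar>w n x\<bar> <= \<bar>avg rho (w n) x\<bar> + \<bar>w n x - avg rho (w n) x\<bar>" by linarith
   ultimately have "dl / 2 <= \<bar>avg rho (w n) x\<bar> \<or> dl / 2 <= \<bar>w n x - avg rho (w n) x\<bar>" by linarith
   then show "x \<in> A n \<union> B" by (auto simp: A_def B_def)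
  qed
  then have "measure lborel {x. dl <= \<bar>w n x\<bar>} <= measure lborel (A n \<union> B)"
  proof (rule measure_mono_fmeasurable)
   have "A n \<in> fmeasurable lborel" "B \<in> fmeasurable lborel" using fA B(2) by (auto simp: fmeasurable_def)
   then show "A n \<union> B \<in> fmeasurable lborel" by (rule fmeasurable.Un)
  qed measurable
  also have "... <= measure lborel (A n) + measure lborel B"
   by (rule measure_Un_le) auto
  also have "... < e" using n0[OF n] B(1) rho(2) by simp
  finally show ?thesis .
 qed
 then show "\<exists>no. \<forall>n\<ge>no. norm (measure lborel {x. dl <= \<bar>w n x\<bar>} - 0) < e" by auto
qed

subsection \<open>Continuity of integral functionals under convergence in measure\<close>

definition conv_meas :: "(nat => 'a::euclidean_space => 'b::{banach,second_countable_topology}) => ('a => 'b) => bool" where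
 "conv_meas f u \<longleftrightarrow> (\<forall>dl>0. (%n. measure lborel {x. dl <= norm (f n x - u x)}) ~~> 0)"

text \<open>The third clause encodes o(|y|^r) at infinity when r > 2. The domain is a general
  Euclidean space so that g(u) phi, as a function of the pair (u, phi), is covered along with
  G(u).\<close>

definition subcritical :: "real => ('c::euclidean_space => real) => bool" where
 "subcritical r Q \<longleftrightarrow> continuous_on UNIV Q &
  (\<forall>e>0. \<exists>d>0. \<forall>y. norm y <= d --> \<bar>Q y\<bar> <= e * (norm y)^2) &
  (\<forall>e>0. \<exists>C\<ge>0. \<forall>y. \<bar>Q y\<bar> <= e * norm y powr r + C * (norm y)^2)"

lemma L2_superlevel:
 assumes "L2 f" "dl > 0"
 shows "emeasure lborel {x. dl <= norm (f x)} <= ennreal (nsq f / dl^2)" "{x. dl <= norm (f x)} \<in> fmeasurable lborel"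
  "measure lborel {x. dl <= norm (f x)} <= nsq f / dl^2"
proof -
 have [measurable]: "f \<in> borel_measurable borel" using assms(1) by (simp add: L2_def)
 show 1: "emeasure lborel {x. dl <= norm (f x)} <= ennreal (nsq f / dl^2)"
  using measure_superlevel_le[of "%x. norm (f x)" "nsq f" dl] nn_integral_nsq[OF assms(1)] assms(2) by simp
 have "emeasure lborel {x. dl <= norm (f x)} < \<infinity>" using 1 by (auto intro: le_less_trans)
 moreover have "{x. dl <= norm (f x)} \<in> sets lborel" by measurable
 ultimately show "{x. dl <= norm (f x)} \<in> fmeasurable lborel" by (simp add: fmeasurable_def)
 show "measure lborel {x. dl <= norm (f x)} <= nsq f / dl^2"
  unfolding measure_def using 1 by (intro enn2real_leI) (simp_all add: nsq_nonneg)
qed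

lemma subcritical_bound:
 assumes "subcritical r Q"
 shows "\<exists>C\<ge>0. \<forall>y. \<bar>Q y\<bar> <= C * ((norm y)^2 + norm y powr r)"
proof -
 obtain C where C: "C >= 0" "!!y. \<bar>Q y\<bar> <= 1 * norm y powr r + C * (norm y)^2"
  using assms unfolding subcritical_def by (meson zero_less_one)
 have "\<bar>Q y\<bar> <= (1 + C) * ((norm y)^2 + norm y powr r)" for y
 proof -
  have "0 <= (norm y)^2 + C * norm y powr r" using C(1) by simp
  then show ?thesis using C(2)[of y] by (simp add: algebra_simps)
 qed
 then show ?thesis using C(1) by (intro exI[of _ "1 + C"]) auto
qed

lemma subcritical_large:
 assumes Q: "subcritical r Q" and r: "r > 2" and e: "e > 0"
 shows "\<exists>M. \<forall>y. norm y >= M --> \<bar>Q y\<bar> <= e * norm y powr r"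
proof -
 obtain C where C: "C >= 0" "!!y. \<bar>Q y\<bar> <= e/2 * norm y powr r + C * (norm y)^2"
  using Q e unfolding subcritical_def by (meson half_gt_zero)
 define M where "M = max 1 ((2 * C / e) powr (1 / (r - 2)))"
 have M: "2 * C / e <= t powr (r - 2) & 1 <= t" if "t >= M" for t
 proof -
  have "2 * C / e = ((2 * C / e) powr (1 / (r - 2))) powr (r - 2)" using r C(1) e by (simp add: powr_powr)
  also have "... <= t powr (r - 2)" using that r by (intro powr_mono2) (auto simp: M_def)
  finally show ?thesis using that by (simp add: M_def)
 qed
 have "\<bar>Q y\<bar> <= e * norm y powr r" if y: "norm y >= M" for y
 proof -
  have "norm y powr r = norm y powr (r - 2) * (norm y)^2"
   using M[OF y] by (simp add: powr_diff)
  moreover have "2 * C / e * (norm y)^2 <= norm y powr (r - 2) * (norm y)^2"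
   using M[OF y] by (intro mult_right_mono) auto
  ultimately have "C * (norm y)^2 <= e / 2 * norm y powr r" using e by (simp add: field_simps)
  then show ?thesis using C(2)[of y] by simp
 qed
 then show ?thesis by blast
qed

text \<open>Small and large arguments contribute at most \<open>eps\<close> times \<open>S\<close>,
  whose integrals are bounded. For arguments in a compact set, uniform continuity of
  \<open>Q\<close> leaves a small error on the set where \<open>z\<close> is not small, which has
  finite measure; the remaining set, where f n and z differ by at least \<eta>, has measure tending
  to 0.\<close>

theorem integral_tendsto_conv_meas:
 fixes Q :: "'c::euclidean_space => real" and z :: "'a::euclidean_space => 'c"
 assumes Q: "subcritical r Q" and r: "r > 2"
  and zn: "!!n. L2 (f n)" "!!n. integrable lborel (%x. norm (f n x) powr r)"
   "!!n. nsq (f n) + (LINT x|lborel. norm (f n x) powr r) <= R"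
  and z: "L2 z" "integrable lborel (%x. norm (z x) powr r)"
  and conv: "conv_meas f z"
 shows "(%n. LINT x|lborel. Q (f n x)) ~~> (LINT x|lborel. Q (z x))"
proof -
 have Qc: "continuous_on UNIV Q" using Q by (simp add: subcritical_def)
 have [measurable]: "Q \<in> borel_measurable borel" using Qc by (rule borel_measurable_continuous_onI)
 have [measurable]: "f n \<in> borel_measurable borel" "z \<in> borel_measurable borel" for n using zn(1)[of n] z(1) by (auto simp: L2_def)
 define S where "S y = (norm y)^2 + norm y powr r" for y :: 'c
 have S0: "S y >= 0" for y by (simp add: S_def)
 have Sz: "integrable lborel (%x. S (z x))" and Sf: "integrable lborel (%x. S (f n x))" for n
  unfolding S_def by (rule Bochner_Integration.integrable_add[OF L2_integrable[OF z(1)] z(2)] Bochner_Integration.integrable_add[OF L2_integrable[OF zn(1)] zn(2)])+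
 obtain CQ where CQ: "!!y. \<bar>Q y\<bar> <= CQ * S y" using subcritical_bound[OF Q] by (auto simp: S_def)
 have Qi: "integrable lborel (%x. Q (w x))" if "integrable lborel (%x. S (w x))" "w \<in> borel_measurable borel" for w :: "'a => 'c"
  by (rule Bochner_Integration.integrable_bound[OF integrable_mult_right[OF that(1), of CQ]])
   (use CQ that(2) in "auto intro: order_trans[OF _ abs_ge_self]")
 define R' where "R' = max R (LINT x|lborel. S (z x))"
 have Rz: "(LINT x|lborel. S (z x)) <= R'" and Rf: "(LINT x|lborel. S (f n x)) <= R'" for n
  using zn(3)[of n] zn(1)[of n] zn(2)[of n] by (auto simp: R'_def S_def nsq_def L2_def max_def)
 have R0: "R' >= 0" using Rz Bochner_Integration.integral_nonneg[of lborel "%x. S (z x)"] S0 by (meson order_trans)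
 have nz: "nsq z <= R'"
 proof -
  have "nsq z <= (LINT x|lborel. S (z x))"
   unfolding nsq_def by (rule integral_mono) (use z(1) Sz in "auto simp: L2_def S_def")
  then show ?thesis using Rz by simp
 qed
 show ?thesis
 proof (rule LIMSEQ_I)
  fix e :: real assume e: "e > 0"
  \<comment> \<open>The two integrals of \<open>S\<close> add up to at most 2 R', so this part
    contributes at most e / 4.\<close>
  define eps where "eps = e / (8 * (R' + 1))"
  have eps: "eps > 0" using e R0 by (simp add: eps_def)
  obtain d where d: "d > 0" "!!y. norm y <= d ==> \<bar>Q y\<bar> <= eps * (norm y)^2"
   using Q eps unfolding subcritical_def by meson
  obtain M0 where M0: "!!y. norm y >= M0 ==> \<bar>Q y\<bar> <= eps * norm y powr r"
   using subcritical_large[OF Q r eps] by blast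
  define M where "M = max M0 d"
  have M: "M >= d" "!!y. norm y >= M ==> \<bar>Q y\<bar> <= eps * norm y powr r" using M0 by (auto simp: M_def)
  have small: "\<bar>Q y\<bar> <= eps * S y" if "norm y <= d" for y
   using d(2)[OF that] eps by (simp add: S_def distrib_left add_increasing2)
  have large: "\<bar>Q y\<bar> <= eps * S y" if "norm y >= M" for y
   using M(2)[OF that] eps by (simp add: S_def distrib_left add_increasing)
  \<comment> \<open>The radius leaves room: of two arguments at distance below \<eta> <= d / 2,
    either both lie in \<open>K\<close> or both have norm at least \<open>M\<close>.\<close>
  define K where "K = cball (0::'c) (3 * M + 3 * d)"
  have cK: "compact K" by (simp add: K_def)
  have cQK: "continuous_on K Q" using Qc continuous_on_subset by blast
  obtain B where B: "!!y. y \<in> K ==> \<bar>Q y\<bar> <= B"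
   using compact_imp_bounded[OF compact_continuous_image[OF cQK cK]] by (auto simp: bounded_iff)
  have B0: "B >= 0" using B[of 0] M(1) d(1) by (force simp: K_def)
  \<comment> \<open>Chebyshev's inequality bounds the measure of the set \<open>Y\<close> below by 4
    R' / d^2, whence this calibration.\<close>
  define eps' where "eps' = e / (8 * (4 * R' / d^2 + 1))"
  have den: "4 * R' / d^2 + 1 > 0" using R0 by (simp add: add_nonneg_pos)
  have eps': "eps' > 0" using e den by (simp add: eps'_def)
  obtain \<eta>0 where \<eta>0: "\<eta>0 > 0" "!!y y'. y \<in> K ==> y' \<in> K ==> dist y' y < \<eta>0 ==> dist (Q y') (Q y) < eps'"
   using compact_uniformly_continuous[OF cQK cK] eps' unfolding uniformly_continuous_on_def by metis
  define \<eta> where "\<eta> = min \<eta>0 (d / 2)"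
  have \<eta>: "\<eta> > 0" "\<eta> <= d / 2" using \<eta>0 d by (auto simp: \<eta>_def)
  have pw: "\<bar>Q y' - Q y\<bar> <= eps * (S y + S y') + eps' * (if d / 2 <= norm y then 1 else 0) + 2 * B * (if \<eta> <= norm (y' - y) then 1 else 0)" for y y'
  proof -
   have one: "\<bar>Q y\<bar> <= eps * S y + B" for y
   proof (cases "norm y <= M")
    case True
    then have "y \<in> K" using M(1) d(1) by (simp add: K_def)
    then show ?thesis using B[of y] eps S0[of y] by (simp add: add_increasing)
   next
    case False then show ?thesis using large[of y] B0 by simp
   qed
   have P: "0 <= eps' * (if d / 2 <= norm y then 1 else 0)" "0 <= 2 * B * (if \<eta> <= norm (y' - y) then 1 else 0)"
    using eps' B0 by auto
   consider "\<eta> <= norm (y' - y)" | "norm (y' - y) < \<eta>" "norm y < d / 2" | "norm (y' - y) < \<eta>" "d / 2 <= norm y" "norm y <= 3 * M + 2 * d"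
    | "norm (y' - y) < \<eta>" "norm y > 3 * M + 2 * d" by linarith
   then show ?thesis
   proof cases
    case 1
    then show ?thesis using one[of y] one[of y'] P by (simp add: distrib_left)
   next
    case 2
    then have "norm y' <= d" using norm_triangle_sub[of y' y] \<eta>(2) by linarith
    then show ?thesis using small[of y] small[of y'] 2 P d(1) by (simp add: distrib_left)
   next
    case 3
    then have "norm y' <= 3 * M + 3 * d" using norm_triangle_sub[of y' y] \<eta>(2) d(1) by linarith
    then have "y' \<in> K" "y \<in> K" using 3 d(1) by (auto simp: K_def)
    moreover have "dist y' y < \<eta>0" using 3(1) by (simp add: dist_norm \<eta>_def)
    ultimately have "\<bar>Q y' - Q y\<bar> < eps'" using \<eta>0(2)[of y y'] by (simp add: dist_real_def)
    moreover have "0 <= eps * (S y + S y')" using eps S0 by simp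
    ultimately show ?thesis using 3 P(2) by simp
   next
    case 4
    have "norm y <= norm y' + norm (y' - y)" using norm_triangle_sub[of y y'] by (simp add: norm_minus_commute)
    then have "norm y' >= M" "norm y >= M" using 4 M(1) d(1) \<eta>(2) by linarith+
    then show ?thesis using large[of y] large[of y'] P by (simp add: distrib_left)
   qed
  qed
  define X where "X n = {x. \<eta> <= norm (f n x - z x)}" for n
  define Y where "Y = {x. d / 2 <= norm (z x)}"
  have Xf: "X n \<in> fmeasurable lborel" for n unfolding X_def by (rule L2_superlevel(2)[OF L2_diff[OF zn(1) z(1)] \<eta>(1)])
  have Yf: "Y \<in> fmeasurable lborel" "measure lborel Y <= R' / (d / 2)^2"
   unfolding Y_def using L2_superlevel(2,3)[OF z(1), of "d/2"] d(1) nz by (auto intro: order_trans[OF _ divide_right_mono])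
  have "(%n. 2 * B * measure lborel (X n)) ~~> 2 * B * 0"
   using conv \<eta>(1) unfolding conv_meas_def X_def by (intro tendsto_intros) auto
  then have "\<forall>\<^sub>F n in sequentially. 2 * B * measure lborel (X n) < e / 4"
   using e by (intro order_tendstoD(2)) auto
  then obtain n0 where n0: "!!n. n >= n0 ==> 2 * B * measure lborel (X n) < e / 4" by (auto simp: eventually_sequentially)
  have "norm ((LINT x|lborel. Q (f n x)) - (LINT x|lborel. Q (z x))) < e" if n: "n >= n0" for n
  proof -
   have iX: "integrable lborel (indicator (X n) :: 'a => real)" and iY: "integrable lborel (indicator Y :: 'a => real)"
    using Xf[of n] Yf(1) by (auto simp: integrable_indicator_iff fmeasurable_def)
   have "norm ((LINT x|lborel. Q (f n x)) - (LINT x|lborel. Q (z x))) = norm (LINT x|lborel. Q (f n x) - Q (z x))"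
    using Qi[OF Sf, of n] Qi[OF Sz] by simp
   also have "... <= (LINT x|lborel. eps * (S (z x) + S (f n x)) + eps' * indicator Y x + 2 * B * indicator (X n) x)"
   proof (rule LINT_norm_bound)
    show "integrable lborel (%x. Q (f n x) - Q (z x))" using Qi[OF Sf, of n] Qi[OF Sz] by simp
    show "integrable lborel (%x. eps * (S (z x) + S (f n x)) + eps' * indicator Y x + 2 * B * indicator (X n) x)"
     using Sf Sz iX iY by simp
    show "norm (Q (f n x) - Q (z x)) <= eps * (S (z x) + S (f n x)) + eps' * indicator Y x + 2 * B * indicator (X n) x" for x
    proof -
     have "indicator Y x = (if d / 2 <= norm (z x) then 1 else 0 :: real)" "indicator (X n) x = (if \<eta> <= norm (f n x - z x) then 1 else 0 :: real)"
      by (simp_all add: X_def Y_def)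
     then show ?thesis using pw[of "f n x" "z x"] by (simp only: real_norm_def)
    qed
   qed
   also have "... = eps * ((LINT x|lborel. S (z x)) + (LINT x|lborel. S (f n x))) + eps' * measure lborel Y + 2 * B * measure lborel (X n)"
    using Sf[of n] Sz iX iY by simp
   also have "... <= eps * (R' + R') + eps' * (R' / (d / 2)^2) + 2 * B * measure lborel (X n)"
    using Rz Rf[of n] Yf(2) eps eps' by (intro add_mono mult_left_mono order_refl) auto
   also have "... < e / 4 + e / 8 + e / 4"
   proof -
    have "eps * (R' + R') <= e / 4"
     using e R0 by (simp add: eps_def field_simps)
    moreover have "eps' * (R' / (d / 2)^2) <= e / 8"
    proof -
     have "eps' * (4 * R' / d^2) <= eps' * (4 * R' / d^2 + 1)" using eps' by (intro mult_left_mono) auto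
     also have "... = e / 8" 
     proof -
      have "e / (8 * D) * D = e / 8" if "D > 0" for D :: real using that by simp
      then show ?thesis unfolding eps'_def using den by blast
     qed
     finally show ?thesis by (simp add: power_divide mult.commute)
    qed
    ultimately show ?thesis using n0[OF n] by linarith
   qed
   also have "... < e" using e by simp
   finally show ?thesis .
  qed
  then show "\<exists>no. \<forall>n\<ge>no. norm ((LINT x|lborel. Q (f n x)) - (LINT x|lborel. Q (z x))) < e" by blast
 qed
qed

lemma subcritical_integrable:
 fixes Q :: "'c::euclidean_space => real" and z :: "'a::euclidean_space => 'c"
 assumes Q: "subcritical r Q" and z: "L2 z" "integrable lborel (%x. norm (z x) powr r)"
 shows "integrable lborel (%x. Q (z x))"
proof -
 have [measurable]: "Q \<in> borel_measurable borel" using Q by (auto simp: subcritical_def intro: borel_measurable_continuous_onI)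
 have [measurable]: "z \<in> borel_measurable borel" using z(1) by (auto simp: L2_def)
 obtain CQ where CQ: "!!y. \<bar>Q y\<bar> <= CQ * ((norm y)^2 + norm y powr r)" using subcritical_bound[OF Q] by auto
 have "integrable lborel (%x. CQ * ((norm (z x))^2 + norm (z x) powr r))" using z L2_integrable[OF z(1)] by auto
 then show ?thesis
  by (rule Bochner_Integration.integrable_bound) (use CQ in "auto intro: order_trans[OF _ abs_ge_self]")
qed

lemma norm_pair_powr_le:
 fixes a b r :: real
 assumes "r > 0"
 shows "norm (a, b) powr r <= 2 powr r * (\<bar>a\<bar> powr r + \<bar>b\<bar> powr r)"
proof -
 have "norm (a, b) <= \<bar>a\<bar> + \<bar>b\<bar>" using norm_Pair_le[of a b] by simp
 also have "... <= 2 * max \<bar>a\<bar> \<bar>b\<bar>" by simp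
 finally have "norm (a, b) powr r <= (2 * max \<bar>a\<bar> \<bar>b\<bar>) powr r" using assms by (intro powr_mono2) auto
 also have "... = 2 powr r * (max \<bar>a\<bar> \<bar>b\<bar>) powr r" by (rule powr_mult)
 also have "(max \<bar>a\<bar> \<bar>b\<bar>) powr r <= \<bar>a\<bar> powr r + \<bar>b\<bar> powr r" by (auto simp: max_def)
 finally show ?thesis by (simp add: mult_left_mono)
qed

lemma pair_L2_Lr:
 fixes u v :: "'a::euclidean_space => real"
 assumes r: "r > 0" and u: "L2 u" "integrable lborel (%x. \<bar>u x\<bar> powr r)" and v: "L2 v" "integrable lborel (%x. \<bar>v x\<bar> powr r)"
 shows "L2 (%x. (u x, v x))" "nsq (%x. (u x, v x)) = nsq u + nsq v"
  "integrable lborel (%x. norm (u x, v x) powr r)"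
  "(LINT x|lborel. norm (u x, v x) powr r) <= 2 powr r * ((LINT x|lborel. \<bar>u x\<bar> powr r) + (LINT x|lborel. \<bar>v x\<bar> powr r))"
proof -
 have [measurable]: "u \<in> borel_measurable borel" "v \<in> borel_measurable borel" using u v by (auto simp: L2_def)
 have n: "(norm (u x, v x))^2 = (norm (u x))^2 + (norm (v x))^2" for x by (simp add: norm_Pair)
 show "L2 (%x. (u x, v x))" using L2_integrable[OF u(1)] L2_integrable[OF v(1)] by (simp add: L2_def n)
 show "nsq (%x. (u x, v x)) = nsq u + nsq v"
  unfolding nsq_def n using L2_integrable[OF u(1)] L2_integrable[OF v(1)] by simp
 have b: "integrable lborel (%x. 2 powr r * (\<bar>u x\<bar> powr r + \<bar>v x\<bar> powr r))" using u v by auto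
 show i: "integrable lborel (%x. norm (u x, v x) powr r)"
  by (rule Bochner_Integration.integrable_bound[OF b]) (use norm_pair_powr_le[OF r] in "auto intro: order_trans[OF _ abs_ge_self]")
 have "(LINT x|lborel. norm (u x, v x) powr r) <= (LINT x|lborel. 2 powr r * (\<bar>u x\<bar> powr r + \<bar>v x\<bar> powr r))"
  by (rule integral_mono[OF i b]) (rule norm_pair_powr_le[OF r])
 then show "(LINT x|lborel. norm (u x, v x) powr r) <= 2 powr r * ((LINT x|lborel. \<bar>u x\<bar> powr r) + (LINT x|lborel. \<bar>v x\<bar> powr r))"
  using u v by simp
qed

lemma conv_meas_sum_bound:
 fixes f :: "nat => 'a::euclidean_space => 'b::{banach,second_countable_topology}" and g :: "nat => 'a => 'c::{banach,second_countable_topology}"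
  and F :: "nat => 'a => 'd::{banach,second_countable_topology}"
 assumes f: "conv_meas f u" "!!n. L2 (f n)" "L2 u" and g: "conv_meas g v" "!!n. L2 (g n)" "L2 v"
  and F: "!!n. L2 (F n)" "L2 U" "!!n x. norm (F n x - U x) <= norm (f n x - u x) + norm (g n x - v x)"
 shows "conv_meas F U"
 unfolding conv_meas_def
proof (intro allI impI)
 fix dl :: real assume dl: "dl > 0"
 have le: "measure lborel {x. dl <= norm (F n x - U x)} <=
  measure lborel {x. dl / 2 <= norm (f n x - u x)} + measure lborel {x. dl / 2 <= norm (g n x - v x)}" for n
 proof -
  have fm: "{x. dl / 2 <= norm (f n x - u x)} \<in> fmeasurable lborel" "{x. dl / 2 <= norm (g n x - v x)} \<in> fmeasurable lborel"
   by (rule L2_superlevel, (intro L2_diff f g), use dl in simp)+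
  have FM: "{x. dl <= norm (F n x - U x)} \<in> fmeasurable lborel" by (rule L2_superlevel(2)[OF L2_diff[OF F(1,2)] dl])
  have "measure lborel {x. dl <= norm (F n x - U x)} <=
   measure lborel ({x. dl / 2 <= norm (f n x - u x)} \<union> {x. dl / 2 <= norm (g n x - v x)})"
  proof (rule measure_mono_fmeasurable[OF _ fmeasurableD[OF FM] fmeasurable.Un[OF fm]])
   show "{x. dl <= norm (F n x - U x)} \<subseteq> {x. dl / 2 <= norm (f n x - u x)} \<union> {x. dl / 2 <= norm (g n x - v x)}"
   proof
    fix x assume "x \<in> {x. dl <= norm (F n x - U x)}"
    then show "x \<in> {x. dl / 2 <= norm (f n x - u x)} \<union> {x. dl / 2 <= norm (g n x - v x)}" using F(3)[of n x] by auto
   qed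
  qed
  also have "... <= measure lborel {x. dl / 2 <= norm (f n x - u x)} + measure lborel {x. dl / 2 <= norm (g n x - v x)}"
   by (rule measure_Un_le) (intro fmeasurableD fm)+
  finally show ?thesis .
 qed
 have t0: "(%n. measure lborel {x. dl / 2 <= norm (f n x - u x)} + measure lborel {x. dl / 2 <= norm (g n x - v x)}) ~~> 0"
  using tendsto_add[OF f(1)[unfolded conv_meas_def, rule_format, of "dl / 2"] g(1)[unfolded conv_meas_def, rule_format, of "dl / 2"]] dl
  by (simp only: half_gt_zero add_0_right simp_thms True_implies_equals)
 show "(%n. measure lborel {x. dl <= norm (F n x - U x)}) ~~> 0"
  by (rule squeeze_null[OF t0]) (intro allI measure_nonneg, intro allI le)
qed

lemma conv_meas_pair:
 fixes f g :: "nat => 'a::euclidean_space => real"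
 assumes f: "conv_meas f u" "!!n. L2 (f n)" "L2 u" and g: "conv_meas g v" "!!n. L2 (g n)" "L2 v"
 shows "conv_meas (%n x. (f n x, g n x)) (%x. (u x, v x))"
proof -
 have L: "L2 (%x. (p x, q x))" if "L2 p" "L2 q" for p q :: "'a => real"
 proof -
  have "(%x. (p x, q x)) \<in> borel_measurable lborel" using that by (intro borel_measurable_Pair) (auto simp: L2_def)
  then show ?thesis using L2_integrable[OF that(1)] L2_integrable[OF that(2)] by (simp add: L2_def norm_Pair)
 qed
 show ?thesis
  by (rule conv_meas_sum_bound[OF f g L[OF f(2) g(2)] L[OF f(3) g(3)]]) (simp add: norm_Pair_le del: real_norm_def)
qed

lemma conv_meas_subseq: "conv_meas f u ==> strict_mono rho ==> conv_meas (%n. f (rho n)) u"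
 unfolding conv_meas_def using LIMSEQ_subseq_LIMSEQ unfolding comp_def by blast

subsection \<open>The variational setting\<close>

text \<open>The hypotheses common to both assertions; (g3) and (g4) are premises of the lemmas that
  build families of low energy. The type argument ties the locale to the domain of the
  functions.\<close>

locale fractional_nls =
 fixes s :: real and g :: "real => real" and space_type :: "'a::euclidean_space itself"
 assumes N2: "DIM('a) >= 2" and s01: "0 < s" "s < 1"
  and g_cont: "continuous_on UNIV g" and g_zero: "((%t. g t / t) \<longlongrightarrow> 0) (at 0)"
  and g_inf: "((%t. g t / \<bar>t\<bar> powr (1 + 4 * s / real DIM('a))) \<longlongrightarrow> 0) at_infinity"
  and g_odd: "!!t. g (- t) = - g t"
begin

abbreviation E :: "('a => real) set" where "E \<equiv> Collect (Hsr s)"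
abbreviation en :: "('a => real) => real" where "en u \<equiv> eform s u u"
definition r :: real where "r = 2 + 4 * s / real DIM('a)"
definition psi :: "('a => real) => real" where "psi u = (LINT x|lborel. Gprim g (u x))"
definition dpsi :: "('a => real) => ('a => real) => real" where "dpsi u phi = (LINT x|lborel. g (u x) * phi x)"

section \<open>Growth of the nonlinearity and of its primitive\<close>

lemma r_gt_2: "r > 2" using s01 by (simp add: r_def)

lemma g_0: "g 0 = 0" using g_odd[of 0] by simp

lemma g_small:
 assumes "e > 0" shows "\<exists>d>0. \<forall>t. \<bar>t\<bar> <= d --> \<bar>g t\<bar> <= e * \<bar>t\<bar>"
proof -
 obtain d where d: "d > 0" "!!t. t ~= 0 ==> \<bar>t\<bar> < d ==> \<bar>g t / t\<bar> < e"
  using LIM_D[OF g_zero assms] by auto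
 have "\<bar>g t\<bar> <= e * \<bar>t\<bar>" if "\<bar>t\<bar> <= d / 2" for t
  using d(2)[of t] that d(1) by (cases "t = 0") (auto simp: g_0 field_simps)
 then show ?thesis using d(1) by (intro exI[of _ "d / 2"]) auto
qed

text \<open>\<open>r - 1\<close> is the exponent p of (g2). The bounded middle range, away from 0
  and from infinity, is absorbed into the linear term.\<close>

lemma g_growth:
 assumes e: "e > 0" shows "\<exists>C\<ge>0. \<forall>t. \<bar>g t\<bar> <= e * \<bar>t\<bar> powr (r - 1) + C * \<bar>t\<bar>"
proof -
 obtain d where d: "d > 0" "!!t. \<bar>t\<bar> <= d ==> \<bar>g t\<bar> <= 1 * \<bar>t\<bar>" using g_small[of 1] by auto
 have "\<forall>\<^sub>F t in at_infinity. \<bar>g t / \<bar>t\<bar> powr (r - 1)\<bar> < e"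
  using tendstoD[OF g_inf e] by (simp add: r_def dist_real_def)
 then obtain M where M: "!!t. M <= \<bar>t\<bar> ==> \<bar>g t / \<bar>t\<bar> powr (r - 1)\<bar> < e" by (auto simp: eventually_at_infinity)
 obtain B where B: "B >= 0" "!!t. \<bar>t\<bar> <= M ==> \<bar>g t\<bar> <= B"
 proof -
  have "compact (g ` cball 0 \<bar>M\<bar>)" by (rule compact_continuous_image[OF continuous_on_subset[OF g_cont]]) auto
  from compact_imp_bounded[OF this] obtain B where "\<forall>y\<in>g ` cball 0 \<bar>M\<bar>. \<bar>y\<bar> <= B" by (auto simp: bounded_iff)
  then have "\<bar>t\<bar> <= M ==> \<bar>g t\<bar> <= \<bar>B\<bar>" for t by (force simp: dist_norm)
  then show ?thesis using that[of "\<bar>B\<bar>"] by simp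
 qed
 have "\<bar>g t\<bar> <= e * \<bar>t\<bar> powr (r - 1) + (1 + B / d) * \<bar>t\<bar>" for t
 proof -
  have P: "0 <= e * \<bar>t\<bar> powr (r - 1)" "0 <= B / d * \<bar>t\<bar>" using e B(1) d(1) by auto
  consider "\<bar>t\<bar> <= d" | "d < \<bar>t\<bar>" "\<bar>t\<bar> <= M" | "d < \<bar>t\<bar>" "M <= \<bar>t\<bar>" by linarith
  then show ?thesis
  proof cases
   case 1 then show ?thesis using d(2)[of t] P unfolding distrib_right mult_1 by linarith
  next
   case 2
   have "B * d <= B * \<bar>t\<bar>" using B(1) 2 by (intro mult_left_mono) auto
   then have "B <= B / d * \<bar>t\<bar>" using d(1) by (simp add: field_simps)
   then show ?thesis using B(2)[of t] 2 P unfolding distrib_right mult_1 by linarith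
  next
   case 3
   have "\<bar>g t\<bar> < e * \<bar>t\<bar> powr (r - 1)" using M[of t] 3 d(1) by (simp add: abs_divide pos_divide_less_eq)
   then show ?thesis using P unfolding distrib_right mult_1 by linarith
  qed
 qed
 then show ?thesis using B(1) d(1) by (intro exI[of _ "1 + B / d"]) auto
qed

lemma Gprim_deriv: "(Gprim g has_real_derivative g t) (at t)"
proof -
 let ?b = "\<bar>t\<bar> + 1"
 have "((%u. LBINT y=0..u. g y) has_vector_derivative g t) (at t within {-?b..?b})"
  using interval_integral_FTC2[of "-?b" 0 ?b g t, OF _ _ continuous_on_subset[OF g_cont]] by (auto simp: zero_ereal_def)
 then have "((%u. LBINT y=0..u. g y) has_vector_derivative g t) (at t)"
  using at_within_Icc_at[of "-?b" t ?b] by simp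
 then show ?thesis by (simp add: has_real_derivative_iff_has_vector_derivative Gprim_def[abs_def] zero_ereal_def)
qed

lemma Gprim_0: "Gprim g 0 = 0" by (simp add: Gprim_def flip: zero_ereal_def)

lemma Gprim_even: "Gprim g (- t) = Gprim g t"
proof -
 have "((%t. Gprim g (- t) - Gprim g t) has_real_derivative (- g (- x) - g x)) (at x)" for x
  using DERIV_mirror[where f = "Gprim g" and x = x and y = "g (- x)"] Gprim_deriv by (intro DERIV_diff) auto
 then have "\<forall>x. ((%t. Gprim g (- t) - Gprim g t) has_real_derivative 0) (at x)" by (simp add: g_odd)
 from DERIV_isconst_all[OF this, of t 0] show ?thesis by simp
qed

lemma Gprim_cont: "continuous_on UNIV (Gprim g)"
 using Gprim_deriv by (intro DERIV_continuous_on) (auto intro: has_field_derivative_at_within)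

lemma Gprim_le:
 assumes "!!y. \<bar>y\<bar> <= \<bar>t\<bar> ==> \<bar>g y\<bar> <= B" shows "\<bar>Gprim g t\<bar> <= B * \<bar>t\<bar>"
proof -
 have "norm (Gprim g t - Gprim g 0) <= B * norm (t - 0)"
  by (rule field_differentiable_bound[of "{-\<bar>t\<bar>..\<bar>t\<bar>}" "Gprim g" g])
   (use assms in "auto intro!: has_field_derivative_at_within[OF Gprim_deriv]")
 then show ?thesis by (simp add: Gprim_0)
qed

lemma powr_Suc_r: "\<bar>t\<bar> powr (r - 1) * \<bar>t\<bar> = \<bar>t\<bar> powr r" for t :: real
 using powr_add[of "\<bar>t\<bar>" "r - 1" 1] by (cases "t = 0") auto

lemma subcritical_Gprim: "subcritical r (Gprim g)"
 unfolding subcritical_def real_norm_def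
proof (intro conjI allI impI)
 show "continuous_on UNIV (Gprim g)" by (rule Gprim_cont)
next
 fix e :: real assume "e > 0"
 then obtain d where d: "d > 0" "!!t. \<bar>t\<bar> <= d ==> \<bar>g t\<bar> <= e * \<bar>t\<bar>" using g_small by blast
 have "\<bar>Gprim g y\<bar> <= e * \<bar>y\<bar>\<^sup>2" if "\<bar>y\<bar> <= d" for y
 proof -
  have "\<bar>g z\<bar> <= e * \<bar>y\<bar>" if "\<bar>z\<bar> <= \<bar>y\<bar>" for z
   using d(2)[of z] mult_left_mono[OF that, of e] that \<open>\<bar>y\<bar> <= d\<close> \<open>e > 0\<close> by linarith
  from Gprim_le[of y, OF this] show ?thesis by (simp add: power2_eq_square mult.assoc)
 qed
 then show "\<exists>d>0. \<forall>y. \<bar>y\<bar> <= d --> \<bar>Gprim g y\<bar> <= e * \<bar>y\<bar>\<^sup>2" using d(1) by blast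
next
 fix e :: real assume e: "e > 0"
 then obtain C where C: "C >= 0" "!!t. \<bar>g t\<bar> <= e * \<bar>t\<bar> powr (r - 1) + C * \<bar>t\<bar>" using g_growth by blast
 have "\<bar>Gprim g y\<bar> <= e * \<bar>y\<bar> powr r + C * \<bar>y\<bar>\<^sup>2" for y
 proof -
  have "\<bar>g z\<bar> <= e * \<bar>y\<bar> powr (r - 1) + C * \<bar>y\<bar>" if "\<bar>z\<bar> <= \<bar>y\<bar>" for z
  proof -
   have "e * \<bar>z\<bar> powr (r - 1) <= e * \<bar>y\<bar> powr (r - 1)" using that e r_gt_2 by (intro mult_left_mono powr_mono2) auto
   then show ?thesis using C(2)[of z] mult_left_mono[OF that C(1)] by linarith
  qed
  from Gprim_le[of y, OF this] have "\<bar>Gprim g y\<bar> <= e * (\<bar>y\<bar> powr (r - 1) * \<bar>y\<bar>) + C * (\<bar>y\<bar> * \<bar>y\<bar>)"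
   by (simp add: algebra_simps)
  then show ?thesis by (simp only: powr_Suc_r power2_eq_square)
 qed
 then show "\<exists>C\<ge>0. \<forall>y. \<bar>Gprim g y\<bar> <= e * \<bar>y\<bar> powr r + C * \<bar>y\<bar>\<^sup>2" using C(1) by blast
qed

lemma subcritical_g_mult: "subcritical r (%z::real \<times> real. g (fst z) * snd z)"
 unfolding subcritical_def
proof (intro conjI allI impI)
 show "continuous_on UNIV (%z::real \<times> real. g (fst z) * snd z)"
  by (intro continuous_intros continuous_on_compose2[OF g_cont]) auto
next
 fix e :: real assume "e > 0"
 then obtain d where d: "d > 0" "!!t. \<bar>t\<bar> <= d ==> \<bar>g t\<bar> <= e * \<bar>t\<bar>" using g_small by blast
 have "\<bar>g (fst z) * snd z\<bar> <= e * (norm z)^2" if "norm z <= d" for z :: "real \<times> real"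
 proof -
  have n: "\<bar>fst z\<bar> <= norm z" "\<bar>snd z\<bar> <= norm z" using norm_fst_le[of "fst z" "snd z"] norm_snd_le[of "snd z" "fst z"] by auto
  have "\<bar>g (fst z)\<bar> <= e * norm z" using d(2)[of "fst z"] n(1) that mult_left_mono[OF n(1), of e] \<open>e > 0\<close> by linarith
  then have "\<bar>g (fst z)\<bar> * \<bar>snd z\<bar> <= (e * norm z) * norm z" using n \<open>e > 0\<close> by (intro mult_mono) auto
  then show ?thesis by (simp add: abs_mult power2_eq_square mult.assoc)
 qed
 then show "\<exists>d>0. \<forall>z::real \<times> real. norm z <= d --> \<bar>g (fst z) * snd z\<bar> <= e * (norm z)^2" using d(1) by blast
next
 fix e :: real assume e: "e > 0"
 then obtain C where C: "C >= 0" "!!t. \<bar>g t\<bar> <= e * \<bar>t\<bar> powr (r - 1) + C * \<bar>t\<bar>" using g_growth by blast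
 have "\<bar>g (fst z) * snd z\<bar> <= e * norm z powr r + C * (norm z)^2" for z :: "real \<times> real"
 proof -
  have n: "\<bar>fst z\<bar> <= norm z" "\<bar>snd z\<bar> <= norm z" using norm_fst_le[of "fst z" "snd z"] norm_snd_le[of "snd z" "fst z"] by auto
  have "\<bar>g (fst z)\<bar> <= e * norm z powr (r - 1) + C * norm z"
  proof -
   have "e * \<bar>fst z\<bar> powr (r - 1) <= e * norm z powr (r - 1)" using n e r_gt_2 by (intro mult_left_mono powr_mono2) auto
   then show ?thesis using C(2)[of "fst z"] mult_left_mono[OF n(1) C(1)] by linarith
  qed
  then have "\<bar>g (fst z)\<bar> * \<bar>snd z\<bar> <= (e * norm z powr (r - 1) + C * norm z) * norm z"
   using n e C(1) by (intro mult_mono) auto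
  also have "... = e * (norm z powr (r - 1) * norm z) + C * (norm z * norm z)" by (simp add: algebra_simps)
  also have "norm z powr (r - 1) * norm z = norm z powr r" using powr_Suc_r[of "norm z"] by simp
  finally show ?thesis by (simp only: power2_eq_square abs_mult)
 qed
 then show "\<exists>C\<ge>0. \<forall>z::real \<times> real. \<bar>g (fst z) * snd z\<bar> <= e * norm z powr r + C * (norm z)^2" using C(1) by blast
qed

section \<open>Weak limits and the potential term\<close>

lemma Lr_integrable: "Hsr s u ==> integrable lborel (%x::'a. \<bar>u x\<bar> powr r)"
 using Gagliardo_Nirenberg[OF s01, where 'a='a] by (auto simp: r_def Hsr_iff)

lemma en_parts: "0 <= aform s u u" "0 <= nsq u" "en u = aform s u u + nsq u" "0 <= en u"
 using aform_nonneg[of s u] by (auto simp: eform_def bform_self)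

lemma L2_Lr_bounded:
 "\<exists>R'. \<forall>u. Hsr s u --> en u <= R --> nsq u + (LINT x|lborel. \<bar>u x\<bar> powr r) <= R'"
proof -
 obtain C where C: "C >= 0" "!!u::'a => real. Hsr s u ==> (LINT x|lborel. \<bar>u x\<bar> powr r) <= C * aform s u u * (bform u u) powr (2 * s / real DIM('a))"
  using Gagliardo_Nirenberg[OF s01, where 'a='a] by (auto simp: r_def Hsr_iff)
 have "nsq u + (LINT x|lborel. \<bar>u x\<bar> powr r) <= R + C * R * R powr (2 * s / real DIM('a))" if "Hsr s u" "en u <= R" for u :: "'a => real"
 proof -
  have n: "0 <= aform s u u" "0 <= nsq u" "aform s u u <= R" "nsq u <= R" using en_parts[of u] that(2) by linarith+
  have "C * aform s u u * (bform u u) powr (2 * s / real DIM('a)) <= C * R * R powr (2 * s / real DIM('a))"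
   using n C(1) s01 by (intro mult_mono powr_mono2) (auto simp: bform_self)
  then show ?thesis using C(2)[OF that(1)] n by linarith
 qed
 then show ?thesis by blast
qed

text \<open>One subsequence converges both weakly and, by \<open>weakly_null_in_measure\<close>
  applied to the differences from the limit, in measure. Linear quantities use the former, nonlinear
  ones the latter.\<close>

lemma weak_limit:
 assumes f: "!!n. Hsr s (f n)" and R: "!!n. en (f n) <= R"
 obtains rho u where "strict_mono (rho :: nat => nat)" "Hsr s u"
  "!!\<l>. Hsr.bounded_lin_on s E \<l> ==> (%n. \<l> (f (rho n))) ~~> \<l> u" "conv_meas (%n. f (rho n)) u"
proof -
 obtain rho u where rho: "strict_mono (rho :: nat => nat)" and u: "u \<in> E"
  and w: "!!\<l>. Hsr.bounded_lin_on s E \<l> ==> (%n. \<l> (f (rho n))) ~~> \<l> u"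
  using Hsr.weak_compactness[of f s R] f R by auto
 let ?w = "%n x. f (rho n) x - u x"
 have wH: "Hsr s (?w n)" for n using Hsr.diff_mem[of "f (rho n)" s u] f u by simp
 have wR: "en (?w n) <= 2 * R + 2 * en u" for n
 proof -
  have "en (?w n) + en (%x. f (rho n) x + u x) = 2 * en (f (rho n)) + 2 * en u"
   using Hsr.ip_lc_lc[of "f (rho n)" s u 1 "-1"] Hsr.ip_lc_lc[of "f (rho n)" s u 1 1] f u by simp
  then show ?thesis using R[of "rho n"] en_parts(4)[of "%x. f (rho n) x + u x"] by linarith
 qed
 have wl: "(%n. \<l> (?w n)) ~~> 0" if l: "Hsr.bounded_lin_on s E \<l>" for \<l>
 proof -
  have "\<l> (%x. 1 * f (rho n) x + (- 1) * u x) = 1 * \<l> (f (rho n)) + (- 1) * \<l> u" for n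
   using l f u unfolding Hsr.bounded_lin_on_def by blast
  then show ?thesis using LIM_zero[OF w[OF l]] by simp
 qed
 have "conv_meas (%n. f (rho n)) u"
  unfolding conv_meas_def using weakly_null_in_measure[where w = ?w, OF N2 s01 wH wR wl] by simp
 with rho u w show ?thesis using that by blast
qed

lemma conv_meas_strong:
 assumes "!!n. L2 (f n)" "L2 u" "(%n. nsq (%x. f n x - u x)) ~~> 0"
 shows "conv_meas f (u :: 'a => real)"
 unfolding conv_meas_def
proof (intro allI impI)
 fix dl :: real assume d: "dl > 0"
 show "(%n. measure lborel {x. dl <= norm (f n x - u x)}) ~~> 0"
 proof (rule squeeze_null)
  show "(%n. nsq (%x. f n x - u x) / dl^2) ~~> 0" using tendsto_divide[OF assms(3) tendsto_const, of "dl^2"] d by simp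
 qed (use L2_superlevel(3)[OF L2_diff[OF assms(1,2)] d] in auto)
qed

lemma psi_tendsto:
 assumes f: "!!n. Hsr s (f n)" "!!n. en (f n) <= R" and u: "Hsr s u" and c: "conv_meas f u"
 shows "(%n. psi (f n)) ~~> psi u"
proof -
 obtain R' where "!!u. Hsr s u ==> en u <= R ==> nsq u + (LINT x|lborel. \<bar>u x\<bar> powr r) <= R'"
  using L2_Lr_bounded[of R] by blast
 then show ?thesis unfolding psi_def
  by (intro integral_tendsto_conv_meas[OF subcritical_Gprim r_gt_2, where R=R'])
   (use f u c Lr_integrable[OF f(1)] Lr_integrable[OF u] HsrD(1)[OF f(1)] HsrD(1)[OF u] in auto)
qed

text \<open>Both arguments vary, the direction included. This is the complete continuity of the
  derivative of \<open>psi\<close>, and it stands in for a modulus of continuity of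
  \<open>g\<close>.\<close>

lemma dpsi_tendsto:
 assumes f: "!!n. Hsr s (f n)" "!!n. en (f n) <= R" and u: "Hsr s u" and c: "conv_meas f u"
  and h: "!!n. Hsr s (h n)" "!!n. en (h n) <= R" and phi: "Hsr s phi" and ch: "conv_meas h phi"
 shows "(%n. dpsi (f n) (h n)) ~~> dpsi u phi"
proof -
 obtain R' where R': "!!u. Hsr s u ==> en u <= R ==> nsq u + (LINT x|lborel. \<bar>u x\<bar> powr r) <= R'"
  using L2_Lr_bounded[of R] by blast
 have r0: "r > 0" using r_gt_2 by simp
 note pn = pair_L2_Lr[OF r0 HsrD(1)[OF f(1)] Lr_integrable[OF f(1)] HsrD(1)[OF h(1)] Lr_integrable[OF h(1)]]
 note pu = pair_L2_Lr[OF r0 HsrD(1)[OF u] Lr_integrable[OF u] HsrD(1)[OF phi] Lr_integrable[OF phi]]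
 have "(%n. LINT x|lborel. (%z. g (fst z) * snd z) (f n x, h n x)) ~~> (LINT x|lborel. (%z. g (fst z) * snd z) (u x, phi x))"
 proof (rule integral_tendsto_conv_meas[OF subcritical_g_mult r_gt_2, where f="%n x. (f n x, h n x)" and z="%x. (u x, phi x)" and R="2 * R' + 2 powr r * (2 * R')"])
  show "nsq (%x. (f n x, h n x)) + (LINT x|lborel. norm (f n x, h n x) powr r) <= 2 * R' + 2 powr r * (2 * R')" for n
  proof -
   have i: "0 <= (LINT x|lborel. \<bar>f n x\<bar> powr r)" "0 <= (LINT x|lborel. \<bar>h n x\<bar> powr r)" by simp_all
   have b: "nsq (f n) + (LINT x|lborel. \<bar>f n x\<bar> powr r) <= R'" "nsq (h n) + (LINT x|lborel. \<bar>h n x\<bar> powr r) <= R'"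
    using R' f h by auto
   have "nsq (f n) + nsq (h n) <= 2 * R'" "(LINT x|lborel. \<bar>f n x\<bar> powr r) + (LINT x|lborel. \<bar>h n x\<bar> powr r) <= 2 * R'"
    using i b nsq_nonneg[of "f n"] nsq_nonneg[of "h n"] by linarith+
   then show ?thesis using pn(2)[of n n] pn(4)[of n n] powr_ge_zero[of 2 r]
    mult_left_mono[of "(LINT x|lborel. \<bar>f n x\<bar> powr r) + (LINT x|lborel. \<bar>h n x\<bar> powr r)" "2 * R'" "2 powr r"] by linarith
  qed
 qed (use pn pu conv_meas_pair[OF c HsrD(1)[OF f(1)] HsrD(1)[OF u] ch HsrD(1)[OF h(1)] HsrD(1)[OF phi]] in auto)
 then show ?thesis by (simp add: dpsi_def)
qed

end

lemma has_real_derivative_scaled_quotient: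
 assumes A: "(A has_real_derivative 2 * a) (at t)" and B: "(B has_real_derivative 2 * b) (at t)"
  and \<Psi>: "(\<Psi> has_real_derivative p) (at t)" and pos: "B t > 0" "m > 0"
 shows "((%y. 1/2 * (m / B y) powr al * A y - m / B y * \<Psi> y) has_real_derivative
  (m / B t) powr al * (a - al * A t * b / B t) - m / B t * (p - 2 * \<Psi> t * b / B t)) (at t)"
proof -
 have dq: "((%y. m / B y) has_real_derivative (0 * B t - m * (2 * b)) / (B t * B t)) (at t)"
  by (rule DERIV_divide[OF DERIV_const B]) (use pos in simp)
 have dp: "((%y. (m / B y) powr al) has_real_derivative al * (m / B t) powr (al - of_nat 1) * ((0 * B t - m * (2 * b)) / (B t * B t))) (at t)"
  by (rule DERIV_fun_powr[OF dq]) (use pos in simp)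
 have P: "(m / B t) powr (al - of_nat 1) = (m / B t) powr al * (B t / m)" using pos by (simp add: powr_diff)
 have alg: "1/2 * (al * (P * (B t / m)) * ((0 * B t - m * (2 * b)) / (B t * B t))) * A t + 2 * a * (1/2 * P)
  - ((0 * B t - m * (2 * b)) / (B t * B t) * \<Psi> t + p * (m / B t)) = P * (a - al * A t * b / B t) - m / B t * (p - 2 * \<Psi> t * b / B t)" for P
  using pos by (simp add: field_simps)
 show ?thesis
  by (rule DERIV_cong[OF DERIV_diff[OF DERIV_mult[OF DERIV_cmult[OF dp] A] DERIV_mult[OF dq \<Psi>]]]) (simp only: P alg)
qed

context fractional_nls
begin

lemma aform_lc2: "Hsr s u ==> Hsr s v ==> Hsr s w ==> aform s w (%x. c * u x + d * v x) = c * aform s w u + d * aform s w v"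
 using aform_lc[of s u v w c d] by (simp only: aform_commute)

lemma bform_lc1: "Hsr s u ==> Hsr s v ==> Hsr s w ==> bform (%x. c * u x + d * v x) w = c * bform u w + d * bform v w"
 by (intro bform_lc HsrD(1))

lemma bform_lc2: "Hsr s u ==> Hsr s v ==> Hsr s w ==> bform w (%x. c * u x + d * v x) = c * bform w u + d * bform w v"
 using bform_lc1[of u v w c d] by (simp only: bform_commute)

lemma form_bound:
 assumes "Hsr s u" "Hsr s v"
 shows "\<bar>aform s u v\<bar> <= sqrt (en u) * sqrt (en (v :: 'a => real))" "\<bar>bform u v\<bar> <= sqrt (en u) * sqrt (en v)"
proof -
 have H: "Hsr s (%x. t * u x + (- 1) * v x)" for t by (rule Hsr_lc[OF assms])
 have "(aform s u v)^2 <= aform s u u * aform s v v"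
 proof (rule quadratic_discriminant_le)
  fix t
  have "aform s (%x. t * u x + (- 1) * v x) (%x. t * u x + (- 1) * v x) = t^2 * aform s u u - 2 * t * aform s u v + aform s v v"
   unfolding aform_lc[OF assms H] aform_lc2[OF assms assms(1)] aform_lc2[OF assms assms(2)] aform_commute[of s v u]
   by (simp add: power2_eq_square algebra_simps)
  then show "0 <= t^2 * aform s u u - 2 * t * aform s u v + aform s v v" by (metis aform_nonneg)
 qed (rule aform_nonneg)
 also have "... <= en u * en v" using en_parts[of u] en_parts[of v] by (intro mult_mono) auto
 finally show "\<bar>aform s u v\<bar> <= sqrt (en u) * sqrt (en v)"
  by (metis real_sqrt_abs real_sqrt_le_mono real_sqrt_mult)
 have "(bform u v)^2 <= bform u u * bform v v"
 proof (rule quadratic_discriminant_le)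
  fix t
  have "bform (%x. t * u x + (- 1) * v x) (%x. t * u x + (- 1) * v x) = t^2 * bform u u - 2 * t * bform u v + bform v v"
   unfolding bform_lc1[OF assms H] bform_lc2[OF assms assms(1)] bform_lc2[OF assms assms(2)] bform_commute[of v u]
   by (simp add: power2_eq_square algebra_simps)
  then show "0 <= t^2 * bform u u - 2 * t * bform u v + bform v v" by (metis bform_nonneg)
 qed (rule bform_nonneg)
 also have "... <= en u * en v" using en_parts[of u] en_parts[of v] by (intro mult_mono) (auto simp: bform_self)
 finally show "\<bar>bform u v\<bar> <= sqrt (en u) * sqrt (en v)"
  by (metis real_sqrt_abs real_sqrt_le_mono real_sqrt_mult)
qed

lemma bounded_lin_forms:
 assumes "Hsr s v"
 shows "Hsr.bounded_lin_on s E (%u. aform s u v)" "Hsr.bounded_lin_on s E (%u. bform u v)"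
 unfolding Hsr.bounded_lin_on_def using assms form_bound[OF _ assms]
 by (auto simp: aform_lc bform_lc1 intro!: exI[of _ "sqrt (en v)"] simp: mult.commute)

lemma small_forms:
 assumes d: "!!n. Hsr s (d n)" "(%n. en (d n)) ~~> 0" and h: "!!n. Hsr s (h n)" "!!n. en (h n) <= R"
 shows "(%n. aform s (d n) (h n)) ~~> 0" "(%n. bform (d n) (h n)) ~~> 0"
proof -
 have t: "(%n. sqrt (en (d n)) * sqrt R) ~~> 0"
  using tendsto_mult_right[OF tendsto_real_sqrt[OF d(2)], of "sqrt R"] by simp
 have le: "sqrt (en (d n)) * sqrt (en (h n)) <= sqrt (en (d n)) * sqrt R" for n
  using h(2) en_parts(4) by (intro mult_left_mono) auto
 show "(%n. aform s (d n) (h n)) ~~> 0"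
  by (rule Lim_null_comparison[OF always_eventually t]) (use order_trans[OF form_bound(1)[OF d(1) h(1)] le] in simp)
 show "(%n. bform (d n) (h n)) ~~> 0"
  by (rule Lim_null_comparison[OF always_eventually t]) (use order_trans[OF form_bound(2)[OF d(1) h(1)] le] in simp)
qed

lemma dpsi_integrable:
 assumes "Hsr s u" "Hsr s (phi :: 'a => real)" shows "integrable lborel (%x. g (u x) * phi x)"
proof -
 have r0: "r > 0" using r_gt_2 by simp
 note pu = pair_L2_Lr[OF r0 HsrD(1)[OF assms(1)] Lr_integrable[OF assms(1)] HsrD(1)[OF assms(2)] Lr_integrable[OF assms(2)]]
 show ?thesis using subcritical_integrable[OF subcritical_g_mult pu(1,3)] by simp
qed

lemma psi_integrable: "Hsr s u ==> integrable lborel (%x::'a. Gprim g (u x))"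
 using subcritical_integrable[OF subcritical_Gprim HsrD(1), of s u] Lr_integrable[of u] by simp

lemma dpsi_lc:
 assumes "Hsr s u" "Hsr s v" "Hsr s w"
 shows "dpsi w (%x. c * u x + d * v x) = c * dpsi w u + d * dpsi w v"
proof -
 have "dpsi w (%x. c * u x + d * v x) = (LINT x|lborel. c * (g (w x) * u x) + d * (g (w x) * v x))"
  unfolding dpsi_def by (rule Bochner_Integration.integral_cong) (auto simp: algebra_simps)
 then show ?thesis using dpsi_integrable[OF assms(3,1)] dpsi_integrable[OF assms(3,2)] by (simp add: dpsi_def)
qed

lemma add_powr_le:
 fixes a b :: real
 assumes "0 <= a" "0 <= b"
 shows "(a + b) powr r <= 2 powr r * (a powr r + b powr r)"
proof -
 have "(a + b) powr r <= (2 * max a b) powr r" using assms r_gt_2 by (intro powr_mono2) auto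
 also have "... = 2 powr r * (max a b) powr r" by (rule powr_mult)
 also have "(max a b) powr r <= a powr r + b powr r" by (auto simp: max_def)
 finally show ?thesis by (simp add: mult_left_mono)
qed

text \<open>Dominated convergence of difference quotients; the growth of \<open>g\<close> with power
  r - 1 makes W^r + C W^2 an integrable majorant.\<close>

lemma psi_deriv:
 assumes u: "Hsr s u" and phi: "Hsr s phi"
 shows "((%y. psi (%x. u x + y * phi x)) has_real_derivative dpsi (%x. u x + t * phi x) phi) (at t)"
 unfolding has_field_derivative_iff tendsto_at_iff_sequentially
proof (intro allI impI)
 fix X :: "nat => real" assume X: "\<forall>i. X i \<in> UNIV - {t}" "X ~~> t"
 have H: "Hsr s (%x. u x + y * phi x)" for y using Hsr_lc[OF u phi, of 1 y] by simp
 obtain C where C: "C >= 0" "!!t. \<bar>g t\<bar> <= 1 * \<bar>t\<bar> powr (r - 1) + C * \<bar>t\<bar>" using g_growth[of 1] by auto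
 \<comment> \<open>For |y - t| <= 1 every intermediate parameter is bounded by \<open>c\<close>, so
   \<open>W\<close> dominates both u + z phi and phi.\<close>
 define c where "c = \<bar>t\<bar> + 1"
 define W where "W x = \<bar>u x\<bar> + c * \<bar>phi x\<bar>" for x
 have c: "c >= 1" by (simp add: c_def)
 have [measurable]: "u \<in> borel_measurable lborel" "phi \<in> borel_measurable lborel" using HsrD(1)[OF u] HsrD(1)[OF phi] by (auto simp: L2_def)
 have L2W: "L2 W" unfolding W_def
  by (rule L2_add[OF L2_bound(1)[OF HsrD(1)[OF u], of _ 1] L2_bound(1)[OF HsrD(1)[OF phi], of _ c]]) (use c in auto)
 have LrW: "integrable lborel (%x. W x powr r)"
 proof (rule Bochner_Integration.integrable_bound)
  show "integrable lborel (%x. 2 powr r * (\<bar>u x\<bar> powr r + c powr r * \<bar>phi x\<bar> powr r))"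
   using Lr_integrable[OF u] Lr_integrable[OF phi] by auto
  show "AE x in lborel. norm (W x powr r) <= norm (2 powr r * (\<bar>u x\<bar> powr r + c powr r * \<bar>phi x\<bar> powr r))"
   using add_powr_le[of "\<bar>u _\<bar>" "c * \<bar>phi _\<bar>"] c by (auto simp: W_def powr_mult)
  show "(%x. W x powr r) \<in> borel_measurable lborel" unfolding W_def by measurable
 qed
 have bound: "\<bar>Gprim g (u x + y * phi x) - Gprim g (u x + t * phi x)\<bar> <= (W x powr r + C * (W x)^2) * \<bar>y - t\<bar>"
  if y: "\<bar>y - t\<bar> <= 1" for x y
 proof -
  have W0: "0 <= W x" using c by (simp add: W_def)
  have "norm (Gprim g (u x + y * phi x) - Gprim g (u x + t * phi x)) <= (W x powr r + C * (W x)^2) * norm (y - t)"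
  proof (rule field_differentiable_bound[of "closed_segment y t" "%z. Gprim g (u x + z * phi x)" "%z. g (u x + z * phi x) * phi x"])
   fix z assume z: "z \<in> closed_segment y t"
   show "((%z. Gprim g (u x + z * phi x)) has_field_derivative g (u x + z * phi x) * phi x) (at z within closed_segment y t)"
    by (rule has_field_derivative_at_within, rule DERIV_chain2[OF Gprim_deriv]) (auto intro!: derivative_eq_intros)
   have "\<bar>z - t\<bar> <= 1" using z y by (auto simp: closed_segment_eq_real_ivl split: if_splits)
   then have "\<bar>z\<bar> <= c" by (simp add: c_def)
   then have "\<bar>z\<bar> * \<bar>phi x\<bar> <= c * \<bar>phi x\<bar>" by (intro mult_right_mono) auto
   then have z1: "\<bar>u x + z * phi x\<bar> <= W x" using abs_triangle_ineq[of "u x" "z * phi x"] by (simp add: W_def abs_mult)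
   have "1 * \<bar>phi x\<bar> <= c * \<bar>phi x\<bar>" using c by (intro mult_right_mono) auto
   then have f1: "\<bar>phi x\<bar> <= W x" by (simp add: W_def)
   have "\<bar>u x + z * phi x\<bar> powr (r - 1) <= W x powr (r - 1)" using z1 r_gt_2 by (intro powr_mono2) auto
   then have "\<bar>g (u x + z * phi x)\<bar> <= W x powr (r - 1) + C * W x"
    using C(2)[of "u x + z * phi x"] mult_left_mono[OF z1 C(1)] by simp
   then have "\<bar>g (u x + z * phi x)\<bar> * \<bar>phi x\<bar> <= (W x powr (r - 1) + C * W x) * W x"
    using f1 W0 C(1) by (intro mult_mono) auto
   also have "... = W x powr r + C * (W x)^2" using powr_Suc_r[of "W x"] W0 by (simp add: distrib_right power2_eq_square)
   finally show "norm (g (u x + z * phi x) * phi x) <= W x powr r + C * (W x)^2" by (simp add: abs_mult)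
  qed auto
  then show ?thesis by simp
 qed
 obtain n0 where n0: "!!n. n >= n0 ==> \<bar>X n - t\<bar> <= 1"
  using LIMSEQ_D[OF X(2), of 1] by (force simp: less_imp_le)
 let ?q = "%n x. (Gprim g (u x + X (n + n0) * phi x) - Gprim g (u x + t * phi x)) / (X (n + n0) - t)"
 have ne: "X n - t ~= 0" for n using X(1) by auto
 have [measurable]: "Gprim g \<in> borel_measurable borel" "g \<in> borel_measurable borel"
  using Gprim_cont g_cont by (auto intro: borel_measurable_continuous_onI)
 have "(%n. LINT x|lborel. ?q n x) ~~> (LINT x|lborel. g (u x + t * phi x) * phi x)"
 proof (rule integral_dominated_convergence[where w = "%x. W x powr r + C * (W x)^2"])
  show "integrable lborel (%x. W x powr r + C * (W x)^2)" using LrW L2_integrable[OF L2W] by simp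
  show "AE x in lborel. (%n. ?q n x) ~~> g (u x + t * phi x) * phi x"
  proof (rule AE_I2)
   fix x
   have "((%z. Gprim g (u x + z * phi x)) has_real_derivative g (u x + t * phi x) * phi x) (at t)"
    by (rule DERIV_chain2[OF Gprim_deriv]) (auto intro!: derivative_eq_intros)
   then have "(%n. (Gprim g (u x + X n * phi x) - Gprim g (u x + t * phi x)) / (X n - t)) ~~> g (u x + t * phi x) * phi x"
    unfolding has_field_derivative_iff tendsto_at_iff_sequentially comp_def using X by blast
   then show "(%n. ?q n x) ~~> g (u x + t * phi x) * phi x" by (rule LIMSEQ_ignore_initial_segment)
  qed
  show "AE x in lborel. norm (?q n x) <= W x powr r + C * (W x)^2" for n
   using bound[OF n0[of "n + n0"]] ne[of "n + n0"] by (auto simp: abs_divide divide_le_eq)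
 qed measurable
 moreover have "(LINT x|lborel. ?q n x) = (psi (%x. u x + X (n + n0) * phi x) - psi (%x. u x + t * phi x)) / (X (n + n0) - t)" for n
  using psi_integrable[OF H] by (simp add: psi_def)
 ultimately have "(%n. (psi (%x. u x + X (n + n0) * phi x) - psi (%x. u x + t * phi x)) / (X (n + n0) - t)) ~~> dpsi (%x. u x + t * phi x) phi"
  by (simp only: dpsi_def)
 then show "((%y. (psi (%x. u x + y * phi x) - psi (%x. u x + t * phi x)) / (y - t)) \<circ> X) ~~> dpsi (%x. u x + t * phi x) phi"
  unfolding comp_def by (rule LIMSEQ_offset)
qed

subsection \<open>The dilation-invariant functional\<close>

text \<open>Dilating \<open>u\<close> to mass m multiplies \<open>aform\<close> by (m / b)^al and
  \<open>psi\<close> by m / b, which is the origin of the two powers in \<open>J\<close>.\<close>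

definition al :: real where "al = 1 - 2 * s / real DIM('a)"

definition J :: "real => ('a => real) => real" where
 "J m u = 1/2 * (m / bform u u) powr al * aform s u u - m / bform u u * psi u"

definition dJ :: "real => ('a => real) => ('a => real) => real" where
 "dJ m u phi = (m / bform u u) powr al * (aform s u phi - al * aform s u u * bform u phi / bform u u)
  - m / bform u u * (dpsi u phi - 2 * psi u * bform u phi / bform u u)"

lemma J_deriv:
 assumes u: "Hsr s u" and phi: "Hsr s phi" and m: "m > 0"
  and pos: "bform (%x. u x + t * phi x) (%x. u x + t * phi x) > 0"
 shows "((%y. J m (%x. u x + y * phi x)) has_real_derivative dJ m (%x. u x + t * phi x) phi) (at t)"
proof -
 define A where "A y = aform s u u + 2 * y * aform s u phi + y^2 * aform s phi phi" for y
 define B where "B y = bform u u + 2 * y * bform u phi + y^2 * bform phi phi" for y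
 have H: "Hsr s (%x. u x + y * phi x)" for y using Hsr_lc[OF u phi, of 1 y] by simp
 have A1: "aform s (%x. u x + y * phi x) w = aform s u w + y * aform s phi w" if "Hsr s w" for y w
  using aform_lc[OF u phi that, of 1 y] by simp
 have B1: "bform (%x. u x + y * phi x) w = bform u w + y * bform phi w" if "Hsr s w" for y w
  using bform_lc1[OF u phi that, of 1 y] by simp
 have A2: "aform s w (%x. u x + y * phi x) = aform s w u + y * aform s w phi" if "Hsr s w" for y w
  using aform_lc2[OF u phi that, of 1 y] by simp
 have B2: "bform w (%x. u x + y * phi x) = bform w u + y * bform w phi" if "Hsr s w" for y w
  using bform_lc2[OF u phi that, of 1 y] by simp
 have Aeq: "aform s (%x. u x + y * phi x) (%x. u x + y * phi x) = A y" for y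
  unfolding A1[OF H] A2[OF u] A2[OF phi] A_def aform_commute[of s phi u] by (simp add: power2_eq_square algebra_simps)
 have Beq: "bform (%x. u x + y * phi x) (%x. u x + y * phi x) = B y" for y
  unfolding B1[OF H] B2[OF u] B2[OF phi] B_def bform_commute[of phi u] by (simp add: power2_eq_square algebra_simps)
 define a b where "a = aform s (%x. u x + t * phi x) phi" and "b = bform (%x. u x + t * phi x) phi"
 have quad: "((%y. c0 + 2 * y * c1 + y^2 * c2) has_real_derivative 2 * (c1 + t * c2)) (at t)" for c0 c1 c2 :: real
  by (auto intro!: derivative_eq_intros simp: algebra_simps)
 have dA: "(A has_real_derivative 2 * a) (at t)" unfolding A_def[abs_def] a_def A1[OF phi] by (rule quad)
 have dB: "(B has_real_derivative 2 * b) (at t)" unfolding B_def[abs_def] b_def B1[OF phi] by (rule quad)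
 have B0: "B t > 0" using pos Beq by simp
 from has_real_derivative_scaled_quotient[OF dA dB psi_deriv[OF u phi] B0 m, of al] show ?thesis
  unfolding J_def dJ_def Aeq Beq a_def b_def .
qed


section \<open>Uniform bounds for the derivative and the gradient\<close>

lemma homogeneous_bound:
 assumes lin: "!!u c. Hsr s u ==> \<l> (%x. c * u x) = c * \<l> u" and c: "c >= 0"
  and b: "!!phi::'a => real. Hsr s phi ==> en phi <= 1 ==> \<bar>\<l> phi\<bar> <= c" and phi: "Hsr s phi"
 shows "\<bar>\<l> phi\<bar> <= c * sqrt (en phi)"
proof (rule field_le_epsilon)
 fix e :: real assume e: "e > 0"
 \<comment> \<open>The added term keeps \<open>k\<close> positive when \<open>phi\<close> has
   seminorm zero.\<close>
 define k where "k = sqrt (en phi) + e / (c + 1)"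
 have k: "k > 0" "sqrt (en phi) <= k" using e c en_parts(4)[of phi] by (auto simp: k_def add_nonneg_pos)
 have H: "Hsr s (%x. (1 / k) * phi x)" using Hsr.scale_mem[of phi s "1/k"] phi by simp
 have "en (%x. (1 / k) * phi x) = (1 / k)^2 * en phi"
  using Hsr.ip_lc_lc[of phi s phi "1/k" 0] phi by simp
 also have "... <= 1"
  using power_mono[OF k(2), of 2] k(1) en_parts(4)[of phi] by (simp add: power_divide)
 finally have "\<bar>\<l> (%x. (1 / k) * phi x)\<bar> <= c" by (rule b[OF H])
 then have "k * \<bar>\<l> (%x. (1 / k) * phi x)\<bar> <= k * c" using k(1) by (intro mult_left_mono) auto
 moreover have "\<bar>\<l> phi\<bar> = k * \<bar>\<l> (%x. (1 / k) * phi x)\<bar>" unfolding lin[OF phi] using k(1) by (simp add: abs_mult)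
 ultimately have "\<bar>\<l> phi\<bar> <= c * k" by (simp only: mult.commute)
 also have "... = c * sqrt (en phi) + c / (c + 1) * e" by (simp add: k_def distrib_left)
 also have "c / (c + 1) * e <= 1 * e" using c e by (intro mult_right_mono) auto
 finally show "\<bar>\<l> phi\<bar> <= c * sqrt (en phi) + e" by simp
qed

lemma en_zero: "en (%_. 0) = 0"
 using Hsr.ip_scale[of "%_::'a. 0" s "%_::'a. 0" 0] by (simp add: Hsr_zero)

lemma dJ_lc:
 assumes "Hsr s u" "Hsr s v" "Hsr s w"
 shows "dJ m w (%x. c * u x + d * v x) = c * dJ m w u + d * dJ m w v"
 unfolding dJ_def aform_lc2[OF assms] bform_lc2[OF assms] dpsi_lc[OF assms]
 by (simp add: algebra_simps add_divide_distrib diff_divide_distrib)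

lemma en_diff_commute: "Hsr s u ==> Hsr s v ==> en (%x. u x - v x) = en (%x. v x - u x)"
 using Hsr.ip_diff_diff[of u s v] Hsr.ip_diff_diff[of v s u] Hsr.ip_commute[of u s v] by simp

lemma nsq_le_en: "nsq u <= en u" "aform s u u <= en u"
 using en_parts[of u] by auto

lemma conv_meas_en:
 assumes "!!n. Hsr s (f n)" "Hsr s u" "(%n. en (%x. f n x - u x)) ~~> 0"
 shows "conv_meas f u"
 by (rule conv_meas_strong[OF HsrD(1)[OF assms(1)] HsrD(1)[OF assms(2)]])
  (rule squeeze_null[OF assms(3)], auto simp: nsq_le_en)

text \<open>Two bounded sequences at vanishing distance share the limit of the derivative along one
  subsequence: the values of the two forms converge after extraction from a bounded subset of R^4,
  and \<open>psi\<close> and \<open>dpsi\<close> depend only on the limits in measure. The lower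
  bound \<open>bt\<close> keeps the denominators away from 0.\<close>

lemma dJ_compact:
 assumes u: "!!n. Hsr s (u n)" "!!n. en (u n) <= R" "!!n. bt <= bform (u n) (u n)"
  and w: "!!n. Hsr s (w n)" "!!n. en (w n) <= R" "!!n. bt <= bform (w n) (w n)"
  and phi: "!!n. Hsr s (phi n)" "!!n. en (phi n) <= R" and bt: "bt > 0" and m: "m > 0"
  and uw: "(%n. en (%x. u n x - w n x)) ~~> 0"
 obtains rho l where "strict_mono (rho :: nat => nat)" "(%n. dJ m (u (rho n)) (phi (rho n))) ~~> l"
  "(%n. dJ m (w (rho n)) (phi (rho n))) ~~> l"
proof -
 obtain rho1 U where 1: "strict_mono (rho1 :: nat => nat)" "Hsr s U" "conv_meas (%n. u (rho1 n)) U"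
  using weak_limit[of u R] u by metis
 obtain rho2 \<Phi> where 2: "strict_mono (rho2 :: nat => nat)" "Hsr s \<Phi>" "conv_meas (%n. phi (rho1 (rho2 n))) \<Phi>"
  using weak_limit[of "%n. phi (rho1 n)" R] phi by metis
 define X where "X n = (let v = u (rho1 (rho2 n)); f = phi (rho1 (rho2 n)) in (aform s v v, bform v v, aform s v f, bform v f))" for n
 have R0: "0 <= R" using en_parts(4)[of "u 0"] u(2)[of 0] by linarith
 have le: "sqrt (en p) * sqrt (en q) <= R" if "en p <= R" "en q <= R" for p q
 proof -
  have "sqrt (en p) * sqrt (en q) <= sqrt R * sqrt R" using that en_parts(4) R0 by (intro mult_mono) auto
  then show ?thesis using R0 by simp
 qed
 have bd: "range X \<subseteq> {-R..R} \<times> {-R..R} \<times> {-R..R} \<times> {-R..R}"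
 proof -
  have "aform s p q \<in> {-R..R}" "bform p q \<in> {-R..R}" if "Hsr s p" "Hsr s q" "en p <= R" "en q <= R" for p q
   using form_bound[OF that(1,2)] le[OF that(3,4)] by (auto simp: abs_le_iff)
  then show ?thesis using u phi by (auto simp: X_def Let_def simp del: atLeastAtMost_iff)
 qed
 have "bounded (range X)" by (rule bounded_subset[OF _ bd]) (intro bounded_Times bounded_closed_interval)
 then obtain l rho3 where 3: "strict_mono (rho3 :: nat => nat)" "(X \<circ> rho3) ~~> l"
  using bounded_imp_convergent_subsequence[of X] by blast
 define rho where "rho n = rho1 (rho2 (rho3 n))" for n
 have rho: "strict_mono rho" using 1(1) 2(1) 3(1) by (simp add: rho_def strict_mono_def)
 obtain A B a b where l: "l = (A, B, a, b)" by (cases l)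
 have lims: "(%n. aform s (u (rho n)) (u (rho n))) ~~> A" "(%n. bform (u (rho n)) (u (rho n))) ~~> B"
  "(%n. aform s (u (rho n)) (phi (rho n))) ~~> a" "(%n. bform (u (rho n)) (phi (rho n))) ~~> b"
  using tendsto_fst[OF 3(2)] tendsto_fst[OF tendsto_snd[OF 3(2)]] tendsto_fst[OF tendsto_snd[OF tendsto_snd[OF 3(2)]]]
   tendsto_snd[OF tendsto_snd[OF tendsto_snd[OF 3(2)]]]
  by (simp_all add: X_def Let_def l rho_def comp_def)
 let ?d = "%n x. u (rho n) x - w (rho n) x"
 have dH: "Hsr s (?d n)" for n using Hsr.diff_mem[of "u (rho n)" s "w (rho n)"] u w by simp
 have d0: "(%n. en (?d n)) ~~> 0" using LIMSEQ_subseq_LIMSEQ[OF uw rho] by (simp add: comp_def)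
 have da: "aform s (?d n) f = aform s (u (rho n)) f - aform s (w (rho n)) f"
  and db: "bform (?d n) f = bform (u (rho n)) f - bform (w (rho n)) f" if "Hsr s f" for f :: "'a => real" and n
  using aform_lc[OF u(1)[of "rho n"] w(1)[of "rho n"] that, of 1 "-1"] bform_lc1[OF u(1)[of "rho n"] w(1)[of "rho n"] that, of 1 "-1"] by simp_all
 have wlims: "(%n. aform s (w (rho n)) (w (rho n))) ~~> A" "(%n. bform (w (rho n)) (w (rho n))) ~~> B"
  "(%n. aform s (w (rho n)) (phi (rho n))) ~~> a" "(%n. bform (w (rho n)) (phi (rho n))) ~~> b"
 proof -
  note sm = small_forms[OF dH d0]
  note su = sm[of "%n. u (rho n)", OF u(1,2)] and sw = sm[of "%n. w (rho n)", OF w(1,2)] and sp = sm[of "%n. phi (rho n)", OF phi(1,2)]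
  show "(%n. aform s (w (rho n)) (phi (rho n))) ~~> a" "(%n. bform (w (rho n)) (phi (rho n))) ~~> b"
   using tendsto_diff[OF lims(3) sp(1)] tendsto_diff[OF lims(4) sp(2)] by (simp_all add: da db phi(1))
  show "(%n. aform s (w (rho n)) (w (rho n))) ~~> A" "(%n. bform (w (rho n)) (w (rho n))) ~~> B"
   using tendsto_diff[OF tendsto_diff[OF lims(1) su(1)] sw(1)] tendsto_diff[OF tendsto_diff[OF lims(2) su(2)] sw(2)]
   by (simp_all add: da db u(1) w(1) aform_commute[of s "w (rho _)" "u (rho _)"] bform_commute[of "w (rho _)" "u (rho _)"])
 qed
 have cu: "conv_meas (%n. u (rho n)) U" and cp: "conv_meas (%n. phi (rho n)) \<Phi>"
  using conv_meas_subseq[OF conv_meas_subseq[OF 1(3) 2(1)] 3(1)] conv_meas_subseq[OF 2(3) 3(1)] by (simp_all add: rho_def)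
 have cd: "conv_meas ?d (%_. 0)" using d0 by (intro conv_meas_en dH Hsr_zero) simp
 have cw: "conv_meas (%n. w (rho n)) U"
  by (rule conv_meas_sum_bound[OF cu HsrD(1)[OF u(1)] HsrD(1)[OF 1(2)] cd HsrD(1)[OF dH] L2_zero HsrD(1)[OF w(1)] HsrD(1)[OF 1(2)]]) simp
 note fin = cu 1(2) u phi 2(2) cp w cw
 have p: "(%n. psi (u (rho n))) ~~> psi U" "(%n. psi (w (rho n))) ~~> psi U"
  "(%n. dpsi (u (rho n)) (phi (rho n))) ~~> dpsi U \<Phi>" "(%n. dpsi (w (rho n)) (phi (rho n))) ~~> dpsi U \<Phi>"
  by (intro psi_tendsto[where R=R] dpsi_tendsto[where R=R] fin)+
 have B: "B > 0" using LIMSEQ_le_const[OF lims(2), of bt] u(3) bt by force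
 let ?l = "(m / B) powr al * (a - al * A * b / B) - m / B * (dpsi U \<Phi> - 2 * psi U * b / B)"
 have "(%n. dJ m (u (rho n)) (phi (rho n))) ~~> ?l" unfolding dJ_def
  by (intro tendsto_intros lims p) (use B m in auto)
 moreover have "(%n. dJ m (w (rho n)) (phi (rho n))) ~~> ?l" unfolding dJ_def
  by (intro tendsto_intros wlims p) (use B m in auto)
 ultimately show ?thesis using that rho by blast
qed

text \<open>By contradiction from \<open>dJ_compact\<close>, with equal sequences for the bound and
  two sequences for the uniform continuity. As \<open>g\<close> is only continuous, compactness is
  the source of uniformity.\<close>

lemma dJ_uniform:
 assumes bt: "bt > 0" and m: "m > 0"
 shows "\<exists>C\<ge>0. \<forall>u phi. Hsr s u --> en u <= R --> bt <= bform u u --> Hsr s phi --> \<bar>dJ m u phi\<bar> <= C * sqrt (en phi)" (is ?bd)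
  and "e > 0 ==> \<exists>d>0. \<forall>u w phi. Hsr s u --> en u <= R --> bt <= bform u u --> Hsr s w --> en w <= R --> bt <= bform w w -->
   en (%x. u x - w x) <= d --> Hsr s phi --> \<bar>dJ m u phi - dJ m w phi\<bar> <= e * sqrt (en phi)" (is "_ ==> ?uc")
proof -
 have hom: "dJ m u (%x. c * phi x) = c * dJ m u phi" if "Hsr s u" "Hsr s phi" for u phi :: "'a => real" and c
  using dJ_lc[OF that(2,2,1), of m c 0] by simp
 define P where "P u \<longleftrightarrow> Hsr s u & en u <= R & bt <= bform u u" for u
 have "\<exists>C\<ge>0. \<forall>u phi. P u --> Hsr s phi --> en phi <= 1 --> \<bar>dJ m u phi\<bar> <= C"
 proof (rule ccontr)
  assume no: "\<not> ?thesis"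
  have "\<exists>u phi. P u & Hsr s phi & en phi <= 1 & real n < \<bar>dJ m u phi\<bar>" for n :: nat
  proof (rule ccontr)
   assume "\<not> ?thesis"
   then have "\<forall>u phi. P u --> Hsr s phi --> en phi <= 1 --> \<bar>dJ m u phi\<bar> <= real n" by (simp add: not_less)
   moreover have "0 <= real n" by simp
   ultimately show False using no by blast
  qed
  then obtain u phi where u: "!!n. P (u n)" "!!n. Hsr s (phi n)" "!!n. en (phi n) <= 1" "!!n. real n < \<bar>dJ m (u n) (phi n)\<bar>" by metis
  obtain rho l where rho: "strict_mono (rho :: nat => nat)" "(%n. dJ m (u (rho n)) (phi (rho n))) ~~> l"
   by (rule dJ_compact[of u "max R 1" bt u phi m]) (use u(1-3) bt m in "auto simp: P_def le_max_iff_disj en_zero")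
  have "Bseq (%n. dJ m (u (rho n)) (phi (rho n)))" using rho(2) by (auto intro!: convergent_imp_Bseq simp: convergent_def)
  then obtain K where "\<forall>n. norm (dJ m (u (rho n)) (phi (rho n))) <= K" unfolding Bseq_def by blast
  then have K: "\<bar>dJ m (u (rho n)) (phi (rho n))\<bar> <= K" for n by (simp only: real_norm_def)
  obtain n where "K < real n" using reals_Archimedean2 by blast
  also have "real n <= real (rho n)" using seq_suble[OF rho(1)] by simp
  finally show False using u(4)[of "rho n"] K[of n] by linarith
 qed
 then obtain C where C: "C >= 0" "!!u phi. P u ==> Hsr s phi ==> en phi <= 1 ==> \<bar>dJ m u phi\<bar> <= C" by blast
 show ?bd
 proof (intro exI[of _ C] conjI allI impI C(1))
  fix u phi :: "'a => real" assume u: "Hsr s u" "en u <= R" "bt <= bform u u" and phi: "Hsr s phi"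
  have P: "P u" using u by (simp add: P_def)
  show "\<bar>dJ m u phi\<bar> <= C * sqrt (en phi)" by (rule homogeneous_bound[OF hom[OF u(1)] C(1) C(2)[OF P] phi])
 qed
 assume e: "e > 0"
 have "\<exists>d>0. \<forall>u w phi. P u --> P w --> en (%x. u x - w x) <= d --> Hsr s phi --> en phi <= 1 --> \<bar>dJ m u phi - dJ m w phi\<bar> <= e"
 proof (rule ccontr)
  assume no: "\<not> ?thesis"
  define Q where "Q n u w phi \<longleftrightarrow> P u & P w & en (%x. u x - w x) <= inverse (real (Suc n)) & Hsr s phi & en phi <= 1 & e < \<bar>dJ m u phi - dJ m w phi\<bar>" for n u w phi
  have "\<exists>u w phi. Q n u w phi" for n
  proof (rule ccontr)
   assume "\<not> ?thesis"
   then have "\<forall>u w phi. P u --> P w --> en (%x. u x - w x) <= inverse (real (Suc n)) --> Hsr s phi --> en phi <= 1 --> \<bar>dJ m u phi - dJ m w phi\<bar> <= e"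
    by (simp add: Q_def not_less)
   then have "\<exists>d>0. \<forall>u w phi. P u --> P w --> en (%x. u x - w x) <= d --> Hsr s phi --> en phi <= 1 --> \<bar>dJ m u phi - dJ m w phi\<bar> <= e"
    by (intro exI[of _ "inverse (real (Suc n))"] conjI) simp_all
   with no show False by (rule notE)
  qed
  then obtain u w phi where Q: "!!n. Q n (u n) (w n) (phi n)" by metis
  then have u: "P (u n)" "P (w n)" "en (%x. u n x - w n x) <= inverse (real (Suc n))" "Hsr s (phi n)" "en (phi n) <= 1"
   "e < \<bar>dJ m (u n) (phi n) - dJ m (w n) (phi n)\<bar>" for n using Q[of n] unfolding Q_def by blast+
  have d: "(%n. en (%x. u n x - w n x)) ~~> 0"
   by (rule squeeze_null[OF LIMSEQ_inverse_real_of_nat])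
    (use u(3) en_parts(4) in auto)
  obtain rho l where rho: "strict_mono (rho :: nat => nat)" "(%n. dJ m (u (rho n)) (phi (rho n))) ~~> l" "(%n. dJ m (w (rho n)) (phi (rho n))) ~~> l"
   by (rule dJ_compact[of u "max R 1" bt w phi m]) (use u(1,2,4,5) d bt m in "auto simp: P_def le_max_iff_disj")
  have "(%n. \<bar>dJ m (u (rho n)) (phi (rho n)) - dJ m (w (rho n)) (phi (rho n))\<bar>) ~~> \<bar>l - l\<bar>" by (intro tendsto_intros rho)
  from LIMSEQ_le_const[OF this, of e] show False using u(6) e by (force simp: less_imp_le)
 qed
 then obtain d where d: "d > 0" "!!u w phi. P u ==> P w ==> en (%x. u x - w x) <= d ==> Hsr s phi ==> en phi <= 1 ==> \<bar>dJ m u phi - dJ m w phi\<bar> <= e" by blast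
 show ?uc
 proof (intro exI[of _ d] conjI allI impI d(1))
  fix u w phi :: "'a => real" assume u: "Hsr s u" "en u <= R" "bt <= bform u u" and w: "Hsr s w" "en w <= R" "bt <= bform w w"
   and uw: "en (%x. u x - w x) <= d" and phi: "Hsr s phi"
  have P: "P u" "P w" using u w by (simp_all add: P_def)
  have lin: "dJ m u (%x. c * v x) - dJ m w (%x. c * v x) = c * (dJ m u v - dJ m w v)" if "Hsr s v" for v c
   unfolding hom[OF u(1) that] hom[OF w(1) that] by (simp only: right_diff_distrib)
  show "\<bar>dJ m u phi - dJ m w phi\<bar> <= e * sqrt (en phi)"
   by (rule homogeneous_bound[of "%phi. dJ m u phi - dJ m w phi", OF lin less_imp_le[OF e] d(2)[OF P uw] phi])
 qed
qed

text \<open>The gradient as a Riesz representative, unique only up to seminorm zero and hence picked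
  by choice.\<close>

definition GJ :: "real => ('a => real) => 'a => real" where
 "GJ m u = (SOME w. Hsr s w & (\<forall>phi. Hsr s phi --> eform s w phi = dJ m u phi))"

lemma GJ:
 assumes u: "Hsr s u" and pos: "bform u u > 0" and m: "m > 0"
 shows "Hsr s (GJ m u)" "!!phi. Hsr s phi ==> eform s (GJ m u) phi = dJ m u phi"
proof -
 obtain C where C: "!!phi. Hsr s phi ==> \<bar>dJ m u phi\<bar> <= C * sqrt (en phi)" using dJ_uniform(1)[OF pos m, of "en u"] u by blast
 have b: "Hsr.bounded_lin_on s E (dJ m u)"
  unfolding Hsr.bounded_lin_on_def using C by (auto simp: dJ_lc u)
 have V: "Hsr.closed_subspace s E"
  unfolding Hsr.closed_subspace_def using Hsr_zero Hsr_lc by auto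
 from Hsr.Riesz[OF V b] have "\<exists>w. Hsr s w & (\<forall>phi. Hsr s phi --> eform s w phi = dJ m u phi)" by auto
 from someI_ex[OF this] show "Hsr s (GJ m u)" "!!phi. Hsr s phi ==> eform s (GJ m u) phi = dJ m u phi" unfolding GJ_def by blast+
qed

lemma sqrt_le_of_sq:
 fixes x C :: real
 assumes "x <= C * sqrt x" "0 <= x" "0 <= C" shows "sqrt x <= C"
proof (cases "x = 0")
 case False
 then have "sqrt x > 0" using assms(2) by simp
 moreover have "sqrt x * sqrt x <= C * sqrt x" using assms(1,2) by simp
 ultimately show ?thesis by (rule mult_right_le_imp_le[rotated])
qed (use assms in simp)

text \<open>Both bounds follow by testing the derivative with the representative itself, or with the
  difference of two of them.\<close>

lemma GJ_uniform:
 assumes bt: "bt > 0" and m: "m > 0"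
 shows "\<exists>C\<ge>0. \<forall>u. Hsr s u --> en u <= R --> bt <= bform u u --> sqrt (en (GJ m u)) <= C"
  and "e > 0 ==> \<exists>d>0. \<forall>u w. Hsr s u --> en u <= R --> bt <= bform u u --> Hsr s w --> en w <= R --> bt <= bform w w -->
   en (%x. u x - w x) <= d --> sqrt (en (%x. GJ m u x - GJ m w x)) <= e"
proof -
 obtain C where C: "C >= 0" "!!u phi. Hsr s u ==> en u <= R ==> bt <= bform u u ==> Hsr s phi ==> \<bar>dJ m u phi\<bar> <= C * sqrt (en phi)"
  using dJ_uniform(1)[OF bt m, of R] by blast
 have "sqrt (en (GJ m u)) <= C" if "Hsr s u" "en u <= R" "bt <= bform u u" for u
 proof (rule sqrt_le_of_sq)
  have pos: "bform u u > 0" using that bt by linarith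
  show "en (GJ m u) <= C * sqrt (en (GJ m u))"
   using GJ[OF that(1) pos m] C(2)[OF that GJ(1)[OF that(1) pos m]] by (simp add: abs_le_iff)
 qed (use C(1) en_parts(4) in auto)
 then show "\<exists>C\<ge>0. \<forall>u. Hsr s u --> en u <= R --> bt <= bform u u --> sqrt (en (GJ m u)) <= C" using C(1) by blast
 assume e: "e > 0"
 obtain d where d: "d > 0" "!!u w phi. Hsr s u ==> en u <= R ==> bt <= bform u u ==> Hsr s w ==> en w <= R ==> bt <= bform w w ==>
   en (%x. u x - w x) <= d ==> Hsr s phi ==> \<bar>dJ m u phi - dJ m w phi\<bar> <= e * sqrt (en phi)"
  using dJ_uniform(2)[OF bt m e, of R] by blast
 have "sqrt (en (%x. GJ m u x - GJ m w x)) <= e" if P: "Hsr s u" "en u <= R" "bt <= bform u u" "Hsr s w" "en w <= R" "bt <= bform w w"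
  "en (%x. u x - w x) <= d" for u w
 proof (rule sqrt_le_of_sq)
  have pos: "bform u u > 0" "bform w w > 0" using P bt by linarith+
  let ?D = "%x. GJ m u x - GJ m w x"
  have D: "Hsr s ?D" using Hsr.diff_mem[of "GJ m u" s "GJ m w"] GJ(1) P pos m by simp
  have "en ?D = eform s (GJ m u) ?D - eform s (GJ m w) ?D"
   using Hsr.ip_diff[of "GJ m u" s "GJ m w" ?D] GJ(1) P pos m D by simp
  also have "... = dJ m u ?D - dJ m w ?D" using GJ(2)[OF P(1) pos(1) m D] GJ(2)[OF P(4) pos(2) m D] by simp
  finally show "en ?D <= e * sqrt (en ?D)" using d(2)[OF P D] by linarith
 qed (use e en_parts(4) in auto)
 then show "\<exists>d>0. \<forall>u w. Hsr s u --> en u <= R --> bt <= bform u u --> Hsr s w --> en w <= R --> bt <= bform w w -->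
   en (%x. u x - w x) <= d --> sqrt (en (%x. GJ m u x - GJ m w x)) <= e" using d(1) by blast
qed

end

subsection \<open>Dilations\<close>

lemma WT_dilate:
 fixes u :: "'a::euclidean_space => real"
 assumes u: "L2 u" and k: "k > 0"
 shows "AE xi in lborel. WT s (%x. u (k *\<^sub>R x)) xi = (k powr s / k ^ DIM('a)) *\<^sub>R WT s u ((1 / k) *\<^sub>R xi)"
proof -
 have L: "L2 (%x. u (k *\<^sub>R x))" using L2_affine[OF _ u, of k 0] k by simp
 have "AE xi in lborel. FT (%x. u (k *\<^sub>R x)) xi = complex_of_real (1 / k ^ DIM('a)) * FT u ((1 / k) *\<^sub>R xi)"
  by (rule L2_fourier_unique[OF FT[OF L] L2_fourier_dilate[OF FT[OF u] k]])
 then show ?thesis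
 proof eventually_elim
  case (elim xi)
  have "norm xi = k * norm ((1 / k) *\<^sub>R xi)" using k by simp
  then have "norm xi powr s = k powr s * norm ((1 / k) *\<^sub>R xi) powr s" using k by (metis powr_mult)
  then show ?case unfolding WT_def elim scaleR_conv_of_real by simp
 qed
qed

lemma dilate_forms:
 fixes u :: "'a::euclidean_space => real"
 assumes u: "Hsr s u" and k: "k > 0"
 shows "Hsr s (%x. u (k *\<^sub>R x))"
  "aform s (%x. u (k *\<^sub>R x)) (%x. u (k *\<^sub>R x)) = k powr (2 * s) / k ^ DIM('a) * aform s u u"
  "bform (%x. u (k *\<^sub>R x)) (%x. u (k *\<^sub>R x)) = bform u u / k ^ DIM('a)"
proof -
 have L: "L2 (%x. u (k *\<^sub>R x))" using L2_affine[OF _ HsrD(1)[OF u], of k 0] k by simp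
 have LW: "L2 (%xi. WT s u ((1 / k) *\<^sub>R xi))" using L2_affine[OF _ HsrD(2)[OF u], of "1 / k" 0] k by simp
 have m: "WT s (%x. u (k *\<^sub>R x)) \<in> borel_measurable lborel" "(%xi. (k powr s / k ^ DIM('a)) *\<^sub>R WT s u ((1 / k) *\<^sub>R xi)) \<in> borel_measurable lborel"
  using WT_measurable[OF L, of s] L2_scaleR[OF LW] by (auto simp: L2_def)
 have LW2: "L2 (WT s (%x. u (k *\<^sub>R x)))"
  by (rule L2_cong_AE[OF L2_scaleR[OF LW, of "k powr s / k ^ DIM('a)"] m(1)]) (use WT_dilate[OF HsrD(1)[OF u] k, of s] in eventually_elim, simp)
 show "Hsr s (%x. u (k *\<^sub>R x))" using L LW2 HsrD(3)[OF u] by (auto simp: Hsr_iff radial_def)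
 have "nsq (WT s (%x. u (k *\<^sub>R x))) = nsq (%xi. (k powr s / k ^ DIM('a)) *\<^sub>R WT s u ((1 / k) *\<^sub>R xi))"
  by (rule nsq_cong_AE[OF m WT_dilate[OF HsrD(1)[OF u] k]])
 also have "... = (k powr s / k ^ DIM('a))^2 * (nsq (WT s u) / \<bar>1 / k\<bar> ^ DIM('a))"
  using nsq_affine[of "1 / k" "WT s u" 0] k by (simp only: nsq_scaleR) simp
 also have "... = k powr (2 * s) / k ^ DIM('a) * nsq (WT s u)"
  using k by (simp add: power_divide powr_sq power2_eq_square[of "k ^ DIM('a)"])
 finally show "aform s (%x. u (k *\<^sub>R x)) (%x. u (k *\<^sub>R x)) = k powr (2 * s) / k ^ DIM('a) * aform s u u"
  by (simp only: aform_self)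
 show "bform (%x. u (k *\<^sub>R x)) (%x. u (k *\<^sub>R x)) = bform u u / k ^ DIM('a)"
  using nsq_affine[of k u 0] k by (simp add: bform_self)
qed

text \<open>Meant for the weighted transform, which is complex valued; real and imaginary parts are
  treated separately.\<close>

lemma (in near_identity) L2_continuous_complex:
 fixes f :: "'a => complex"
 assumes f: "L2 f"
 shows "(%n. nsq (%x. f (T n x) - f x)) ~~> 0"
proof -
 have m: "f \<in> borel_measurable lborel" using f by (simp add: L2_def)
 have L: "L2 (%x. Re (f x))" "L2 (%x. Im (f x))"
  by (rule L2_bound(1)[OF f measurable_compose[OF m borel_measurable_Re] AE_I2, of 1], simp add: abs_Re_le_cmod,
    rule L2_bound(1)[OF f measurable_compose[OF m borel_measurable_Im] AE_I2, of 1], simp add: abs_Im_le_cmod)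
 have mT: "(%x. h (T n x)) \<in> borel_measurable lborel" if "h \<in> borel_measurable borel" for h :: "'a => real" and n
  using measurable_compose[OF T_measurable that, of n] by simp
 have LT: "L2 (%x. h (T n x))" if "L2 h" for h :: "'a => real" and n
  using integrable_T(1)[OF L2_integrable[OF that], of n] mT[of h n] L2_measurable_borel[OF that] by (simp add: L2_def)
 have "nsq (%x. f (T n x) - f x) = nsq (%x. Re (f (T n x)) - Re (f x)) + nsq (%x. Im (f (T n x)) - Im (f x))" for n
  unfolding nsq_def using L2_integrable[OF L2_diff[OF LT[OF L(1), of n] L(1)]] L2_integrable[OF L2_diff[OF LT[OF L(2), of n] L(2)]]
  by (subst Bochner_Integration.integral_add[symmetric]) (simp_all add: cmod_power2)
 then show ?thesis using tendsto_add[OF L2_continuous[OF L(1)] L2_continuous[OF L(2)]] by simp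
qed

context fractional_nls
begin

lemma en_add_le: "Hsr s u ==> Hsr s v ==> en (%x. u x + v x) <= 2 * en u + 2 * en v"
 using Hsr.ip_lc_lc[of u s v 1 "-1"] Hsr.ip_lc_lc[of u s v 1 1] en_parts(4)[of "%x. u x - v x"] by simp

text \<open>Strong continuity of dilations in H^s. On the frequency side a dilation by k becomes one
  by 1 / k with a scalar factor \<open>?c n\<close> tending to 1, so both parts of the norm reduce
  to continuity in L^2.\<close>

lemma dilate_near_identity:
 assumes u: "Hsr s u" and k: "k ~~> 1" "!!n. k n > 0"
 shows "(%n. en (%x. u (k n *\<^sub>R x) - u x)) ~~> 0"
proof -
 interpret D: near_identity "%n (x::'a). k n *\<^sub>R x" "%n. 1 / k n ^ DIM('a)" by (rule near_identity_dilation[OF k])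
 have k': "(%n. 1 / k n) ~~> 1" "!!n. 1 / k n > 0" using tendsto_divide[OF tendsto_const[of 1] k(1)] k(2) by auto
 interpret D': near_identity "%n (x::'a). (1 / k n) *\<^sub>R x" "%n. 1 / (1 / k n) ^ DIM('a)" by (rule near_identity_dilation[OF k'])
 let ?F = "WT s u" and ?c = "%n. k n powr s / k n ^ DIM('a)"
 note Lu = HsrD(1)[OF u] and LF = HsrD(2)[OF u]
 have LT: "L2 (%xi. ?F ((1 / k n) *\<^sub>R xi))" for n using L2_affine[OF _ LF, of "1 / k n" 0] k(2)[of n] by simp
 have eq: "aform s (%x. u (k n *\<^sub>R x) - u x) (%x. u (k n *\<^sub>R x) - u x) <= 2 * ((?c n)^2 * nsq (%xi. ?F ((1 / k n) *\<^sub>R xi) - ?F xi)) + 2 * ((?c n - 1)^2 * nsq ?F)" for n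
 proof -
  have Hd: "Hsr s (%x. u (k n *\<^sub>R x))" by (rule dilate_forms(1)[OF u k(2)])
  have L1: "L2 (%xi. ?c n *\<^sub>R (?F ((1 / k n) *\<^sub>R xi) - ?F xi) + (?c n - 1) *\<^sub>R ?F xi)"
   by (intro L2_add L2_scaleR L2_diff LT LF)
  have "aform s (%x. u (k n *\<^sub>R x) - u x) (%x. u (k n *\<^sub>R x) - u x) = nsq (%xi. WT s (%x. u (k n *\<^sub>R x)) xi - ?F xi)"
   by (rule aform_diff_self[OF Hd u])
  also have "... = nsq (%xi. ?c n *\<^sub>R (?F ((1 / k n) *\<^sub>R xi) - ?F xi) + (?c n - 1) *\<^sub>R ?F xi)"
  proof (rule nsq_cong_AE)
   show "(%xi. WT s (%x. u (k n *\<^sub>R x)) xi - ?F xi) \<in> borel_measurable lborel" using L2_diff[OF HsrD(2)[OF Hd] LF] by (simp add: L2_def)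
   show "(%xi. ?c n *\<^sub>R (?F ((1 / k n) *\<^sub>R xi) - ?F xi) + (?c n - 1) *\<^sub>R ?F xi) \<in> borel_measurable lborel" using L1 by (simp only: L2_def)
   show "AE xi in lborel. WT s (%x. u (k n *\<^sub>R x)) xi - ?F xi = ?c n *\<^sub>R (?F ((1 / k n) *\<^sub>R xi) - ?F xi) + (?c n - 1) *\<^sub>R ?F xi"
    using WT_dilate[OF Lu k(2), of s n] by eventually_elim (simp add: algebra_simps)
  qed
  also have "... <= 2 * nsq (%xi. ?c n *\<^sub>R (?F ((1 / k n) *\<^sub>R xi) - ?F xi)) + 2 * nsq (%xi. (?c n - 1) *\<^sub>R ?F xi)"
   by (intro nsq_add_le L2_scaleR L2_diff LT LF)
  finally show ?thesis by (simp only: nsq_scaleR)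
 qed
 have "(%n. 2 * ((?c n)^2 * nsq (%xi. ?F ((1 / k n) *\<^sub>R xi) - ?F xi)) + 2 * ((?c n - 1)^2 * nsq ?F))
  ~~> 2 * ((1 powr s / 1 ^ DIM('a))^2 * 0) + 2 * ((1 powr s / 1 ^ DIM('a) - 1)^2 * nsq ?F)"
  by (intro tendsto_intros k(1) D'.L2_continuous_complex[OF LF]) auto
 then have t: "(%n. 2 * ((?c n)^2 * nsq (%xi. ?F ((1 / k n) *\<^sub>R xi) - ?F xi)) + 2 * ((?c n - 1)^2 * nsq ?F)) ~~> 0" by simp
 have "(%n. aform s (%x. u (k n *\<^sub>R x) - u x) (%x. u (k n *\<^sub>R x) - u x)) ~~> 0"
  by (rule squeeze_null[OF t]) (intro allI aform_nonneg, intro allI eq)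
 from tendsto_add[OF this D.L2_continuous[OF Lu]] show ?thesis by (simp add: eform_def bform_self)
qed

text \<open>Mass is restored by dilation and not by rescaling the amplitude, because
  \<open>J\<close> is invariant under dilations. The factor k solves k^N = b / m.\<close>

definition normalize :: "real => ('a => real) => 'a => real" where
 "normalize m u x = u (((bform u u / m) powr (1 / real DIM('a))) *\<^sub>R x)"

lemma normalize:
 assumes u: "Hsr s u" and pos: "bform u u > 0" and m: "m > 0"
 shows "Hsr s (normalize m u)" "bform (normalize m u) (normalize m u) = m" "J m (normalize m u) = J m u"
proof -
 define k where "k = (bform u u / m) powr (1 / real DIM('a))"
 have k: "k > 0" using pos m by (simp add: k_def)
 have n: "normalize m u = (%x. u (k *\<^sub>R x))" by (simp add: normalize_def k_def fun_eq_iff)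
 have kN: "k ^ DIM('a) = bform u u / m" using pos m k by (simp add: k_def powr_powr flip: powr_realpow)
 note d = dilate_forms[OF u k]
 show "Hsr s (normalize m u)" using d(1) by (simp add: n)
 show b: "bform (normalize m u) (normalize m u) = m" using d(3) pos m by (simp add: n kN)
 have "psi (normalize m u) = psi u / k ^ DIM('a)"
  using integral_affine[of k "%x. Gprim g (u x)" 0] k by (simp add: n psi_def)
 then have p: "psi (normalize m u) = m / bform u u * psi u" using pos m by (simp add: kN)
 have "k powr (2 * s) = (bform u u / m) powr (2 * s / real DIM('a))" by (simp add: k_def powr_powr)
 then have "k powr (2 * s) / k ^ DIM('a) = (bform u u / m) powr (2 * s / real DIM('a) - 1)"
  using pos m by (simp add: kN powr_diff)
 also have "2 * s / real DIM('a) - 1 = - al" by (simp add: al_def)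
 also have "(bform u u / m) powr (- al) = (m / bform u u) powr al" using pos m by (simp add: powr_minus powr_divide)
 finally have a: "aform s (normalize m u) (normalize m u) = (m / bform u u) powr al * aform s u u" using d(2) by (simp add: n)
 show "J m (normalize m u) = J m u" using m by (simp add: J_def b a p)
qed

lemma normalize_uminus: "normalize m (%x. - u x) = (%x. - normalize m u x)"
 by (simp add: normalize_def fun_eq_iff bform_def)

lemma en_tendsto_bform:
 assumes f: "!!n. Hsr s (f n)" and u: "Hsr s u" and c: "(%n. en (%x. f n x - u x)) ~~> 0"
 shows "(%n. bform (f n) (f n)) ~~> bform u u"
 unfolding bform_self
 by (rule nsq_tendsto[OF HsrD(1)[OF f] HsrD(1)[OF u]])
  (rule squeeze_null[OF c], auto simp: nsq_le_en)

text \<open>Dilations are strongly but not uniformly continuous. So the variable dilation is applied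
  to the difference, where only its norm matters, and otherwise to the fixed function
  \<open>?v\<close>, with a ratio \<open>?q n\<close> tending to 1.\<close>

lemma normalize_continuous:
 assumes f: "!!n. Hsr s (f n)" and u: "Hsr s u" and c: "(%n. en (%x. f n x - u x)) ~~> 0"
  and pos: "!!n. bform (f n) (f n) > 0" "bform u u > 0" and m: "m > 0"
 shows "(%n. en (%x. normalize m (f n) x - normalize m u x)) ~~> 0"
proof -
 define k where "k v = (bform v v / m) powr (1 / real DIM('a))" for v :: "'a => real"
 have kpos: "k (f n) > 0" "k u > 0" for n using pos(1)[of n] pos(2) m by (auto simp: k_def)
 have kt: "(%n. k (f n)) ~~> k u"
  unfolding k_def by (intro tendsto_intros en_tendsto_bform f u c) (use pos m in auto)
 let ?v = "%x. u (k u *\<^sub>R x)" and ?q = "%n. k (f n) / k u"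
 have v: "Hsr s ?v" by (rule dilate_forms(1)[OF u kpos(2)])
 have d: "Hsr s (%x. f n x - u x)" for n using Hsr.diff_mem[of "f n" s u] f u by simp
 have q: "?q ~~> 1" "!!n. ?q n > 0" using tendsto_divide[OF kt tendsto_const[of "k u"]] kpos by auto
 have t2: "(%n. en (%x. ?v (?q n *\<^sub>R x) - ?v x)) ~~> 0" by (rule dilate_near_identity[OF v q])
 let ?a = "%n. aform s (%x. f n x - u x) (%x. f n x - u x)" and ?b = "%n. bform (%x. f n x - u x) (%x. f n x - u x)"
 have ab: "?a ~~> 0" "?b ~~> 0"
  by (rule squeeze_null[OF c], use en_parts(1)[of "%x. f _ x - u x"] nsq_le_en in "simp_all add: bform_self")+
 have "(%n. k (f n) powr (2 * s) / k (f n) ^ DIM('a) * ?a n + ?b n / k (f n) ^ DIM('a)) ~~> k u powr (2 * s) / k u ^ DIM('a) * 0 + 0 / k u ^ DIM('a)"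
  by (intro tendsto_intros kt ab) (use kpos in "auto simp: less_imp_neq[symmetric]")
 moreover have "en (%x. f n (k (f n) *\<^sub>R x) - u (k (f n) *\<^sub>R x)) = k (f n) powr (2 * s) / k (f n) ^ DIM('a) * ?a n + ?b n / k (f n) ^ DIM('a)" for n
  using dilate_forms(2,3)[OF d kpos(1), of n n] by (simp add: eform_def)
 ultimately have t1: "(%n. en (%x. f n (k (f n) *\<^sub>R x) - u (k (f n) *\<^sub>R x))) ~~> 0" by simp
 have le: "en (%x. normalize m (f n) x - normalize m u x) <= 2 * en (%x. f n (k (f n) *\<^sub>R x) - u (k (f n) *\<^sub>R x)) + 2 * en (%x. ?v (?q n *\<^sub>R x) - ?v x)" for n
 proof -
  have e: "(%x. normalize m (f n) x - normalize m u x) = (%x. (f n (k (f n) *\<^sub>R x) - u (k (f n) *\<^sub>R x)) + (?v (?q n *\<^sub>R x) - ?v x))"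
   using kpos(2) by (simp add: normalize_def k_def[symmetric] fun_eq_iff)
  show ?thesis unfolding e
   by (rule en_add_le[OF dilate_forms(1)[OF d kpos(1)]])
    (use Hsr.diff_mem[of "%x. ?v (?q n *\<^sub>R x)" s ?v] dilate_forms(1)[OF v q(2)] v in simp)
 qed
 show ?thesis
 proof (rule squeeze_null)
  show "(%n. 2 * en (%x. f n (k (f n) *\<^sub>R x) - u (k (f n) *\<^sub>R x)) + 2 * en (%x. ?v (?q n *\<^sub>R x) - ?v x)) ~~> 0"
   using tendsto_add[OF tendsto_mult_left[OF t1, of 2] tendsto_mult_left[OF t2, of 2]] by simp
 qed (use le en_parts(4) in auto)
qed


subsection \<open>Compactness and deformation\<close>

lemma J_sphere: "m > 0 ==> bform u u = m ==> J m u = aform s u u / 2 - psi u"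
 by (simp add: J_def)

lemma dJ_sphere: "m > 0 ==> bform u u = m ==> dJ m u phi = aform s u phi + (2 * psi u - al * aform s u u) / m * bform u phi - dpsi u phi"
 by (simp add: dJ_def field_simps)

text \<open>On the sphere the |u|^r integral is at most \<open>K\<close> times \<open>aform\<close>;
  with the coefficient 1 / (4 K) it costs a quarter of \<open>aform\<close>, while J <= 0 says that
  half of \<open>aform\<close> is at most \<open>psi\<close>. Growth strictly below the critical
  power is what allows a coefficient that small.\<close>

lemma coercive:
 assumes m: "m > 0"
 shows "\<exists>R. \<forall>u. Hsr s u --> bform u u = m --> J m u <= 0 --> en u <= R"
proof -
 obtain C where C: "C >= 0" "!!u::'a => real. Hsr s u ==> (LINT x|lborel. \<bar>u x\<bar> powr r) <= C * aform s u u * (bform u u) powr (2 * s / real DIM('a))"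
  using Gagliardo_Nirenberg[OF s01, where 'a='a] by (auto simp: r_def Hsr_iff)
 define K where "K = C * m powr (2 * s / real DIM('a)) + 1"
 have K: "K > 0" using C(1) by (simp add: K_def add_nonneg_pos)
 obtain D where D: "D >= 0" "!!y. \<bar>Gprim g y\<bar> <= 1 / (4 * K) * norm y powr r + D * (norm y)^2"
 proof -
  have "1 / (4 * K) > 0" using K by simp
  then show ?thesis using subcritical_Gprim that unfolding subcritical_def by blast
 qed
 have "en u <= 4 * D * m + m" if u: "Hsr s u" "bform u u = m" "J m u <= 0" for u
 proof -
  have a: "0 <= aform s u u" by (rule aform_nonneg)
  have "psi u <= (LINT x|lborel. 1 / (4 * K) * norm (u x) powr r + D * (norm (u x))^2)"
   unfolding psi_def
  proof (rule integral_mono)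
   show "integrable lborel (%x. 1 / (4 * K) * norm (u x) powr r + D * (norm (u x))^2)"
    using Lr_integrable[OF u(1)] L2_integrable[OF HsrD(1)[OF u(1)]] by simp
  qed (use psi_integrable[OF u(1)] D(2) in "auto simp: abs_le_iff")
  also have "... = 1 / (4 * K) * (LINT x|lborel. \<bar>u x\<bar> powr r) + D * m"
   using Lr_integrable[OF u(1)] L2_integrable[OF HsrD(1)[OF u(1)]] u(2) by (simp add: bform_self nsq_def)
  also have "1 / (4 * K) * (LINT x|lborel. \<bar>u x\<bar> powr r) <= 1 / (4 * K) * (K * aform s u u)"
   using C(2)[OF u(1)] K a u(2) by (intro mult_left_mono) (auto simp: K_def algebra_simps)
  also have "1 / (4 * K) * (K * aform s u u) = aform s u u / 4" using K by simp
  finally have "psi u <= aform s u u / 4 + D * m" by simp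
  then show ?thesis using u(3) J_sphere[OF m u(2)] by (simp add: eform_def u(2))
 qed
 then show ?thesis by blast
qed

text \<open>At a negative level the limiting multiplier is positive, so that \<open>aform\<close>
  plus this multiple of \<open>bform\<close> is comparable to the full norm. Testing the derivative
  with the difference from the weak limit, where the nonlinear term vanishes asymptotically, gives
  strong convergence, and with it the mass of the limit.\<close>

lemma Palais_Smale:
 assumes m: "m > 0" and c: "c < 0"
  and u: "!!n. Hsr s (u n)" "!!n. bform (u n) (u n) = m" "!!n. en (u n) <= R"
  and J: "(%n. J m (u n)) ~~> c" and G: "(%n. en (GJ m (u n))) ~~> 0"
 obtains rho v where "strict_mono (rho :: nat => nat)" "Hsr s v" "bform v v = m" "J m v = c"
  "!!phi. Hsr s phi ==> dJ m v phi = 0" "(%n. en (%x. u (rho n) x - v x)) ~~> 0"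
proof -
 obtain rho1 v where 1: "strict_mono (rho1 :: nat => nat)" "Hsr s v" "conv_meas (%n. u (rho1 n)) v"
  "!!\<l>. Hsr.bounded_lin_on s E \<l> ==> (%n. \<l> (u (rho1 n))) ~~> \<l> v"
  using weak_limit[of u R] u by metis
 have "range (%n. aform s (u (rho1 n)) (u (rho1 n))) \<subseteq> {0..R}" using order_trans[OF nsq_le_en(2) u(3)] by (auto simp: aform_nonneg)
 then have "bounded (range (%n. aform s (u (rho1 n)) (u (rho1 n))))" using bounded_closed_interval bounded_subset by blast
 then obtain A rho2 where 2: "strict_mono (rho2 :: nat => nat)" "((%n. aform s (u (rho1 n)) (u (rho1 n))) \<circ> rho2) ~~> A"
  using bounded_imp_convergent_subsequence by blast
 define rho where "rho n = rho1 (rho2 n)" for n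
 have rho: "strict_mono rho" using 1(1) 2(1) by (simp add: rho_def strict_mono_def)
 define w where "w n = u (rho n)" for n
 have w: "Hsr s (w n)" "bform (w n) (w n) = m" "en (w n) <= R" for n using u by (simp_all add: w_def)
 have wA: "(%n. aform s (w n) (w n)) ~~> A" using 2(2) by (simp add: w_def rho_def comp_def)
 have wl: "(%n. \<l> (w n)) ~~> \<l> v" if "Hsr.bounded_lin_on s E \<l>" for \<l>
  using LIMSEQ_subseq_LIMSEQ[OF 1(4)[OF that] 2(1)] by (simp add: w_def rho_def comp_def)
 have wc: "conv_meas w v" using conv_meas_subseq[OF 1(3) 2(1)] by (simp add: w_def[abs_def] rho_def)
 have cc: "conv_meas (%_. phi) phi" if "Hsr s phi" for phi :: "'a => real"
  by (rule conv_meas_en[of "%_. phi"]) (use that en_zero in auto)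
 have wp: "(%n. psi (w n)) ~~> psi v" by (rule psi_tendsto[OF w(1,3) 1(2) wc])
 have wJ: "(%n. J m (w n)) ~~> c" and wG: "(%n. en (GJ m (w n))) ~~> 0"
  using LIMSEQ_subseq_LIMSEQ[OF J rho] LIMSEQ_subseq_LIMSEQ[OF G rho] by (simp_all add: w_def comp_def)
 have "(%n. aform s (w n) (w n) / 2 - psi (w n)) ~~> A / 2 - psi v" by (intro tendsto_intros wA wp) simp
 then have cA: "c = A / 2 - psi v" using wJ LIMSEQ_unique unfolding J_sphere[OF m w(2)] by blast
 have A0: "A >= 0" using LIMSEQ_le_const[OF wA, of 0] aform_nonneg by blast
 define \<mu> where "\<mu> = (2 * psi v - al * A) / m"
 define \<mu>n where "\<mu>n n = (2 * psi (w n) - al * aform s (w n) (w n)) / m" for n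
 have \<mu>n: "\<mu>n ~~> \<mu>" unfolding \<mu>n_def \<mu>_def by (intro tendsto_intros wA wp) (use m in simp)
 have \<mu>: "\<mu> > 0"
 proof -
  have "2 * psi v - al * A = - 2 * c + (1 - al) * A" using cA by (simp add: algebra_simps)
  moreover have "(1 - al) * A >= 0" using A0 s01 by (simp add: al_def)
  ultimately show ?thesis using m c by (simp add: \<mu>_def)
 qed
 have dJw: "dJ m (w n) phi = aform s (w n) phi + \<mu>n n * bform (w n) phi - dpsi (w n) phi" for n phi
  by (simp add: dJ_sphere[OF m w(2)] \<mu>n_def)
 have pos: "bform (w n) (w n) > 0" for n using w(2) m by simp
 have dJ0: "(%n. dJ m (w n) (f n)) ~~> 0" if f: "!!n. Hsr s (f n)" "!!n. en (f n) <= K" for f K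
 proof (rule Lim_null_comparison[OF always_eventually])
  show "(%n. sqrt (en (GJ m (w n))) * sqrt K) ~~> 0" using tendsto_mult_right[OF tendsto_real_sqrt[OF wG], of "sqrt K"] by simp
  show "\<forall>n. norm (dJ m (w n) (f n)) <= sqrt (en (GJ m (w n))) * sqrt K"
  proof
   fix n
   have "\<bar>dJ m (w n) (f n)\<bar> <= sqrt (en (GJ m (w n))) * sqrt (en (f n))"
    using Hsr.ip_Cauchy_Schwarz(2)[of "GJ m (w n)" s "f n"] GJ(1)[OF w(1) pos m, of n] GJ(2)[OF w(1) pos m f(1), of n n] f(1) by simp
   also have "... <= sqrt (en (GJ m (w n))) * sqrt K" using f(2) en_parts(4) by (intro mult_left_mono) auto
   finally show "norm (dJ m (w n) (f n)) <= sqrt (en (GJ m (w n))) * sqrt K" by simp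
  qed
 qed
 define h where "h n = (%x. w n x - v x)" for n
 have hH: "Hsr s (h n)" for n using Hsr.diff_mem[of "w n" s v] w(1) 1(2) by (simp add: h_def)
 have hR: "en (h n) <= 2 * R + 2 * en v" for n
 proof -
  have "en (h n) <= 2 * en (w n) + 2 * en (%x. (-1) * v x)"
   using en_add_le[OF w(1), of "%x. (-1) * v x" n] Hsr.scale_mem[of v s "-1"] 1(2) by (simp add: h_def)
  also have "en (%x. (-1) * v x) = en v" using Hsr.ip_lc_lc[of v s v "-1" 0] 1(2) by simp
  finally show ?thesis using w(3)[of n] by linarith
 qed
 have hl: "(%n. \<l> (h n)) ~~> 0" if l: "Hsr.bounded_lin_on s E \<l>" for \<l>
 proof -
  have "\<l> (%x. 1 * w n x + (- 1) * v x) = 1 * \<l> (w n) + (- 1) * \<l> v" for n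
   using l w(1) 1(2) unfolding Hsr.bounded_lin_on_def by blast
  then show ?thesis using LIM_zero[OF wl[OF l]] by (simp add: h_def)
 qed
 have hc: "conv_meas h (%_. 0)" using wc by (simp add: conv_meas_def h_def)
 have bl: "(%n. aform s (h n) v) ~~> 0" "(%n. bform (h n) v) ~~> 0" using hl bounded_lin_forms[OF 1(2)] by auto
 have sp: "aform s (w n) (h n) = aform s (h n) (h n) + aform s (h n) v" "bform (w n) (h n) = bform (h n) (h n) + bform (h n) v" for n
  using aform_lc2[OF hH[of n] 1(2) hH[of n], of 1 1] bform_lc2[OF hH[of n] 1(2) hH[of n], of 1 1]
  by (simp_all add: h_def aform_commute[of s "w n"] bform_commute[of "w n"])
 have hd: "(%n. dpsi (w n) (h n)) ~~> 0"
 proof -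
  have "(%n. dpsi (w n) (h n)) ~~> dpsi v (%_. 0)"
   by (rule dpsi_tendsto[where R = "max R (2 * R + 2 * en v)"]) (use w 1(2) wc hH hR hc Hsr_zero in "auto simp: le_max_iff_disj")
  then show ?thesis by (simp add: dpsi_def)
 qed
 have bh: "0 <= bform (h n) (h n)" "bform (h n) (h n) <= 2 * R + 2 * en v" for n using nsq_le_en(1)[of "h n"] hR[of n] by (auto simp: bform_self)
 have t1: "(%n. (\<mu>n n - \<mu>) * bform (h n) (h n)) ~~> 0"
 proof (rule Lim_null_comparison[OF always_eventually])
  show "(%n. \<bar>\<mu>n n - \<mu>\<bar> * (2 * R + 2 * en v)) ~~> 0"
   using tendsto_mult_right[OF tendsto_rabs[OF LIM_zero[OF \<mu>n]], of "2 * R + 2 * en v"] by simp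
 qed (use bh in "auto simp: abs_mult intro!: mult_left_mono")
 \<comment> \<open>The formula for \<open>dJ\<close> is solved for the part quadratic in
   \<open>h n\<close>. Every other term tends to 0; the last one is a null sequence times a bounded
   one.\<close>
 have "(%n. dJ m (w n) (h n) + dpsi (w n) (h n) - aform s (h n) v - \<mu>n n * bform (h n) v - (\<mu>n n - \<mu>) * bform (h n) (h n)) ~~> 0 + 0 - 0 - \<mu> * 0 - 0"
  by (intro tendsto_intros dJ0[OF hH hR] hd bl \<mu>n t1)
 then have t2: "(%n. aform s (h n) (h n) + \<mu> * bform (h n) (h n)) ~~> 0" by (simp add: dJw sp algebra_simps)
 have h0: "(%n. en (h n)) ~~> 0"
 proof (rule squeeze_null)
  \<comment> \<open>This factor compensates a small \<mu> in front of \<open>bform\<close> and is at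
    least 1 for \<open>aform\<close>.\<close>
  show "(%n. (1 + 1 / \<mu>) * (aform s (h n) (h n) + \<mu> * bform (h n) (h n))) ~~> 0"
   using tendsto_mult_left[OF t2, of "1 + 1 / \<mu>"] by simp
  show "\<forall>n. en (h n) <= (1 + 1 / \<mu>) * (aform s (h n) (h n) + \<mu> * bform (h n) (h n))"
  proof
   fix n
   have "(1 + 1 / \<mu>) * (aform s (h n) (h n) + \<mu> * bform (h n) (h n)) = en (h n) + aform s (h n) (h n) / \<mu> + \<mu> * bform (h n) (h n)"
    using \<mu> by (simp add: field_simps eform_def)
   moreover have "0 <= aform s (h n) (h n) / \<mu>" "0 <= \<mu> * bform (h n) (h n)" using aform_nonneg[of s "h n"] \<mu> bh(1)[of n] by simp_all
   ultimately show "en (h n) <= (1 + 1 / \<mu>) * (aform s (h n) (h n) + \<mu> * bform (h n) (h n))" by linarith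
  qed
 qed (use en_parts(4) in auto)
 have bv: "bform v v = m"
  using en_tendsto_bform[OF w(1) 1(2) h0[unfolded h_def]] by (simp add: w(2) LIMSEQ_const_iff)
 have "(%n. en (w n)) ~~> en v" by (rule Hsr.ip_self_tendsto) (use w(1) 1(2) h0[unfolded h_def] in auto)
 moreover have "(%n. en (w n)) ~~> A + m" using tendsto_add[OF wA tendsto_const[of m]] by (simp add: eform_def w(2))
 ultimately have Av: "aform s v v = A" using LIMSEQ_unique by (fastforce simp: eform_def bv)
 have Jv: "J m v = c" using J_sphere[OF m bv] Av cA by simp
 have dv: "dJ m v phi = 0" if phi: "Hsr s phi" for phi
 proof -
  have "(%n. dJ m (w n) phi) ~~> aform s v phi + \<mu> * bform v phi - dpsi v phi" unfolding dJw
   by (intro tendsto_intros \<mu>n wl bounded_lin_forms phi dpsi_tendsto[where R = "max R (en phi)"] w 1(2) wc cc)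
    (use w(3) in "auto simp: le_max_iff_disj")
  moreover have "(%n. dJ m (w n) phi) ~~> 0" by (rule dJ0[of "%_. phi" "en phi"]) (use phi in auto)
  ultimately have "aform s v phi + \<mu> * bform v phi - dpsi v phi = 0" by (rule LIMSEQ_unique)
  then show ?thesis by (simp add: dJ_sphere[OF m bv] Av \<mu>_def)
 qed
 show ?thesis using that[OF rho 1(2) bv Jv dv] h0 by (simp add: h_def w_def)
qed


section \<open>Euler steps along the gradient\<close>

definition S :: "real => ('a => real) set" where "S m = {u. Hsr s u & bform u u = m}"

definition crit :: "real => ('a => real) set" where "crit m = {u \<in> S m. \<forall>phi. Hsr s phi --> dJ m u phi = 0}"

definition step :: "real => real => ('a => real) => 'a => real" where
 "step m h u = (%x. u x + (- h) * GJ m u x)"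

lemma SD: "u \<in> S m ==> Hsr s u" "u \<in> S m ==> bform u u = m" by (auto simp: S_def)

text \<open>Otherwise a Palais-Smale sequence outside \<open>N\<close> would converge to a critical
  point at level c, around which \<open>N\<close> contains a ball of the sphere. The restriction J
  <= 0 supplies boundedness through \<open>coercive\<close>.\<close>

lemma gradient_gap:
 assumes m: "m > 0" and c: "c < 0"
  and N: "!!u. u \<in> crit m ==> J m u = c ==> \<exists>d>0. \<forall>w\<in>S m. en (%x. w x - u x) < d --> w \<in> N"
 obtains dl e where "dl > 0" "e > 0" "!!u. u \<in> S m ==> J m u <= 0 ==> u \<notin> N ==> \<bar>J m u - c\<bar> <= e ==> dl <= sqrt (en (GJ m u))"
proof (rule ccontr)
 assume no: "\<not> thesis"
 have "\<exists>u. u \<in> S m & J m u <= 0 & u \<notin> N & \<bar>J m u - c\<bar> <= inverse (real (Suc n)) & sqrt (en (GJ m u)) < inverse (real (Suc n))" for n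
 proof (rule ccontr)
  assume n: "\<not> ?thesis"
  have q: "inverse (real (Suc n)) <= sqrt (en (GJ m u))" if a: "u \<in> S m" "J m u <= 0" "u \<notin> N" "\<bar>J m u - c\<bar> <= inverse (real (Suc n))" for u
   using n a by (meson not_less)
  have p: "inverse (real (Suc n)) > 0" by simp
  show False using that[OF p p q] no by blast
 qed
 then obtain u where u: "!!n. u n \<in> S m" "!!n. J m (u n) <= 0" "!!n. u n \<notin> N" "!!n. \<bar>J m (u n) - c\<bar> <= inverse (real (Suc n))"
   "!!n. sqrt (en (GJ m (u n))) < inverse (real (Suc n))" by metis
 obtain R where R: "!!u. Hsr s u ==> bform u u = m ==> J m u <= 0 ==> en u <= R" using coercive[OF m] by blast
 have Jt: "(%n. J m (u n)) ~~> c"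
  by (rule LIM_zero_cancel, rule Lim_null_comparison[OF always_eventually LIMSEQ_inverse_real_of_nat]) (use u(4) in simp)
 have "(%n. sqrt (en (GJ m (u n)))) ~~> 0"
  by (rule squeeze_null[OF LIMSEQ_inverse_real_of_nat])
   (use u(5) en_parts(4) less_imp_le in auto)
 from tendsto_power[OF this, of 2] have Gt: "(%n. en (GJ m (u n))) ~~> 0" using en_parts(4) by simp
 obtain rho v where v: "strict_mono (rho :: nat => nat)" "Hsr s v" "bform v v = m" "J m v = c"
  "!!phi. Hsr s phi ==> dJ m v phi = 0" "(%n. en (%x. u (rho n) x - v x)) ~~> 0"
  using Palais_Smale[OF m c SD(1)[OF u(1)] SD(2)[OF u(1)] R[OF SD(1)[OF u(1)] SD(2)[OF u(1)] u(2)] Jt Gt] by blast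
 have "v \<in> crit m" using v by (simp add: crit_def S_def)
 then obtain d where d: "d > 0" "!!w. w \<in> S m ==> en (%x. w x - v x) < d ==> w \<in> N" using N v(4) by blast
 have "\<forall>\<^sub>F n in sequentially. en (%x. u (rho n) x - v x) < d" using order_tendstoD(2)[OF v(6) d(1)] .
 then obtain n where "en (%x. u (rho n) x - v x) < d" by (auto simp: eventually_sequentially)
 then show False using d(2)[OF u(1)] u(3) by blast
qed

lemma step_Hsr: "Hsr s u ==> bform u u > 0 ==> m > 0 ==> Hsr s (step m h u)"
 unfolding step_def using Hsr_lc[of s u "GJ m u" 1 "- h"] GJ(1)[of u m] by simp

text \<open>Mean value theorem on the segment of the step: the slope at an intermediate point is at
  least q^2 - eps q, where q is the gradient norm at the start. Where the gap holds, q >= dl = 2 eps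
  gives a definite drop; elsewhere the level rises by at most h eps^2, which is harmless far below
  c.\<close>

lemma deformation_step:
 assumes m: "m > 0" and c: "c < 0"
  and N: "!!u. u \<in> crit m ==> J m u = c ==> \<exists>d>0. \<forall>w\<in>S m. en (%x. w x - u x) < d --> w \<in> N"
 obtains e h where "e > 0" "c + e <= 0"
  "!!u. u \<in> S m ==> J m u <= c + e ==> bform (step m h u) (step m h u) > 0"
  "!!u. u \<in> S m ==> J m u <= c + e ==> u \<notin> N ==> J m (step m h u) <= c - e"
proof -
 obtain dl e0 where gap: "dl > 0" "e0 > 0" "!!u. u \<in> S m ==> J m u <= 0 ==> u \<notin> N ==> \<bar>J m u - c\<bar> <= e0 ==> dl <= sqrt (en (GJ m u))"
  using gradient_gap[OF m c N] by blast
 obtain R where "!!u. Hsr s u ==> bform u u = m ==> J m u <= 0 ==> en u <= R" using coercive[OF m] by blast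
 then have R: "en u <= R" if "u \<in> S m" "J m u <= 0" for u using that by (auto simp: S_def)
 \<comment> \<open>After a step, \<open>en\<close> is at most twice its old value plus twice a
   quantity bounded by 1.\<close>
 define R' where "R' = 2 * max R 0 + 2"
 have R': "R <= R'" "R' >= 0" by (auto simp: R'_def)
 have m2: "m / 2 > 0" using m by simp
 obtain C where C: "C >= 0" "!!u. Hsr s u ==> en u <= R' ==> m / 2 <= bform u u ==> sqrt (en (GJ m u)) <= C"
  using GJ_uniform(1)[OF m2 m, of R'] by blast
 define eps where "eps = dl / 2"
 have eps: "eps > 0" using gap(1) by (simp add: eps_def)
 obtain d where d: "d > 0" "!!u w phi. Hsr s u ==> en u <= R' ==> m / 2 <= bform u u ==> Hsr s w ==> en w <= R' ==> m / 2 <= bform w w ==>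
   en (%x. u x - w x) <= d ==> Hsr s phi ==> \<bar>dJ m u phi - dJ m w phi\<bar> <= eps * sqrt (en phi)"
  using dJ_uniform(2)[OF m2 m eps, of R'] by blast
 define k where "k = sqrt (min d 1)"
 have k: "k > 0" "k^2 <= d" "k^2 <= 1" using d(1) by (simp_all add: k_def)
 \<comment> \<open>The three bounds keep the step within distance \<open>d\<close> of its start,
   keep the mass at least m / 2, and limit the rise at low levels to e0 / 2.\<close>
 define h where "h = min (k / (C + 1)) (min (m / (4 * (sqrt R' * C + 1))) (e0 / (2 * eps^2)))"
 have h: "h > 0" using k(1) C(1) m gap(2) eps R'(2) by (auto simp: h_def add_nonneg_pos)
 have hC: "h * C <= k"
 proof -
  have "h <= k / (C + 1)" by (simp add: h_def)
  then have "h * (C + 1) <= k" using C(1) by (simp add: pos_le_divide_eq)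
  then show ?thesis using h by (simp add: distrib_left)
 qed
 have hm: "2 * h * (sqrt R' * C) <= m / 2"
 proof -
  have p: "sqrt R' * C + 1 > 0" using C(1) R'(2) by (simp add: add_nonneg_pos)
  have "h <= m / (4 * (sqrt R' * C + 1))" by (simp add: h_def)
  then have "h * (4 * (sqrt R' * C + 1)) <= m" using p by (simp add: pos_le_divide_eq)
  then show ?thesis using h by (simp add: algebra_simps)
 qed
 have he: "h * eps^2 <= e0 / 2"
 proof -
  have "h <= e0 / (2 * eps^2)" by (simp add: h_def)
  then show ?thesis using eps by (simp add: field_simps)
 qed
 have main: "bform (step m t u) (step m t u) >= m / 2" "en (step m t u) <= R'" "en (%x. u x - step m t u x) <= d" "Hsr s (step m t u)"
  if u: "u \<in> S m" "J m u <= 0" and t: "0 <= t" "t <= h" for u t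
 proof -
  let ?G = "GJ m u"
  have uH: "Hsr s u" and ub: "bform u u = m" and uR: "en u <= R" using u R by (auto simp: S_def)
  have GH: "Hsr s ?G" using GJ(1)[OF uH] ub m by simp
  have GC: "sqrt (en ?G) <= C" by (rule C(2)[OF uH]) (use uR R' ub m in auto)
  show "Hsr s (step m t u)" using step_Hsr[OF uH] ub m by simp
  have tg: "(t * sqrt (en ?G))^2 <= k^2"
  proof (rule power_mono)
   have "t * sqrt (en ?G) <= h * C" using t GC en_parts(4) h by (intro mult_mono) auto
   then show "t * sqrt (en ?G) <= k" using hC by simp
  qed (use t en_parts(4) in auto)
  have tG: "t^2 * en ?G <= k^2" using tg en_parts(4)[of ?G] by (simp add: power_mult_distrib)
  have e1: "en (%x. t * ?G x) = t^2 * en ?G" and e2: "en (%x. (- t) * ?G x) = t^2 * en ?G"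
   using Hsr.ip_lc_lc[of ?G s ?G t 0] Hsr.ip_lc_lc[of ?G s ?G "- t" 0] GH by simp_all
  have "(%x. u x - step m t u x) = (%x. t * ?G x)" by (simp add: step_def fun_eq_iff)
  then show "en (%x. u x - step m t u x) <= d" using e1 tG k(2) by simp
  have "en (step m t u) <= 2 * en u + 2 * en (%x. (- t) * ?G x)"
   unfolding step_def by (rule en_add_le[OF uH]) (use Hsr.scale_mem[of ?G s "- t"] GH in simp)
  also have "... <= R'" using e2 tG k(3) uR by (simp add: R'_def)
  finally show "en (step m t u) <= R'" .
  have "bform (step m t u) (step m t u) = m - 2 * t * bform u ?G + t^2 * bform ?G ?G"
  proof -
   have H: "Hsr s (%x. 1 * u x + (- t) * ?G x)" by (rule Hsr_lc[OF uH GH])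
   have "bform (%x. 1 * u x + (- t) * ?G x) (%x. 1 * u x + (- t) * ?G x) = bform u u - 2 * t * bform u ?G + t^2 * bform ?G ?G"
    unfolding bform_lc1[OF uH GH H] bform_lc2[OF uH GH uH] bform_lc2[OF uH GH GH] bform_commute[of ?G u]
    by (simp add: power2_eq_square algebra_simps)
   then show ?thesis by (simp add: step_def ub)
  qed
  moreover have "t * bform u ?G <= h * (sqrt R' * C)"
  proof -
   have "\<bar>bform u ?G\<bar> <= sqrt (en u) * sqrt (en ?G)" by (rule form_bound(2)[OF uH GH])
   also have "... <= sqrt R' * C" using uR R' GC en_parts(4) by (intro mult_mono) auto
   finally have "t * \<bar>bform u ?G\<bar> <= h * (sqrt R' * C)" using t h by (intro mult_mono) auto
   then show ?thesis using t(1) by (metis abs_ge_self mult_left_mono order_trans)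
  qed
  moreover have "0 <= t^2 * bform ?G ?G" by (simp add: bform_nonneg)
  ultimately show "bform (step m t u) (step m t u) >= m / 2" using hm by (simp add: algebra_simps)
 qed
 have dec: "J m (step m h u) <= J m u - h * ((sqrt (en (GJ m u)))^2 - eps * sqrt (en (GJ m u)))" if u: "u \<in> S m" "J m u <= 0" for u
 proof -
  let ?G = "GJ m u"
  have uH: "Hsr s u" and ub: "bform u u = m" and uR: "en u <= R" using u R by (auto simp: S_def)
  have pos: "bform u u > 0" using ub m by simp
  have GH: "Hsr s ?G" by (rule GJ(1)[OF uH pos m])
  have "\<exists>z. - h < z & z < 0 & J m (%x. u x + 0 * ?G x) - J m (%x. u x + (- h) * ?G x) = (0 - - h) * dJ m (%x. u x + z * ?G x) ?G"
  proof (rule MVT2)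
   fix z assume z: "- h <= z" "z <= 0"
   show "((%z. J m (%x. u x + z * ?G x)) has_real_derivative dJ m (%x. u x + z * ?G x) ?G) (at z)"
    by (rule J_deriv[OF uH GH m]) (use main(1)[OF u, of "- z"] z m in "simp add: step_def")
  qed (use h in simp)
  then obtain z where z: "- h < z" "z < 0" "J m u - J m (step m h u) = h * dJ m (step m (- z) u) ?G"
   by (auto simp: step_def)
  have t: "0 <= - z" "- z <= h" using z by auto
  have "\<bar>dJ m u ?G - dJ m (step m (- z) u) ?G\<bar> <= eps * sqrt (en ?G)"
   by (rule d(2)[OF uH _ _ main(4,2,1,3)[OF u t] GH]) (use uR R' ub m in auto)
  moreover have "dJ m u ?G = (sqrt (en ?G))^2" using GJ(2)[OF uH pos m GH] en_parts(4)[of ?G] by simp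
  ultimately have "(sqrt (en ?G))^2 - eps * sqrt (en ?G) <= dJ m (step m (- z) u) ?G" by linarith
  then have "h * ((sqrt (en ?G))^2 - eps * sqrt (en ?G)) <= h * dJ m (step m (- z) u) ?G" using h by (intro mult_left_mono) auto
  then show ?thesis using z(3) by linarith
 qed
 define e where "e = min (e0 / 2) (min (h * dl^2 / 4) (- c / 2))"
 \<comment> \<open>A drop of h dl^2 / 2 must lead from c + e to c - e, a rise of e0 / 2 from below c
   - e0 must end below c - e, and c + e must stay nonpositive.\<close>
 have e: "e > 0" "e <= e0 / 2" "e <= h * dl^2 / 4" "c + e <= 0" using gap h c by (auto simp: e_def min_def)
 show ?thesis
 proof (rule that[OF e(1,4)])
  fix u assume u: "u \<in> S m" "J m u <= c + e"
  then have u0: "J m u <= 0" using e(4) by linarith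
  show "bform (step m h u) (step m h u) > 0" using main(1)[OF u(1) u0, of h] h m by simp
  assume uN: "u \<notin> N"
  define q where "q = sqrt (en (GJ m u))"
  have q0: "q >= 0" using en_parts(4) by (simp add: q_def)
  have dq: "J m (step m h u) <= J m u - h * (q^2 - eps * q)" using dec[OF u(1) u0] by (simp add: q_def)
  show "J m (step m h u) <= c - e"
  proof (cases "J m u >= c - e0")
   case True
   then have "dl <= q" unfolding q_def using u(2) e(2) gap(2) by (intro gap(3)[OF u(1) u0 uN]) auto
   then have "dl * dl <= q * q" "dl * q <= q * q" using gap(1) q0 by (auto intro: mult_mono mult_right_mono)
   then have "dl^2 / 2 <= q^2 - eps * q" by (simp add: eps_def power2_eq_square)
   then have "h * (dl^2 / 2) <= h * (q^2 - eps * q)" using h by (intro mult_left_mono) auto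
   then show ?thesis using dq u(2) e(3) by simp
  next
   case False
   have "(q - eps / 2)^2 = q^2 - eps * q + eps^2 / 4" by (simp add: power2_eq_square algebra_simps)
   then have "- eps\<^sup>2 <= q^2 - eps * q" using zero_le_power2[of "q - eps / 2"] zero_le_power2[of eps] by linarith
   then have "h * (- eps\<^sup>2) <= h * (q^2 - eps * q)" using h by (intro mult_left_mono) auto
   then show ?thesis using dq False he e(2) by simp
  qed
 qed
qed

lemma step_continuous:
 assumes f: "!!n. Hsr s (f n)" "!!n. bform (f n) (f n) = m" and u: "Hsr s u" "bform u u = m" and m: "m > 0"
  and c: "(%n. en (%x. f n x - u x)) ~~> 0"
 shows "(%n. en (%x. step m h (f n) x - step m h u x)) ~~> 0"
proof -
 have "(%n. en (f n)) ~~> en u" by (rule Hsr.ip_self_tendsto) (use f u c in auto)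
 then have "Bseq (%n. en (f n))" using convergent_imp_Bseq convergentI by blast
 then obtain R where R: "!!n. norm (en (f n)) <= R" unfolding Bseq_def by blast
 define R' where "R' = max R (en u)"
 have G: "Hsr s (GJ m (f n))" "Hsr s (GJ m u)" for n using GJ(1)[OF f(1)] GJ(1)[OF u(1)] f(2) u(2) m by simp_all
 have G0: "(%n. sqrt (en (%x. GJ m (f n) x - GJ m u x))) ~~> 0"
 proof (rule LIMSEQ_I)
  fix e :: real assume "e > 0"
  then have e2: "e / 2 > 0" by simp
  obtain d where d: "d > 0" "!!u w. Hsr s u ==> en u <= R' ==> m <= bform u u ==> Hsr s w ==> en w <= R' ==> m <= bform w w ==>
   en (%x. u x - w x) <= d ==> sqrt (en (%x. GJ m u x - GJ m w x)) <= e / 2" using GJ_uniform(2)[OF m m e2, of R'] by blast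
  obtain n0 where n0: "!!n. n >= n0 ==> en (%x. f n x - u x) < d"
   using order_tendstoD(2)[OF c d(1)] by (auto simp: eventually_sequentially)
  have "norm (sqrt (en (%x. GJ m (f n) x - GJ m u x)) - 0) < e" if "n >= n0" for n
  proof -
   have "sqrt (en (%x. GJ m (f n) x - GJ m u x)) <= e / 2"
    by (rule d(2)[OF f(1) _ _ u(1)]) (use R[of n] f(2)[of n] u(2) n0[OF that] in "auto simp: R'_def")
   then show ?thesis using \<open>e > 0\<close> en_parts(4) by simp
  qed
  then show "\<exists>no. \<forall>n\<ge>no. norm (sqrt (en (%x. GJ m (f n) x - GJ m u x)) - 0) < e" by blast
 qed
 have G1: "(%n. en (%x. GJ m (f n) x - GJ m u x)) ~~> 0" using tendsto_power[OF G0, of 2] en_parts(4) by simp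
 have le: "en (%x. step m h (f n) x - step m h u x) <= 2 * en (%x. f n x - u x) + 2 * (h^2 * en (%x. GJ m (f n) x - GJ m u x))" for n
 proof -
  let ?p = "%x. f n x - u x" and ?q = "%x. GJ m (f n) x - GJ m u x"
  have H: "Hsr s ?p" "Hsr s ?q" using Hsr.diff_mem[of "f n" s u] Hsr.diff_mem[of "GJ m (f n)" s "GJ m u"] f u G by simp_all
  have e: "(%x. step m h (f n) x - step m h u x) = (%x. ?p x + (- h) * ?q x)" by (simp add: step_def fun_eq_iff algebra_simps)
  have "en (%x. (- h) * ?q x) = h^2 * en ?q" using Hsr.ip_lc_lc[of ?q s ?q "- h" 0] H by simp
  then show ?thesis unfolding e using en_add_le[OF H(1), of "%x. (- h) * ?q x"] Hsr.scale_mem[of ?q s "- h"] H by simp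
 qed
 have "(%n. 2 * en (%x. f n x - u x) + 2 * (h^2 * en (%x. GJ m (f n) x - GJ m u x))) ~~> 2 * 0 + 2 * (h^2 * 0)"
  by (intro tendsto_intros c G1)
 then have t: "(%n. 2 * en (%x. f n x - u x) + 2 * (h^2 * en (%x. GJ m (f n) x - GJ m u x))) ~~> 0" by simp
 show ?thesis by (rule squeeze_null[OF t]) (use le en_parts(4) in auto)
qed

section \<open>Behaviour under change of sign\<close>

lemma uminus_forms:
 "aform s (%x. - u x) v = - aform s u v" if "Hsr s u" "Hsr s v"
 using aform_lc[OF that(1,1,2), of "-1" 0] by simp

lemma dJ_uminus:
 assumes "Hsr s u" "Hsr s phi" shows "dJ m (%x. - u x) phi = - dJ m u phi"
proof -
 have H: "Hsr s (%x. - u x)" using Hsr.scale_mem[of u s "-1"] assms by simp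
 have "aform s (%x. - u x) (%x. - u x) = aform s u u"
  by (simp only: uminus_forms[OF assms(1) H] uminus_forms[OF assms(1,1)] aform_commute[of s u "%x. - u x"] minus_minus)
 moreover have "bform (%x. - u x) (%x. - u x) = bform u u" "bform (%x. - u x) phi = - bform u phi"
  "dpsi (%x. - u x) phi = - dpsi u phi" "psi (%x. - u x) = psi u"
  by (simp_all add: bform_def dpsi_def psi_def g_odd Gprim_even)
 ultimately show ?thesis using uminus_forms[OF assms] by (simp add: dJ_def algebra_simps)
qed

lemma J_uminus:
 assumes "Hsr s u" shows "J m (%x. - u x) = J m u"
proof -
 have H: "Hsr s (%x. - u x)" using Hsr.scale_mem[of u s "-1"] assms by simp
 have "aform s (%x. - u x) (%x. - u x) = aform s u u"
  by (simp only: uminus_forms[OF assms(1) H] uminus_forms[OF assms(1,1)] aform_commute[of s u "%x. - u x"] minus_minus)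
 then show ?thesis by (simp add: J_def bform_def psi_def Gprim_even)
qed

text \<open>The chosen gradient need not be odd as a function; only its class for the seminorm is,
  so the step is odd up to seminorm zero.\<close>

lemma step_odd:
 assumes u: "Hsr s u" "bform u u > 0" and m: "m > 0"
 shows "en (%x. step m h (%x. - u x) x - (- step m h u x)) = 0"
proof -
 have H: "Hsr s (%x. - u x)" using Hsr.scale_mem[of u s "-1"] u by simp
 have b: "bform (%x. - u x) (%x. - u x) > 0" using u(2) by (simp add: bform_def)
 let ?D = "%x. GJ m (%x. - u x) x + GJ m u x"
 note G1 = GJ[OF H b m] and G2 = GJ[OF u m]
 have D: "Hsr s ?D" using Hsr.add_mem[of "GJ m (%x. - u x)" s "GJ m u"] G1 G2 by simp
 have "en ?D = eform s (GJ m (%x. - u x)) ?D + eform s (GJ m u) ?D"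
  using Hsr.ip_lc[of "GJ m (%x. - u x)" s "GJ m u" ?D 1 1] G1 G2 D by simp
 then have "en ?D = 0" using G1(2)[OF D] G2(2)[OF D] dJ_uminus[OF u(1) D] by simp
 then have "en (%x. (- h) * ?D x) = 0" using Hsr.ip_lc_lc[of ?D s ?D "- h" 0] D by simp
 moreover have "(%x. step m h (%x. - u x) x - (- step m h u x)) = (%x. (- h) * ?D x)"
  by (simp add: step_def fun_eq_iff algebra_simps)
 ultimately show ?thesis by simp
qed

end

subsection \<open>The Lusternik-Schnirelmann covering theorem\<close>

text \<open>Pairing of a mod 2 cochain with an integral chain. Coefficients are reduced modulo 2, so
  that all signs of the boundary operator disappear.\<close>

definition chain_eval :: "(((nat => real) => 'a) => bit) => 'a chain => bit" where
 "chain_eval F c = (\<Sum>sig\<in>Poly_Mapping.keys c. of_int (Poly_Mapping.lookup c sig) * F sig)"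

lemma chain_eval_superset:
 assumes "finite A" "Poly_Mapping.keys c \<subseteq> A"
 shows "chain_eval F c = (\<Sum>sig\<in>A. of_int (Poly_Mapping.lookup c sig) * F sig)"
 unfolding chain_eval_def
 by (rule sum.mono_neutral_left) (use assms in "auto simp: in_keys_iff")

lemma chain_eval_0 [simp]: "chain_eval F 0 = 0"
 by (simp add: chain_eval_def)

lemma chain_eval_of [simp]: "chain_eval F (frag_of sig) = F sig"
 by (cases "F sig") (simp_all add: chain_eval_def)

lemma chain_eval_add: "chain_eval F (a + b) = chain_eval F a + chain_eval F b"
proof -
 let ?A = "Poly_Mapping.keys a \<union> Poly_Mapping.keys b"
 have "Poly_Mapping.keys (a + b) \<subseteq> ?A" by (rule keys_add)
 then show ?thesis
  by (simp add: chain_eval_superset[of ?A] lookup_add distrib_right sum.distrib del: add_bit_eq_xor mult_bit_eq_and)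
qed

lemma chain_eval_minus: "chain_eval F (- a) = chain_eval F a"
 by (simp add: chain_eval_def)

lemma chain_eval_diff: "chain_eval F (a - b) = chain_eval F a + chain_eval F b"
 using chain_eval_add[of F a "- b"] by (simp add: chain_eval_minus)

lemma chain_eval_sign: "chain_eval F (frag_cmul ((-1) ^ k) a) = chain_eval F a"
 by (cases "even k") (auto simp: chain_eval_minus)

lemma chain_eval_sum: "chain_eval F (\<Sum>i\<in>I. f i) = (\<Sum>i\<in>I. chain_eval F (f i))"
 by (induction I rule: infinite_finite_induct) (auto simp: chain_eval_add simp del: add_bit_eq_xor)

lemma chain_eval_cong:
 "(!!sig. sig \<in> Poly_Mapping.keys c ==> F sig = G sig) ==> chain_eval F c = chain_eval G c"
 unfolding chain_eval_def by (rule sum.cong) auto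

lemma chain_eval_plus: "chain_eval (%sig. F sig + G sig) c = chain_eval F c + chain_eval G c"
 by (simp add: chain_eval_def distrib_left sum.distrib del: add_bit_eq_xor mult_bit_eq_and)

lemma chain_eval_chain_map:
 "chain_eval F (chain_map p g c) = chain_eval (%sig. F (simplex_map p g sig)) c"
proof -
 have "Poly_Mapping.keys c \<subseteq> UNIV" by simp
 then show ?thesis
  by (induction c rule: frag_induction) (auto simp: chain_map_diff chain_eval_diff)
qed

text \<open>The coface map, which omits vertex \<open>k\<close>.\<close>

definition skip :: "nat => nat => nat" where
 "skip k i = (if i < k then i else Suc i)"

text \<open>The cup product of the coboundaries of the 0-cochains \<open>eps 0, \<dots>, eps (p - 1)\<close>.\<close>

definition cup :: "(nat => 'a => bit) => nat => (nat => 'a) => bit" where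
 "cup eps p x = (\<Prod>j<p. eps j (x j) + eps j (x (Suc j)))"

lemma cup_Suc: "cup eps (Suc p) x = cup eps p x * (eps p (x p) + eps p (x (Suc p)))"
 unfolding cup_def by simp

lemma cup_cong: "(!!i. i <= p ==> x i = y i) ==> cup eps p x = cup eps p y"
 unfolding cup_def by (rule prod.cong) auto

lemma bit_arith:
 fixes A a b c B :: bit
 shows "A * (b + c) + A * (a + c) + A * (a + b) = 0"
  and "B + A = 0 ==> B = A"
 by (cases A; cases a; cases b; cases c; cases B; simp)+

text \<open>A product of coboundaries is closed. In the inductive step the faces omitting a vertex k
  <= p share the last edge, and their sum is known by induction. The faces omitting p + 1 or p + 2
  end with the edges (p, p + 2) and (p, p + 1), and the three edges of the last triangle
  cancel.\<close>

lemma cup_cocycle: "(\<Sum>k\<le>Suc p. cup eps p (%i. x (skip k i))) = 0"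
proof (induction p)
 case 0
 show ?case by (simp add: cup_def)
next
 case (Suc p)
 let ?A = "cup eps p x" and ?B = "\<Sum>k\<le>p. cup eps p (%i. x (skip k i))"
 have last: "cup eps p (%i. x (skip k i)) = ?A" if "k >= Suc p" for k
  using that by (intro cup_cong) (auto simp: skip_def)
 have "?B + ?A = 0" using Suc by (simp add: last del: add_bit_eq_xor)
 then have B: "?B = ?A" by (rule bit_arith)
 have 1: "cup eps (Suc p) (%i. x (skip k i)) =
   cup eps p (%i. x (skip k i)) * (eps p (x (Suc p)) + eps p (x (Suc (Suc p))))" if "k <= p" for k
  using that unfolding cup_Suc by (simp add: skip_def)
 have 2: "cup eps (Suc p) (%i. x (skip (Suc p) i)) = ?A * (eps p (x p) + eps p (x (Suc (Suc p))))"
  unfolding cup_Suc by (simp add: last) (simp add: skip_def)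
 have 3: "cup eps (Suc p) (%i. x (skip (Suc (Suc p)) i)) = ?A * (eps p (x p) + eps p (x (Suc p)))"
  unfolding cup_Suc by (simp add: last) (simp add: skip_def)
 have "(\<Sum>k\<le>Suc (Suc p). cup eps (Suc p) (%i. x (skip k i))) =
   ?B * (eps p (x (Suc p)) + eps p (x (Suc (Suc p)))) + ?A * (eps p (x p) + eps p (x (Suc (Suc p))))
   + ?A * (eps p (x p) + eps p (x (Suc p)))"
  by (simp only: sum.atMost_Suc 2 3 sum_distrib_right) (simp add: 1 del: add_bit_eq_xor mult_bit_eq_and)
 also have "... = 0" unfolding B by (rule bit_arith)
 finally show ?case .
qed

text \<open>Leibniz rule: the first factor is closed, so only the coboundary of \<open>eps p\<close>
  remains.\<close>

lemma cup_coboundary: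
 "(\<Sum>k\<le>Suc p. cup eps p (%i. x (skip k i)) * eps p (x (skip k p))) = cup eps (Suc p) x"
proof -
 let ?A = "cup eps p x" and ?B = "\<Sum>k\<le>p. cup eps p (%i. x (skip k i))"
 have last: "cup eps p (%i. x (skip (Suc p) i)) = ?A"
  by (intro cup_cong) (auto simp: skip_def)
 have "?B + ?A = 0" using cup_cocycle[of eps p x] by (simp add: last del: add_bit_eq_xor)
 then have B: "?B = ?A" by (rule bit_arith)
 have "(\<Sum>k\<le>Suc p. cup eps p (%i. x (skip k i)) * eps p (x (skip k p))) =
  ?B * eps p (x (Suc p)) + ?A * eps p (x p)"
  unfolding sum.atMost_Suc last sum_distrib_right by (simp add: skip_def del: add_bit_eq_xor mult_bit_eq_and)
 also have "... = cup eps (Suc p) x"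
  unfolding B cup_Suc by (simp add: distrib_left add.commute del: add_bit_eq_xor mult_bit_eq_and)
 finally show ?thesis .
qed

definition cup_s where "cup_s eps p sig = cup eps p (%i. simplicial_vertex i sig)"

text \<open>A primitive of \<open>cup_s eps (Suc p)\<close>. Unlike the product itself it is not
  invariant under the antipode when the \<open>eps j\<close> are odd, and its defect of invariance
  is \<open>cup_s eps p\<close>.\<close>

definition cobdry_s where
 "cobdry_s eps p sig = cup_s eps p sig * eps p (simplicial_vertex p sig)"

lemma simplicial_vertex_face:
 assumes "i <= p" "k <= Suc p"
 shows "simplicial_vertex i (singular_face (Suc p) k sig) = simplicial_vertex (skip k i) sig"
proof -
 have "simplical_face k (%j. if j = i then 1 else 0::real) = (%j. if j = skip k i then 1 else 0)"
  by (rule ext) (auto simp: simplical_face_def skip_def)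
 then show ?thesis using assms
  by (simp add: simplicial_vertex_def singular_face_def)
qed

lemma chain_eval_cobdry_s:
 "chain_eval (cobdry_s eps p) (chain_boundary (Suc p) c) = chain_eval (cup_s eps (Suc p)) c"
proof -
 have "Poly_Mapping.keys c \<subseteq> UNIV" by simp
 then show ?thesis
 proof (induction c rule: frag_induction)
  case (one sig)
  have "cobdry_s eps p (singular_face (Suc p) k sig) =
   cup eps p (%i. simplicial_vertex (skip k i) sig) * eps p (simplicial_vertex (skip k p) sig)" if "k <= Suc p" for k
   unfolding cobdry_s_def cup_s_def using that
   by (simp add: simplicial_vertex_face cong: cup_cong)
  then show ?case
   using cup_coboundary[where x = "%i. simplicial_vertex i sig"]
   by (simp add: chain_boundary_of chain_eval_sum chain_eval_sign cup_s_def del: sum.atMost_Suc)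
 qed (auto simp: chain_boundary_diff chain_eval_diff)
qed

text \<open>The space R^(n+1) without the origin, inside the sequences, so that the dimensions are
  nested; the index \<open>n\<close> is that of the sphere.\<close>

definition punct :: "nat => (nat => real) set" where
 "punct n = {x. x ~= (%_. 0) & (\<forall>i>n. x i = 0)}"

abbreviation neg_fun :: "(nat => real) => nat => real" where
 "neg_fun \<equiv> %x i. - x i"

abbreviation punct_top :: "nat => (nat => real) topology" where
 "punct_top n \<equiv> subtopology (powertop_real UNIV) (punct n)"

lemma punct_mono: "i <= n ==> punct i \<subseteq> punct n"
 by (auto simp: punct_def)

lemma neg_fun_punct: "x \<in> punct n ==> neg_fun x \<in> punct n"
 by (auto simp: punct_def fun_eq_iff)

lemma continuous_map_neg_fun: "continuous_map (punct_top n) (punct_top n) neg_fun"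
proof -
 have "continuous_map (powertop_real UNIV) (powertop_real UNIV) neg_fun"
  unfolding continuous_map_componentwise_UNIV
  by (auto intro!: continuous_intros continuous_map_product_projection)
 then show ?thesis
  by (auto simp: continuous_map_in_subtopology neg_fun_punct intro: continuous_map_from_subtopology)
qed

text \<open>The chain triangulating an \<open>i\<close>-dimensional hemisphere of the boundary of the
  cross-polytope; its boundary is the \<open>(i-1)\<close>-sphere, made of two opposite hemispheres.\<close>

fun hemi :: "nat => (nat => real) chain" where
 "hemi 0 = frag_of (oriented_simplex 0 (%_ j. if j = 0 then 1 else 0))"
| "hemi (Suc i) = simplicial_cone i (%j. if j = Suc i then 1 else 0)
  (hemi i - frag_cmul ((-1) ^ i) (chain_map i neg_fun (hemi i)))"

lemma simplicial_chain_neg: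
 assumes "simplicial_chain p (punct n) c"
 shows "simplicial_chain p (punct n) (chain_map p neg_fun c)"
 using assms unfolding simplicial_chain_def
proof (induction c rule: frag_induction)
 case (one f)
 then obtain l where f: "f ` standard_simplex p \<subseteq> punct n" "f = oriented_simplex p l"
  by (auto simp: simplicial_simplex)
 have "simplex_map p neg_fun f = oriented_simplex p (%j i. - l j i)"
  unfolding f(2) by (auto simp: simplex_map_def oriented_simplex_def sum_negf fun_eq_iff)
 moreover have "simplex_map p neg_fun f ` standard_simplex p \<subseteq> punct n"
  using f(1) by (auto simp: simplex_map_def image_subset_iff intro!: neg_fun_punct)
 ultimately show ?case by (auto simp: simplicial_simplex)
next
 case (diff a b)
 then show ?case
  by (metis chain_map_diff simplicial_chain_def simplicial_chain_diff)
qed auto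

lemma simplicial_chain_hemi: "simplicial_chain i (punct i) (hemi i)"
proof (induction i)
 case 0
 have "(%i. (if i = 0 then 1 else 0) * x (0::nat)) \<in> punct 0" if "x \<in> standard_simplex 0" for x
  using that by (auto simp: punct_def standard_simplex_def fun_eq_iff)
 then show ?case
  by (auto simp: simplicial_simplex_oriented_simplex image_subset_iff)
next
 case (Suc i)
 \<comment> \<open>The segment from the apex to a point of \<open>punct i\<close> avoids the origin:
   a nonzero coordinate of index at most i can only vanish for u = 0, where the apex
   remains.\<close>
 have T: "(%j. (1 - u) * (if j = Suc i then 1 else 0) + u * x j) \<in> punct (Suc i)"
  if "0 <= u" "u <= 1" and x: "x \<in> punct i" for x u
 proof -
  obtain j where j: "x j ~= 0" "j <= i"
   using x by (auto simp: punct_def fun_eq_iff) (metis not_le)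
  have "(%j. (1 - u) * (if j = Suc i then 1 else 0) + u * x j) ~= (%_. 0)"
  proof
   assume a: "(%j. (1 - u) * (if j = Suc i then 1 else 0) + u * x j) = (%_. 0)"
   from fun_cong[OF a, of j] j have "u = 0" by simp
   with fun_cong[OF a, of "Suc i"] show False by simp
  qed
  then show ?thesis using x by (auto simp: punct_def)
 qed
 show ?case
  unfolding hemi.simps
  by (rule simplicial_chain_simplicial_cone[OF _ T])
   (auto intro!: simplicial_chain_diff simplicial_chain_cmul simplicial_chain_neg Suc)
qed

lemma singular_chain_hemi: "i <= n ==> singular_chain i (punct_top n) (hemi i)"
 using singular_chain_mono[OF simplicial_imp_singular_chain[OF simplicial_chain_hemi] punct_mono] .

text \<open>The base of the cone is a cycle: by induction its boundary is built from a lower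
  hemisphere and the antipodal one with signs alternating in the dimension, and the antipode is an
  involution.\<close>

lemma chain_boundary_hemi:
 "chain_boundary (Suc i) (hemi (Suc i)) = hemi i - frag_cmul ((-1) ^ i) (chain_map i neg_fun (hemi i))"
proof (induction i)
 case 0
 have c: "simplicial_chain 0 (punct 0) (hemi 0 - chain_map 0 neg_fun (hemi 0))"
  by (intro simplicial_chain_diff simplicial_chain_neg simplicial_chain_hemi)
 show ?case
  using chain_boundary_simplicial_cone[OF c] by (simp add: frag_extend_diff)
next
 case (Suc i)
 let ?d = "hemi (Suc i) - frag_cmul ((-1) ^ Suc i) (chain_map (Suc i) neg_fun (hemi (Suc i)))"
 have c: "simplicial_chain (Suc i) (punct (Suc i)) ?d"
  by (intro simplicial_chain_diff simplicial_chain_cmul simplicial_chain_neg simplicial_chain_hemi)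
 have s: "singular_chain j (punct_top j) (hemi j)" for j by (rule singular_chain_hemi) simp
 have "chain_map i neg_fun (chain_map i neg_fun (hemi i)) = hemi i"
 proof -
  have "chain_map i neg_fun (chain_map i neg_fun (hemi i)) = chain_map i (neg_fun \<circ> neg_fun) (hemi i)"
   by (simp add: chain_map_compose)
  also have "... = hemi i"
   by (rule chain_map_id_gen[OF s]) (auto simp: fun_eq_iff)
  finally show ?thesis .
 qed
 then have "chain_boundary (Suc i) ?d = 0"
  unfolding chain_boundary_diff chain_boundary_cmul chain_boundary_chain_map[OF s] Suc
  by (cases "even i") (simp_all add: chain_map_diff chain_map_add chain_map_minus)
 then show ?case
  using chain_boundary_simplicial_cone[OF c, of "%j. if j = Suc (Suc i) then 1 else 0"]
  by (simp add: simplicial_cone_def)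
qed

text \<open>Subdivision commutes with the boundary and with chain maps, so simplices can be made
  small without disturbing the relation between the hemispheres.\<close>

lemma iterated_subdivision:
 assumes "singular_chain p X c"
 shows "singular_chain p X ((singular_subdivision p ^^ m) c)"
  and "chain_boundary p ((singular_subdivision p ^^ m) c) = (singular_subdivision (p - Suc 0) ^^ m) (chain_boundary p c)"
  and "(singular_subdivision p ^^ m) (chain_map p g c) = chain_map p g ((singular_subdivision p ^^ m) c)"
proof -
 have 1: "singular_chain p X ((singular_subdivision p ^^ m) c)" for m
  by (induction m) (auto intro: singular_chain_singular_subdivision assms)
 then show "singular_chain p X ((singular_subdivision p ^^ m) c)" by simp
 show "chain_boundary p ((singular_subdivision p ^^ m) c) = (singular_subdivision (p - Suc 0) ^^ m) (chain_boundary p c)"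
  by (induction m) (auto simp: chain_boundary_singular_subdivision[OF 1])
 show "(singular_subdivision p ^^ m) (chain_map p g c) = chain_map p g ((singular_subdivision p ^^ m) c)"
  by (induction m) (auto simp: naturality_singular_subdivision[OF 1])
qed

lemma simplicial_vertex_simplex_map:
 "i <= p ==> simplicial_vertex i (simplex_map p g sig) = g (simplicial_vertex i sig)"
 by (simp add: simplicial_vertex_def simplex_map_def)

lemma simplicial_vertex_in:
 assumes "singular_simplex p (punct_top n) sig" "i <= p"
 shows "simplicial_vertex i sig \<in> punct n"
 using assms by (auto simp: singular_simplex_subtopology simplicial_vertex_def image_subset_iff)

text \<open>The cohomological core of the Borsuk-Ulam theorem. Stokes' formula moves the evaluation
  to the boundary, which consists of two antipodal copies of the lower hemisphere. As
  \<open>eps p\<close> is odd and \<open>cup_s eps p\<close> is even, the two values of the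
  primitive add up to \<open>cup_s eps p\<close>. The induction starts from the empty product on a
  single vertex.\<close>

lemma chain_eval_hemi:
 assumes odd: "!!j x. x \<in> punct n ==> eps j (neg_fun x) = eps j x + 1" and "p <= n"
 shows "chain_eval (cup_s eps p) ((singular_subdivision p ^^ m) (hemi p)) = 1"
 using \<open>p <= n\<close>
proof (induction p)
 case 0
 have "(singular_subdivision 0 ^^ m) (hemi 0) = hemi 0"
  by (induction m) (use singular_subdivision_zero[OF singular_chain_hemi[of 0 0]] in auto)
 then show ?case by (simp add: cup_s_def cup_def)
next
 case (Suc p)
 let ?c = "(singular_subdivision p ^^ m) (hemi p)"
 have sp: "singular_chain p (punct_top n) (hemi p)" "singular_chain (Suc p) (punct_top n) (hemi (Suc p))"
  using Suc.prems by (auto intro!: singular_chain_hemi simp del: hemi.simps)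
 have pw: "(singular_subdivision p ^^ m) (frag_cmul ((-1) ^ k) c) = frag_cmul ((-1) ^ k) ((singular_subdivision p ^^ m) c)"
  for k c using singular_subdivision_power_diff[of m p 0 c] by (cases "even k") auto
 have "chain_eval (cup_s eps (Suc p)) ((singular_subdivision (Suc p) ^^ m) (hemi (Suc p))) =
  chain_eval (cobdry_s eps p) ((singular_subdivision p ^^ m) (chain_boundary (Suc p) (hemi (Suc p))))"
  unfolding chain_eval_cobdry_s[symmetric] iterated_subdivision(2)[OF sp(2)] by simp
 also have "... = chain_eval (cobdry_s eps p) ?c + chain_eval (cobdry_s eps p) (chain_map p neg_fun ?c)"
  unfolding chain_boundary_hemi singular_subdivision_power_diff pw iterated_subdivision(3)[OF sp(1)]
  by (simp add: chain_eval_diff chain_eval_sign del: add_bit_eq_xor)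
 also have "... = chain_eval (%sig. cobdry_s eps p sig + cobdry_s eps p (simplex_map p neg_fun sig)) ?c"
  by (simp add: chain_eval_plus chain_eval_chain_map del: add_bit_eq_xor)
 also have "... = chain_eval (cup_s eps p) ?c"
 proof (rule chain_eval_cong)
  fix sig assume "sig \<in> Poly_Mapping.keys ?c"
  with iterated_subdivision(1)[OF sp(1), of m] have "singular_simplex p (punct_top n) sig"
   by (auto simp: singular_chain_def)
  then have v: "simplicial_vertex i sig \<in> punct n" if "i <= p" for i
   using that by (rule simplicial_vertex_in)
  have "cup_s eps p (simplex_map p neg_fun sig) = cup_s eps p sig"
   unfolding cup_s_def cup_def
   by (rule prod.cong) (auto simp: simplicial_vertex_simplex_map odd v simp del: add_bit_eq_xor add_diff_eq)
  then show "cobdry_s eps p sig + cobdry_s eps p (simplex_map p neg_fun sig) = cup_s eps p sig"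
   unfolding cobdry_s_def
   by (cases "cup_s eps p sig") (auto simp: simplicial_vertex_simplex_map odd v)
 qed
 also have "... = 1" using Suc by simp
 finally show ?case .
qed

text \<open>Each pair defines an odd 0-cochain, equal to 1 on one set and 0 on the other. After
  enough subdivisions every simplex lies in one of the sets, where the corresponding cochain is
  constant, so the product of the k coboundaries vanishes on it. By \<open>chain_eval_hemi\<close>
  the total is nevertheless 1.\<close>

theorem Lusternik_Schnirelmann_cover:
 assumes opn: "!!j. j < k ==> openin (punct_top k) (U j)"
   "!!j. j < k ==> openin (punct_top k) {x \<in> punct k. neg_fun x \<in> U j}"
  and disj: "!!j x. j < k ==> x \<in> U j ==> neg_fun x \<notin> U j"
  and cov: "!!x. x \<in> punct k ==> \<exists>j<k. x \<in> U j \<or> neg_fun x \<in> U j"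
 shows False
proof -
 \<comment> \<open>Outside the sets any odd function will do; this one is the sign of the first
   nonzero coordinate.\<close>
 define sg :: "(nat => real) => bit" where "sg x = (if x (LEAST i. x i ~= 0) > 0 then 1 else 0)" for x
 have sg: "sg (neg_fun x) = sg x + 1" if x: "x \<in> punct k" for x
 proof -
  from x obtain i where "x i ~= 0" by (auto simp: punct_def fun_eq_iff)
  then have "x (LEAST i. x i ~= 0) ~= 0" by (rule LeastI)
  then show ?thesis by (auto simp: sg_def)
 qed
 define eps where "eps j x = (if x \<in> U j then 1 else if neg_fun x \<in> U j then 0 else sg x)" for j x
 have "U j \<inter> {x. neg_fun x \<in> U j} = {}" if "j < k" for j
  using disj that by blast
 \<comment> \<open>Indices from \<open>k\<close> on receive the default \<open>sg\<close>, which
   keeps oddness at every index as \<open>chain_eval_hemi\<close> demands.\<close>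
 define eps' where "eps' j = (if j < k then eps j else sg)" for j
 have odd: "eps' j (neg_fun x) = eps' j x + 1" if "x \<in> punct k" for j x
  using disj[of j x] sg[OF that] by (auto simp: eps'_def eps_def)
 define \<C> where "\<C> = U ` {..<k} \<union> (%j. {x \<in> punct k. neg_fun x \<in> U j}) ` {..<k}"
 have C1: "openin (punct_top k) V" if "V \<in> \<C>" for V
  using that opn by (auto simp: \<C>_def)
 have C2: "topspace (punct_top k) \<subseteq> \<Union>\<C>"
  using cov by (fastforce simp: \<C>_def)
 obtain m where m: "!!m' f. m <= m' ==> f \<in> Poly_Mapping.keys ((singular_subdivision k ^^ m') (hemi k))
   ==> \<exists>V\<in>\<C>. f \<in> standard_simplex k \<rightarrow> V"
  by (rule sufficient_iterated_singular_subdivision_exists[OF C1 C2 singular_chain_hemi[of k k]]) auto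
 have "chain_eval (cup_s eps' k) ((singular_subdivision k ^^ m) (hemi k)) = chain_eval (%_. 0) ((singular_subdivision k ^^ m) (hemi k))"
 proof (rule chain_eval_cong)
  fix sig assume "sig \<in> Poly_Mapping.keys ((singular_subdivision k ^^ m) (hemi k))"
  from m[OF order.refl this] obtain V where V: "V \<in> \<C>" "sig \<in> standard_simplex k \<rightarrow> V" by blast
  have vt: "simplicial_vertex i sig \<in> V" if "i <= k" for i
   using V(2) that by (auto simp: simplicial_vertex_def Pi_iff)
  from V(1) consider j where "j < k" "V = U j" | j where "j < k" "V = {x \<in> punct k. neg_fun x \<in> U j}"
   by (auto simp: \<C>_def)
  then obtain j where j: "j < k" "!!x y. x \<in> V ==> y \<in> V ==> eps' j x = eps' j y"
  proof cases
   case (1 j) then show ?thesis using that[of j] by (auto simp: eps'_def eps_def)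
  next
   case (2 j)
   then have "eps' j x = 0" if "x \<in> V" for x
    using that disj[of j x] by (auto simp: eps'_def eps_def)
   then show ?thesis using that[of j] 2 by auto
  qed
  have "eps' j (simplicial_vertex j sig) + eps' j (simplicial_vertex (Suc j) sig) = 0"
   using j(2)[OF vt vt, of j "Suc j"] j(1) by simp
  then show "cup_s eps' k sig = 0"
   unfolding cup_s_def cup_def using j(1) by (auto simp: prod_zero_iff simp del: add_bit_eq_xor)
 qed
 moreover have "chain_eval (%_. 0) c = 0" for c :: "(nat => real) chain"
  by (simp add: chain_eval_def)
 ultimately show False
  using chain_eval_hemi[of k eps' k m] odd by simp
qed

subsection \<open>An index of symmetric sublevel sets\<close>

context fractional_nls
begin

text \<open>Openness in the sphere for the seminorm. Such a set does not separate points of the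
  sphere at seminorm distance zero.\<close>

definition sopen :: "real => ('a => real) set => bool" where
 "sopen m U \<longleftrightarrow> (\<forall>u\<in>S m. u \<in> U --> (\<exists>d>0. \<forall>w\<in>S m. en (%x. w x - u x) < d --> w \<in> U))"

text \<open>A covering version of the statement that Krasnoselskii's genus of \<open>A\<close> is at
  most \<open>j\<close>. In this form subadditivity, pullback under odd maps and the topological
  lower bound are direct.\<close>

definition cov :: "real => ('a => real) set => nat => bool" where
 "cov m A j \<longleftrightarrow> (\<exists>U. (\<forall>i<j. sopen m (U i) & (\<forall>u\<in>S m. u \<in> U i --> (%x. - u x) \<notin> U i)) &
  (\<forall>u\<in>A. \<exists>i<j. u \<in> U i \<or> (%x. - u x) \<in> U i))"

definition Lev :: "real => real => ('a => real) set" where "Lev m c = {u \<in> S m. J m u <= c}"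

lemma S_uminus: "u \<in> S m ==> (%x. - u x) \<in> S m"
 using Hsr.scale_mem[of u s "-1"] by (simp add: S_def bform_def)

lemma cov_mono:
 assumes "cov m A j" "B \<subseteq> A" "j <= k" shows "cov m B k"
proof -
 obtain U where U: "!!i. i < j ==> sopen m (U i) & (\<forall>u\<in>S m. u \<in> U i --> (%x. - u x) \<notin> U i)"
  "!!u. u \<in> A ==> \<exists>i<j. u \<in> U i \<or> (%x. - u x) \<in> U i" using assms(1) unfolding cov_def by blast
 show ?thesis unfolding cov_def
 proof (intro exI[of _ "%i. if i < j then U i else {}"] conjI allI impI ballI)
  fix i show "sopen m (if i < j then U i else {})" using U(1)[of i] by (simp add: sopen_def)
 next
  fix i u assume "u \<in> S m" "u \<in> (if i < j then U i else {})"
  then show "(%x. - u x) \<notin> (if i < j then U i else {})" using U(1)[of i] by (auto split: if_splits)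
 next
  fix u assume "u \<in> B"
  then obtain i where "i < j" "u \<in> U i \<or> (%x. - u x) \<in> U i" using U(2) assms(2) by blast
  then show "\<exists>i<k. u \<in> (if i < j then U i else {}) \<or> (%x. - u x) \<in> (if i < j then U i else {})"
   using assms(3) by (intro exI[of _ i]) auto
 qed
qed

lemma cov_Un:
 assumes "cov m A j" "cov m B k" shows "cov m (A \<union> B) (j + k)"
proof -
 obtain U where U: "!!i. i < j ==> sopen m (U i) & (\<forall>u\<in>S m. u \<in> U i --> (%x. - u x) \<notin> U i)"
  "!!u. u \<in> A ==> \<exists>i<j. u \<in> U i \<or> (%x. - u x) \<in> U i" using assms(1) unfolding cov_def by blast
 obtain V where V: "!!i. i < k ==> sopen m (V i) & (\<forall>u\<in>S m. u \<in> V i --> (%x. - u x) \<notin> V i)"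
  "!!u. u \<in> B ==> \<exists>i<k. u \<in> V i \<or> (%x. - u x) \<in> V i" using assms(2) unfolding cov_def by blast
 show ?thesis unfolding cov_def
 proof (intro exI[of _ "%i. if i < j then U i else V (i - j)"] conjI allI impI ballI)
  fix i assume "i < j + k"
  then show "sopen m (if i < j then U i else V (i - j))" using U(1)[of i] V(1)[of "i - j"] by simp
 next
  fix i u assume "i < j + k" "u \<in> S m" "u \<in> (if i < j then U i else V (i - j))"
  then show "(%x. - u x) \<notin> (if i < j then U i else V (i - j))" using U(1)[of i] V(1)[of "i - j"] by (cases "i < j") auto
 next
  fix u assume "u \<in> A \<union> B"
  then consider i where "i < j" "u \<in> U i \<or> (%x. - u x) \<in> U i" | i where "i < k" "u \<in> V i \<or> (%x. - u x) \<in> V i" using U(2) V(2) by blast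
  then show "\<exists>i<j + k. u \<in> (if i < j then U i else V (i - j)) \<or> (%x. - u x) \<in> (if i < j then U i else V (i - j))"
  proof cases
   case (1 i) then show ?thesis by (intro exI[of _ i]) auto
  next
   case (2 i) then show ?thesis by (intro exI[of _ "j + i"]) auto
  qed
 qed
qed

lemma cov_empty: "cov m {} 0" by (simp add: cov_def)

lemma en_scale: "Hsr s u ==> en (%x. c * u x) = c^2 * en u"
 using Hsr.ip_lc_lc[of u s u c 0] by simp

lemma diff_Hsr: "Hsr s u ==> Hsr s v ==> Hsr s (%x. u x - v x)"
 using Hsr.diff_mem[of u s v] by simp

lemma en_triangle: "Hsr s u ==> Hsr s v ==> Hsr s w ==> en (%x. u x - w x) <= 2 * en (%x. u x - v x) + 2 * en (%x. v x - w x)"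
 using en_add_le[OF diff_Hsr diff_Hsr, of u v v w] by simp

lemma sopenI:
 assumes "!!u f. u \<in> S m ==> u \<in> V ==> (!!n. f n \<in> S m) ==> (%n. en (%x. f n x - u x)) ~~> 0 ==> \<exists>n::nat. f n \<in> V"
 shows "sopen m V"
 unfolding sopen_def
proof (intro ballI impI)
 fix u assume u: "u \<in> S m" "u \<in> V"
 show "\<exists>d>0. \<forall>w\<in>S m. en (%x. w x - u x) < d --> w \<in> V"
 proof (rule ccontr)
  assume no: "\<not> ?thesis"
  have "\<exists>w. w \<in> S m & en (%x. w x - u x) < inverse (real (Suc n)) & w \<notin> V" for n
  proof -
   have "inverse (real (Suc n)) > 0" by simp
   then show ?thesis using no by blast
  qed
  then obtain f where f: "!!n. f n \<in> S m" "!!n. en (%x. f n x - u x) < inverse (real (Suc n))" "!!n. f n \<notin> V" by metis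
  have "(%n. en (%x. f n x - u x)) ~~> 0"
   by (rule squeeze_null[OF LIMSEQ_inverse_real_of_nat])
    (use f(2) en_parts(4) less_imp_le in auto)
  from assms[OF u f(1) this] f(3) show False by blast
 qed
qed

lemma sopen_cong: "sopen m U ==> u \<in> S m ==> w \<in> S m ==> en (%x. w x - u x) = 0 ==> u \<in> U ==> w \<in> U"
 unfolding sopen_def by fastforce

lemma sopen_ball:
 assumes "Hsr s v" shows "sopen m {w \<in> S m. en (%x. w x - v x) < dl}"
proof (rule sopenI)
 fix u f assume u: "u \<in> S m" "u \<in> {w \<in> S m. en (%x. w x - v x) < dl}" and f: "!!n. f n \<in> S m" "(%n. en (%x. f n x - u x)) ~~> 0"
 have "(%n. en (%x. f n x - v x)) ~~> en (%x. u x - v x)"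
  by (rule Hsr.ip_self_tendsto) (use u f assms diff_Hsr in "auto simp: S_def")
 then have "\<forall>\<^sub>F n in sequentially. en (%x. f n x - v x) < dl" using u(2) by (intro order_tendstoD(2)) auto
 then show "\<exists>n. f n \<in> {w \<in> S m. en (%x. w x - v x) < dl}" using f(1) by (auto simp: eventually_sequentially)
qed

text \<open>The squared radius m is small enough for disjointness: if u and -u were both in the ball
  around v, then 4 en v < 4 m by \<open>en_add_le\<close>, whereas en v >= m on the sphere.\<close>

lemma cov_balls:
 assumes m: "m > 0" and F: "finite F" "F \<subseteq> S m"
 shows "cov m {w \<in> S m. \<exists>v\<in>F. en (%x. w x - v x) < m \<or> en (%x. - w x - v x) < m} (card F)"
 using F
proof (induction F rule: finite_induct)
 case empty
 then show ?case using cov_empty by simp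
next
 case (insert v F)
 have vH: "Hsr s v" and vm: "bform v v = m" using insert(4) by (auto simp: S_def)
 have "cov m {w \<in> S m. en (%x. w x - v x) < m \<or> en (%x. - w x - v x) < m} 1"
  unfolding cov_def
 proof (intro exI[of _ "%_. {w \<in> S m. en (%x. w x - v x) < m}"] conjI allI impI ballI)
  fix u assume u: "u \<in> S m" "u \<in> {w \<in> S m. en (%x. w x - v x) < m}"
  show "(%x. - u x) \<notin> {w \<in> S m. en (%x. w x - v x) < m}"
  proof
   assume "(%x. - u x) \<in> {w \<in> S m. en (%x. w x - v x) < m}"
   then have "en (%x. - u x - v x) < m" by simp
   moreover have "en (%x. u x - v x) < m" using u by simp
   moreover have "en (%x. (u x - v x) + (- u x - v x)) <= 2 * en (%x. u x - v x) + 2 * en (%x. - u x - v x)"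
    by (rule en_add_le[OF diff_Hsr diff_Hsr]) (use u(1) S_uminus[OF u(1)] vH in "auto simp: S_def")
   moreover have "(%x. (u x - v x) + (- u x - v x)) = (%x. (- 2) * v x)" by (simp add: fun_eq_iff)
   moreover have "en (%x. (- 2) * v x) = 4 * en v" using en_scale[OF vH, of "- 2"] by simp
   moreover have "en v >= m" using nsq_le_en(1)[of v] vm by (simp add: bform_self)
   ultimately show False by simp
  qed
 qed (use sopen_ball[OF vH] S_uminus in auto)
 from cov_Un[OF this insert(3)] insert(4) have "cov m ({w \<in> S m. en (%x. w x - v x) < m \<or> en (%x. - w x - v x) < m} \<union>
  {w \<in> S m. \<exists>v\<in>F. en (%x. w x - v x) < m \<or> en (%x. - w x - v x) < m}) (1 + card F)" by simp
 then show ?case by (rule cov_mono) (use insert(1,2) in auto)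
qed

section \<open>Transport of coverings through the deformation\<close>

definition defo :: "real => real => ('a => real) => 'a => real" where "defo m h u = normalize m (step m h u)"

text \<open>Functions at seminorm distance zero are compared by applying a sequential limit to a
  constant sequence.\<close>

lemma bform_cong0:
 assumes "Hsr s p" "Hsr s q" "en (%x. p x - q x) = 0" shows "bform p p = bform q q"
 using en_tendsto_bform[of "%_. p" q] assms by (simp add: LIMSEQ_const_iff)

lemma defo_odd:
 assumes u: "u \<in> S m" and m: "m > 0" and pos: "bform (step m h u) (step m h u) > 0"
 shows "bform (step m h (%x. - u x)) (step m h (%x. - u x)) > 0" "en (%x. defo m h (%x. - u x) x - (- defo m h u x)) = 0"
proof -
 have uH: "Hsr s u" "bform u u > 0" using u m by (auto simp: S_def)
 have nH: "Hsr s (%x. - u x)" "bform (%x. - u x) (%x. - u x) > 0" using S_uminus[OF u] m by (auto simp: S_def)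
 have H: "Hsr s (step m h (%x. - u x))" "Hsr s (step m h u)" using step_Hsr nH uH m by auto
 have H2: "Hsr s (%x. - step m h u x)" using Hsr.scale_mem[of "step m h u" s "-1"] H by simp
 have z: "en (%x. step m h (%x. - u x) x - (- step m h u x)) = 0" by (rule step_odd[OF uH m])
 have b: "bform (step m h (%x. - u x)) (step m h (%x. - u x)) = bform (%x. - step m h u x) (%x. - step m h u x)"
  by (rule bform_cong0[OF H(1) H2 z])
 also have "... = bform (step m h u) (step m h u)" by (simp add: bform_def)
 finally show p: "bform (step m h (%x. - u x)) (step m h (%x. - u x)) > 0" using pos by simp
 have "(%n::nat. en (%x. normalize m (step m h (%x. - u x)) x - normalize m (%x. - step m h u x) x)) ~~> 0"
  by (rule normalize_continuous[OF H(1) H2 _ p _ m]) (use z p b in auto)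
 then show "en (%x. defo m h (%x. - u x) x - (- defo m h u x)) = 0"
  by (simp add: LIMSEQ_const_iff defo_def normalize_uminus)
qed

text \<open>The covering sets are pulled back along the deformation. It is odd and continuous for
  the seminorm only, which is enough because the sets are open for the seminorm and hence
  saturated.\<close>

lemma cov_pullback:
 assumes m: "m > 0" and B: "cov m B j" and A: "A \<subseteq> S m"
  and T: "!!u. u \<in> A ==> bform (step m h u) (step m h u) > 0 & defo m h u \<in> B"
 shows "cov m A j"
proof -
 obtain U where U: "!!i. i < j ==> sopen m (U i)" "!!i u. i < j ==> u \<in> S m ==> u \<in> U i ==> (%x. - u x) \<notin> U i"
  "!!u. u \<in> B ==> \<exists>i<j. u \<in> U i \<or> (%x. - u x) \<in> U i" using B unfolding cov_def by blast
 define V where "V i = {u \<in> S m. bform (step m h u) (step m h u) > 0 & defo m h u \<in> U i}" for i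
 have sH: "Hsr s (step m h u)" if "u \<in> S m" for u using step_Hsr[of u m] that m by (simp add: S_def)
 have dS: "defo m h u \<in> S m" if "u \<in> S m" "bform (step m h u) (step m h u) > 0" for u
  using normalize[OF sH[OF that(1)] that(2) m] by (simp add: defo_def S_def)
 show ?thesis unfolding cov_def
 proof (intro exI[of _ V] conjI allI impI ballI)
  fix i assume i: "i < j"
  show "sopen m (V i)"
  proof (rule sopenI)
   fix u f assume u: "u \<in> S m" "u \<in> V i" and f: "!!n. f n \<in> S m" "(%n. en (%x. f n x - u x)) ~~> 0"
   have up: "bform (step m h u) (step m h u) > 0" "defo m h u \<in> U i" using u by (auto simp: V_def)
   have st: "(%n. en (%x. step m h (f n) x - step m h u x)) ~~> 0"
    by (rule step_continuous) (use u f m in "auto simp: S_def")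
   have "\<forall>\<^sub>F n in sequentially. bform (step m h (f n)) (step m h (f n)) > 0"
    by (rule order_tendstoD(1)[OF en_tendsto_bform[OF sH[OF f(1)] sH[OF u(1)] st] up(1)])
   then obtain n0 where n0: "!!n. n >= n0 ==> bform (step m h (f n)) (step m h (f n)) > 0" by (auto simp: eventually_sequentially)
   have "(%n. en (%x. normalize m (step m h (f (n + n0))) x - normalize m (step m h u) x)) ~~> 0"
    by (rule normalize_continuous[OF sH[OF f(1)] sH[OF u(1)] LIMSEQ_ignore_initial_segment[OF st] _ up(1) m]) (simp add: n0)
   moreover obtain d where d: "d > 0" "!!w. w \<in> S m ==> en (%x. w x - defo m h u x) < d ==> w \<in> U i"
    using U(1)[OF i] dS[OF u(1) up(1)] up(2) unfolding sopen_def by blast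
   ultimately have "\<forall>\<^sub>F n in sequentially. en (%x. normalize m (step m h (f (n + n0))) x - normalize m (step m h u) x) < d"
    by (intro order_tendstoD(2))
   then obtain n where n: "en (%x. defo m h (f (n + n0)) x - defo m h u x) < d" by (auto simp: eventually_sequentially defo_def)
   have "f (n + n0) \<in> V i" using d(2)[OF dS[OF f(1) n0] n] n0 f(1) by (simp add: V_def)
   then show "\<exists>n. f n \<in> V i" by blast
  qed
  fix u assume u: "u \<in> S m" "u \<in> V i"
  have up: "bform (step m h u) (step m h u) > 0" "defo m h u \<in> U i" using u by (auto simp: V_def)
  show "(%x. - u x) \<notin> V i"
  proof
   assume "(%x. - u x) \<in> V i"
   then have a: "defo m h (%x. - u x) \<in> U i" by (simp add: V_def)
   have "(%x. - defo m h u x) \<in> U i"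
    by (rule sopen_cong[OF U(1)[OF i] dS[OF S_uminus[OF u(1)] defo_odd(1)[OF u(1) m up(1)]] S_uminus[OF dS[OF u(1) up(1)]] _ a])
     (use defo_odd(2)[OF u(1) m up(1)] en_diff_commute[of "defo m h (%x. - u x)" "%x. - defo m h u x"]
      dS[OF S_uminus[OF u(1)] defo_odd(1)[OF u(1) m up(1)]] S_uminus[OF dS[OF u(1) up(1)]] in "simp add: S_def")
   then show False using U(2)[OF i dS[OF u(1) up(1)] up(2)] by blast
  qed
 next
  fix u assume u: "u \<in> A"
  have uS: "u \<in> S m" and up: "bform (step m h u) (step m h u) > 0" using u A T by auto
  obtain i where i: "i < j" "defo m h u \<in> U i \<or> (%x. - defo m h u x) \<in> U i" using U(3) T[OF u] by blast
  have "u \<in> V i \<or> (%x. - u x) \<in> V i"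
  proof (cases "defo m h u \<in> U i")
   case True then show ?thesis using uS up by (simp add: V_def)
  next
   case False
   then have a: "(%x. - defo m h u x) \<in> U i" using i by blast
   have "defo m h (%x. - u x) \<in> U i"
    by (rule sopen_cong[OF U(1)[OF i(1)] S_uminus[OF dS[OF uS up]] dS[OF S_uminus[OF uS] defo_odd(1)[OF uS m up]] _ a])
     (use defo_odd(2)[OF uS m up] in simp)
   then show ?thesis using S_uminus[OF uS] defo_odd(1)[OF uS m up] by (simp add: V_def)
  qed
  then show "\<exists>i<j. u \<in> V i \<or> (%x. - u x) \<in> V i" using i(1) by blast
 qed
qed

text \<open>Balls around \<open>F\<close> contain a neighbourhood of the critical points at level c
  and take card F pairs; the deformation pushes the remainder below the level, where
  \<open>j\<close> pairs are available. \<open>F\<close> represents the critical points up to sign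
  and seminorm zero.\<close>

lemma cov_local:
 assumes m: "m > 0" and c: "c < 0" and F: "finite F" "F \<subseteq> S m"
  and cr: "!!u. u \<in> crit m ==> J m u = c ==> \<exists>v\<in>F. en (%x. u x - v x) = 0 \<or> en (%x. - u x - v x) = 0"
 shows "\<exists>e>0. \<forall>j. cov m (Lev m (c - e)) j --> cov m (Lev m (c + e)) (j + card F)"
proof -
 define N where "N = {w \<in> S m. \<exists>v\<in>F. en (%x. w x - v x) < m \<or> en (%x. - w x - v x) < m}"
 have Nn: "\<exists>d>0. \<forall>w\<in>S m. en (%x. w x - u x) < d --> w \<in> N" if u: "u \<in> crit m" "J m u = c" for u
 proof (intro exI[of _ "m / 2"] conjI ballI impI)
  show "m / 2 > 0" using m by simp
  fix w assume w: "w \<in> S m" "en (%x. w x - u x) < m / 2"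
  have uH: "Hsr s u" and wH: "Hsr s w" using u w by (auto simp: crit_def S_def)
  obtain v where v: "v \<in> F" "en (%x. u x - v x) = 0 \<or> en (%x. - u x - v x) = 0" using cr[OF u] by blast
  have vH: "Hsr s v" using v F by (auto simp: S_def)
  from v(2) have "en (%x. w x - v x) < m \<or> en (%x. - w x - v x) < m"
  proof
   assume "en (%x. u x - v x) = 0"
   then show ?thesis using en_triangle[OF wH uH vH] w(2) by simp
  next
   assume a: "en (%x. - u x - v x) = 0"
   have n: "Hsr s (%x. - u x)" "Hsr s (%x. - w x)" using Hsr.scale_mem[of _ s "-1"] uH wH by auto
   have "en (%x. - w x - (- u x)) = en (%x. w x - u x)"
    using en_scale[OF diff_Hsr[OF wH uH], of "- 1"] by (simp add: algebra_simps)
   then show ?thesis using en_triangle[OF n(2,1) vH] w(2) a by simp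
  qed
  then show "w \<in> N" using w(1) v(1) by (auto simp: N_def)
 qed
 obtain e h where e: "e > 0" "c + e <= 0"
  "!!u. u \<in> S m ==> J m u <= c + e ==> bform (step m h u) (step m h u) > 0"
  "!!u. u \<in> S m ==> J m u <= c + e ==> u \<notin> N ==> J m (step m h u) <= c - e"
  using deformation_step[OF m c Nn] by blast
 have "cov m (Lev m (c + e)) (j + card F)" if j: "cov m (Lev m (c - e)) j" for j
 proof -
  have "cov m (Lev m (c + e) - N) j"
  proof (rule cov_pullback[OF m j, where h = h])
   fix u assume u: "u \<in> Lev m (c + e) - N"
   have uS: "u \<in> S m" "J m u <= c + e" "u \<notin> N" using u by (auto simp: Lev_def)
   have sH: "Hsr s (step m h u)" using step_Hsr[of u m] uS(1) m by (simp add: S_def)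
   show "bform (step m h u) (step m h u) > 0 & defo m h u \<in> Lev m (c - e)"
    using normalize[OF sH e(3)[OF uS(1,2)] m] e(3)[OF uS(1,2)] e(4)[OF uS] by (simp add: defo_def Lev_def S_def)
  qed (auto simp: Lev_def)
  from cov_Un[OF this cov_balls[OF m F]] show ?thesis by (rule cov_mono) (auto simp: N_def)
 qed
 then show ?thesis using e(1) by blast
qed

lemma J_cong0:
 assumes "Hsr s p" "Hsr s q" "en (%x. p x - q x) = 0" shows "J m p = J m q" "psi p = psi q"
proof -
 have "nsq (%x. p x - q x) = 0" using nsq_le_en(1)[of "%x. p x - q x"] assms(3) nsq_nonneg[of "%x. p x - q x"] by linarith
 then have ae: "AE x in lborel. p x - q x = 0" using nsq_eq_0[OF HsrD(1)[OF diff_Hsr[OF assms(1,2)]]] by simp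
 have [measurable]: "p \<in> borel_measurable lborel" "q \<in> borel_measurable lborel" "Gprim g \<in> borel_measurable borel"
  using HsrD(1)[OF assms(1)] HsrD(1)[OF assms(2)] Gprim_cont by (auto simp: L2_def intro: borel_measurable_continuous_onI)
 show p: "psi p = psi q" unfolding psi_def by (rule integral_cong_AE) (use ae in "auto elim!: eventually_mono")
 have "(%n::nat. en p) ~~> en q" by (rule Hsr.ip_self_tendsto) (use assms in auto)
 then have "en p = en q" by (simp add: LIMSEQ_const_iff)
 then show "J m p = J m q" using bform_cong0[OF assms] p by (simp add: J_def eform_def)
qed

text \<open>A continuity argument in the level. \<open>n c\<close> allows one additional pair for
  each element of \<open>F\<close> up to level c. At the infimum \<open>b\<close> of the levels
  where this count fails, \<open>cov_local\<close> passes from b - e to b + e, so that no failure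
  can occur just above \<open>b\<close>.\<close>

lemma cov_sweep:
 assumes m: "m > 0" and c: "c1 <= c0" "c0 < 0" and F: "finite F" "F \<subseteq> S m" and j: "cov m (Lev m c1) j"
  and cr: "!!u. u \<in> crit m ==> c1 <= J m u ==> J m u <= c0 ==> \<exists>v\<in>F. en (%x. u x - v x) = 0 \<or> en (%x. - u x - v x) = 0"
 shows "cov m (Lev m c0) (j + card F)"
proof -
 define n where "n c = j + card {v\<in>F. J m v <= c}" for c
 define B where "B = {c. c1 <= c & c <= c0 & \<not> cov m (Lev m c) (n c)}"
 have Lm: "Lev m c \<subseteq> Lev m c'" if "c <= c'" for c c' using that by (auto simp: Lev_def)
 have "B = {}"
 proof (rule ccontr)
  assume ne: "B ~= {}"
  define b where "b = Inf B"
  have bb: "bdd_below B" by (rule bdd_belowI[of _ c1]) (simp add: B_def)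
  have b1: "c1 <= b" unfolding b_def by (rule cInf_greatest[OF ne]) (simp add: B_def)
  have b0: "b <= c0" using ne cInf_lower[OF _ bb] by (force simp: b_def B_def)
  define Fb where "Fb = {v\<in>F. J m v = b}"
  have "\<exists>e>0. \<forall>j. cov m (Lev m (b - e)) j --> cov m (Lev m (b + e)) (j + card Fb)"
  proof (rule cov_local[OF m])
   fix u assume u: "u \<in> crit m" "J m u = b"
   have uS: "u \<in> S m" using u by (simp add: crit_def)
   obtain v where v: "v \<in> F" "en (%x. u x - v x) = 0 \<or> en (%x. - u x - v x) = 0" using cr[OF u(1)] u(2) b0 b1 by auto
   have "J m v = b" using J_cong0(1)[of u v] J_cong0(1)[of "%x. - u x" v] v S_uminus[OF uS] uS F(2) J_uminus[of u] u(2) by (auto simp: S_def)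
   then show "\<exists>v\<in>Fb. en (%x. u x - v x) = 0 \<or> en (%x. - u x - v x) = 0" using v by (auto simp: Fb_def)
  qed (use F b0 c(2) in "auto simp: Fb_def")
  then obtain e where e: "e > 0" "!!j. cov m (Lev m (b - e)) j ==> cov m (Lev m (b + e)) (j + card Fb)" by blast
  \<comment> \<open>Either b - e lies below \<open>c1\<close>, where the initial covering serves, or
    it lies below the infimum and hence outside \<open>B\<close>.\<close>
  have "cov m (Lev m (b - e)) (n (b - e))"
  proof (cases "c1 <= b - e")
   case True
   have "b - e \<notin> B" using cInf_lower[OF _ bb, of "b - e"] e(1) by (auto simp: b_def)
   then show ?thesis using True b0 e(1) by (auto simp: B_def)
  next
   case False
   then show ?thesis by (intro cov_mono[OF j Lm]) (auto simp: n_def)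
  qed
  from e(2)[OF this] have cv: "cov m (Lev m (b + e)) (n (b - e) + card Fb)" .
  have le: "n (b - e) + card Fb <= n c" if "b <= c" for c
  proof -
   have "card {v\<in>F. J m v <= b - e} + card Fb = card ({v\<in>F. J m v <= b - e} \<union> Fb)"
    
   proof (rule card_Un_disjoint[symmetric])
    show "{v\<in>F. J m v <= b - e} \<inter> Fb = {}"
    proof (rule equals0I)
     fix v assume "v \<in> {v\<in>F. J m v <= b - e} \<inter> Fb"
     then have "J m v <= b - e" "J m v = b" unfolding Fb_def by blast+
     then show False using e(1) by linarith
    qed
   qed (simp_all add: Fb_def F(1))
   also have "... <= card {v\<in>F. J m v <= c}" using F(1) e(1) that by (intro card_mono) (auto simp: Fb_def)
   finally show ?thesis by (simp add: n_def)
  qed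
  have "c \<notin> B" if "c < b + e" for c
  proof
   assume cB: "c \<in> B"
   then have "b <= c" using cInf_lower[OF _ bb] by (simp add: b_def)
   then show False using cov_mono[OF cv Lm[of c] le] that cB by (simp add: B_def)
  qed
  moreover obtain c where "c \<in> B" "c < b + e" using cInf_lessD[OF ne, of "b + e"] e(1) by (auto simp: b_def)
  ultimately show False by blast
 qed
 then have "cov m (Lev m c0) (n c0)" using c(1) by (auto simp: B_def)
 then show ?thesis by (rule cov_mono) (use F(1) in "auto simp: n_def intro!: card_mono")
qed

text \<open>At nonpositive levels coercivity bounds the norm, hence \<open>psi\<close> from above,
  hence \<open>J\<close> from below.\<close>

lemma Lev_empty: assumes m: "m > 0" shows "\<exists>c1<0. Lev m c1 = {}"
proof -
 obtain R where R: "!!u. Hsr s u ==> bform u u = m ==> J m u <= 0 ==> en u <= R" using coercive[OF m] by blast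
 obtain R' where R': "!!u::'a => real. Hsr s u ==> en u <= R ==> nsq u + (LINT x|lborel. \<bar>u x\<bar> powr r) <= R'"
  using L2_Lr_bounded[of R] by blast
 obtain C where C: "C >= 0" "!!y. \<bar>Gprim g y\<bar> <= C * ((norm y)^2 + norm y powr r)" using subcritical_bound[OF subcritical_Gprim] by blast
 have low: "- (C * \<bar>R'\<bar>) <= J m u" if u: "u \<in> S m" "J m u <= 0" for u
 proof -
  have uH: "Hsr s u" "bform u u = m" using u by (auto simp: S_def)
  have i: "integrable lborel (%x. C * ((norm (u x))^2 + norm (u x) powr r))"
   using Lr_integrable[OF uH(1)] L2_integrable[OF HsrD(1)[OF uH(1)]] by simp
  have "psi u <= (LINT x|lborel. C * ((norm (u x))^2 + norm (u x) powr r))"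
   unfolding psi_def by (rule integral_mono[OF psi_integrable[OF uH(1)] i]) (use C(2) in "auto simp: abs_le_iff")
  also have "... = C * (nsq u + (LINT x|lborel. \<bar>u x\<bar> powr r))"
   using Lr_integrable[OF uH(1)] L2_integrable[OF HsrD(1)[OF uH(1)]] by (simp add: nsq_def)
  also have "... <= C * \<bar>R'\<bar>" using R'[OF uH(1) R[OF uH u(2)]] C(1) by (intro mult_left_mono) auto
  finally show ?thesis using J_sphere[OF m uH(2)] aform_nonneg[of s u] by simp
 qed
 have "Lev m (- (C * \<bar>R'\<bar>) - 1) = {}"
 proof (rule equals0I)
  fix u assume "u \<in> Lev m (- (C * \<bar>R'\<bar>) - 1)"
  moreover have "0 <= C * \<bar>R'\<bar>" using C(1) by simp
  ultimately show False using low[of u] by (simp add: Lev_def)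
 qed
 moreover have "- (C * \<bar>R'\<bar>) - 1 < 0" using mult_nonneg_nonneg[OF C(1) abs_ge_zero[of R']] by linarith
 ultimately show ?thesis by blast
qed

lemma bounded_lin_eform:
 assumes "Hsr s v" shows "Hsr.bounded_lin_on s E (%u. eform s u v)"
 unfolding Hsr.bounded_lin_on_def using assms Hsr.ip_lc[of _ s _ v] Hsr.ip_Cauchy_Schwarz(2)[of _ s v]
 by (auto intro!: exI[of _ "sqrt (en v)"] simp: mult.commute)

text \<open>If every w in the sublevel had a nonzero product with one of finitely many f i, the
  half-spaces where these products are positive would give a covering. The resulting orthogonal
  sequence has, along a subsequence, a weak limit of seminorm zero, so \<open>psi\<close> tends to 0
  there, against psi >= -c > 0.\<close>

lemma cov_finite:
 assumes m: "m > 0" and c: "c < 0" shows "\<exists>j. cov m (Lev m c) j"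
proof (rule ccontr)
 assume no: "\<nexists>j. cov m (Lev m c) j"
 have ex: "\<exists>w. w \<in> Lev m c & (\<forall>i<n. eform s w (f i) = 0)" if f: "!!i. i < n ==> f i \<in> Lev m c" for f and n :: nat
 proof (rule ccontr)
  assume a: "\<not> ?thesis"
  have fH: "Hsr s (f i)" if "i < n" for i using f[OF that] by (simp add: Lev_def S_def)
  have neg: "eform s (%x. - u x) v = - eform s u v" if "Hsr s u" "Hsr s v" for u v :: "'a => real"
   using Hsr.ip_scale[of u s v "-1"] that by simp
  have "cov m (Lev m c) n" unfolding cov_def
  proof (intro exI[of _ "%i. {w \<in> S m. eform s w (f i) > 0}"] conjI allI impI ballI)
   fix i assume i: "i < n"
   show "sopen m {w \<in> S m. eform s w (f i) > 0}"
   proof (rule sopenI)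
    fix u h assume u: "u \<in> S m" "u \<in> {w \<in> S m. eform s w (f i) > 0}" and h: "!!k. h k \<in> S m" "(%k. en (%x. h k x - u x)) ~~> 0"
    have "(%k. eform s (h k) (f i)) ~~> eform s u (f i)"
     by (rule Hsr.ip_tendsto) (use u h fH[OF i] in "auto simp: S_def")
    then have "\<forall>\<^sub>F k in sequentially. eform s (h k) (f i) > 0" using u(2) by (intro order_tendstoD(1)) auto
    then show "\<exists>k. h k \<in> {w \<in> S m. eform s w (f i) > 0}" using h(1) by (auto simp: eventually_sequentially)
   qed
   fix u assume "u \<in> S m" "u \<in> {w \<in> S m. eform s w (f i) > 0}"
   then show "(%x. - u x) \<notin> {w \<in> S m. eform s w (f i) > 0}" using neg[OF _ fH[OF i]] by (auto simp: S_def)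
  next
   fix u assume u: "u \<in> Lev m c"
   then obtain i where i: "i < n" "eform s u (f i) ~= 0" using a by blast
   have uS: "u \<in> S m" using u by (simp add: Lev_def)
   show "\<exists>i<n. u \<in> {w \<in> S m. eform s w (f i) > 0} \<or> (%x. - u x) \<in> {w \<in> S m. eform s w (f i) > 0}"
    using i neg[OF _ fH[OF i(1)], of u] uS S_uminus[OF uS] by (intro exI[of _ i]) (auto simp: S_def)
  qed
  then show False using no by blast
 qed
 have "\<exists>f :: nat => 'a => real. \<forall>n. f n \<in> Lev m c & (\<forall>i<n. eform s (f n) (f i) = 0)"
  by (rule dependent_wellorder_choice[where P = "%(f :: nat => 'a => real) n w. w \<in> Lev m c & (\<forall>i<n. eform s w (f i) = 0)"]) (use ex in auto)
 then obtain f :: "nat => 'a => real" where f0: "\<forall>n. f n \<in> Lev m c & (\<forall>i<n. eform s (f n) (f i) = 0)" by (rule exE)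
 then have f: "f n \<in> Lev m c" "i < n ==> eform s (f n) (f i) = 0" for i n by simp_all
 have fH: "Hsr s (f n)" "bform (f n) (f n) = m" "J m (f n) <= c" for n using f(1)[of n] by (auto simp: Lev_def S_def)
 obtain R where R: "!!u. Hsr s u ==> bform u u = m ==> J m u <= 0 ==> en u <= R" using coercive[OF m] by blast
 have fR: "en (f n) <= R" for n using R[OF fH(1,2)] fH(3)[of n] c by auto
 obtain rho U where w: "strict_mono (rho :: nat => nat)" "Hsr s U"
  "!!\<l>. Hsr.bounded_lin_on s E \<l> ==> (%n. \<l> (f (rho n))) ~~> \<l> U" "conv_meas (%n. f (rho n)) U"
  using weak_limit[of f R] fH(1) fR by metis
 have "eform s U (f i) = 0" for i
 proof -
  have "\<forall>\<^sub>F n in sequentially. eform s (f (rho n)) (f i) = 0"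
   using eventually_gt_at_top[of i] by eventually_elim (meson f(2) less_le_trans seq_suble[OF w(1)])
  then have "(%n. eform s (f (rho n)) (f i)) ~~> 0" by (rule tendsto_eventually)
  then show ?thesis using w(3)[OF bounded_lin_eform[OF fH(1)], of i] LIMSEQ_unique by blast
 qed
 then have "eform s (f i) U = 0" for i using Hsr.ip_commute[of U s "f i"] fH(1) w(2) by simp
 then have "en U = 0" using w(3)[OF bounded_lin_eform[OF w(2)]] by (simp add: LIMSEQ_const_iff)
 then have "psi U = psi (%_. 0)" by (intro J_cong0(2)) (use w(2) Hsr_zero in auto)
 then have "psi U = 0" by (simp add: psi_def Gprim_0)
 then have "(%n. psi (f (rho n))) ~~> 0" using psi_tendsto[OF fH(1) fR w(2,4)] by simp
 moreover have "- c <= psi (f n)" for n using J_sphere[OF m fH(2)] fH(3)[of n] aform_nonneg[of s "f n"] by simp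
 ultimately have "- c <= 0" by (intro LIMSEQ_le_const) auto
 then show False using c by simp
qed

text \<open>The covering sets are pulled back to \<open>punct k\<close>, a space of dimension k + 1.
  Its sphere has dimension k and is not covered by k antipodal pairs.\<close>

lemma not_cov:
 assumes A: "A \<subseteq> S m" and \<Phi>: "!!sig. sig \<in> punct k ==> \<Phi> sig \<in> A" and odd: "!!sig. sig \<in> punct k ==> \<Phi> (neg_fun sig) = (%x. - \<Phi> sig x)"
  and cont: "!!sig eps. sig \<in> punct k ==> eps > 0 ==> \<exists>W. openin (punct_top k) W & sig \<in> W & (\<forall>\<tau>\<in>W. en (%x. \<Phi> \<tau> x - \<Phi> sig x) < eps)"
 shows "\<not> cov m A k"
proof
 assume "cov m A k"
 then obtain U where U: "!!i. i < k ==> sopen m (U i)" "!!i u. i < k ==> u \<in> S m ==> u \<in> U i ==> (%x. - u x) \<notin> U i"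
  "!!u. u \<in> A ==> \<exists>i<k. u \<in> U i \<or> (%x. - u x) \<in> U i" unfolding cov_def by blast
 have ts: "topspace (punct_top k) = punct k" by simp
 define V where "V i = {sig \<in> punct k. \<Phi> sig \<in> U i}" for i
 have V: "openin (punct_top k) (V i)" if i: "i < k" for i
  unfolding openin_subopen[of _ "V i"]
 proof
  fix sig assume s: "sig \<in> V i"
  then have sp: "sig \<in> punct k" "\<Phi> sig \<in> U i" by (auto simp: V_def)
  then obtain d where d: "d > 0" "!!w. w \<in> S m ==> en (%x. w x - \<Phi> sig x) < d ==> w \<in> U i"
   using U(1)[OF i] \<Phi>[OF sp(1)] A unfolding sopen_def by blast
  obtain W where W: "openin (punct_top k) W" "sig \<in> W" "\<forall>\<tau>\<in>W. en (%x. \<Phi> \<tau> x - \<Phi> sig x) < d" using cont[OF sp(1) d(1)] by blast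
  have "W \<subseteq> punct k" using openin_subset[OF W(1)] ts by simp
  moreover have "\<tau> \<in> V i" if "\<tau> \<in> W" "\<tau> \<in> punct k" for \<tau>
   using d(2)[OF subsetD[OF A \<Phi>[OF that(2)]]] W(3) that by (simp add: V_def)
  ultimately have "W \<subseteq> V i" by blast
  then show "\<exists>T. openin (punct_top k) T & sig \<in> T & T \<subseteq> V i" using W by blast
 qed
 show False
 proof (rule Lusternik_Schnirelmann_cover[of k V])
  fix j assume j: "j < k"
  show "openin (punct_top k) (V j)" by (rule V[OF j])
  show "openin (punct_top k) {x \<in> punct k. neg_fun x \<in> V j}"
   using openin_continuous_map_preimage[OF continuous_map_neg_fun V[OF j]] by (simp add: ts)
  fix x assume "x \<in> V j"
  then have x: "x \<in> punct k" "\<Phi> x \<in> U j" by (auto simp: V_def)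
  show "neg_fun x \<notin> V j" using U(2)[OF j _ x(2)] \<Phi>[OF x(1)] A odd[OF x(1)] by (auto simp: V_def)
 next
  fix x assume x: "x \<in> punct k"
  obtain j where "j < k" "\<Phi> x \<in> U j \<or> (%y. - \<Phi> x y) \<in> U j" using U(3)[OF \<Phi>[OF x]] by blast
  then show "\<exists>j<k. x \<in> V j \<or> neg_fun x \<in> V j" using x neg_fun_punct[OF x] odd[OF x] by (auto simp: V_def)
 qed
qed

end

subsection \<open>Critical points are solutions\<close>

lemma L2_fourier_inner:
 fixes f h :: "'a::euclidean_space => complex"
 assumes f: "L2_fourier f v" and h: "L2_fourier h w"
 shows "(LINT x|lborel. f x \<bullet> h x) = (LINT x|lborel. v x \<bullet> w x)"
proof -
 have I: "(LINT x|lborel. p x \<bullet> q x) = (nsq (%x. p x + q x) - nsq p - nsq q) / 2" if "L2 p" "L2 q" for p q :: "'a => complex"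
  unfolding nsq_def dot_norm using L2_integrable[OF that(1)] L2_integrable[OF that(2)] L2_integrable[OF L2_add[OF that]] by simp
 have s: "L2_fourier (%x. f x + h x) (%x. v x + w x)" using L2_fourier_lincomb[OF f h, of 1 1] by simp
 then show ?thesis
  unfolding I[OF L2_fourier_L2(1)[OF f] L2_fourier_L2(1)[OF h]] I[OF L2_fourier_L2(2)[OF f] L2_fourier_L2(2)[OF h]]
  using L2_fourier_nsq[OF f] L2_fourier_nsq[OF h] L2_fourier_nsq[OF s] by simp
qed

lemma frac_lap_WT:
 fixes u :: "'a::euclidean_space => real"
 assumes u: "Hsr s u" and w: "frac_lap s u w"
 shows "L2_fourier w (WT s u)"
proof -
 obtain v where v: "L2_fourier (%x. complex_of_real (u x)) v" "L2_fourier w (%xi. complex_of_real (norm xi powr s) * v xi)"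
  using w unfolding frac_lap_def by blast
 have ae: "AE xi in lborel. v xi = FT u xi" by (rule L2_fourier_unique[OF v(1) FT[OF HsrD(1)[OF u]]])
 show ?thesis
  by (rule L2_fourier_cong[OF v(2)]) (use L2_fourier_L2(1)[OF v(2)] HsrD(2)[OF u] ae in "auto simp: L2_def WT_def elim!: eventually_mono")
qed

text \<open>The transform of a real function is unchanged by conjugation combined with reflection, a
  symmetry kept by the even multiplier. Realness matters because \<open>solves_P\<close> integrates
  a product without conjugation.\<close>

lemma frac_lap_real:
 fixes u :: "'a::euclidean_space => real"
 assumes u: "Hsr s u" and w: "frac_lap s u w"
 shows "AE x in lborel. Im (w x) = 0"
proof -
 have F: "L2_fourier w (WT s u)" by (rule frac_lap_WT[OF u w])
 have c: "L2_fourier (%x. cnj (w x)) (%xi. cnj (WT s u (- xi)))" by (rule L2_fourier_cnj[OF F])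
 have "L2_fourier (%x. complex_of_real (u x)) (%xi. cnj (FT u (- xi)))" using L2_fourier_cnj[OF FT[OF HsrD(1)[OF u]]] by simp
 from L2_fourier_unique[OF this FT[OF HsrD(1)[OF u]]] have ae: "AE xi in lborel. cnj (WT s u (- xi)) - WT s u xi = 0"
  by eventually_elim (simp add: WT_def)
 have d: "L2_fourier (%x. cnj (w x) - w x) (%xi. cnj (WT s u (- xi)) - WT s u xi)" by (rule L2_fourier_diff[OF c F])
 have "nsq (%x. cnj (w x) - w x) = 0" using L2_fourier_nsq[OF d] ae nsq_eq_0[OF L2_fourier_L2(2)[OF d]] by simp
 then have "AE x in lborel. cnj (w x) - w x = 0" using nsq_eq_0[OF L2_fourier_L2(1)[OF d]] by simp
 then show ?thesis by eventually_elim (simp add: complex_eq_iff)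
qed

lemma frac_lap_pairing:
 fixes u :: "'a::euclidean_space => real"
 assumes u: "Hsr s u" "frac_lap s u w" and h: "Hsr s h" "frac_lap s h k"
 shows "(LINT x|lborel. w x * k x) = complex_of_real (aform s u h)"
proof -
 note F = frac_lap_WT[OF u] frac_lap_WT[OF h]
 have m: "w \<in> borel_measurable lborel" "k \<in> borel_measurable lborel" using F[THEN L2_fourier_L2(1)] by (simp_all add: L2_def)
 have "(LINT x|lborel. w x * k x) = (LINT x|lborel. complex_of_real (w x \<bullet> k x))"
 proof (rule integral_cong_AE)
  show "AE x in lborel. w x * k x = complex_of_real (w x \<bullet> k x)"
   using frac_lap_real[OF u] frac_lap_real[OF h] by eventually_elim (simp add: complex_eq_iff inner_complex_def)
  show "(%x. w x * k x) \<in> borel_measurable lborel" using m by (rule borel_measurable_times)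
  show "(%x. complex_of_real (w x \<bullet> k x)) \<in> borel_measurable lborel"
   by (rule measurable_compose[OF borel_measurable_inner[OF m]]) measurable
 qed
 also have "... = complex_of_real (LINT x|lborel. w x \<bullet> k x)" by simp
 also have "(LINT x|lborel. w x \<bullet> k x) = aform s u h" unfolding aform_def by (rule L2_fourier_inner[OF F])
 finally show ?thesis .
qed

lemma AE_eq_aform:
 fixes d :: "'a::euclidean_space => real"
 assumes d: "L2 d" and z: "nsq d = 0" shows "aform s d d = 0"
proof -
 have "nsq (FT d) = 0" using nsq_FT[OF d] z by simp
 then have "AE xi in lborel. WT s d xi = 0" using nsq_eq_0[OF L2_FT[OF d]] by (auto simp: WT_def elim!: eventually_mono)
 then have "nsq (WT s d) = nsq (%_::'a. 0 :: complex)" by (intro nsq_cong_AE) (use WT_measurable[OF d, of s] in auto)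
 then show ?thesis by (simp add: aform_self)
qed

context fractional_nls
begin

lemma en_eq_0_iff:
 assumes "Hsr s u" "Hsr s v" shows "en (%x. u x - v x) = 0 \<longleftrightarrow> (AE x in lborel. u x = v x)"
proof -
 have L: "L2 (%x. u x - v x)" by (rule HsrD(1)[OF diff_Hsr[OF assms]])
 have "en (%x. u x - v x) = 0 \<longleftrightarrow> nsq (%x. u x - v x) = 0"
 proof
  show "en (%x. u x - v x) = 0 ==> nsq (%x. u x - v x) = 0" using en_parts(1-3)[of "%x. u x - v x"] by linarith
  show "nsq (%x. u x - v x) = 0 ==> en (%x. u x - v x) = 0" using en_parts(3)[of "%x. u x - v x"] AE_eq_aform[OF L, of s] by linarith
 qed
 then show ?thesis using nsq_eq_0[OF L] by simp
qed

text \<open>Surjectivity of the transform provides a fractional derivative, so the choice in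
  \<open>energy\<close> denotes one; its L^2 norm does not depend on the choice.\<close>

lemma energy_eq_J:
 assumes m: "m > 0" and u: "u \<in> S m" shows "energy s g u = J m u"
proof -
 have uH: "Hsr s u" "bform u u = m" using u by (auto simp: S_def)
 obtain w0 where "L2_fourier w0 (WT s u)" using L2_fourier_surj[OF HsrD(2)[OF uH(1)]] by blast
 then have "frac_lap s u w0" using FT[OF HsrD(1)[OF uH(1)]] by (auto simp: frac_lap_def WT_def[abs_def])
 then have "frac_lap s u (SOME w. frac_lap s u w)" by (rule someI[where P = "frac_lap s u"])
 from L2_fourier_nsq[OF frac_lap_WT[OF uH(1) this]] show ?thesis
  by (simp add: energy_def J_sphere[OF m uH(2)] aform_self nsq_def psi_def)
qed

text \<open>On the sphere the terms of \<open>dJ\<close> containing \<open>bform u phi\<close>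
  collect into one multiplier, whose sign is read off after eliminating \<open>psi\<close> through
  \<open>J\<close>.\<close>

lemma crit_solves:
 assumes m: "m > 0" and u: "u \<in> crit m" and neg: "J m u < 0"
 shows "\<exists>\<mu>>0. solves_P s g m \<mu> u"
proof -
 have uH: "Hsr s u" "bform u u = m" and d: "!!phi. Hsr s phi ==> dJ m u phi = 0" using u by (auto simp: crit_def S_def)
 define \<mu> where "\<mu> = (2 * psi u - al * aform s u u) / m"
 have "2 * psi u - al * aform s u u = - 2 * J m u + 2 * s / real DIM('a) * aform s u u"
  by (simp add: J_sphere[OF m uH(2)] al_def algebra_simps)
 moreover have "0 <= 2 * s / real DIM('a) * aform s u u" using s01 aform_nonneg[of s u] by simp
 ultimately have "\<mu> > 0" using neg m by (simp add: \<mu>_def)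
 moreover have "solves_P s g m \<mu> u" unfolding solves_P_def
 proof (intro conjI allI impI uH(1))
  show "(LINT x|lborel. (u x)^2) = m" using uH(2) by (simp add: bform_def power2_eq_square)
  fix phi :: "'a => real" and wu wphi assume h: "Hsr s phi" "frac_lap s u wu" "frac_lap s phi wphi"
  have "aform s u phi + \<mu> * bform u phi = dpsi u phi" using d[OF h(1)] by (simp add: dJ_sphere[OF m uH(2)] \<mu>_def)
  then show "(LINT x|lborel. wu x * wphi x) + complex_of_real (\<mu> * (LINT x|lborel. u x * phi x)) = complex_of_real (LINT x|lborel. g (u x) * phi x)"
   unfolding frac_lap_pairing[OF uH(1) h(2) h(1,3)] by (simp add: bform_def dpsi_def flip: of_real_add of_real_mult)
 qed
 ultimately show ?thesis by blast
qed

end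

subsection \<open>Lipschitz test functions\<close>

lemma efun_quotient_tendsto:
 "(%n. (cmod (efun (inverse (real (Suc n)) *\<^sub>R e) xi - 1) / inverse (real (Suc n)))^2) ~~> (e \<bullet> xi)^2"
proof -
 let ?th = "complex_of_real (e \<bullet> xi)" and ?t = "%n. complex_of_real (inverse (real (Suc n)))"
 have "((%z. exp (- \<i> * (z * ?th))) has_field_derivative - \<i> * ?th) (at 0)"
  by (auto intro!: derivative_eq_intros)
 then have "((%z. (exp (- \<i> * (z * ?th)) - 1) / z) \<longlongrightarrow> - \<i> * ?th) (at 0)" by (simp add: has_field_derivative_iff)
 moreover have "?t ~~> complex_of_real 0" by (rule tendsto_of_real[OF LIMSEQ_inverse_real_of_nat])
 then have "filterlim ?t (at (complex_of_real 0)) sequentially" by (rule filterlim_atI) (simp only: of_real_eq_iff, simp)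
 then have "filterlim ?t (at 0) sequentially" by simp
 ultimately have "(%n. (exp (- \<i> * (?t n * ?th)) - 1) / ?t n) ~~> - \<i> * ?th" by (rule filterlim_compose)
 then have "(%n. (cmod ((exp (- \<i> * (?t n * ?th)) - 1) / ?t n))^2) ~~> (cmod (- \<i> * ?th))^2" by (intro tendsto_intros)
 moreover have "cmod ((exp (- \<i> * (?t n * ?th)) - 1) / ?t n) = cmod (efun (inverse (real (Suc n)) *\<^sub>R e) xi - 1) / inverse (real (Suc n))" for n
  by (simp add: norm_divide norm_of_real del: of_real_inverse of_nat_Suc)
 moreover have "(cmod (- \<i> * ?th))^2 = (e \<bullet> xi)^2" by (simp add: norm_mult)
 ultimately show ?thesis by simp
qed

lemma supported_nsq_le:
 fixes f :: "'a::euclidean_space => real"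
 assumes "f \<in> borel_measurable borel" "c >= 0" "!!x. \<bar>f x\<bar> <= c" "!!x. norm x >= R ==> f x = 0"
 shows "L2 f" "nsq f <= c^2 * measure lborel (ball (0::'a) R)"
proof -
 have le: "AE x in lborel. norm (f x) <= c * norm (indicator (ball (0::'a) R) x :: real)"
  using assms(2-4) by (intro AE_I2) (auto simp: indicator_def)
 show "L2 f" "nsq f <= c^2 * measure lborel (ball (0::'a) R)"
  using L2_bound[OF L2_indicator_ball, of f c 0 R] le assms(1) by (simp_all add: nsq_indicator_ball)
qed

definition lip1 :: "real => ('a::euclidean_space => real) => bool" where
 "lip1 L u \<longleftrightarrow> L >= 0 & (\<forall>x y. \<bar>u x - u y\<bar> <= L * norm (x - y)) & (\<forall>x. norm x >= 1 --> u x = 0)"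

lemma lip1_continuous: "lip1 L u ==> continuous_on UNIV u"
 by (rule lipschitz_on_continuous_on[of L]) (auto simp: lip1_def dist_norm intro!: lipschitz_onI)

text \<open>Difference quotients in each coordinate direction have explicit transforms, and Fatou's
  lemma lets the increment tend to 0. Increments of length at most 1 keep the supports in the ball
  of radius 2.\<close>

lemma lip1_gradient:
 fixes u :: "'a::euclidean_space => real"
 assumes u: "lip1 L u" and L2u: "L2 u"
 shows "(\<integral>\<^sup>+xi. ennreal ((norm xi)^2 * (cmod (FT u xi))^2) \<partial>lborel) <= ennreal (real DIM('a) * (L^2 * measure lborel (ball (0::'a) 2)))"
proof -
 let ?V = "L^2 * measure lborel (ball (0::'a) 2)"
 have L: "L >= 0" "!!x y. \<bar>u x - u y\<bar> <= L * norm (x - y)" "!!x. norm x >= 1 ==> u x = 0" using u by (auto simp: lip1_def)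
 have FTm [measurable]: "FT u \<in> borel_measurable borel" using L2_FT[OF L2u] by (simp add: L2_def)
 have um: "u \<in> borel_measurable borel" using L2u by (simp add: L2_def)
 have one: "(\<integral>\<^sup>+xi. ennreal ((e \<bullet> xi)^2 * (cmod (FT u xi))^2) \<partial>lborel) <= ennreal ?V" if e: "e \<in> Basis" for e :: 'a
 proof -
  define t where "t n = inverse (real (Suc n))" for n
  have t: "0 < t n" "t n <= 1" for n by (simp_all add: t_def inverse_le_1_iff)
  let ?f = "%n xi. (cmod (efun (t n *\<^sub>R e) xi - 1) / t n)^2 * (cmod (FT u xi))^2"
  have fn: "(\<integral>\<^sup>+xi. ennreal (?f n xi) \<partial>lborel) <= ennreal ?V" for n
  proof -
   let ?h = "t n *\<^sub>R e"
   have nh: "norm ?h = t n" using t[of n] e by simp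
   have i: "integrable lborel (%xi. (cmod (efun ?h xi - 1))^2 * (cmod (FT u xi))^2)"
   proof (rule Bochner_Integration.integrable_bound)
    show "integrable lborel (%xi. 4 * (cmod (FT u xi))^2)" using L2_integrable[OF L2_FT[OF L2u]] by simp
    have "(cmod (efun ?h xi - 1))^2 <= 2^2" for xi by (rule power_mono) (use norm_iexp_minus_1_le[of ?h xi] in auto)
    then show "AE xi in lborel. norm ((cmod (efun ?h xi - 1))^2 * (cmod (FT u xi))^2) <= norm (4 * (cmod (FT u xi))^2)"
     by (intro AE_I2) (simp add: mult_right_mono)
    show "(%xi. (cmod (efun ?h xi - 1))^2 * (cmod (FT u xi))^2) \<in> borel_measurable lborel" by measurable
   qed
   have "nsq (%x. u (?h + x) - u x) <= (L * t n)^2 * measure lborel (ball (0::'a) 2)"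
   proof (rule supported_nsq_le(2))
    show "(%x. u (?h + x) - u x) \<in> borel_measurable borel" using um by measurable
    show "\<bar>u (?h + x) - u x\<bar> <= L * t n" for x using L(2)[of "?h + x" x] nh by simp
    fix x :: 'a assume "norm x >= 2"
    moreover have "norm x <= norm (?h + x) + norm ?h" using norm_triangle_ineq4[of "?h + x" ?h] by simp
    ultimately show "u (?h + x) - u x = 0" using L(3) nh t(2)[of n] by simp
   qed (use L t[of n] in auto)
   then have b: "(LINT xi|lborel. (cmod (efun ?h xi - 1))^2 * (cmod (FT u xi))^2) / (t n)^2 <= ?V"
    unfolding nsq_translate_diff[OF L2u] using t[of n] by (simp add: divide_le_eq power_mult_distrib mult_ac)
   have eq: "?f n xi = (cmod (efun ?h xi - 1))^2 * (cmod (FT u xi))^2 / (t n)^2" for xi by (simp add: power_divide)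
   have "(\<integral>\<^sup>+xi. ennreal (?f n xi) \<partial>lborel) = ennreal (LINT xi|lborel. (cmod (efun ?h xi - 1))^2 * (cmod (FT u xi))^2 / (t n)^2)"
    unfolding eq by (rule nn_integral_eq_integral) (use i in auto)
   also have "... <= ennreal ?V" using b by (intro ennreal_leI) simp
   finally show ?thesis .
  qed
  have lim: "liminf (%n. ennreal (?f n xi)) = ennreal ((e \<bullet> xi)^2 * (cmod (FT u xi))^2)" for xi
   unfolding t_def by (intro lim_imp_Liminf tendsto_ennrealI tendsto_mult efun_quotient_tendsto tendsto_const) simp
  have "(\<integral>\<^sup>+xi. ennreal ((e \<bullet> xi)^2 * (cmod (FT u xi))^2) \<partial>lborel) <= liminf (%n. \<integral>\<^sup>+xi. ennreal (?f n xi) \<partial>lborel)"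
   unfolding lim[symmetric] by (rule nn_integral_liminf) measurable
  also have "... <= ennreal ?V"
   using Liminf_mono[OF always_eventually, of "%n. \<integral>\<^sup>+xi. ennreal (?f n xi) \<partial>lborel" "%_. ennreal ?V" sequentially] fn by (simp add: Liminf_const)
  finally show ?thesis .
 qed
 have eq: "ennreal ((norm xi)^2 * (cmod (FT u xi))^2) = (\<Sum>e\<in>Basis. ennreal ((e \<bullet> xi)^2 * (cmod (FT u xi))^2))" for xi :: 'a
 proof -
  have "(norm xi)^2 = (\<Sum>e\<in>Basis. (e \<bullet> xi)^2)"
   unfolding power2_norm_eq_inner by (subst euclidean_inner) (simp add: power2_eq_square inner_commute)
  then show ?thesis by (subst sum_ennreal) (simp_all add: sum_distrib_right)
 qed
 have "(\<integral>\<^sup>+xi. ennreal ((norm xi)^2 * (cmod (FT u xi))^2) \<partial>lborel) = (\<Sum>e\<in>Basis. (\<integral>\<^sup>+xi. ennreal ((e \<bullet> xi)^2 * (cmod (FT u xi))^2) \<partial>lborel))"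
  unfolding eq by (rule nn_integral_sum) measurable
 also have "... <= (\<Sum>e\<in>(Basis::'a set). ennreal ?V)" by (rule sum_mono) (rule one)
 also have "... = ennreal (real DIM('a) * ?V)" by (simp add: ennreal_mult' ennreal_of_nat_eq_real_of_nat)
 finally show ?thesis .
qed

text \<open>Interpolation between L^2 and the gradient: |xi|^(2s) is at most th^(2s) below frequency
  \<open>th\<close> and at most th^(2s-2) |xi|^2 above it. A large \<open>th\<close> makes the
  gradient term small, which is used for the continuity of the family.\<close>

lemma lip1_aform:
 fixes u :: "'a::euclidean_space => real"
 assumes u: "lip1 L u" and L2u: "L2 u" and s: "0 < s" "s < 1" and l: "th > 0"
 shows "L2 (WT s u)" "aform s u u <= th powr (2 * s) * nsq u + th powr (2 * s - 2) * (real DIM('a) * (L^2 * measure lborel (ball (0::'a) 2)))"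
proof -
 let ?D = "real DIM('a) * (L^2 * measure lborel (ball (0::'a) 2))"
 have FTm [measurable]: "FT u \<in> borel_measurable borel" using L2_FT[OF L2u] by (simp add: L2_def)
 have i1: "integrable lborel (%xi. (cmod (FT u xi))^2)" by (rule L2_integrable[OF L2_FT[OF L2u]])
 have nn: "(\<integral>\<^sup>+xi. ennreal ((norm xi)^2 * (cmod (FT u xi))^2) \<partial>lborel) <= ennreal ?D" by (rule lip1_gradient[OF u L2u])
 have i2: "integrable lborel (%xi. (norm xi)^2 * (cmod (FT u xi))^2)"
  by (rule integrableI_nonneg) (use nn in "auto intro: le_less_trans")
 have I2: "(LINT xi|lborel. (norm xi)^2 * (cmod (FT u xi))^2) <= ?D"
  using nn nn_integral_eq_integral[OF i2] by simp
 have i3: "integrable lborel (%xi. th powr (2 * s) * (cmod (FT u xi))^2 + th powr (2 * s - 2) * ((norm xi)^2 * (cmod (FT u xi))^2))"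
  using i1 i2 by simp
 have pw: "norm xi powr (2 * s) * (cmod (FT u xi))^2 <= th powr (2 * s) * (cmod (FT u xi))^2 + th powr (2 * s - 2) * ((norm xi)^2 * (cmod (FT u xi))^2)" for xi
 proof -
  have "norm xi powr (2 * s) <= th powr (2 * s) + th powr (2 * s - 2) * (norm xi)^2"
  proof (cases "norm xi <= th")
   case True
   then have "norm xi powr (2 * s) <= th powr (2 * s)" using s by (intro powr_mono2) auto
   then show ?thesis by (simp add: add_increasing2)
  next
   case False
   then have p: "norm xi > 0" using l by linarith
   have "norm xi powr (2 * s) = norm xi powr (2 * s - 2) * (norm xi)^2" using p by (simp add: powr_diff)
   also have "... <= th powr (2 * s - 2) * (norm xi)^2" using False l s by (intro mult_right_mono powr_mono2') auto
   finally show ?thesis by (simp add: add_increasing)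
  qed
  then have "norm xi powr (2 * s) * (cmod (FT u xi))^2 <= (th powr (2 * s) + th powr (2 * s - 2) * (norm xi)^2) * (cmod (FT u xi))^2"
   by (intro mult_right_mono) auto
  then show ?thesis by (simp only: distrib_right mult.assoc)
 qed
 have i4: "integrable lborel (%xi. norm xi powr (2 * s) * (cmod (FT u xi))^2)"
  by (rule Bochner_Integration.integrable_bound[OF i3]) (use pw in "auto intro!: AE_I2 intro: order_trans[OF _ abs_ge_self]")
 then show LW: "L2 (WT s u)" using L2_WT_iff[OF L2u] by simp
 have "aform s u u = (LINT xi|lborel. norm xi powr (2 * s) * (cmod (FT u xi))^2)"
  unfolding aform_self nsq_def WT_def by (simp add: norm_mult power_mult_distrib powr_sq)
 also have "... <= (LINT xi|lborel. th powr (2 * s) * (cmod (FT u xi))^2 + th powr (2 * s - 2) * ((norm xi)^2 * (cmod (FT u xi))^2))"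
  by (rule integral_mono[OF i4 i3 pw])
 also have "... = th powr (2 * s) * nsq u + th powr (2 * s - 2) * (LINT xi|lborel. (norm xi)^2 * (cmod (FT u xi))^2)"
  using i1 i2 nsq_FT[OF L2u] by (simp add: nsq_def)
 also have "... <= th powr (2 * s) * nsq u + th powr (2 * s - 2) * ?D" using I2 by (intro add_left_mono mult_left_mono) auto
 finally show "aform s u u <= th powr (2 * s) * nsq u + th powr (2 * s - 2) * ?D" .
qed

section \<open>An odd family of plateau functions\<close>

definition clamp1 :: "real => real" where "clamp1 t = max (- 1) (min 1 t)"

lemma clamp1: "\<bar>clamp1 t\<bar> <= 1" "\<bar>clamp1 t - clamp1 t'\<bar> <= \<bar>t - t'\<bar>" "clamp1 (- t) = - clamp1 t" "clamp1 0 = 0"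
 "t >= 1 ==> clamp1 t = 1" by (auto simp: clamp1_def max_def min_def)

text \<open>Scaled to l^1 norm 1, so that the coefficients range over a compact set although
  \<open>sig\<close> ranges over a cone.\<close>

definition hat :: "nat => (nat => real) => nat => real" where "hat k sig i = sig i / (\<Sum>j\<le>k. \<bar>sig j\<bar>)"

definition hpoly :: "nat => (nat => real) => real => real" where "hpoly k sig rho = (\<Sum>i\<le>k. hat k sig i * rho ^ i)"

text \<open>For large \<open>Lam\<close> the values in the unit ball are t0 and -t0, except near its
  boundary and near the zeros of a polynomial in |x| with coefficients proportional to
  \<open>sig\<close>. Radial polynomials of degree at most k provide the k + 1 parameters.\<close>

definition tf :: "nat => real => real => (nat => real) => 'a::euclidean_space => real" where
 "tf k t0 Lam sig x = t0 * (clamp1 (Lam * (1 - min 1 (norm x))) * clamp1 (Lam * hpoly k sig (min 1 (norm x))))"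

lemma punct_sum_pos: "sig \<in> punct k ==> (\<Sum>j\<le>k. \<bar>sig j\<bar>) > 0"
proof -
 assume s: "sig \<in> punct k"
 then obtain i where i: "sig i ~= 0" by (auto simp: punct_def fun_eq_iff)
 then have "i <= k" using s by (auto simp: punct_def not_le)
 then show ?thesis using i by (intro sum_pos2[of _ i]) auto
qed

lemma hat_sum: assumes "sig \<in> punct k" shows "(\<Sum>i\<le>k. \<bar>hat k sig i\<bar>) = 1"
proof -
 have "(\<Sum>i\<le>k. \<bar>hat k sig i\<bar>) = (\<Sum>i\<le>k. \<bar>sig i\<bar>) / (\<Sum>j\<le>k. \<bar>sig j\<bar>)"
  unfolding sum_divide_distrib by (rule sum.cong) (use punct_sum_pos[OF assms] in "auto simp: hat_def abs_divide")
 then show ?thesis using punct_sum_pos[OF assms] by simp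
qed

lemma hat_neg: "hat k (neg_fun sig) i = - hat k sig i" by (simp add: hat_def)

lemma tf_neg: "tf k t0 Lam (neg_fun sig) x = - tf k t0 Lam sig x"
 by (simp add: tf_def hpoly_def hat_neg sum_negf clamp1(3))

lemma tf_bound: "t0 >= 0 ==> \<bar>tf k t0 Lam sig x\<bar> <= t0"
proof -
 assume t0: "t0 >= 0"
 let ?a = "clamp1 (Lam * (1 - min 1 (norm x)))" and ?b = "clamp1 (Lam * hpoly k sig (min 1 (norm x)))"
 have "\<bar>?a\<bar> * \<bar>?b\<bar> <= 1 * 1" by (intro mult_mono clamp1) auto
 then have "t0 * (\<bar>?a\<bar> * \<bar>?b\<bar>) <= t0 * 1" using t0 by (intro mult_left_mono) auto
 then show ?thesis using t0 by (simp add: tf_def abs_mult)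
qed

lemma tf_supp: "norm x >= 1 ==> tf k t0 Lam sig x = 0" by (simp add: tf_def clamp1(4))

lemma hpoly_lip:
 assumes "sig \<in> punct k" "0 <= a" "a <= 1" "0 <= b" "b <= 1"
 shows "\<bar>hpoly k sig a - hpoly k sig b\<bar> <= real k * \<bar>a - b\<bar>"
proof -
 have "\<bar>hpoly k sig a - hpoly k sig b\<bar> = \<bar>\<Sum>i\<le>k. hat k sig i * (a ^ i - b ^ i)\<bar>"
  by (simp add: hpoly_def right_diff_distrib sum_subtractf)
 also have "... <= (\<Sum>i\<le>k. \<bar>hat k sig i\<bar> * (real k * \<bar>a - b\<bar>))"
 proof (rule order_trans[OF sum_abs], rule sum_mono)
  fix i assume "i \<in> {..k}"
  have "\<bar>a ^ i - b ^ i\<bar> <= real i * \<bar>a - b\<bar>" using norm_power_diff[of a b i] assms by simp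
  also have "... <= real k * \<bar>a - b\<bar>" using \<open>i \<in> {..k}\<close> by (intro mult_right_mono) auto
  finally show "\<bar>hat k sig i * (a ^ i - b ^ i)\<bar> <= \<bar>hat k sig i\<bar> * (real k * \<bar>a - b\<bar>)" by (simp add: abs_mult mult_left_mono)
 qed
 also have "... = real k * \<bar>a - b\<bar>" using hat_sum[OF assms(1)] by (simp flip: sum_distrib_right)
 finally show ?thesis .
qed

lemma prod_diff_le: "\<bar>a * b - a' * b'\<bar> <= \<bar>a - a'\<bar> + \<bar>b - b'\<bar>" if "\<bar>a'\<bar> <= 1" "\<bar>b\<bar> <= 1" for a b a' b' :: real
proof -
 have "a * b - a' * b' = (a - a') * b + a' * (b - b')" by (simp add: algebra_simps)
 moreover have "\<bar>(a - a') * b\<bar> <= \<bar>a - a'\<bar>" "\<bar>a' * (b - b')\<bar> <= \<bar>b - b'\<bar>"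
  using mult_left_le[OF that(2), of "\<bar>a - a'\<bar>"] mult_right_mono[OF that(1), of "\<bar>b - b'\<bar>"] by (simp_all add: abs_mult)
 ultimately show ?thesis by linarith
qed

lemma tf_lip1:
 assumes s: "sig \<in> punct k" and t0: "t0 >= 0" and L: "Lam >= 0"
 shows "lip1 (t0 * (Lam + Lam * real k)) (tf k t0 Lam sig)"
 unfolding lip1_def
proof (intro conjI allI impI)
 show "t0 * (Lam + Lam * real k) >= 0" using t0 L by simp
 fix x y :: 'a
 define a b where "a = min 1 (norm x)" and "b = min 1 (norm y)"
 have ab: "0 <= a" "a <= 1" "0 <= b" "b <= 1" "\<bar>a - b\<bar> <= norm (x - y)"
  using norm_triangle_ineq3[of x y] by (auto simp: a_def b_def)
 let ?c = "%a. clamp1 (Lam * (1 - a))" and ?p = "%a. clamp1 (Lam * hpoly k sig a)"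
 have "\<bar>?c a * ?p a - ?c b * ?p b\<bar> <= \<bar>?c a - ?c b\<bar> + \<bar>?p a - ?p b\<bar>" by (rule prod_diff_le) (rule clamp1)+
 also have "... <= \<bar>Lam * (1 - a) - Lam * (1 - b)\<bar> + \<bar>Lam * hpoly k sig a - Lam * hpoly k sig b\<bar>" by (intro add_mono clamp1)
 also have "... = Lam * \<bar>a - b\<bar> + Lam * \<bar>hpoly k sig a - hpoly k sig b\<bar>"
 proof -
  have "Lam * (1 - a) - Lam * (1 - b) = Lam * (b - a)" "Lam * hpoly k sig a - Lam * hpoly k sig b = Lam * (hpoly k sig a - hpoly k sig b)"
   by (simp_all add: algebra_simps)
  then show ?thesis using L by (simp add: abs_mult abs_minus_commute)
 qed
 also have "... <= Lam * \<bar>a - b\<bar> + Lam * (real k * \<bar>a - b\<bar>)" using hpoly_lip[OF s ab(1-4)] L by (intro add_left_mono mult_left_mono)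
 also have "... = (Lam + Lam * real k) * \<bar>a - b\<bar>" by (simp add: algebra_simps)
 also have "... <= (Lam + Lam * real k) * norm (x - y)" using ab(5) L by (intro mult_left_mono) auto
 finally have "t0 * \<bar>?c a * ?p a - ?c b * ?p b\<bar> <= t0 * ((Lam + Lam * real k) * norm (x - y))" using t0 by (intro mult_left_mono)
 then show "\<bar>tf k t0 Lam sig x - tf k t0 Lam sig y\<bar> <= t0 * (Lam + Lam * real k) * norm (x - y)"
  using t0 by (simp add: tf_def a_def b_def abs_mult mult.assoc flip: right_diff_distrib)
qed (rule tf_supp)

lemma tf_diff:
 assumes t0: "t0 >= 0" and L: "Lam >= 0"
 shows "\<bar>tf k t0 Lam sig x - tf k t0 Lam \<tau> x\<bar> <= t0 * Lam * (\<Sum>i\<le>k. \<bar>hat k sig i - hat k \<tau> i\<bar>)"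
proof -
 let ?a = "min 1 (norm x)"
 let ?c = "clamp1 (Lam * (1 - ?a))" and ?p = "%sig. clamp1 (Lam * hpoly k sig ?a)"
 have "\<bar>hpoly k sig ?a - hpoly k \<tau> ?a\<bar> = \<bar>\<Sum>i\<le>k. (hat k sig i - hat k \<tau> i) * ?a ^ i\<bar>"
  by (simp add: hpoly_def left_diff_distrib sum_subtractf)
 also have "... <= (\<Sum>i\<le>k. \<bar>hat k sig i - hat k \<tau> i\<bar>)"
 proof (rule order_trans[OF sum_abs], rule sum_mono)
  fix i
  have "?a ^ i <= 1" "0 <= ?a ^ i" by (auto intro: power_le_one)
  then show "\<bar>(hat k sig i - hat k \<tau> i) * ?a ^ i\<bar> <= \<bar>hat k sig i - hat k \<tau> i\<bar>" by (simp add: abs_mult mult_left_le del: power_abs)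
 qed
 finally have h: "\<bar>hpoly k sig ?a - hpoly k \<tau> ?a\<bar> <= (\<Sum>i\<le>k. \<bar>hat k sig i - hat k \<tau> i\<bar>)" .
 have "\<bar>?c * ?p sig - ?c * ?p \<tau>\<bar> <= \<bar>?c - ?c\<bar> + \<bar>?p sig - ?p \<tau>\<bar>" by (rule prod_diff_le) (rule clamp1)+
 also have "... <= \<bar>Lam * hpoly k sig ?a - Lam * hpoly k \<tau> ?a\<bar>" using clamp1(2) by simp
 also have "... = Lam * \<bar>hpoly k sig ?a - hpoly k \<tau> ?a\<bar>" using L by (simp add: abs_mult flip: right_diff_distrib)
 also have "... <= Lam * (\<Sum>i\<le>k. \<bar>hat k sig i - hat k \<tau> i\<bar>)" using h L by (rule mult_left_mono)
 finally have "t0 * \<bar>?c * ?p sig - ?c * ?p \<tau>\<bar> <= t0 * (Lam * (\<Sum>i\<le>k. \<bar>hat k sig i - hat k \<tau> i\<bar>))" using t0 by (intro mult_left_mono)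
 then show ?thesis using t0 by (simp add: tf_def abs_mult mult.assoc flip: right_diff_distrib)
qed

lemma tf_L2:
 assumes s: "sig \<in> punct k" and t0: "t0 >= 0" and L: "Lam >= 0"
 shows "L2 (tf k t0 Lam sig :: 'a::euclidean_space => real)" "nsq (tf k t0 Lam sig :: 'a => real) <= t0^2 * measure lborel (ball (0::'a) 1)"
 by (rule supported_nsq_le[OF borel_measurable_continuous_onI[OF lip1_continuous[OF tf_lip1[OF assms]]] t0 tf_bound[OF t0] tf_supp], assumption)+

lemma convergent_coordinates:
 fixes x :: "nat => nat => real"
 assumes "!!n i. \<bar>x n i\<bar> <= 1"
 shows "\<exists>r. strict_mono (r :: nat => nat) & (\<forall>i<k. convergent (%n. x (r n) i))"
proof (induction k)
 case 0 show ?case by (intro exI[of _ id]) (auto simp: strict_mono_def)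
next
 case (Suc k)
 then obtain r where r: "strict_mono (r :: nat => nat)" "!!i. i < k ==> convergent (%n. x (r n) i)" by blast
 have "bounded (range (%n. x (r n) k))" using assms by (auto simp: bounded_iff)
 then obtain l q where q: "strict_mono (q :: nat => nat)" "((%n. x (r n) k) \<circ> q) ~~> l" using bounded_imp_convergent_subsequence by blast
 have "convergent (%n. x (r (q n)) i)" if "i < Suc k" for i
 proof (cases "i = k")
  case True then show ?thesis using q(2) by (auto simp: convergent_def comp_def)
 next
  case False
  then have "i < k" using that by simp
  then obtain l' where "(%n. x (r n) i) ~~> l'" using r(2)[of i] by (auto simp: convergent_def)
  then show ?thesis using LIMSEQ_subseq_LIMSEQ[OF _ q(1)] by (fastforce simp: convergent_def comp_def)
 qed
 then show ?case using r(1) q(1) by (intro exI[of _ "%n. r (q n)"]) (auto simp: strict_mono_def)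
qed

text \<open>By contradiction and compactness of the coefficients: a limit of normalised polynomials
  is nonzero and has finitely many roots, the corresponding spheres are null sets, and off them the
  function reaches t0 or -t0 once \<open>Lam\<close> is large. Evenness of \<open>Q\<close> removes
  the sign.\<close>

lemma tf_plateau:
 fixes Q :: "real => real"
 assumes Q: "continuous_on UNIV Q" "!!t. Q (- t) = Q t" "Q 0 = 0" and t0: "t0 > 0" "Q t0 > 0"
 shows "\<exists>Lam\<ge>0. \<forall>sig\<in>punct k. Q t0 * measure lborel (ball (0::'a::euclidean_space) 1) / 2 <= (LINT x::'a|lborel. Q (tf k t0 Lam sig x))"
proof (rule ccontr)
 let ?V = "measure lborel (ball (0::'a) 1)"
 assume no: "\<not> ?thesis"
 have "\<exists>sig\<in>punct k. (LINT x::'a|lborel. Q (tf k t0 (real n) sig x)) < Q t0 * ?V / 2" for n :: nat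
 proof (rule ccontr)
  assume "\<not> ?thesis"
  then have "\<forall>sig\<in>punct k. Q t0 * ?V / 2 <= (LINT x::'a|lborel. Q (tf k t0 (real n) sig x))" by (simp add: not_less)
  then show False using no of_nat_0_le_iff[of n] by blast
 qed
 then obtain sig where sig: "!!n. sig n \<in> punct k" "!!n. (LINT x::'a|lborel. Q (tf k t0 (real n) (sig n) x)) < Q t0 * ?V / 2" by metis
 define y where "y n i = (if i <= k then hat k (sig n) i else 0)" for n i
 have "\<bar>y n i\<bar> <= 1" for n i
  using member_le_sum[of i "{..k}" "%i. \<bar>hat k (sig n) i\<bar>"] hat_sum[OF sig(1)[of n]] by (auto simp: y_def)
 from convergent_coordinates[of y, OF this] obtain r where r: "strict_mono (r :: nat => nat)" "!!i. i < Suc k ==> convergent (%n. y (r n) i)" by blast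
 define c where "c i = lim (%n. y (r n) i)" for i
 have c: "(%n. hat k (sig (r n)) i) ~~> c i" if "i <= k" for i
  using r(2)[of i] that by (auto simp: c_def y_def convergent_LIMSEQ_iff)
 have "(%n. \<Sum>i\<le>k. \<bar>hat k (sig (r n)) i\<bar>) ~~> (\<Sum>i\<le>k. \<bar>c i\<bar>)" by (intro tendsto_intros c) simp
 then have c1: "(\<Sum>i\<le>k. \<bar>c i\<bar>) = 1" using hat_sum[OF sig(1)] by (simp add: LIMSEQ_const_iff)
 define Z where "Z = {z. (\<Sum>i\<le>k. c i * z ^ i) = 0}"
 have "\<exists>i\<le>k. c i ~= 0" using c1 by (metis abs_zero sum.neutral zero_neq_one atMost_iff)
 then obtain i0 where "i0 <= k" "c i0 ~= 0" by blast
 then have Zf: "finite Z" unfolding Z_def by (intro polyfun_rootbound_finite) auto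
 have sph: "sphere (0::'a) rho \<in> null_sets lborel" for rho
  using negligible_sphere[of "0::'a" rho] by (auto simp: null_sets_completion_iff negligible_iff_null_sets negligible_convex_frontier)
 have "(\<Union>rho\<in>insert 1 Z. sphere (0::'a) rho) \<in> null_sets lborel" using Zf sph by (intro null_sets.finite_UN) auto
 then have ae: "AE x::'a in lborel. norm x ~= 1 & norm x \<notin> Z"
  by (rule AE_I') (auto simp: dist_norm)
 have cm: "compact (Q ` {- t0..t0})" by (intro compact_continuous_image continuous_on_subset[OF Q(1)]) auto
 from compact_imp_bounded[OF this] obtain B where B: "!!t. \<bar>t\<bar> <= t0 ==> \<bar>Q t\<bar> <= B" by (force simp: bounded_iff abs_le_iff)
 have Qm [measurable]: "Q \<in> borel_measurable borel" by (rule borel_measurable_continuous_onI[OF Q(1)])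
 have iV: "integrable lborel (indicator (ball (0::'a) 1) :: 'a => real)" 
 proof -
  have "(%x. (norm (indicator (ball (0::'a) 1) x :: real))^2) = (indicator (ball (0::'a) 1) :: 'a => real)"
   by (auto simp: indicator_def fun_eq_iff)
  then show ?thesis using L2_integrable[OF L2_indicator_ball[of "0::'a" 1]] by simp
 qed
 have "(%n. LINT x::'a|lborel. Q (tf k t0 (real (r n)) (sig (r n)) x)) ~~> (LINT x::'a|lborel. Q t0 * indicator (ball 0 1) x)"
 proof (rule integral_dominated_convergence[where w = "%x. B * indicator (ball 0 1) x"])
  show "integrable lborel (%x::'a. B * indicator (ball 0 1) x)" using iV by simp
  show "(%x::'a. Q t0 * indicator (ball 0 1) x) \<in> borel_measurable lborel" by measurable
  show "(%x::'a. Q (tf k t0 (real (r n)) (sig (r n)) x)) \<in> borel_measurable lborel" for n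
  proof -
   have "(tf k t0 (real (r n)) (sig (r n)) :: 'a => real) \<in> borel_measurable borel"
    using borel_measurable_continuous_onI[OF lip1_continuous[OF tf_lip1[OF sig(1), of t0 "real (r n)" "r n"]]] t0 by simp
   from measurable_compose[OF this Qm] show ?thesis by simp
  qed
  show "AE x::'a in lborel. norm (Q (tf k t0 (real (r n)) (sig (r n)) x)) <= B * indicator (ball 0 1) x" for n
  proof (rule AE_I2)
   fix x :: 'a
   show "norm (Q (tf k t0 (real (r n)) (sig (r n)) x)) <= B * indicator (ball 0 1) x"
    using B[OF tf_bound[of t0 k "real (r n)" "sig (r n)" x]] t0 tf_supp[of x k t0 "real (r n)" "sig (r n)"] Q(3)
    by (cases "norm x < 1") auto
  qed
  show "AE x::'a in lborel. (%n. Q (tf k t0 (real (r n)) (sig (r n)) x)) ~~> Q t0 * indicator (ball 0 1) x"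
   using ae
  proof eventually_elim
   case (elim x)
   show ?case
   proof (cases "norm x < 1")
    case False then show ?thesis using tf_supp[of x] Q(3) by simp
   next
    case True
    let ?p = "%n. hpoly k (sig (r n)) (norm x)"
    define P where "P = (\<Sum>i\<le>k. c i * norm x ^ i)"
    have P0: "P ~= 0" using elim by (simp add: P_def Z_def)
    have pt: "?p ~~> P" unfolding hpoly_def P_def by (intro tendsto_intros c) simp
    have rn: "filterlim (%n. real (r n)) at_top sequentially"
     by (rule filterlim_compose[OF filterlim_real_sequentially filterlim_subseq[OF r(1)]])
    have "\<forall>\<^sub>F n in sequentially. \<bar>?p n\<bar> > \<bar>P\<bar> / 2" using order_tendstoD(1)[OF tendsto_rabs[OF pt], of "\<bar>P\<bar> / 2"] P0 by simp
    moreover have "\<forall>\<^sub>F n in sequentially. real (r n) >= max (2 / \<bar>P\<bar>) (1 / (1 - norm x))" using rn by (simp only: filterlim_at_top)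
    ultimately have "\<forall>\<^sub>F n in sequentially. Q (tf k t0 (real (r n)) (sig (r n)) x) = Q t0"
    proof eventually_elim
     case (elim n)
     have "1 <= real (r n) * (1 - norm x)" using elim(2) True by (simp add: pos_divide_le_eq)
     then have a: "clamp1 (real (r n) * (1 - norm x)) = 1" by (rule clamp1(5))
     have "1 <= real (r n) * (\<bar>P\<bar> / 2)" using elim(2) P0 by (simp add: pos_divide_le_eq)
     also have "... <= real (r n) * \<bar>?p n\<bar>" using elim(1) by (intro mult_left_mono) auto
     finally have "1 <= \<bar>real (r n) * ?p n\<bar>" by (simp add: abs_mult)
     then have b: "clamp1 (real (r n) * ?p n) = 1 \<or> clamp1 (real (r n) * ?p n) = - 1" by (auto simp: clamp1_def)
     have m1: "min 1 (norm x) = norm x" using True by simp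
     from b have "tf k t0 (real (r n)) (sig (r n)) x = t0 \<or> tf k t0 (real (r n)) (sig (r n)) x = - t0"
      unfolding tf_def m1 a by auto
     then show ?case using Q(2) by auto
    qed
    then show ?thesis using True by (simp add: tendsto_eventually)
   qed
  qed
 qed
 then have "(%n. LINT x::'a|lborel. Q (tf k t0 (real (r n)) (sig (r n)) x)) ~~> Q t0 * ?V" by simp
 then have "Q t0 * ?V <= Q t0 * ?V / 2" by (rule LIMSEQ_le_const2) (use sig(2) less_imp_le in blast)
 moreover have "Q t0 * ?V > 0" using t0(2) bvol_pos[of 1, where 'a='a] by simp
 ultimately show False by simp
qed

context fractional_nls
begin

subsection \<open>Odd families of low energy\<close>

text \<open>The bound of \<open>lip1_aform\<close> at th = 1 and amplitude 1: the first volume comes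
  from the mass, the other term from the Lipschitz constant.\<close>

definition A0 :: "nat => real => real" where
 "A0 k Lam = measure lborel (ball (0::'a) 1) + real DIM('a) * ((Lam + Lam * real k)^2 * measure lborel (ball (0::'a) 2))"

lemma A0_pos: "A0 k Lam > 0"
 unfolding A0_def using bvol_pos[of 1, where 'a='a] by (intro add_pos_nonneg) auto

lemma tf_Hsr:
 assumes s: "sig \<in> punct k" and t0: "t0 >= 0" and L: "Lam >= 0"
 shows "Hsr s (tf k t0 Lam sig :: 'a => real)" "aform s (tf k t0 Lam sig :: 'a => real) (tf k t0 Lam sig) <= t0^2 * A0 k Lam"
proof -
 note l = lip1_aform[OF tf_lip1[OF assms] tf_L2(1)[OF assms] s01, where th = 1, where 'a='a]
 show "Hsr s (tf k t0 Lam sig :: 'a => real)"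
  using l(1)[OF zero_less_one] tf_L2(1)[OF assms] by (auto simp: Hsr_iff radial_def tf_def)
 show "aform s (tf k t0 Lam sig :: 'a => real) (tf k t0 Lam sig) <= t0^2 * A0 k Lam"
 proof -
  have "aform s (tf k t0 Lam sig :: 'a => real) (tf k t0 Lam sig) <= nsq (tf k t0 Lam sig :: 'a => real) +
   real DIM('a) * (t0^2 * (Lam + Lam * real k)^2 * measure lborel (ball (0::'a) 2))"
   using l(2)[OF zero_less_one] unfolding powr_one_eq_one mult_1 power_mult_distrib .
  also have "... <= t0^2 * measure lborel (ball (0::'a) 1) + t0^2 * (real DIM('a) * ((Lam + Lam * real k)^2 * measure lborel (ball (0::'a) 2)))"
   by (rule add_mono[OF tf_L2(2)[OF assms]]) (simp only: mult_ac order_refl)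
  finally show ?thesis unfolding A0_def distrib_left[of "t0^2"] .
 qed
qed

lemma openin_hat:
 "openin (punct_top k) {\<tau> \<in> punct k. (\<Sum>i\<le>k. \<bar>hat k \<tau> i - c i\<bar>) < dl}"
proof -
 have co: "continuous_on (punct k) (%\<tau>. \<tau> i)" for i
  by (rule continuous_on_subset[OF continuous_on_product_coordinates]) simp
 have "continuous_on (punct k) (%\<tau>. \<Sum>i\<le>k. \<bar>hat k \<tau> i - c i\<bar>)"
  unfolding hat_def by (intro continuous_intros co) (use punct_sum_pos in force)
 from continuous_openin_preimage_gen[OF this open_lessThan[of dl]]
 have "openin (top_of_set (punct k)) (punct k \<inter> (%\<tau>. \<Sum>i\<le>k. \<bar>hat k \<tau> i - c i\<bar>) -` {..<dl})" .
 moreover have "punct k \<inter> (%\<tau>. \<Sum>i\<le>k. \<bar>hat k \<tau> i - c i\<bar>) -` {..<dl} = {\<tau> \<in> punct k. (\<Sum>i\<le>k. \<bar>hat k \<tau> i - c i\<bar>) < dl}" by auto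
 ultimately show ?thesis by (simp add: euclidean_product_topology)
qed

text \<open>Uniform closeness of the functions controls the low frequencies; the common Lipschitz
  bound handles the high ones once \<open>th\<close> is large.\<close>

lemma tf_cont:
 assumes s: "sig \<in> punct k" and t0: "t0 >= 0" and L: "Lam >= 0" and e: "eps > 0"
 shows "\<exists>W. openin (punct_top k) W & sig \<in> W & (\<forall>\<tau>\<in>W. en (%x::'a. tf k t0 Lam \<tau> x - tf k t0 Lam sig x) < eps)"
proof -
 let ?l = "t0 * (Lam + Lam * real k)"
 define K where "K = real DIM('a) * ((2 * ?l)^2 * measure lborel (ball (0::'a) 2))"
 have K: "K >= 0" by (simp add: K_def)
 define q where "q = 2 * (K + 1) / eps"
 have q: "q > 0" using K e by (simp add: q_def)
 \<comment> \<open>Solves th^(2s-2) = 1 / q, which brings the gradient term below eps / 2.\<close>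
 define th where "th = q powr (1 / (2 - 2 * s))"
 have th: "th > 0" using q by (simp add: th_def)
 have "1 / (2 - 2 * s) * (2 * s - 2) = - 1" using s01 by (simp add: field_simps)
 then have tq: "th powr (2 * s - 2) = 1 / q" using q by (simp add: th_def powr_powr powr_minus_divide)
 have tK: "th powr (2 * s - 2) * K < eps / 2" unfolding tq q_def using K e by (simp add: field_simps)
 define M where "M = (th powr (2 * s) + 1) * (t0 * Lam)^2 * measure lborel (ball (0::'a) 1) + 1"
 have M: "M > 0" by (simp add: M_def add_nonneg_pos)
 define dl where "dl = sqrt (eps / (2 * M))"
 have dl: "dl > 0" using e M by (simp add: dl_def)
 let ?W = "{\<tau> \<in> punct k. (\<Sum>i\<le>k. \<bar>hat k \<tau> i - hat k sig i\<bar>) < dl}"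
 have "en (%x::'a. tf k t0 Lam \<tau> x - tf k t0 Lam sig x) < eps" if t: "\<tau> \<in> ?W" for \<tau>
 proof -
  let ?d = "%x::'a. tf k t0 Lam \<tau> x - tf k t0 Lam sig x"
  define D where "D = (\<Sum>i\<le>k. \<bar>hat k \<tau> i - hat k sig i\<bar>)"
  have tp: "\<tau> \<in> punct k" and D: "0 <= D" "D < dl" using t by (auto simp: D_def intro: sum_nonneg)
  have l1: "lip1 (2 * ?l) ?d"
   unfolding lip1_def
  proof (intro conjI allI impI)
   fix x y :: 'a
   have "\<bar>tf k t0 Lam \<tau> x - tf k t0 Lam \<tau> y\<bar> <= ?l * norm (x - y)" "\<bar>tf k t0 Lam sig x - tf k t0 Lam sig y\<bar> <= ?l * norm (x - y)"
    using tf_lip1[OF tp t0 L, where 'a='a] tf_lip1[OF s t0 L, where 'a='a] unfolding lip1_def by blast+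
   then show "\<bar>?d x - ?d y\<bar> <= 2 * ?l * norm (x - y)" by linarith
  qed (use t0 L in "auto simp: tf_supp")
  have dm: "?d \<in> borel_measurable borel" by (rule borel_measurable_continuous_onI[OF lip1_continuous[OF l1]])
  have c0: "0 <= t0 * Lam * D" using t0 L D(1) by simp
  have bd: "\<bar>?d x\<bar> <= t0 * Lam * D" for x using tf_diff[OF t0 L, of k \<tau> x sig] by (simp add: D_def)
  have z: "?d x = 0" if "norm x >= 1" for x using that by (simp add: tf_supp)
  note dn = supported_nsq_le[OF dm c0 bd z]
  have "en ?d <= (th powr (2 * s) + 1) * nsq ?d + th powr (2 * s - 2) * K"
   using lip1_aform(2)[OF l1 dn(1) s01 th] by (simp add: eform_def bform_self K_def distrib_right)
  also have "(th powr (2 * s) + 1) * nsq ?d <= (th powr (2 * s) + 1) * ((t0 * Lam * D)^2 * measure lborel (ball (0::'a) 1))"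
   using dn(2) by (intro mult_left_mono) auto
  also have "... = (M - 1) * D^2" by (simp add: M_def power_mult_distrib mult_ac)
  also have "... <= M * dl^2"
  proof -
   have "D^2 <= dl^2" using D by (intro power_mono) auto
   then have "M * D^2 <= M * dl^2" using M by (intro mult_left_mono) auto
   moreover have "(M - 1) * D^2 <= M * D^2" by (intro mult_right_mono) auto
   ultimately show ?thesis by linarith
  qed
  also have "M * dl^2 = eps / 2" using e M by (simp add: dl_def)
  finally show ?thesis using tK by linarith
 qed
 moreover have "sig \<in> ?W" using s dl by simp
 ultimately show ?thesis using openin_hat[of k "hat k sig" dl] by blast
qed

text \<open>The sequential continuity of \<open>normalize\<close> in eps-delta form, as open sets of
  parameters require.\<close>

lemma normalize_eps:
 assumes v: "Hsr s v" "bform v v > 0" and m: "m > 0" and e: "eps > 0"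
 shows "\<exists>dl>0. \<forall>f. Hsr s f --> bform f f > 0 --> en (%x. f x - v x) < dl --> en (%x. normalize m f x - normalize m v x) < eps"
proof (rule ccontr)
 assume no: "\<not> ?thesis"
 define P where "P n f \<longleftrightarrow> Hsr s f & bform f f > 0 & en (%x. f x - v x) < inverse (real (Suc n)) & eps <= en (%x. normalize m f x - normalize m v x)" for n f
 have "\<exists>f. P n f" for n
 proof (rule ccontr)
  assume "\<not> ?thesis"
  then have "\<forall>f. Hsr s f --> bform f f > 0 --> en (%x. f x - v x) < inverse (real (Suc n)) --> en (%x. normalize m f x - normalize m v x) < eps"
   by (simp add: P_def not_le)
  moreover have "inverse (real (Suc n)) > 0" by simp
  ultimately show False using no by blast
 qed
 then obtain f where "!!n. P n (f n)" by metis
 then have f: "Hsr s (f n)" "bform (f n) (f n) > 0" "en (%x. f n x - v x) < inverse (real (Suc n))"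
  "eps <= en (%x. normalize m (f n) x - normalize m v x)" for n by (simp_all add: P_def)
 have c: "(%n. en (%x. f n x - v x)) ~~> 0"
  by (rule squeeze_null[OF LIMSEQ_inverse_real_of_nat])
   (use f(3) en_parts(4) less_imp_le in auto)
 have "(%n. en (%x. normalize m (f n) x - normalize m v x)) ~~> 0" by (rule normalize_continuous[OF f(1) v(1) c f(2) v(2) m])
 then have "eps <= 0" by (rule LIMSEQ_le_const) (use f(4) in blast)
 then show False using e by simp
qed

lemma family_not_cov:
 assumes m: "m > 0" and t0: "t0 >= 0" and L: "Lam >= 0"
  and pos: "!!sig. sig \<in> punct k ==> bform (tf k t0 Lam sig :: 'a => real) (tf k t0 Lam sig) > 0"
  and J: "!!sig. sig \<in> punct k ==> J m (tf k t0 Lam sig) <= c"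
 shows "\<not> cov m (Lev m c) k"
proof (rule not_cov[where \<Phi> = "%sig. normalize m (tf k t0 Lam sig)"])
 show "Lev m c \<subseteq> S m" by (auto simp: Lev_def)
 fix sig :: "nat => real" assume s: "sig \<in> punct k"
 note H = tf_Hsr(1)[OF s t0 L]
 show "normalize m (tf k t0 Lam sig) \<in> Lev m c"
  using normalize[OF H pos[OF s] m] J[OF s] by (simp add: Lev_def S_def)
 have "(tf k t0 Lam (neg_fun sig) :: 'a => real) = (%x. - tf k t0 Lam sig x)" by (simp add: fun_eq_iff tf_neg)
 then show "normalize m (tf k t0 Lam (neg_fun sig)) = (%x. - normalize m (tf k t0 Lam sig) x)" by (simp only: normalize_uminus)
 fix eps :: real assume "eps > 0"
 then obtain dl where d: "dl > 0" "!!f. Hsr s f ==> bform f f > 0 ==> en (%x. f x - tf k t0 Lam sig x) < dl ==>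
  en (%x. normalize m f x - normalize m (tf k t0 Lam sig) x) < eps" using normalize_eps[OF H pos[OF s] m] by blast
 obtain W where W: "openin (punct_top k) W" "sig \<in> W" "!!\<tau>. \<tau> \<in> W ==> en (%x::'a. tf k t0 Lam \<tau> x - tf k t0 Lam sig x) < dl"
  using tf_cont[OF s t0 L d(1)] by blast
 have Wp: "W \<subseteq> punct k" using openin_subset[OF W(1)] by simp
 have "en (%x. normalize m (tf k t0 Lam \<tau>) x - normalize m (tf k t0 Lam sig) x) < eps" if "\<tau> \<in> W" for \<tau>
  by (rule d(2)[OF tf_Hsr(1)[OF _ t0 L] pos W(3)[OF that]]) (use that Wp in auto)
 then show "\<exists>W. openin (punct_top k) W & sig \<in> W & (\<forall>\<tau>\<in>W. en (%x. normalize m (tf k t0 Lam \<tau>) x - normalize m (tf k t0 Lam sig) x) < eps)"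
  using W(1,2) by blast
qed

lemma al_bounds: "0 < al" "al < 1"
proof -
 have "2 * s < real DIM('a)" using N2 s01 by linarith
 then show "0 < al" "al < 1" using s01 by (auto simp: al_def)
qed

text \<open>With X = m / bform u u >= m / B one has J <= X^al (A / 2 - X^(1-al) bt). The last
  premise makes the bracket at most -A / 2, which gives one negative level for the whole family. The
  positive lower bound on \<open>psi\<close> also keeps the family away from null functions.\<close>

lemma family_low_level:
 assumes m: "m > 0" and t0: "t0 > 0" and L: "Lam >= 0" and b: "bt > 0"
  and p: "!!sig. sig \<in> punct k ==> bt <= psi (tf k t0 Lam sig)"
  and big: "t0^2 * A0 k Lam <= (m / (t0^2 * measure lborel (ball (0::'a) 1))) powr (1 - al) * bt"
 shows "\<exists>c<0. \<not> cov m (Lev m c) k"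
proof -
 define B A where "B = t0^2 * measure lborel (ball (0::'a) 1)" and "A = t0^2 * A0 k Lam"
 have B: "B > 0" using t0 bvol_pos[of 1, where 'a='a] by (simp add: B_def)
 have A: "A > 0" using t0 A0_pos by (simp add: A_def)
 note big' = big[folded A_def B_def]
 have t0': "t0 >= 0" using t0 by simp
 define c where "c = - (A / 2 * (m / B) powr al)"
 have c: "c < 0" using A B m by (simp add: c_def)
 have "\<not> cov m (Lev m c) k"
 proof (rule family_not_cov[OF m t0' L])
  fix sig :: "nat => real" assume s: "sig \<in> punct k"
  let ?u = "tf k t0 Lam sig :: 'a => real"
  note H = tf_Hsr[OF s t0' L] and P = p[OF s]
  show pos: "bform ?u ?u > 0"
  proof (rule ccontr)
   assume "\<not> bform ?u ?u > 0"
   then have "nsq ?u = 0" using nsq_nonneg[of ?u] by (simp add: bform_self)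
   then have "AE x in lborel. ?u x = 0" using nsq_eq_0[OF HsrD(1)[OF H(1)]] by simp
   then have "psi ?u = 0" unfolding psi_def by (intro integral_eq_zero_AE) (auto simp: Gprim_0 elim!: eventually_mono)
   then show False using P b by simp
  qed
  define X where "X = m / bform ?u ?u"
  have bB: "bform ?u ?u <= B" using tf_L2(2)[OF s t0' L, where 'a='a] by (simp add: bform_self B_def)
  have X0: "m / B <= X" unfolding X_def using bB pos m by (intro divide_left_mono) auto
  have X: "X > 0" using m pos by (simp add: X_def)
  have "J m ?u <= 1/2 * X powr al * A - X * bt"
   unfolding J_def X_def[symmetric] using H(2)[folded A_def] P X by (intro diff_mono mult_left_mono) auto
  also have "X * bt = X powr al * (X powr (1 - al) * bt)" using X by (simp flip: powr_add)
  also have "1/2 * X powr al * A - X powr al * (X powr (1 - al) * bt) <= 1/2 * X powr al * A - X powr al * A"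
  proof -
   have "(m / B) powr (1 - al) * bt <= X powr (1 - al) * bt"
    using X0 al_bounds m B b by (intro mult_right_mono powr_mono2) auto
   then have "A <= X powr (1 - al) * bt" using big' by linarith
   then show ?thesis by (intro diff_mono mult_left_mono order_refl) auto
  qed
  also have "... = - (A / 2 * X powr al)" by simp
  also have "... <= c"
  proof -
   have "(m / B) powr al <= X powr al" using X0 al_bounds m B by (intro powr_mono2) auto
   then show ?thesis unfolding c_def neg_le_iff_le using A by (intro mult_left_mono) auto
  qed
  finally show "J m ?u <= c" .
 qed
 then show ?thesis using c by blast
qed

lemma low_level_large_mass:
 assumes t0: "t0 > 0" "Gprim g t0 > 0"
 shows "\<exists>mk\<ge>0. \<forall>m>mk. \<exists>c<0. \<not> cov m (Lev m c) k"
proof -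
 let ?V = "measure lborel (ball (0::'a) 1)"
 obtain Lam where L: "Lam >= 0" "!!sig. sig \<in> punct k ==> Gprim g t0 * ?V / 2 <= (LINT x::'a|lborel. Gprim g (tf k t0 Lam sig x))"
  using tf_plateau[OF Gprim_cont Gprim_even Gprim_0 t0, of k, where 'a='a] by blast
 define bt where "bt = Gprim g t0 * ?V / 2"
 have V: "?V > 0" using bvol_pos[of 1, where 'a='a] by simp
 have b: "bt > 0" using t0 V by (simp add: bt_def)
 let ?B = "t0^2 * ?V" and ?A = "t0^2 * A0 k Lam"
 have B: "?B > 0" and A: "?A > 0" using t0 V A0_pos by auto
 \<comment> \<open>The mass at which the last premise of \<open>family_low_level\<close> holds with
   equality.\<close>
 define mk where "mk = ?B * (?A / bt) powr (1 / (1 - al))"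
 have "\<exists>c<0. \<not> cov m (Lev m c) k" if m: "m > mk" for m
 proof -
  have mk0: "mk >= 0" using B by (simp add: mk_def)
  have "(?A / bt) powr (1 / (1 - al)) <= m / ?B" using m B by (simp add: mk_def pos_le_divide_eq mult.commute)
  then have "((?A / bt) powr (1 / (1 - al))) powr (1 - al) <= (m / ?B) powr (1 - al)" using al_bounds by (intro powr_mono2) auto
  then have "?A / bt <= (m / ?B) powr (1 - al)" using al_bounds A b by (simp add: powr_powr)
  then have big: "?A <= (m / ?B) powr (1 - al) * bt" using b by (simp add: pos_divide_le_eq)
  show ?thesis by (rule family_low_level[OF _ t0(1) L(1) b _ big]) (use L(2) m mk0 in "auto simp: psi_def bt_def")
 qed
 moreover have "mk >= 0" using B by (simp add: mk_def)
 ultimately show ?thesis by blast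
qed

text \<open>(g4) concerns the derivative of G; comparing it with the derivative of M t^r on (0, t)
  integrates it, which is why the bound is requested with the factor r. Evenness covers negative
  arguments.\<close>

lemma Gprim_lower:
 assumes g4: "filterlim (%t. g t / (\<bar>t\<bar> powr (4 * s / real DIM('a)) * t)) at_top (at 0)" and M: "M > 0"
 shows "\<exists>d>0. \<forall>t. \<bar>t\<bar> <= d --> M * \<bar>t\<bar> powr r <= Gprim g t"
proof -
 have "\<forall>\<^sub>F t in at 0. M * r <= g t / (\<bar>t\<bar> powr (4 * s / real DIM('a)) * t)" using g4 by (simp only: filterlim_at_top)
 then obtain d where d: "d > 0" "!!t. t ~= 0 ==> \<bar>t\<bar> < d ==> M * r <= g t / (\<bar>t\<bar> powr (4 * s / real DIM('a)) * t)"
  by (auto simp: eventually_at dist_real_def)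
 have gl: "M * (r * t powr (r - 1)) <= g t" if "0 < t" "t < d" for t
 proof -
  have e: "t powr (4 * s / real DIM('a)) * t = t powr (r - 1)"
  proof -
   have e1: "r - 1 = 4 * s / real DIM('a) + 1" by (simp add: r_def)
   show ?thesis unfolding e1 powr_add using that by simp
  qed
  have "M * r <= g t / t powr (r - 1)" using d(2)[of t] that e by simp
  then show ?thesis using that by (simp add: pos_le_divide_eq mult_ac)
 qed
 have pos: "M * t powr r <= Gprim g t" if t: "0 <= t" "t < d" for t
 proof -
  have "Gprim g 0 - M * 0 powr r <= Gprim g t - M * t powr r"
  proof (rule DERIV_nonneg_imp_increasing_open[OF t(1)])
   fix x assume x: "0 < x" "x < t"
   have "((%x. Gprim g x - M * x powr r) has_real_derivative g x - M * (r * x powr (r - 1))) (at x)"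
    by (intro DERIV_diff DERIV_cmult Gprim_deriv has_real_derivative_powr x)
   then show "\<exists>y. ((%x. Gprim g x - M * x powr r) has_real_derivative y) (at x) & 0 <= y"
    using gl[of x] x t by (intro exI conjI) auto
  next
   show "continuous_on {0..t} (%x. Gprim g x - M * x powr r)"
    by (intro continuous_intros continuous_on_subset[OF Gprim_cont] continuous_on_powr') (use r_gt_2 in auto)
  qed
  then show ?thesis using r_gt_2 by (simp add: Gprim_0)
 qed
 have "M * \<bar>t\<bar> powr r <= Gprim g t" if "\<bar>t\<bar> <= d / 2" for t
  using pos[of "\<bar>t\<bar>"] that d(1) Gprim_even[of t] by (cases "t >= 0") auto
 then show ?thesis using d(1) by (intro exI[of _ "d / 2"]) auto
qed

text \<open>Under scaling to amplitude d both sides of the last premise of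
  \<open>family_low_level\<close> are proportional to d^2, since 2 (1 - al) = r - 2. Hence
  \<open>M\<close> can be fixed before the amplitude, and (g4) then supplies a small d at which G
  dominates M |t|^r.\<close>

lemma low_level_g4:
 assumes g4: "filterlim (%t. g t / (\<bar>t\<bar> powr (4 * s / real DIM('a)) * t)) at_top (at 0)" and m: "m > 0"
 shows "\<exists>c<0. \<not> cov m (Lev m c) k"
proof -
 let ?V = "measure lborel (ball (0::'a) 1)"
 have V: "?V > 0" using bvol_pos[of 1, where 'a='a] by simp
 have "continuous_on UNIV (%t::real. \<bar>t\<bar> powr r)" by (intro continuous_on_powr' continuous_intros) (use r_gt_2 in auto)
 from tf_plateau[OF this, of 1 k, where 'a='a] r_gt_2
 obtain Lam where L: "Lam >= 0" "!!sig. sig \<in> punct k ==> ?V / 2 <= (LINT x::'a|lborel. \<bar>tf k 1 Lam sig x\<bar> powr r)" by auto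
 define M where "M = A0 k Lam / ((m / ?V) powr (1 - al) * (?V / 2))"
 have M: "M > 0" using A0_pos V m by (simp add: M_def)
 obtain d where d: "d > 0" "!!t. \<bar>t\<bar> <= d ==> M * \<bar>t\<bar> powr r <= Gprim g t" using Gprim_lower[OF g4 M] by blast
 define bt where "bt = M * d powr r * (?V / 2)"
 have b: "bt > 0" using M d V by (simp add: bt_def)
 show ?thesis
 proof (rule family_low_level[OF m d(1) L(1) b])
  fix sig :: "nat => real" assume s: "sig \<in> punct k"
  have sc: "(tf k d Lam sig :: 'a => real) = (%x. d * tf k 1 Lam sig x)" by (simp add: tf_def fun_eq_iff)
  have H: "Hsr s (tf k d Lam sig :: 'a => real)" using tf_Hsr(1)[OF s _ L(1)] d(1) by simp
  have "bt <= M * d powr r * (LINT x::'a|lborel. \<bar>tf k 1 Lam sig x\<bar> powr r)"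
   unfolding bt_def using L(2)[OF s] M by (intro mult_left_mono) auto
  also have "... = (LINT x::'a|lborel. M * \<bar>tf k d Lam sig x\<bar> powr r)"
   using d(1) by (simp add: sc abs_mult powr_mult mult.assoc)
  also have "... <= psi (tf k d Lam sig)" unfolding psi_def
  proof (rule integral_mono)
   show "integrable lborel (%x::'a. M * \<bar>tf k d Lam sig x\<bar> powr r)" using Lr_integrable[OF H] by simp
   show "integrable lborel (%x::'a. Gprim g (tf k d Lam sig x))" by (rule psi_integrable[OF H])
   show "M * \<bar>tf k d Lam sig x\<bar> powr r <= Gprim g (tf k d Lam sig x)" for x :: 'a using d(2)[OF tf_bound] d(1) by simp
  qed
  finally show "bt <= psi (tf k d Lam sig)" .
 next
  have e0: "2 * (1 - al) = r - 2" by (simp add: al_def r_def)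
  have e3: "(d^2) powr (1 - al) = d powr (2 * (1 - al))" using d(1) powr_powr[of d 2 "1 - al"] by simp
  have "(m / (d^2 * ?V)) powr (1 - al) = (m / ?V) powr (1 - al) / (d^2) powr (1 - al)"
   using m V d(1) by (simp add: powr_divide powr_mult)
  also note e3[unfolded e0]
  finally have e1: "(m / (d^2 * ?V)) powr (1 - al) = (m / ?V) powr (1 - al) / d powr (r - 2)" .
  have e2: "d powr r / d powr (r - 2) = d^2" using d(1) by (simp flip: powr_diff)
  have "(m / (d^2 * ?V)) powr (1 - al) * bt = (d powr r / d powr (r - 2)) * (M * ((m / ?V) powr (1 - al) * (?V / 2)))"
   unfolding e1 bt_def by simp
  also have "M * ((m / ?V) powr (1 - al) * (?V / 2)) = A0 k Lam" unfolding M_def using V m by simp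
  finally show "d^2 * A0 k Lam <= (m / (d^2 * ?V)) powr (1 - al) * bt" unfolding e2 by simp
 qed
qed

section \<open>From coverings to critical points and solutions\<close>

definition distinct_crit :: "real => real => ('a => real) set => bool" where
 "distinct_crit m c F \<longleftrightarrow> finite F & F \<subseteq> crit m & (\<forall>u\<in>F. J m u <= c) &
  (\<forall>u\<in>F. \<forall>v\<in>F. u ~= v --> en (%x. u x - v x) ~= 0 & en (%x. - u x - v x) ~= 0)"

lemma distinct_critD:
 assumes "distinct_crit m c F"
 shows "finite F" "F \<subseteq> crit m" "!!u. u \<in> F ==> J m u <= c"
  "!!u v. u \<in> F ==> v \<in> F ==> u ~= v ==> en (%x. u x - v x) ~= 0 & en (%x. - u x - v x) ~= 0"
 using assms by (simp_all add: distinct_crit_def)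

text \<open>Critical points are added one at a time. If a set \<open>F\<close> of fewer than k of
  them represented all critical points up to level c, sweeping upwards from an empty sublevel would
  cover \<open>Lev m c\<close> with card F pairs.\<close>

lemma many_critical_points:
 assumes m: "m > 0" and c: "c < 0" and nc: "\<not> cov m (Lev m c) k" and j: "j <= k"
 shows "\<exists>F. distinct_crit m c F & card F = j"
 using j
proof (induction j)
 case 0 show ?case by (intro exI[of _ "{}"]) (simp add: distinct_crit_def)
next
 case (Suc j)
 then obtain F where F0: "distinct_crit m c F" "card F = j" by (meson Suc_leD)
 note F = distinct_critD(1)[OF F0(1)] F0(2) distinct_critD(2-)[OF F0(1)]
 have FS: "F \<subseteq> S m" using F(3) by (auto simp: crit_def)
 obtain c1 where c1: "c1 < 0" "Lev m c1 = {}" using Lev_empty[OF m] by blast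
 \<comment> \<open>The minimum guarantees a starting level not above c.\<close>
 have e: "cov m (Lev m (min c1 c)) 0"
  by (rule cov_mono[OF cov_empty]) (use c1 in "auto simp: Lev_def")
 have "\<exists>u. u \<in> crit m & J m u <= c & (\<forall>v\<in>F. en (%x. u x - v x) ~= 0 & en (%x. - u x - v x) ~= 0)"
 proof (rule ccontr)
  assume no: "\<not> ?thesis"
  have "cov m (Lev m c) (0 + card F)"
   by (rule cov_sweep[OF m min.cobounded2 c F(1) FS e]) (use no in blast)
  then have "cov m (Lev m c) k" by (rule cov_mono) (use F(2) Suc.prems in auto)
  then show False using nc by simp
 qed
 then obtain u where u: "u \<in> crit m" "J m u <= c" "!!v. v \<in> F ==> en (%x. u x - v x) ~= 0 & en (%x. - u x - v x) ~= 0" by blast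
 have uF: "u \<notin> F" using u(3)[of u] en_zero by auto
 have H: "Hsr s w" if "w \<in> insert u F" for w using that u(1) F(3) by (auto simp: crit_def S_def)
 have sym: "en (%x. v x - u x) ~= 0 & en (%x. - v x - u x) ~= 0" if v: "v \<in> F" for v
 proof -
  have "(%x. - v x - u x) = (%x. - u x - v x)" by (simp add: fun_eq_iff)
  then show ?thesis using u(3)[OF v] en_diff_commute[of u v] H v by simp
 qed
 show ?case
 proof (intro exI[of _ "insert u F"] conjI)
  show "card (insert u F) = Suc j" using F(1,2) uF by simp
  have "en (%x. a x - b x) ~= 0 & en (%x. - a x - b x) ~= 0" if "a \<in> insert u F" "b \<in> insert u F" "a ~= b" for a b
   using that u(3) sym F(5) by blast
  then show "distinct_crit m c (insert u F)" using F(1,3,4) u(1,2) by (simp add: distinct_crit_def)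
 qed
qed

lemma solutions_part1:
 assumes g3: "\<exists>t0>0. Gprim g t0 > 0"
 shows "\<exists>mk\<ge>0. \<forall>m>mk. \<exists>(us :: nat => 'a => real) (\<mu>s :: nat => real).
      (\<forall>i<k. \<not> (AE x in lborel. us i x = 0) & \<mu>s i > 0 & solves_P s g m (\<mu>s i) (us i)) &
      (\<forall>i<k. \<forall>j<k. i ~= j --> \<not> (AE x in lborel. us i x = us j x) & \<not> (AE x in lborel. us i x = - us j x))"
proof -
 obtain mk where mk: "mk >= 0" "!!m. m > mk ==> \<exists>c<0. \<not> cov m (Lev m c) k" using g3 low_level_large_mass by blast
 show ?thesis
 proof (intro exI[of _ mk] conjI mk(1) allI impI)
  fix m assume mm: "m > mk"
  then have m: "m > 0" using mk(1) by simp
  obtain c where c: "c < 0" "\<not> cov m (Lev m c) k" using mk(2)[OF mm] by blast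
  obtain F where F0: "distinct_crit m c F" "card F = k" using many_critical_points[OF m c order_refl] by blast
  note F = distinct_critD(1)[OF F0(1)] F0(2) distinct_critD(2-)[OF F0(1)]
  obtain us where us: "bij_betw us {0..<k} F" using ex_bij_betw_nat_finite[OF F(1)] F(2) by blast
  have uF: "us i \<in> F" if "i < k" for i using us that by (auto simp: bij_betw_def)
  have uH: "Hsr s (us i)" "bform (us i) (us i) = m" if "i < k" for i using uF[OF that] F(3) by (auto simp: crit_def S_def)
  have "\<exists>\<mu>. \<mu> > 0 & solves_P s g m \<mu> (us i)" if "i < k" for i
   using crit_solves[OF m, of "us i"] uF[OF that] F(3,4) c(1) by force
  then obtain \<mu>s where \<mu>s: "!!i. i < k ==> \<mu>s i > 0 & solves_P s g m (\<mu>s i) (us i)" by metis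
  show "\<exists>(us :: nat => 'a => real) (\<mu>s :: nat => real). (\<forall>i<k. \<not> (AE x in lborel. us i x = 0) & \<mu>s i > 0 & solves_P s g m (\<mu>s i) (us i)) &
      (\<forall>i<k. \<forall>j<k. i ~= j --> \<not> (AE x in lborel. us i x = us j x) & \<not> (AE x in lborel. us i x = - us j x))"
  proof (intro exI[of _ us] exI[of _ \<mu>s] conjI allI impI)
   fix i assume i: "i < k"
   show "\<not> (AE x in lborel. us i x = 0)" using nsq_eq_0[OF HsrD(1)[OF uH(1)[OF i]]] uH(2)[OF i] m by (simp add: bform_self)
   show "\<mu>s i > 0" "solves_P s g m (\<mu>s i) (us i)" using \<mu>s[OF i] by auto
   fix j assume j: "j < k" "i ~= j"
   have ne: "us i ~= us j" using us i j by (auto simp: bij_betw_def inj_on_def)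
   have n: "Hsr s (%x. - us i x)" using Hsr.scale_mem[of "us i" s "-1"] uH(1)[OF i] by simp
   show "\<not> (AE x in lborel. us i x = us j x)"
    using F(5)[OF uF[OF i] uF[OF j(1)] ne] en_eq_0_iff[OF uH(1)[OF i] uH(1)[OF j(1)]] by simp
   show "\<not> (AE x in lborel. us i x = - us j x)"
   proof
    assume "AE x in lborel. us i x = - us j x"
    then have "AE x in lborel. - us i x = us j x" by eventually_elim simp
    then show False using F(5)[OF uF[OF i] uF[OF j(1)] ne] en_eq_0_iff[OF n uH(1)[OF j(1)]] by simp
   qed
  qed
 qed
qed

text \<open>If no critical value lay in [-e, 0), sweeping with an empty set would carry a finite
  covering of the sublevel -e to every negative level with the same number of pairs, against
  \<open>low_level_g4\<close> for that number.\<close>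

lemma solutions_part2:
 assumes g4: "filterlim (%t. g t / (\<bar>t\<bar> powr (4 * s / real DIM('a)) * t)) at_top (at 0)" and m: "m > 0"
 shows "\<exists>(\<mu> :: nat => real) (u :: nat => 'a => real).
       (\<forall>n. solves_P s g m (\<mu> n) (u n) & energy s g (u n) < 0) & (%n. energy s g (u n)) ~~> 0"
proof -
 have ex: "\<exists>u. u \<in> crit m & - e <= J m u & J m u < 0" if e: "e > 0" for e
 proof (rule ccontr)
  assume no: "\<not> ?thesis"
  obtain j where j: "cov m (Lev m (- e)) j" using cov_finite[OF m, of "- e"] e by auto
  obtain c where c: "c < 0" "\<not> cov m (Lev m c) j" using low_level_g4[OF g4 m] by blast
  \<comment> \<open>The maximum is taken because \<open>c\<close> may lie below -e.\<close>
  have c0: "- e <= max c (- e)" "max c (- e) < 0" using c(1) e by auto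
  have "cov m (Lev m (max c (- e))) (j + card ({} :: ('a => real) set))"
   by (rule cov_sweep[OF m c0 _ _ j]) (use no c0(2) in "auto intro: le_less_trans")
  then have "cov m (Lev m c) j" by (rule cov_mono) (auto simp: Lev_def)
  then show False using c(2) by simp
 qed
 have "\<exists>u \<mu>. solves_P s g m \<mu> u & - inverse (real (Suc n)) <= energy s g u & energy s g (u :: 'a => real) < 0" for n
 proof -
  obtain u where u: "u \<in> crit m" "- inverse (real (Suc n)) <= J m u" "J m u < 0" using ex[of "inverse (real (Suc n))"] by auto
  have "energy s g u = J m u" by (rule energy_eq_J[OF m]) (use u(1) in "simp add: crit_def")
  then show ?thesis using crit_solves[OF m u(1,3)] u by auto
 qed
 then obtain u \<mu> where u: "!!n. solves_P s g m (\<mu> n) (u n :: 'a => real)" "!!n. - inverse (real (Suc n)) <= energy s g (u n)" "!!n. energy s g (u n) < 0" by metis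
 have "(%n. energy s g (u n)) ~~> 0"
 proof (rule real_tendsto_sandwich[OF always_eventually always_eventually _ tendsto_const])
  show "(%n. - inverse (real (Suc n))) ~~> 0" using tendsto_minus[OF LIMSEQ_inverse_real_of_nat] by simp
 qed (use u(2) less_imp_le[OF u(3)] in auto)
 then show ?thesis using u by blast
qed

end

theorem theorem1p3:
  fixes s :: real and g :: "real \<Rightarrow> real"
  assumes N2: "DIM('a::euclidean_space) \<ge> 2"
    and s01: "0 < s" "s < 1"
    and g1: "continuous_on UNIV g" "((\<lambda>t. g t / t) \<longlongrightarrow> 0) (at 0)"
    and g2: "((\<lambda>t. g t / \<bar>t\<bar> powr (1 + 4 * s / real DIM('a))) \<longlongrightarrow> 0) at_infinity"
    and g3: "\<exists>t0>0. Gprim g t0 > 0"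
    and g5: "\<And>t. g (- t) = - g t"
  shows "(\<forall>k::nat. \<exists>mk\<ge>0. \<forall>m>mk. \<exists>(us :: nat \<Rightarrow> 'a \<Rightarrow> real) (\<mu>s :: nat \<Rightarrow> real).
            (\<forall>i<k. \<not> (AE x in lborel. us i x = 0) \<and> \<mu>s i > 0 \<and> solves_P s g m (\<mu>s i) (us i)) \<and>
            (\<forall>i<k. \<forall>j<k. i \<noteq> j \<longrightarrow>
               \<not> (AE x in lborel. us i x = us j x) \<and> \<not> (AE x in lborel. us i x = - us j x)))
       \<and> (filterlim (\<lambda>t. g t / (\<bar>t\<bar> powr (4 * s / real DIM('a)) * t)) at_top (at 0) \<longrightarrow>
           (\<forall>m>0. \<exists>(\<mu> :: nat \<Rightarrow> real) (u :: nat \<Rightarrow> 'a \<Rightarrow> real).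
              (\<forall>n. solves_P s g m (\<mu> n) (u n) \<and> energy s g (u n) < 0) \<and>
              (\<lambda>n. energy s g (u n)) \<longlonglongrightarrow> 0))"
proof -
 interpret fractional_nls s g "TYPE('a)"
  by (rule fractional_nls.intro[OF N2 s01 g1 g2 g5])
 show ?thesis using solutions_part1[OF g3] solutions_part2 by blast
qed

end
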